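(* Let $k$ be a field and let $X$ be a regular $k$-scheme of finite type. Then $\mathrm{rt}(X)=1$.
   Context: Relation type of a standard graded algebra: for a commutative ring $R$ and a standard graded $R$-algebra $A=\bigoplus_{n\ge0}A_n$ (commutative graded, $A_0=R$, generated as an $R$-algebra by finitely many elements $f_1,\ldots,f_m$ of degree $1$), let $\mathcal Q$ be the kernel of the graded surjection $R[T_1,\ldots,T_m]\to A$, $T_i\mapsto f_i$. The relation type $\mathrm{rt}_R(A)$ is the least integer $\ell\ge1$ such that $\mathcal Q$ is generated by its elements of degree at most $\ell$; it does not depend on the chosen generators. Relation type of an ideal: for an ideal $I$ of a Noetherian ring $R$, $\mathrm{rt}_R(I):=\mathrm{rt}_R(R[It])$, where $R[It]=\bigoplus_{n\ge0}I^nt^n\subseteq R[t]$ is the Rees algebra. Relation type of a scheme: if $X=\mathrm{Spec}(k[x_1,\ldots,x_n]/I)$ is an affine scheme of finite type over $k$, then $\mathrm{rt}(X):=\mathrm{rt}_{k[x_1,\ldots,x_n]}(I)$ (independent of the presentation). For a point $x\in X$ in a scheme of finite type over $k$, choosing an affine open neighbourhood $\mathrm{Spec}(k[x_1,\ldots,x_n]/I)$ of $x$ and letting $\mathfrak p_x\subseteq k[x_1,\ldots,x_n]$ be the prime corresponding to $x$, one has $\mathcal O_{X,x}\cong k[x_1,\ldots,x_n]_{\mathfrak p_x}/I_{\mathfrak p_x}$ and sets $\mathrm{rt}(\mathcal O_{X,x}):=\mathrm{rt}(I_{\mathfrak p_x})$, the relation type of the ideal $I_{\mathfrak p_x}$ of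 $k[x_1,\ldots,x_n]_{\mathfrak p_x}$ (independent of choices). For a scheme $X$ of finite type over $k$, $\mathrm{rt}(X):=\max\{\mathrm{rt}(\mathcal O_{X,x}) : x\in X\}$, which agrees with the affine definition. *)

theory Defs
  imports
    "HOL-Algebra.UnivPoly"
    "HOL-Algebra.Ideal_Product"
    "HOL-Algebra.Ring_Divisibility"
    "HOL-Analysis.Abstract_Topology"
    "HOL-Library.Multiset"
    "HOL-Library.Extended_Nat"
begin

section \<open>Localization\<close>

text \<open>A fraction is the equivalence class of all pairs (numerator, denominator) representing it.
  The ring operations are unions over all choices of representatives; the classes united coincide.\<close>

definition fract :: "('a, 'm) ring_scheme \<Rightarrow> 'a set \<Rightarrow> 'a \<Rightarrow> 'a \<Rightarrow> ('a \<times> 'a) set" where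
  "fract R S a s = {(b, t). b \<in> carrier R \<and> t \<in> S \<and>
     (\<exists>u\<in>S. u \<otimes>\<^bsub>R\<^esub> (a \<otimes>\<^bsub>R\<^esub> t \<ominus>\<^bsub>R\<^esub> b \<otimes>\<^bsub>R\<^esub> s) = \<zero>\<^bsub>R\<^esub>)}"

definition loc_ring :: "('a, 'm) ring_scheme \<Rightarrow> 'a set \<Rightarrow> ('a \<times> 'a) set ring" where
  "loc_ring R S = \<lparr>
     carrier = {fract R S a s |a s. a \<in> carrier R \<and> s \<in> S},
     monoid.mult = (\<lambda>X Y. \<Union>(a, s)\<in>X. \<Union>(b, t)\<in>Y. fract R S (a \<otimes>\<^bsub>R\<^esub> b) (s \<otimes>\<^bsub>R\<^esub> t)),
     one = fract R S \<one>\<^bsub>R\<^esub> \<one>\<^bsub>R\<^esub>,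
     zero = fract R S \<zero>\<^bsub>R\<^esub> \<one>\<^bsub>R\<^esub>,
     add = (\<lambda>X Y. \<Union>(a, s)\<in>X. \<Union>(b, t)\<in>Y.
              fract R S (a \<otimes>\<^bsub>R\<^esub> t \<oplus>\<^bsub>R\<^esub> b \<otimes>\<^bsub>R\<^esub> s) (s \<otimes>\<^bsub>R\<^esub> t))\<rparr>"

definition loc_at :: "('a, 'm) ring_scheme \<Rightarrow> 'a set \<Rightarrow> ('a \<times> 'a) set ring" where
  "loc_at R p = loc_ring R (carrier R - p)"

definition loc_ideal :: "('a, 'm) ring_scheme \<Rightarrow> 'a set \<Rightarrow> 'a set \<Rightarrow> ('a \<times> 'a) set set" where
  "loc_ideal R p I = {fract R (carrier R - p) a s |a s. a \<in> I \<and> s \<in> carrier R - p}"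


section \<open>Regular local rings\<close>

definition krull_dim :: "('a, 'm) ring_scheme \<Rightarrow> enat" where
  "krull_dim R = Sup {enat n |n. \<exists>P. (\<forall>i\<le>n. primeideal (P i) R) \<and> (\<forall>i<n. P i \<subset> P (Suc i))}"

definition local_ring :: "('a, 'm) ring_scheme \<Rightarrow> bool" where
  "local_ring R \<longleftrightarrow> cring R \<and> (\<exists>!m. maximalideal m R)"

definition max_ideal :: "('a, 'm) ring_scheme \<Rightarrow> 'a set" where
  "max_ideal R = (THE m. maximalideal m R)"

text \<open>The maximal ideal of a Noetherian local ring \<open>R\<close> can be generated by \<open>dim R\<close> elements.\<close>

definition regular_local_ring :: "('a, 'm) ring_scheme \<Rightarrow> bool" where
  "regular_local_ring R \<longleftrightarrow> local_ring R \<and> noetherian_ring R \<and>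
     (\<exists>fs. set fs \<subseteq> carrier R \<and> enat (length fs) = krull_dim R \<and>
           Idl\<^bsub>R\<^esub> (set fs) = max_ideal R)"


section \<open>Polynomial rings in finitely many variables\<close>

text \<open>The ring \<open>R[T\<^sub>0, \<dots>, T\<^bsub>n-1\<^esub>]\<close>; a monomial is the multiset of its variables.\<close>

definition mpoly_ring :: "('a, 'm) ring_scheme \<Rightarrow> nat \<Rightarrow> (nat multiset \<Rightarrow> 'a) ring" where
  "mpoly_ring R n = \<lparr>
     carrier = {p. (\<forall>m. p m \<in> carrier R) \<and> finite {m. p m \<noteq> \<zero>\<^bsub>R\<^esub>} \<and>
                   (\<forall>m. p m \<noteq> \<zero>\<^bsub>R\<^esub> \<longrightarrow> set_mset m \<subseteq> {..<n})},
     monoid.mult = (\<lambda>p q m. finsum R (\<lambda>(a, b). p a \<otimes>\<^bsub>R\<^esub> q b) {(a, b). a + b = m}),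
     one = (\<lambda>m. if m = {#} then \<one>\<^bsub>R\<^esub> else \<zero>\<^bsub>R\<^esub>),
     zero = (\<lambda>m. \<zero>\<^bsub>R\<^esub>),
     add = (\<lambda>p q m. p m \<oplus>\<^bsub>R\<^esub> q m)\<rparr>"

definition mpoly_const :: "('a, 'm) ring_scheme \<Rightarrow> 'a \<Rightarrow> nat multiset \<Rightarrow> 'a" where
  "mpoly_const R c = (\<lambda>m. if m = {#} then c else \<zero>\<^bsub>R\<^esub>)"

definition mpoly_eval ::
  "('a, 'm) ring_scheme \<Rightarrow> ('b, 'n) ring_scheme \<Rightarrow> ('a \<Rightarrow> 'b) \<Rightarrow> 'b list \<Rightarrow> (nat multiset \<Rightarrow> 'a) \<Rightarrow> 'b" where
  "mpoly_eval R A \<phi> fs p =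
     finsum A (\<lambda>m. \<phi> (p m) \<otimes>\<^bsub>A\<^esub> finprod A (\<lambda>i. (fs ! i) [^]\<^bsub>A\<^esub> count m i) {..<length fs})
       {m. p m \<noteq> \<zero>\<^bsub>R\<^esub>}"

text \<open>The family \<open>fs\<close> generates \<open>A\<close> as an \<open>R\<close>-algebra, with structure map \<open>\<phi>\<close>.\<close>

definition generates_algebra ::
  "('a, 'm) ring_scheme \<Rightarrow> ('b, 'n) ring_scheme \<Rightarrow> ('a \<Rightarrow> 'b) \<Rightarrow> 'b list \<Rightarrow> bool" where
  "generates_algebra R A \<phi> fs \<longleftrightarrow> set fs \<subseteq> carrier A \<and>
     mpoly_eval R A \<phi> fs ` carrier (mpoly_ring R (length fs)) = carrier A"


section \<open>Relation type of graded algebras and of ideals\<close>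

definition relation_ideal ::
  "('a, 'm) ring_scheme \<Rightarrow> ('b, 'n) ring_scheme \<Rightarrow> ('a \<Rightarrow> 'b) \<Rightarrow> 'b list \<Rightarrow> (nat multiset \<Rightarrow> 'a) set" where
  "relation_ideal R A \<phi> fs =
     {p \<in> carrier (mpoly_ring R (length fs)). mpoly_eval R A \<phi> fs p = \<zero>\<^bsub>A\<^esub>}"

definition relation_type_wrt ::
  "('a, 'm) ring_scheme \<Rightarrow> ('b, 'n) ring_scheme \<Rightarrow> ('a \<Rightarrow> 'b) \<Rightarrow> 'b list \<Rightarrow> nat" where
  "relation_type_wrt R A \<phi> fs = (LEAST l. 1 \<le> l \<and>
     relation_ideal R A \<phi> fs =
       Idl\<^bsub>mpoly_ring R (length fs)\<^esub>
         {p \<in> relation_ideal R A \<phi> fs. \<forall>m. p m \<noteq> \<zero>\<^bsub>R\<^esub> \<longrightarrow> size m \<le> l})"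

text \<open>Here \<open>\<phi>\<close> identifies \<open>R\<close> with the degree 0 component of \<open>A\<close>, and \<open>A1\<close> is the degree 1
  component. The relation type does not depend on the family of generators; one is chosen.\<close>

definition relation_type ::
  "('a, 'm) ring_scheme \<Rightarrow> ('b, 'n) ring_scheme \<Rightarrow> ('a \<Rightarrow> 'b) \<Rightarrow> 'b set \<Rightarrow> nat" where
  "relation_type R A \<phi> A1 =
     relation_type_wrt R A \<phi> (SOME fs. set fs \<subseteq> A1 \<and> generates_algebra R A \<phi> fs)"

definition ideal_pow :: "('a, 'm) ring_scheme \<Rightarrow> 'a set \<Rightarrow> nat \<Rightarrow> 'a set" where
  "ideal_pow R I n = (ideal_prod R I ^^ n) (carrier R)"

definition rees_algebra :: "('a, 'm) ring_scheme \<Rightarrow> 'a set \<Rightarrow> ('a, nat \<Rightarrow> 'a) up_ring" where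
  "rees_algebra R I = (UP R)\<lparr>carrier := {p \<in> up R. \<forall>n. p n \<in> ideal_pow R I n}\<rparr>"

definition rt_ideal :: "('a, 'm) ring_scheme \<Rightarrow> 'a set \<Rightarrow> nat" where
  "rt_ideal R I = relation_type R (rees_algebra R I)
     (\<lambda>r. up_ring.monom (UP R) r 0) {up_ring.monom (UP R) a 1 |a. a \<in> I}"


section \<open>Locally ringed spaces\<close>

text \<open>Points form the \<^const>\<open>topspace\<close> of the topology; \<open>sections\<close> and \<open>restr\<close> are only
  meaningful on open sets.\<close>

record ('x, 's) rspace =
  sp_top :: "'x topology"
  sections :: "'x set \<Rightarrow> 's ring"
  restr :: "'x set \<Rightarrow> 'x set \<Rightarrow> 's \<Rightarrow> 's"

abbreviation points :: "('x, 's) rspace \<Rightarrow> 'x set" where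
  "points X \<equiv> topspace (sp_top X)"

abbreviation is_open :: "('x, 's) rspace \<Rightarrow> 'x set \<Rightarrow> bool" where
  "is_open X U \<equiv> openin (sp_top X) U"

locale ringed_space =
  fixes X :: "('x, 's) rspace"
  assumes sections_cring: "is_open X U \<Longrightarrow> cring (sections X U)"
    and restr_hom: "\<lbrakk>is_open X U; is_open X V; V \<subseteq> U\<rbrakk>
          \<Longrightarrow> restr X U V \<in> ring_hom (sections X U) (sections X V)"
    and restr_id: "\<lbrakk>is_open X U; s \<in> carrier (sections X U)\<rbrakk> \<Longrightarrow> restr X U U s = s"
    and restr_restr: "\<lbrakk>is_open X U; is_open X V; is_open X W; W \<subseteq> V; V \<subseteq> U;
            s \<in> carrier (sections X U)\<rbrakk> \<Longrightarrow> restr X V W (restr X U V s) = restr X U W s"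
    and gluing: "\<lbrakk>\<And>V. V \<in> \<V> \<Longrightarrow> is_open X V;
            \<And>V. V \<in> \<V> \<Longrightarrow> \<sigma> V \<in> carrier (sections X V);
            \<And>V W. \<lbrakk>V \<in> \<V>; W \<in> \<V>\<rbrakk> \<Longrightarrow> restr X V (V \<inter> W) (\<sigma> V) = restr X W (V \<inter> W) (\<sigma> W)\<rbrakk>
          \<Longrightarrow> \<exists>!t. t \<in> carrier (sections X (\<Union>\<V>)) \<and> (\<forall>V\<in>\<V>. restr X (\<Union>\<V>) V t = \<sigma> V)"

definition germ :: "('x, 's) rspace \<Rightarrow> 'x \<Rightarrow> 'x set \<Rightarrow> 's \<Rightarrow> ('x set \<times> 's) set" where
  "germ X x U s = {(V, t). is_open X V \<and> x \<in> V \<and> t \<in> carrier (sections X V) \<and>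
     (\<exists>W. is_open X W \<and> x \<in> W \<and> W \<subseteq> U \<inter> V \<and> restr X U W s = restr X V W t)}"

definition stalk :: "('x, 's) rspace \<Rightarrow> 'x \<Rightarrow> ('x set \<times> 's) set ring" where
  "stalk X x = \<lparr>
     carrier = {germ X x U s |U s. is_open X U \<and> x \<in> U \<and> s \<in> carrier (sections X U)},
     monoid.mult = (\<lambda>A B. \<Union>(U, s)\<in>A. \<Union>(V, t)\<in>B.
       germ X x (U \<inter> V)
         (restr X U (U \<inter> V) s \<otimes>\<^bsub>sections X (U \<inter> V)\<^esub> restr X V (U \<inter> V) t)),
     one = germ X x (points X) \<one>\<^bsub>sections X (points X)\<^esub>,
     zero = germ X x (points X) \<zero>\<^bsub>sections X (points X)\<^esub>,
     add = (\<lambda>A B. \<Union>(U, s)\<in>A. \<Union>(V, t)\<in>B.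
       germ X x (U \<inter> V)
         (restr X U (U \<inter> V) s \<oplus>\<^bsub>sections X (U \<inter> V)\<^esub> restr X V (U \<inter> V) t))\<rparr>"

locale locally_ringed_space = ringed_space +
  assumes stalk_local: "x \<in> points X \<Longrightarrow> local_ring (stalk X x)"

definition open_subspace :: "('x, 's) rspace \<Rightarrow> 'x set \<Rightarrow> ('x, 's) rspace" where
  "open_subspace X U = X\<lparr>sp_top := subtopology (sp_top X) U\<rparr>"

definition preim :: "('x, 's) rspace \<Rightarrow> ('x \<Rightarrow> 'y) \<Rightarrow> 'y set \<Rightarrow> 'x set" where
  "preim X f V = {x \<in> points X. f x \<in> V}"

text \<open>The map on stalks \<open>\<O>\<^bsub>Y, f x\<^esub> \<rightarrow> \<O>\<^bsub>X, x\<^esub>\<close> induced by \<open>(f, \<phi>)\<close>.\<close>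

definition stalk_map ::
  "('x, 's) rspace \<Rightarrow> ('x \<Rightarrow> 'y) \<Rightarrow> ('y set \<Rightarrow> 't \<Rightarrow> 's) \<Rightarrow> 'x \<Rightarrow> ('y set \<times> 't) set \<Rightarrow> ('x set \<times> 's) set" where
  "stalk_map X f \<phi> x B = (\<Union>(V, t)\<in>B. germ X x (preim X f V) (\<phi> V t))"

definition lrs_morphism ::
  "('x, 's) rspace \<Rightarrow> ('y, 't) rspace \<Rightarrow> ('x \<Rightarrow> 'y) \<Rightarrow> ('y set \<Rightarrow> 't \<Rightarrow> 's) \<Rightarrow> bool" where
  "lrs_morphism X Y f \<phi> \<longleftrightarrow>
     continuous_map (sp_top X) (sp_top Y) f \<and>
     (\<forall>V. is_open Y V \<longrightarrow> \<phi> V \<in> ring_hom (sections Y V) (sections X (preim X f V))) \<and>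
     (\<forall>V W t. is_open Y V \<and> is_open Y W \<and> W \<subseteq> V \<and> t \<in> carrier (sections Y V) \<longrightarrow>
        \<phi> W (restr Y V W t) = restr X (preim X f V) (preim X f W) (\<phi> V t)) \<and>
     (\<forall>x\<in>points X. {B \<in> carrier (stalk Y (f x)). stalk_map X f \<phi> x B \<in> max_ideal (stalk X x)}
        = max_ideal (stalk Y (f x)))"

definition lrs_iso ::
  "('x, 's) rspace \<Rightarrow> ('y, 't) rspace \<Rightarrow> ('x \<Rightarrow> 'y) \<Rightarrow> ('y set \<Rightarrow> 't \<Rightarrow> 's) \<Rightarrow> bool" where
  "lrs_iso X Y f \<phi> \<longleftrightarrow> lrs_morphism X Y f \<phi> \<and> homeomorphic_map (sp_top X) (sp_top Y) f \<and>
     (\<forall>V. is_open Y V \<longrightarrow> \<phi> V \<in> ring_iso (sections Y V) (sections X (preim X f V)))"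


section \<open>Affine schemes\<close>

definition primes :: "('a, 'm) ring_scheme \<Rightarrow> 'a set set" where
  "primes R = {p. primeideal p R}"

definition zariski_open :: "('a, 'm) ring_scheme \<Rightarrow> 'a set set \<Rightarrow> bool" where
  "zariski_open R U \<longleftrightarrow> (\<exists>S \<subseteq> carrier R. U = {p \<in> primes R. \<not> S \<subseteq> p})"

lemma istopology_zariski_open: "istopology (zariski_open R)"
  unfolding istopology_def
proof (intro conjI allI impI)
  fix U V
  assume "zariski_open R U" "zariski_open R V"
  then obtain S T where S: "S \<subseteq> carrier R" "U = {p \<in> primes R. \<not> S \<subseteq> p}"
    and T: "T \<subseteq> carrier R" "V = {p \<in> primes R. \<not> T \<subseteq> p}"
    unfolding zariski_open_def by blast
  let ?P = "{s \<otimes>\<^bsub>R\<^esub> t |s t. s \<in> S \<and> t \<in> T \<and> s \<otimes>\<^bsub>R\<^esub> t \<in> carrier R}"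
  have "\<not> ?P \<subseteq> p \<longleftrightarrow> \<not> S \<subseteq> p \<and> \<not> T \<subseteq> p" if "p \<in> primes R" for p
  proof -
    interpret primeideal p R using that by (simp add: primes_def)
    show ?thesis
    proof
      assume "\<not> ?P \<subseteq> p"
      then obtain s t where "s \<in> S" "t \<in> T" "s \<otimes>\<^bsub>R\<^esub> t \<notin> p" by blast
      then show "\<not> S \<subseteq> p \<and> \<not> T \<subseteq> p"
        using S(1) T(1) I_l_closed I_r_closed by blast
    next
      assume "\<not> S \<subseteq> p \<and> \<not> T \<subseteq> p"
      then obtain s t where "s \<in> S" "t \<in> T" "s \<notin> p" "t \<notin> p" by blast
      then have "s \<otimes>\<^bsub>R\<^esub> t \<notin> p" "s \<otimes>\<^bsub>R\<^esub> t \<in> carrier R"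
        using S(1) T(1) I_prime by blast+
      then show "\<not> ?P \<subseteq> p" using \<open>s \<in> S\<close> \<open>t \<in> T\<close> by blast
    qed
  qed
  then have "U \<inter> V = {p \<in> primes R. \<not> ?P \<subseteq> p}"
    unfolding S(2) T(2) set_eq_iff Int_iff mem_Collect_eq by meson
  moreover have "?P \<subseteq> carrier R" by blast
  ultimately show "zariski_open R (U \<inter> V)"
    unfolding zariski_open_def by (intro exI conjI)
next
  fix K
  assume "\<forall>U\<in>K. zariski_open R U"
  then have "\<forall>U\<in>K. \<exists>S. S \<subseteq> carrier R \<and> U = {p \<in> primes R. \<not> S \<subseteq> p}"
    unfolding zariski_open_def by simp
  then obtain S where S: "\<forall>U\<in>K. S U \<subseteq> carrier R \<and> U = {p \<in> primes R. \<not> S U \<subseteq> p}"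
    by (rule bchoice [THEN exE])
  have mem: "p \<in> U \<longleftrightarrow> p \<in> primes R \<and> \<not> S U \<subseteq> p" if "U \<in> K" for U p
  proof -
    have "U = {p \<in> primes R. \<not> S U \<subseteq> p}" using S that by simp
    then have "p \<in> U \<longleftrightarrow> p \<in> {p \<in> primes R. \<not> S U \<subseteq> p}" by (rule arg_cong)
    then show ?thesis by simp
  qed
  have "\<Union>K = {p \<in> primes R. \<not> (\<Union>U\<in>K. S U) \<subseteq> p}"
    unfolding set_eq_iff Union_iff mem_Collect_eq UN_subset_iff by (simp add: mem cong: bex_cong)
  moreover have "(\<Union>U\<in>K. S U) \<subseteq> carrier R"
    unfolding UN_subset_iff using S by simp
  ultimately show "zariski_open R (\<Union>K)"
    unfolding zariski_open_def by (intro exI conjI)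
qed

definition spec_sections ::
  "('a, 'm) ring_scheme \<Rightarrow> 'a set set \<Rightarrow> ('a set \<Rightarrow> ('a \<times> 'a) set) ring" where
  "spec_sections R U = \<lparr>
     carrier = {s \<in> (\<Pi>\<^sub>E p\<in>U. carrier (loc_at R p)).
       \<forall>p\<in>U. \<exists>V a f. zariski_open R V \<and> p \<in> V \<and> V \<subseteq> U \<and> a \<in> carrier R \<and> f \<in> carrier R \<and>
         (\<forall>q\<in>V. f \<notin> q \<and> s q = fract R (carrier R - q) a f)},
     monoid.mult = (\<lambda>s t. \<lambda>p\<in>U. s p \<otimes>\<^bsub>loc_at R p\<^esub> t p),
     one = (\<lambda>p\<in>U. \<one>\<^bsub>loc_at R p\<^esub>),
     zero = (\<lambda>p\<in>U. \<zero>\<^bsub>loc_at R p\<^esub>),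
     add = (\<lambda>s t. \<lambda>p\<in>U. s p \<oplus>\<^bsub>loc_at R p\<^esub> t p)\<rparr>"

definition Spec ::
  "('a, 'm) ring_scheme \<Rightarrow> ('a set, 'a set \<Rightarrow> ('a \<times> 'a) set) rspace" where
  "Spec R = \<lparr>sp_top = topology (zariski_open R),
             sections = spec_sections R,
             restr = (\<lambda>U V s. restrict s V)\<rparr>"

text \<open>The canonical map from \<open>R\<close> to the global sections of \<open>Spec R\<close>.\<close>

definition spec_global :: "('a, 'm) ring_scheme \<Rightarrow> 'a \<Rightarrow> 'a set \<Rightarrow> ('a \<times> 'a) set" where
  "spec_global R a = (\<lambda>p\<in>primes R. fract R (carrier R - p) a \<one>\<^bsub>R\<^esub>)"


section \<open>Schemes of finite type over a field\<close>

text \<open>An affine open subset \<open>U \<cong> Spec R\<close> has \<open>R \<cong> sections X U\<close>, so it is no restriction that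
  the ring \<open>R\<close> has elements of the same type \<open>'s\<close> as the sections of \<open>X\<close>.\<close>

locale scheme = locally_ringed_space X for X :: "('x, 's) rspace" +
  assumes locally_affine: "x \<in> points X \<Longrightarrow>
    \<exists>U (R :: 's ring) f \<phi>. is_open X U \<and> x \<in> U \<and> cring R \<and> lrs_iso (open_subspace X U) (Spec R) f \<phi>"

text \<open>A scheme over \<open>k\<close> is a scheme \<open>X\<close> with a structure morphism \<open>(\<pi>, \<psi>)\<close> to \<open>Spec k\<close>.\<close>

definition scheme_over ::
  "('k, 'm) ring_scheme \<Rightarrow> ('x, 's) rspace \<Rightarrow> ('x \<Rightarrow> 'k set) \<Rightarrow>
   ('k set set \<Rightarrow> ('k set \<Rightarrow> ('k \<times> 'k) set) \<Rightarrow> 's) \<Rightarrow> bool" where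
  "scheme_over k X \<pi> \<psi> \<longleftrightarrow> scheme X \<and> lrs_morphism X (Spec k) \<pi> \<psi>"

text \<open>The \<open>k\<close>-algebra structure on the sections over \<open>U\<close> given by the structure morphism.\<close>

definition algebra_map ::
  "('k, 'm) ring_scheme \<Rightarrow> ('x, 's) rspace \<Rightarrow>
   ('k set set \<Rightarrow> ('k set \<Rightarrow> ('k \<times> 'k) set) \<Rightarrow> 's) \<Rightarrow> 'x set \<Rightarrow> 'k \<Rightarrow> 's" where
  "algebra_map k X \<psi> U c = restr X (points X) U (\<psi> (primes k) (spec_global k c))"

text \<open>\<open>(f, \<phi>)\<close> is an isomorphism over \<open>k\<close> from the open subscheme \<open>U\<close> to \<open>Spec A\<close>, where \<open>A\<close> is a
  \<open>k\<close>-algebra with structure map \<open>\<iota>\<close>.  As \<open>Spec k\<close> is affine, compatibility of \<open>(f, \<phi>)\<close> with the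
  morphisms to \<open>Spec k\<close> amounts to compatibility with the maps from \<open>k\<close> to global sections.\<close>

definition affine_chart ::
  "('k, 'm) ring_scheme \<Rightarrow> ('x, 's) rspace \<Rightarrow>
   ('k set set \<Rightarrow> ('k set \<Rightarrow> ('k \<times> 'k) set) \<Rightarrow> 's) \<Rightarrow> 'x set \<Rightarrow>
   ('a, 'n) ring_scheme \<Rightarrow> ('k \<Rightarrow> 'a) \<Rightarrow>
   ('x \<Rightarrow> 'a set) \<Rightarrow> ('a set set \<Rightarrow> ('a set \<Rightarrow> ('a \<times> 'a) set) \<Rightarrow> 's) \<Rightarrow> bool" where
  "affine_chart k X \<psi> U A \<iota> f \<phi> \<longleftrightarrow>
     is_open X U \<and> cring A \<and> \<iota> \<in> ring_hom k A \<and>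
     lrs_iso (open_subspace X U) (Spec A) f \<phi> \<and>
     (\<forall>c\<in>carrier k. \<phi> (primes A) (spec_global A (\<iota> c)) = algebra_map k X \<psi> U c)"

definition finite_type_scheme ::
  "('k, 'm) ring_scheme \<Rightarrow> ('x, 's) rspace \<Rightarrow> ('x \<Rightarrow> 'k set) \<Rightarrow>
   ('k set set \<Rightarrow> ('k set \<Rightarrow> ('k \<times> 'k) set) \<Rightarrow> 's) \<Rightarrow> bool" where
  "finite_type_scheme k X \<pi> \<psi> \<longleftrightarrow> scheme_over k X \<pi> \<psi> \<and>
     (\<exists>\<U>. finite \<U> \<and> \<Union>\<U> = points X \<and>
        (\<forall>U\<in>\<U>. \<exists>(A :: 's ring) \<iota> f \<phi>. affine_chart k X \<psi> U A \<iota> f \<phi> \<and>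
           (\<exists>fs. generates_algebra k A \<iota> fs)))"

definition regular_scheme :: "('x, 's) rspace \<Rightarrow> bool" where
  "regular_scheme X \<longleftrightarrow> scheme X \<and> (\<forall>x\<in>points X. regular_local_ring (stalk X x))"


section \<open>Relation type of a scheme\<close>

text \<open>Some affine open neighbourhood of \<open>x\<close> is \<open>Spec (k[x\<^sub>1, \<dots>, x\<^sub>n] / I)\<close>, and \<open>p\<close> is the prime
  ideal of \<open>k[x\<^sub>1, \<dots>, x\<^sub>n]\<close> corresponding to \<open>x\<close>.\<close>

definition local_presentation ::
  "('k, 'm) ring_scheme \<Rightarrow> ('x, 's) rspace \<Rightarrow>
   ('k set set \<Rightarrow> ('k set \<Rightarrow> ('k \<times> 'k) set) \<Rightarrow> 's) \<Rightarrow> 'x \<Rightarrow>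
   nat \<Rightarrow> (nat multiset \<Rightarrow> 'k) set \<Rightarrow> (nat multiset \<Rightarrow> 'k) set \<Rightarrow> bool" where
  "local_presentation k X \<psi> x n I p \<longleftrightarrow> ideal I (mpoly_ring k n) \<and>
     (\<exists>U f \<phi>. x \<in> U \<and>
        affine_chart k X \<psi> U (mpoly_ring k n Quot I)
          (\<lambda>c. I +>\<^bsub>mpoly_ring k n\<^esub> mpoly_const k c) f \<phi> \<and>
        p = {g \<in> carrier (mpoly_ring k n). I +>\<^bsub>mpoly_ring k n\<^esub> g \<in> f x})"

definition rt_point ::
  "('k, 'm) ring_scheme \<Rightarrow> ('x, 's) rspace \<Rightarrow>
   ('k set set \<Rightarrow> ('k set \<Rightarrow> ('k \<times> 'k) set) \<Rightarrow> 's) \<Rightarrow> 'x \<Rightarrow> nat" where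
  "rt_point k X \<psi> x =
     (let (n, I, p) = SOME (n, I, p). local_presentation k X \<psi> x n I p
      in rt_ideal (loc_at (mpoly_ring k n) p) (loc_ideal (mpoly_ring k n) p I))"

text \<open>The empty scheme is \<open>Spec\<close> of \<open>k[x\<^sub>1, \<dots>, x\<^sub>n]\<close> modulo the unit ideal, which has relation
  type 1.  For an infinite set of values \<^const>\<open>Max\<close> would be unspecified.\<close>

definition rt_scheme ::
  "('k, 'm) ring_scheme \<Rightarrow> ('x, 's) rspace \<Rightarrow>
   ('k set set \<Rightarrow> ('k set \<Rightarrow> ('k \<times> 'k) set) \<Rightarrow> 's) \<Rightarrow> nat" where
  "rt_scheme k X \<psi> = (if points X = {} then 1 else Max (rt_point k X \<psi> ` points X))"

end

theory Submission
  imports Defs "HOL-Algebra.Subrings"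
begin

text \<open>Let \<open>x\<close> be a point of \<open>X\<close> with an affine neighbourhood \<open>Spec (P / I)\<close>, where
  \<open>P = k[x\<^sub>1, \<dots>, x\<^sub>n]\<close>, and let \<open>p\<close> be the prime ideal of \<open>P\<close> corresponding to \<open>x\<close>. The relation
  type at \<open>x\<close> is that of the ideal \<open>I\<^sub>p\<close> of \<open>P\<^sub>p\<close>, and the local ring at \<open>x\<close> is \<open>P\<^sub>p / I\<^sub>p\<close>. By
  assumption the latter is regular, and \<open>P\<^sub>p\<close> is regular as a localization of a polynomial ring
  over a field. The kernel of a surjection of regular local rings is generated by part of a
  regular system of parameters, that is, by a regular sequence; and an ideal generated by a
  regular sequence is of linear type, which means that its relation type is 1.

  The commutative algebra rests on one statement, \<open>height_theorem\<close>: if the maximal ideal of a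
  Noetherian local ring is generated modulo \<open>J\<close> by \<open>d\<close> elements, and there is a chain of primes of
  length \<open>d\<close> over \<open>J\<close>, then \<open>J\<close> together with any initial segment of these elements generates a
  prime ideal. It follows from Krull's principal ideal theorem and Nakayama's lemma. Applied to
  \<open>J = 0\<close> it shows that regular systems of parameters are regular sequences, and applied to
  candidates for \<open>I\<^sub>p\<close> it shows that they generate \<open>I\<^sub>p\<close> (\<open>regular_quotient\<close>). Dimensions never
  have to be computed: a chain of primes of the right length is always at hand.

  Regularity of \<open>P\<^sub>p\<close> is proved by adjoining one variable at a time (\<open>UP_regular_at\<close>): a prime of
  \<open>R[T]\<close> over \<open>q\<close> is \<open>q R[T]\<close>, or is locally generated by \<open>q\<close> and one more element. For an ideal
  generated by a regular sequence, the linear relations generate all others by a direct induction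
  on the degree (\<open>form_in_W\<close>).

  On the geometric side, the stalk at \<open>x\<close> is compared with the stalk of the spectrum of \<open>P / I\<close>
  (\<open>cmp_iso\<close>), which is a localization of \<open>P / I\<close> (\<open>Spec_stalk\<close>). A scheme of finite type is only
  given with charts to \<open>Spec A\<close> for finitely generated algebras \<open>A\<close>; presentations \<open>A \<cong> P / I\<close>
  turn them into charts to \<open>Spec (P / I)\<close> (\<open>lrs_iso_change_ring\<close>).\<close>

section \<open>Ideals in commutative rings\<close>

context cring begin

lemma genideal_insert:
  assumes "A \<subseteq> carrier R" "y \<in> carrier R"
  shows "Idl (insert y A) = {a \<oplus> r \<otimes> y | a r. a \<in> Idl A \<and> r \<in> carrier R}" (is "_ = ?S")
proof
  interpret I: ideal "Idl A" R by (rule genideal_ideal[OF assms(1)])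
  have "ideal ?S R"
  proof (rule idealI[OF ring_axioms])
    show "subgroup ?S (add_monoid R)"
    proof
      show "?S \<subseteq> carrier (add_monoid R)" using assms(2) by auto
      show "\<one>\<^bsub>add_monoid R\<^esub> \<in> ?S"
        using assms(2) by (auto intro!: exI[of _ \<zero>])
      fix x x' assume "x \<in> ?S" "x' \<in> ?S"
      then obtain a r a' r' where *: "x = a \<oplus> r \<otimes> y" "a \<in> Idl A" "r \<in> carrier R"
        "x' = a' \<oplus> r' \<otimes> y" "a' \<in> Idl A" "r' \<in> carrier R" by blast
      then have c: "a \<in> carrier R" "a' \<in> carrier R" by auto
      have "x \<oplus> x' = (a \<oplus> a') \<oplus> (r \<oplus> r') \<otimes> y" using * c assms(2) by algebra
      then show "x \<otimes>\<^bsub>add_monoid R\<^esub> x' \<in> ?S" using * by auto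
    next
      fix x assume "x \<in> ?S"
      then obtain a r where *: "x = a \<oplus> r \<otimes> y" "a \<in> Idl A" "r \<in> carrier R" by blast
      then have c: "a \<in> carrier R" by auto
      have "\<ominus> x = \<ominus> a \<oplus> (\<ominus> r) \<otimes> y" using * c assms(2) by algebra
      moreover have "inv\<^bsub>add_monoid R\<^esub> x = \<ominus> x" by (simp add: a_inv_def)
      ultimately show "inv\<^bsub>add_monoid R\<^esub> x \<in> ?S" using * by auto
    qed
  next
    fix x b assume "x \<in> ?S" and b: "b \<in> carrier R"
    then obtain a r where *: "x = a \<oplus> r \<otimes> y" "a \<in> Idl A" "r \<in> carrier R" by blast
    then have c: "a \<in> carrier R" by auto
    have "b \<otimes> x = b \<otimes> a \<oplus> (b \<otimes> r) \<otimes> y" using * c assms(2) b by algebra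
    then show "b \<otimes> x \<in> ?S" using * b I.I_l_closed by auto
    moreover have "x \<otimes> b = b \<otimes> x" using * c assms(2) b by (simp add: m_comm)
    ultimately show "x \<otimes> b \<in> ?S" by simp
  qed
  moreover have "insert y A \<subseteq> ?S"
  proof -
    have "\<zero> \<oplus> \<one> \<otimes> y \<in> ?S" using I.zero_closed one_closed by blast
    then have "y \<in> ?S" using assms(2) by simp
    moreover have "a \<in> ?S" if "a \<in> A" for a
    proof -
      have "a \<in> Idl A" using genideal_self[OF assms(1)] that by auto
      then have "a \<oplus> \<zero> \<otimes> y \<in> ?S" using zero_closed by blast
      then show ?thesis using that assms by (auto simp: subset_iff)
    qed
    ultimately show ?thesis by blast
  qed
  ultimately show "Idl (insert y A) \<subseteq> ?S" by (rule genideal_minimal)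
next
  interpret I: ideal "Idl (insert y A)" R
    by (rule genideal_ideal) (use assms in auto)
  have "y \<in> Idl (insert y A)" "Idl A \<subseteq> Idl (insert y A)"
    using genideal_self[of "insert y A"] subset_Idl_subset[of "insert y A" A] assms by auto
  then show "?S \<subseteq> Idl (insert y A)" using assms I.I_l_closed by auto
qed

lemma genideal_of_ideal: "ideal J R \<Longrightarrow> Idl J = J"
  using genideal_minimal[of J J] genideal_self[of J]
  by (meson additive_subgroup.a_subset ideal.axioms(1) subset_antisym subset_refl)

lemma ideal_subset: "ideal J R \<Longrightarrow> J \<subseteq> carrier R"
  by (meson additive_subgroup.a_subset ideal.axioms(1))

lemma genideal_mono: "B \<subseteq> carrier R \<Longrightarrow> A \<subseteq> B \<Longrightarrow> Idl A \<subseteq> Idl B"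
  by (rule subset_Idl_subset)

lemma mem_genideal: "A \<subseteq> carrier R \<Longrightarrow> x \<in> A \<Longrightarrow> x \<in> Idl A"
  using genideal_self by auto

lemma genideal_Un_genideal:
  assumes "A \<subseteq> carrier R" "B \<subseteq> carrier R"
  shows "Idl (Idl A \<union> B) = Idl (A \<union> B)"
proof
  have "Idl A \<subseteq> Idl (A \<union> B)" "B \<subseteq> Idl (A \<union> B)"
    using assms genideal_mono[of "A \<union> B" A] genideal_self[of "A \<union> B"] by auto
  then show "Idl (Idl A \<union> B) \<subseteq> Idl (A \<union> B)"
    using genideal_minimal[OF genideal_ideal, of "A \<union> B" "Idl A \<union> B"] assms by auto
  have "A \<subseteq> Idl A" using genideal_self assms by auto
  then show "Idl (A \<union> B) \<subseteq> Idl (Idl A \<union> B)"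
    by (intro genideal_mono) (use assms ideal_subset[OF genideal_ideal[of A]] in auto)
qed

lemma mem_genideal_insert:
  assumes "A \<subseteq> carrier R" "y \<in> carrier R" "x \<in> Idl (insert y A)"
  obtains a r where "a \<in> Idl A" "r \<in> carrier R" "x = a \<oplus> r \<otimes> y" "a \<in> carrier R"
  using assms genideal_insert[of A y] ideal_subset[OF genideal_ideal[of A]] by blast

lemma mem_ideal_insert:
  assumes "ideal J R" "y \<in> carrier R" "x \<in> Idl (insert y J)"
  obtains a r where "a \<in> J" "r \<in> carrier R" "x = a \<oplus> r \<otimes> y" "a \<in> carrier R"
  using mem_genideal_insert[OF ideal_subset[OF assms(1)] assms(2,3)] genideal_of_ideal[OF assms(1)]
  by metis

lemma ideal_insert: "ideal J R \<Longrightarrow> y \<in> carrier R \<Longrightarrow> ideal (Idl (insert y J)) R"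
  using genideal_ideal[of "insert y J"] ideal_subset by auto

lemma ideal_insert_sub:
  "ideal J R \<Longrightarrow> y \<in> carrier R \<Longrightarrow> J \<subseteq> Idl (insert y J) \<and> y \<in> Idl (insert y J)"
  using genideal_self[of "insert y J"] ideal_subset by auto

lemma ideal_diff: "ideal J R \<Longrightarrow> a \<in> J \<Longrightarrow> b \<in> J \<Longrightarrow> a \<ominus> b \<in> J"
  using additive_subgroup.a_closed additive_subgroup.a_inv_closed a_minus_def ideal.axioms(1) by metis

lemma ideal_cancel:
  assumes "ideal J R" "a \<oplus> b \<in> J" "b \<in> J" "a \<in> carrier R" shows "a \<in> J"
proof -
  have b: "b \<in> carrier R" using assms ideal_subset by auto
  have "(a \<oplus> b) \<ominus> b \<in> J" using ideal_diff[OF assms(1)] assms by auto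
  moreover have "(a \<oplus> b) \<ominus> b = a" using assms(4) b by algebra
  ultimately show ?thesis by simp
qed

lemma primeideal_one_notin: "primeideal Q R \<Longrightarrow> \<one> \<notin> Q"
  using ideal.one_imp_carrier primeideal.I_notcarr primeideal.axioms(1) by metis

subsection \<open>Saturation\<close>

definition submonoid_set :: "'a set \<Rightarrow> bool" where
  "submonoid_set S \<longleftrightarrow> S \<subseteq> carrier R \<and> \<one> \<in> S \<and> (\<forall>s\<in>S. \<forall>t\<in>S. s \<otimes> t \<in> S)"

text \<open>The contraction of the extension of \<open>J\<close> to the localization at \<open>S\<close>. Ideals of a localization
  correspond to saturated ideals, so the arguments about \<open>R\<^sub>Q\<close> below can be carried out in \<open>R\<close>.\<close>

definition saturation :: "'a set \<Rightarrow> 'a set \<Rightarrow> 'a set" where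
  "saturation S J = {u \<in> carrier R. \<exists>s\<in>S. s \<otimes> u \<in> J}"

lemma submonoid_prime: "primeideal Q R \<Longrightarrow> submonoid_set (carrier R - Q)"
  unfolding submonoid_set_def
  using primeideal_one_notin primeideal.I_prime by fastforce

lemma saturation_ideal:
  assumes S: "submonoid_set S" and J: "ideal J R"
  shows "ideal (saturation S J) R"
proof (rule idealI[OF ring_axioms])
  interpret J: ideal J R by fact
  have Sc: "\<And>s. s \<in> S \<Longrightarrow> s \<in> carrier R" and Sm: "\<And>s t. s \<in> S \<Longrightarrow> t \<in> S \<Longrightarrow> s \<otimes> t \<in> S"
    using S by (auto simp: submonoid_set_def)
  show "subgroup (saturation S J) (add_monoid R)"
  proof
    show "saturation S J \<subseteq> carrier (add_monoid R)" by (auto simp: saturation_def)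
    show "\<one>\<^bsub>add_monoid R\<^esub> \<in> saturation S J"
      using S by (auto simp: saturation_def submonoid_set_def intro!: bexI[of _ \<one>])
    fix u v assume "u \<in> saturation S J" "v \<in> saturation S J"
    then obtain s t where *: "u \<in> carrier R" "v \<in> carrier R" "s \<in> S" "t \<in> S" "s \<otimes> u \<in> J" "t \<otimes> v \<in> J"
      by (auto simp: saturation_def)
    have "(s \<otimes> t) \<otimes> (u \<oplus> v) = t \<otimes> (s \<otimes> u) \<oplus> s \<otimes> (t \<otimes> v)" using * Sc[of s] Sc[of t] by algebra
    also have "\<dots> \<in> J" using * Sc by (simp add: J.I_l_closed)
    finally show "u \<otimes>\<^bsub>add_monoid R\<^esub> v \<in> saturation S J"
      using * Sm[of s t] by (auto simp: saturation_def)
  next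
    fix u assume "u \<in> saturation S J"
    then obtain s where *: "u \<in> carrier R" "s \<in> S" "s \<otimes> u \<in> J" by (auto simp: saturation_def)
    have "s \<otimes> (\<ominus> u) = \<ominus> (s \<otimes> u)" using * Sc[of s] by algebra
    also have "\<dots> \<in> J" using * by simp
    finally have "\<ominus> u \<in> saturation S J" using * by (auto simp: saturation_def)
    then show "inv\<^bsub>add_monoid R\<^esub> u \<in> saturation S J" by (simp add: a_inv_def)
  qed
  fix u b assume "u \<in> saturation S J" and b: "b \<in> carrier R"
  then obtain s where *: "u \<in> carrier R" "s \<in> S" "s \<otimes> u \<in> J" by (auto simp: saturation_def)
  have "s \<otimes> (b \<otimes> u) = b \<otimes> (s \<otimes> u)" using * b Sc[of s] by algebra
  also have "\<dots> \<in> J" using * b by (simp add: J.I_l_closed)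
  finally show "b \<otimes> u \<in> saturation S J" using * b by (auto simp: saturation_def)
  then show "u \<otimes> b \<in> saturation S J" using m_comm * b by simp
qed

lemma saturation_sub: "submonoid_set S \<Longrightarrow> ideal J R \<Longrightarrow> J \<subseteq> saturation S J"
proof
  fix u assume S: "submonoid_set S" and J: "ideal J R" and u: "u \<in> J"
  then have "u \<in> carrier R" using ideal_subset by blast
  moreover have "\<one> \<otimes> u \<in> J" "\<one> \<in> S" using u calculation S by (auto simp: submonoid_set_def)
  ultimately show "u \<in> saturation S J" unfolding saturation_def by blast
qed

lemma saturation_mono: "J \<subseteq> K \<Longrightarrow> saturation S J \<subseteq> saturation S K"
  by (auto simp: saturation_def)

lemma saturation_idem:
  assumes "submonoid_set S" "u \<in> carrier R" "s \<in> S" "s \<otimes> u \<in> saturation S J"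
  shows "u \<in> saturation S J"
proof -
  from assms obtain t where t: "t \<in> S" "t \<otimes> (s \<otimes> u) \<in> J" by (auto simp: saturation_def)
  have "(t \<otimes> s) \<otimes> u \<in> J" "t \<otimes> s \<in> S"
    using t assms by (auto simp: submonoid_set_def m_assoc subset_iff)
  then show ?thesis using assms(2) unfolding saturation_def by blast
qed

end

subsection \<open>Noetherian rings\<close>

locale noeth_cring = cring + noetherian_ring
begin

lemma ideal_wf: "wf {(J, K). ideal J R \<and> ideal K R \<and> K \<subset> J}"
proof (rule ccontr)
  assume "\<not> wf {(J, K). ideal J R \<and> ideal K R \<and> K \<subset> J}"
  then obtain f where f: "\<And>i. (f (Suc i), f i) \<in> {(J, K). ideal J R \<and> ideal K R \<and> K \<subset> J}"
    unfolding wf_iff_no_infinite_down_chain by blast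
  have st: "f i \<subset> f (Suc i)" and id: "ideal (f i) R" for i using f[of i] by auto
  have mono: "i \<le> j \<Longrightarrow> f i \<subseteq> f j" for i j
    by (rule lift_Suc_mono_le[of f]) (use st in auto)
  have "subset.chain {I. ideal I R} (range f)"
    unfolding pred_on.chain_def using id by auto (metis mono nat_le_linear subset_iff)+
  then have "\<Union>(range f) \<in> range f" using ideal_chain_is_trivial[of "range f"] by auto
  then obtain n where "\<Union>(range f) = f n" by auto
  then have "f (Suc n) \<subseteq> f n" by blast
  then show False using st[of n] by auto
qed

lemma ideal_maximal:
  assumes "P J0" "\<And>J. P J \<Longrightarrow> ideal J R"
  obtains J where "P J" "\<And>K. P K \<Longrightarrow> J \<subseteq> K \<Longrightarrow> K = J"
proof -
  from wfE_min[OF ideal_wf, of J0 "{J. P J}"] assms(1)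
  obtain J where J: "P J" "\<And>K. (K, J) \<in> {(J, K). ideal J R \<and> ideal K R \<and> K \<subset> J} \<Longrightarrow> \<not> P K" by auto
  show ?thesis by (rule that[OF J(1)]) (use J assms(2) in blast)
qed

text \<open>If \<open>Q\<close> is minimal over \<open>J0\<close>, the ring \<open>R\<^sub>Q / J0 R\<^sub>Q\<close> has only one prime ideal and is therefore
  Artinian; this is the descending chain condition for it. By Noetherian induction it may be
  assumed for all ideals larger than \<open>J\<close>. A maximal annihilator \<open>(J : a)\<close> with \<open>a \<notin> J\<close> is prime
  and lies between \<open>J0\<close> and \<open>Q\<close>, so it equals \<open>Q\<close>: modulo \<open>J\<close>, the element \<open>a\<close> spans a
  one-dimensional space over the residue field of \<open>Q\<close>. The chain obtained by adding \<open>a\<close> to every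
  \<open>L i\<close> is stationary by induction, and \<open>L i\<close> itself differs from it by at most this
  one-dimensional space.\<close>

lemma saturated_stabilizes:
  assumes Q: "primeideal Q R" and J0: "ideal J0 R"
    and min: "\<And>Q'. primeideal Q' R \<Longrightarrow> J0 \<subseteq> Q' \<Longrightarrow> Q' \<subseteq> Q \<Longrightarrow> Q' = Q"
    and S: "S = carrier R - Q"
    and J: "ideal J R" "J0 \<subseteq> J" "saturation S J = J"
    and L: "\<And>i. ideal (L i) R" "\<And>i. saturation S (L i) = L i" "\<And>i. J \<subseteq> L i" "\<And>i::nat. L (Suc i) \<subseteq> L i"
  shows "\<exists>N. \<forall>n\<ge>N. L n = L N"
  using J L
proof (induction J arbitrary: L rule: wf_induct_rule[OF ideal_wf])
  case (1 J)
  interpret J: ideal J R by (rule 1)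
  interpret Q: primeideal Q R by fact
  have Sm: "submonoid_set S" using submonoid_prime[OF Q] S by simp
  have Lanti: "i \<le> j \<Longrightarrow> L j \<subseteq> L i" for i j
    by (rule lift_Suc_antimono_le[of L]) (use 1 in auto)
  show ?case
  proof (cases "J = carrier R")
    case True
    then have "L i = carrier R" for i using 1(7)[of i] ideal_subset[OF 1(5)[of i]] by auto
    then show ?thesis by auto
  next
    case False
    define col where "col a = {r \<in> carrier R. r \<otimes> a \<in> J}" for a
    define Pr where "Pr K \<longleftrightarrow> (\<exists>a\<in>carrier R - J. K = col a)" for K
    have idc: "ideal (col a) R" if "a \<in> carrier R" for a
    proof (rule idealI[OF ring_axioms])
      show "subgroup (col a) (add_monoid R)"
      proof
        show "col a \<subseteq> carrier (add_monoid R)" by (auto simp: col_def)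
        show "\<one>\<^bsub>add_monoid R\<^esub> \<in> col a" using that by (auto simp: col_def)
        show "x \<otimes>\<^bsub>add_monoid R\<^esub> y \<in> col a" if "x \<in> col a" "y \<in> col a" for x y
          using that \<open>a \<in> carrier R\<close> by (auto simp: col_def l_distr)
        show "inv\<^bsub>add_monoid R\<^esub> x \<in> col a" if "x \<in> col a" for x
          using that \<open>a \<in> carrier R\<close> by (auto simp: col_def a_inv_def[symmetric] l_minus)
      qed
      fix x r assume xr: "x \<in> col a" "r \<in> carrier R"
      then show "r \<otimes> x \<in> col a" using that J.I_l_closed by (auto simp: col_def m_assoc)
      then show "x \<otimes> r \<in> col a" using xr m_comm by (auto simp: col_def)
    qed
    \<comment> \<open>an associated prime of \<open>R / J\<close>, found as a maximal annihilator\<close>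
    obtain a0 where "a0 \<in> carrier R - J" using False J.a_subset by auto
    then have "Pr (col a0)" by (auto simp: Pr_def)
    then obtain K where K: "Pr K" "\<And>K'. Pr K' \<Longrightarrow> K \<subseteq> K' \<Longrightarrow> K' = K"
      by (rule ideal_maximal) (auto simp: Pr_def idc)
    then obtain a where a: "a \<in> carrier R" "a \<notin> J" "K = col a" by (auto simp: Pr_def)
    have "primeideal K R"
    proof (rule primeidealI)
      show "ideal K R" using a idc by simp
      have "\<one> \<notin> K" using a by (simp add: col_def)
      then show "carrier R \<noteq> K" by blast
      fix x y assume xy: "x \<in> carrier R" "y \<in> carrier R" "x \<otimes> y \<in> K"
      show "x \<in> K \<or> y \<in> K"
      proof (rule ccontr)
        assume n: "\<not> (x \<in> K \<or> y \<in> K)"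
        then have ya: "y \<otimes> a \<in> carrier R - J" using xy a by (auto simp: col_def)
        have "K \<subseteq> col (y \<otimes> a)"
        proof
          fix r assume r: "r \<in> K"
          then have "r \<in> carrier R" "r \<otimes> a \<in> J" using a by (auto simp: col_def)
          moreover have "r \<otimes> (y \<otimes> a) = y \<otimes> (r \<otimes> a)" using calculation xy a by algebra
          ultimately show "r \<in> col (y \<otimes> a)" using xy J.I_l_closed by (auto simp: col_def)
        qed
        then have "col (y \<otimes> a) = K" using K(2) ya by (auto simp: Pr_def)
        moreover have "x \<in> col (y \<otimes> a)" using xy a by (auto simp: col_def m_assoc)
        ultimately show False using n by auto
      qed
    qed (rule is_cring)
    moreover have "J0 \<subseteq> K"
      using 1(3) a J.I_r_closed J.a_subset by (auto simp: col_def)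
    moreover have "K \<subseteq> Q"
    proof
      fix r assume "r \<in> K"
      then have r: "r \<in> carrier R" "r \<otimes> a \<in> J" using a by (auto simp: col_def)
      show "r \<in> Q"
      proof (rule ccontr)
        assume "r \<notin> Q"
        then have "a \<in> saturation S J" using r a by (auto simp: saturation_def S)
        then show False using a 1(4) by auto
      qed
    qed
    ultimately have KQ: "K = Q" by (rule min)
    define L' where "L' i = saturation S (Idl (insert a (L i)))" for i
    define J' where "J' = saturation S (Idl (insert a J))"
    have idJ': "ideal J' R" unfolding J'_def by (intro saturation_ideal Sm ideal_insert 1 a)
    have idL': "ideal (L' i) R" for i unfolding L'_def by (intro saturation_ideal Sm ideal_insert 1 a)
    have aJ': "J \<subseteq> J'" "a \<in> J'"
      using saturation_sub[OF Sm ideal_insert[OF 1(2) a(1)]] ideal_insert_sub[OF 1(2) a(1)]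
      by (auto simp: J'_def)
    have sat2: "saturation S (saturation S V) = saturation S V" if "ideal V R" for V
    proof
      show "saturation S V \<subseteq> saturation S (saturation S V)"
        by (rule saturation_sub[OF Sm saturation_ideal[OF Sm that]])
      show "saturation S (saturation S V) \<subseteq> saturation S V"
        using saturation_idem[OF Sm] by (auto simp: saturation_def[of S "saturation S V"])
    qed
    have "\<exists>N. \<forall>n\<ge>N. L' n = L' N"
    proof (rule 1(1)[of J'])
      show "(J', J) \<in> {(J, K). ideal J R \<and> ideal K R \<and> K \<subset> J}" using idJ' 1(2) aJ' a by auto
      show "saturation S J' = J'" unfolding J'_def by (rule sat2[OF ideal_insert[OF 1(2) a(1)]])
      show "saturation S (L' i) = L' i" for i unfolding L'_def by (rule sat2[OF ideal_insert[OF 1(5) a(1)]])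
      show "J' \<subseteq> L' i" for i unfolding J'_def L'_def
        by (intro saturation_mono genideal_mono) (use 1(7) ideal_subset[OF 1(5)] a in auto)
      show "L' (Suc i) \<subseteq> L' i" for i unfolding L'_def
        by (intro saturation_mono genideal_mono) (use 1(8)[of i] ideal_subset[OF 1(5)] a in auto)
    qed (use idJ' idL' aJ' 1(3) in auto)
    then obtain N where N: "\<And>n. n \<ge> N \<Longrightarrow> L' n = L' N" by auto
    show ?thesis
    proof (cases "\<forall>i. a \<in> L i")
      case True
      then have "Idl (insert a (L i)) = L i" for i
        using genideal_of_ideal[OF 1(5)[of i]] by (simp add: insert_absorb)
      then have "L' i = L i" for i using 1(6) by (simp add: L'_def)
      then show ?thesis using N by auto
    next
      case False
      then obtain i where i: "a \<notin> L i" by auto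
      define M where "M = max i N"
      \<comment> \<open>from the index \<open>M\<close> on, \<open>L n\<close> meets the span of \<open>a\<close> only in \<open>J\<close>\<close>
      have aM: "a \<notin> L n" if "n \<ge> M" for n using i Lanti[of i n] that by (auto simp: M_def)
      have "L n = L M" if n: "n \<ge> M" for n
      proof
        show "L n \<subseteq> L M" using Lanti n by auto
        show "L M \<subseteq> L n"
        proof
          fix u assume u: "u \<in> L M"
          have uc: "u \<in> carrier R" using u ideal_subset[OF 1(5)] by auto
          have "u \<in> L' M" unfolding L'_def
            using u saturation_sub[OF Sm ideal_insert[OF 1(5) a(1)]] ideal_insert_sub[OF 1(5) a(1)] by blast
          then have "u \<in> L' n" using N[of n] N[of M] n by (auto simp: M_def)
          then obtain s where s: "s \<in> S" "s \<otimes> u \<in> Idl (insert a (L n))" by (auto simp: L'_def saturation_def)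
          obtain v r where v: "v \<in> L n" "r \<in> carrier R" "s \<otimes> u = v \<oplus> r \<otimes> a" "v \<in> carrier R"
            by (rule mem_ideal_insert[OF 1(5) a(1) s(2)]) auto
          have sc: "s \<in> carrier R" using s S by auto
          have "r \<otimes> a = s \<otimes> u \<ominus> v" unfolding v(3) using v a by algebra
          moreover have "s \<otimes> u \<in> L M" using u sc ideal.I_l_closed[OF 1(5)] by auto
          moreover have "v \<in> L M" using v Lanti[OF n] by auto
          ultimately have ra: "r \<otimes> a \<in> L M" using ideal_diff[OF 1(5)] by auto
          have "r \<in> Q"
          proof (rule ccontr)
            assume "r \<notin> Q"
            then have "a \<in> saturation S (L M)" using ra a v by (auto simp: saturation_def S)
            then show False using 1(6) aM[of M] by auto
          qed
          then have "r \<otimes> a \<in> J" using KQ a by (auto simp: col_def)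
          then have "s \<otimes> u \<in> L n" using v 1(7)[of n] additive_subgroup.a_closed[OF ideal.axioms(1)[OF 1(5)[of n]]] by auto
          then have "u \<in> saturation S (L n)" using s uc by (auto simp: saturation_def)
          then show "u \<in> L n" using 1(6) by auto
        qed
      qed
      then show ?thesis by auto
    qed
  qed
qed

text \<open>Nakayama's lemma in \<open>R\<^sub>Q\<close>, for an ideal \<open>K\<close> with \<open>K = K' + x K\<close> locally. If \<open>K' \<noteq> K\<close>, a maximal
  proper \<open>H\<close> between them (saturated in \<open>K\<close>) makes \<open>K / H\<close> a simple module over \<open>R\<^sub>Q\<close>, spanned by
  some \<open>g\<close>. As \<open>x\<close> kills a simple module, \<open>g \<in> K' + x K\<close> vanishes in \<open>K / H\<close>.\<close>

lemma saturated_nakayama: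
  assumes Q: "primeideal Q R" and S: "S = carrier R - Q" and x: "x \<in> Q"
    and K: "ideal K R" "ideal K' R" "K' \<subseteq> K" "saturation S K' = K'"
    and sub: "\<And>k. k \<in> K \<Longrightarrow> \<exists>s\<in>S. \<exists>k'\<in>K'. \<exists>h\<in>K. s \<otimes> k = k' \<oplus> x \<otimes> h"
  shows "K = K'"
proof (rule ccontr)
  assume neq: "K \<noteq> K'"
  interpret Q: primeideal Q R by fact
  have Sm: "submonoid_set S" using submonoid_prime[OF Q] S by simp
  have xc: "x \<in> carrier R" using x Q.a_subset by auto
  define Pr where "Pr H \<longleftrightarrow> ideal H R \<and> K' \<subseteq> H \<and> H \<subset> K \<and> saturation S H \<inter> K = H" for H
  have "Pr K'" using K neq by (auto simp: Pr_def)
  then obtain H where H: "Pr H" "\<And>H'. Pr H' \<Longrightarrow> H \<subseteq> H' \<Longrightarrow> H' = H"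
    by (rule ideal_maximal) (auto simp: Pr_def)
  have Hi: "ideal H R" and HK: "K' \<subseteq> H" "H \<subset> K" and Hs: "saturation S H \<inter> K = H"
    using H by (auto simp: Pr_def)
  interpret H: ideal H R by fact
  obtain g where g: "g \<in> K" "g \<notin> H" using HK by auto
  have gc: "g \<in> carrier R" using g ideal_subset[OF K(1)] by auto
  define G where "G = saturation S (Idl (insert g H)) \<inter> K"
  have Gi: "ideal G R" unfolding G_def
    by (intro i_intersect saturation_ideal Sm ideal_insert Hi gc K)
  have HG: "H \<subseteq> G" "g \<in> G"
    using saturation_sub[OF Sm ideal_insert[OF Hi gc]] ideal_insert_sub[OF Hi gc] HK g by (auto simp: G_def)
  have "saturation S G \<inter> K \<subseteq> G"
    using saturation_idem[OF Sm] by (fastforce simp: G_def saturation_def[of S "saturation S _ \<inter> _"])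
  then have "saturation S G \<inter> K = G" using saturation_sub[OF Sm Gi] by (auto simp: G_def)
  then have "Pr G" if "G \<noteq> K" using that Gi HG HK by (auto simp: Pr_def G_def)
  then have GK: "G = K" using H(2)[of G] HG g by auto
  obtain s k' h where 1: "s \<in> S" "k' \<in> K'" "h \<in> K" "s \<otimes> g = k' \<oplus> x \<otimes> h" using sub[OF g(1)] by blast
  have "h \<in> G" using 1 GK by simp
  then obtain t where t: "t \<in> S" "t \<otimes> h \<in> Idl (insert g H)" by (auto simp: G_def saturation_def)
  obtain h' r where h': "h' \<in> H" "r \<in> carrier R" "t \<otimes> h = h' \<oplus> r \<otimes> g" "h' \<in> carrier R"
    by (rule mem_ideal_insert[OF Hi gc t(2)]) auto
  have c: "s \<in> carrier R" "t \<in> carrier R" "k' \<in> carrier R" "h \<in> carrier R"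
    using 1 t S HK ideal_subset[OF K(1)] by auto
  have "(t \<otimes> s \<ominus> x \<otimes> r) \<otimes> g = t \<otimes> (s \<otimes> g) \<ominus> x \<otimes> r \<otimes> g" using c gc xc h'(2) by algebra
  also have "\<dots> = t \<otimes> k' \<oplus> x \<otimes> (t \<otimes> h) \<ominus> x \<otimes> r \<otimes> g" unfolding 1(4) using c gc xc h'(2) by algebra
  also have "\<dots> = t \<otimes> k' \<oplus> x \<otimes> h'" unfolding h'(3) using c gc xc h'(1,2,4) by algebra
  also have "\<dots> \<in> H" using 1 h' HK c xc H.I_l_closed by auto
  finally have inH: "(t \<otimes> s \<ominus> x \<otimes> r) \<otimes> g \<in> H" .
  have "t \<otimes> s \<ominus> x \<otimes> r \<notin> Q"
  proof
    assume a: "t \<otimes> s \<ominus> x \<otimes> r \<in> Q"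
    have "x \<otimes> r \<in> Q" using x h' Q.I_r_closed by auto
    then have "(t \<otimes> s \<ominus> x \<otimes> r) \<oplus> x \<otimes> r \<in> Q" using a by auto
    moreover have "(t \<otimes> s \<ominus> x \<otimes> r) \<oplus> x \<otimes> r = t \<otimes> s" using c xc h' by algebra
    ultimately show False using Q.I_prime[of t s] 1 t S by auto
  qed
  then have "t \<otimes> s \<ominus> x \<otimes> r \<in> S" using S c xc h' by auto
  then have "g \<in> saturation S H" using inH gc by (auto simp: saturation_def)
  then show False using Hs g by auto
qed

end

section \<open>The height theorem and regular local rings\<close>

definition prime_chain :: "('a, 'm) ring_scheme \<Rightarrow> (nat \<Rightarrow> 'a set) \<Rightarrow> nat \<Rightarrow> bool" where
  "prime_chain R Q d \<longleftrightarrow> (\<forall>i\<le>d. primeideal (Q i) R) \<and> (\<forall>i<d. Q i \<subset> Q (Suc i))"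

lemma prime_chain_tail: "prime_chain R Q (Suc d) \<Longrightarrow> prime_chain R (\<lambda>i. Q (Suc i)) d"
  by (auto simp: prime_chain_def)

lemma prime_chain_mono: "prime_chain R Q d \<Longrightarrow> i \<le> j \<Longrightarrow> j \<le> d \<Longrightarrow> Q i \<subseteq> Q j"
proof (induction j)
  case (Suc j)
  then have "Q j \<subseteq> Q (Suc j)" using Suc_le_lessD unfolding prime_chain_def by blast
  with Suc show ?case by (cases "i = Suc j") auto
qed auto

context noeth_cring begin

text \<open>Krull's principal ideal theorem: above \<open>Q0\<close>, a prime minimal over \<open>Q0 + (x)\<close> has height at most
  one. Suppose that \<open>Q2\<close> is minimal over \<open>Q0 + (x)\<close>. Instead of the symbolic powers of \<open>Q1\<close> one
  takes the powers of a single \<open>y \<in> Q1 - Q0\<close>: let \<open>K n\<close> be the contraction of \<open>Q0 + (y^n)\<close> from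
  the localization in which \<open>x\<close> and everything outside \<open>Q2\<close> is inverted. The chain \<open>K n + (x)\<close>
  becomes stationary at \<open>Q2\<close> by \<open>saturated_stabilizes\<close>, and \<open>x\<close> is a nonzerodivisor modulo \<open>K n\<close>;
  hence \<open>K N = K (Suc N) + x K N\<close> locally, and \<open>K N = K (Suc N)\<close> by Nakayama. Therefore
  \<open>t y^N \<in> Q0 + (y^(N+1))\<close> for some \<open>t = s x^j\<close> with \<open>s \<notin> Q2\<close>, which gives \<open>t \<in> Q0 + (y) \<subseteq> Q1\<close>;
  but \<open>Q1\<close> contains neither \<open>s\<close> nor \<open>x\<close>.\<close>

lemma principal_ideal_theorem:
  assumes Q: "primeideal Q0 R" "primeideal Q1 R" "primeideal Q2 R" "Q0 \<subset> Q1" "Q1 \<subset> Q2"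
    and x: "x \<in> Q2"
  shows "\<exists>Q'. primeideal Q' R \<and> Q0 \<subseteq> Q' \<and> x \<in> Q' \<and> Q' \<subset> Q2"
proof (rule ccontr)
  assume neg: "\<not> ?thesis"
  interpret Q0: primeideal Q0 R by fact
  interpret Q1: primeideal Q1 R by fact
  interpret Q2: primeideal Q2 R by fact
  have xc: "x \<in> carrier R" using x Q2.a_subset by auto
  have xQ1: "x \<notin> Q1" using neg Q by blast
  obtain y where y: "y \<in> Q1" "y \<notin> Q0" using Q by auto
  have yc: "y \<in> carrier R" using y Q1.a_subset by auto
  define S where "S = carrier R - Q2"
  have Sm: "submonoid_set S" unfolding S_def by (rule submonoid_prime[OF Q(3)])
  have pow_notin: "z [^] j \<notin> P" if "primeideal P R" "z \<notin> P" "z \<in> carrier R" for P z and j :: nat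
  proof (induction j)
    case 0 then show ?case using primeideal_one_notin[OF that(1)] by simp
  next
    case (Suc j) then show ?case using primeideal.I_prime[OF that(1), of "z [^] j" z] that by auto
  qed
  define T where "T = {s \<otimes> x [^] j | s (j::nat). s \<in> S}"
  have ST: "S \<subseteq> T"
  proof
    fix s assume s: "s \<in> S"
    then have "s \<otimes> x [^] (0::nat) \<in> T" unfolding T_def by blast
    then show "s \<in> T" using s by (simp add: S_def)
  qed
  have xT: "x \<in> T"
  proof -
    have "\<one> \<otimes> x [^] (1::nat) \<in> T" unfolding T_def using Sm unfolding submonoid_set_def by blast
    then show ?thesis using xc by simp
  qed
  have Tm: "submonoid_set T"
    unfolding submonoid_set_def
  proof (intro conjI ballI)
    show "T \<subseteq> carrier R" using xc by (auto simp: T_def S_def)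
    show "\<one> \<in> T" using ST Sm by (auto simp: submonoid_set_def)
    fix s t assume "s \<in> T" "t \<in> T"
    then obtain s' i t' j where *: "s = s' \<otimes> x [^] (i::nat)" "t = t' \<otimes> x [^] (j::nat)" "s' \<in> S" "t' \<in> S"
      by (auto simp: T_def)
    have "s \<otimes> t = (s' \<otimes> t') \<otimes> (x [^] i \<otimes> x [^] j)" unfolding *(1,2)
      using *(3,4) xc by (simp add: S_def m_ac)
    then have "s \<otimes> t = (s' \<otimes> t') \<otimes> x [^] (i + j)" using xc by (simp add: nat_pow_mult)
    moreover have "s' \<otimes> t' \<in> S" using Sm * by (auto simp: submonoid_set_def)
    ultimately show "s \<otimes> t \<in> T" unfolding T_def by blast
  qed
  define W where "W n = Idl (insert (y [^] n) Q0)" for n :: nat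
  have Wi: "ideal (W n) R" for n unfolding W_def by (rule ideal_insert[OF Q0.is_ideal]) (use yc in auto)
  define K where "K n = saturation T (W n)" for n
  have Ki: "ideal (K n) R" for n unfolding K_def by (rule saturation_ideal[OF Tm Wi])
  have Wsub: "W (Suc n) \<subseteq> W n" for n
  proof -
    have "y [^] Suc n \<in> W n"
      using ideal_insert_sub[OF Q0.is_ideal, of "y [^] n"] ideal.I_r_closed[OF Wi[of n], of "y [^] n" y] yc
      by (auto simp: W_def)
    moreover have "Q0 \<subseteq> W n" using ideal_insert_sub[OF Q0.is_ideal, of "y [^] n"] yc by (auto simp: W_def)
    ultimately show ?thesis unfolding W_def[of "Suc n"] by (intro genideal_minimal Wi) auto
  qed
  have Ksub: "K (Suc n) \<subseteq> K n" for n unfolding K_def by (intro saturation_mono Wsub)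
  have Kcar: "K n \<subseteq> carrier R" for n using ideal_subset[OF Ki] .
  have KT: "u \<in> K n" if "u \<in> carrier R" "s \<in> T" "s \<otimes> u \<in> K n" for u s n
    using saturation_idem[OF Tm that(1,2)] that(3) by (simp add: K_def)
  have KS: "saturation S (K n) = K n" for n
  proof
    show "K n \<subseteq> saturation S (K n)" by (rule saturation_sub[OF Sm Ki])
    show "saturation S (K n) \<subseteq> K n" using KT ST by (auto simp: saturation_def)
  qed
  define L where "L n = saturation S (Idl (insert x (K n)))" for n
  define J0 where "J0 = Idl (insert x Q0)"
  have J0i: "ideal J0 R" unfolding J0_def by (rule ideal_insert[OF Q0.is_ideal xc])
  have satsat: "saturation S (saturation S V) = saturation S V" if "ideal V R" for V
  proof
    show "saturation S V \<subseteq> saturation S (saturation S V)"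
      by (rule saturation_sub[OF Sm saturation_ideal[OF Sm that]])
    show "saturation S (saturation S V) \<subseteq> saturation S V"
      using saturation_idem[OF Sm] by (auto simp: saturation_def[of S "saturation S V"])
  qed
  have Q0K: "Q0 \<subseteq> K n" for n
    using saturation_sub[OF Tm Wi[of n]] ideal_insert_sub[OF Q0.is_ideal, of "y [^] n"] yc
    by (auto simp: W_def K_def)
  have "\<exists>N. \<forall>n\<ge>N. L n = L N"
  proof (rule saturated_stabilizes[OF Q(3) J0i _ S_def])
    show "Q' = Q2" if "primeideal Q' R" "J0 \<subseteq> Q'" "Q' \<subseteq> Q2" for Q'
    proof -
      have "Q0 \<subseteq> Q'" "x \<in> Q'" using ideal_insert_sub[OF Q0.is_ideal xc] that by (auto simp: J0_def)
      then show ?thesis using neg that by blast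
    qed
    show "ideal (saturation S J0) R" by (rule saturation_ideal[OF Sm J0i])
    show "J0 \<subseteq> saturation S J0" by (rule saturation_sub[OF Sm J0i])
    show "saturation S (saturation S J0) = saturation S J0" by (rule satsat[OF J0i])
    show "ideal (L i) R" for i unfolding L_def by (intro saturation_ideal Sm ideal_insert Ki xc)
    show "saturation S (L i) = L i" for i unfolding L_def by (intro satsat ideal_insert Ki xc)
    show "saturation S J0 \<subseteq> L i" for i unfolding J0_def L_def
      by (intro saturation_mono genideal_mono) (use Q0K Kcar xc in auto)
    show "L (Suc i) \<subseteq> L i" for i unfolding L_def
      by (intro saturation_mono genideal_mono) (use Ksub Kcar xc in auto)
  qed
  then obtain N where N: "L (Suc N) = L N" by (metis le_Suc_eq order_refl)
  have "K N = K (Suc N)"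
  proof (rule saturated_nakayama[OF Q(3) S_def x Ki Ki Ksub KS])
    fix k assume k: "k \<in> K N"
    have "k \<in> L N" unfolding L_def
      using k saturation_sub[OF Sm ideal_insert[OF Ki xc]] ideal_insert_sub[OF Ki xc] by blast
    then have "k \<in> L (Suc N)" using N by simp
    then obtain s where s: "s \<in> S" "s \<otimes> k \<in> Idl (insert x (K (Suc N)))" by (auto simp: L_def saturation_def)
    obtain k' r where k': "k' \<in> K (Suc N)" "r \<in> carrier R" "s \<otimes> k = k' \<oplus> r \<otimes> x" "k' \<in> carrier R"
      by (rule mem_ideal_insert[OF Ki xc s(2)]) auto
    have sc: "s \<in> carrier R" using s by (auto simp: S_def)
    have "k' \<oplus> r \<otimes> x \<in> K N" using ideal.I_l_closed[OF Ki k sc] k'(3) by simp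
    then have "r \<otimes> x \<in> K N" using ideal_cancel[OF Ki, of "r \<otimes> x" k'] k' xc Ksub a_comm[of k' "r \<otimes> x"] by auto
    then have "r \<in> K N" using KT[OF k'(2) xT] m_comm[OF k'(2) xc] by simp
    then show "\<exists>s\<in>S. \<exists>k'\<in>K (Suc N). \<exists>h\<in>K N. s \<otimes> k = k' \<oplus> x \<otimes> h"
      using s(1) k'(1,3) m_comm[OF k'(2) xc] by auto
  qed
  moreover have "y [^] N \<in> K N"
    using saturation_sub[OF Tm Wi[of N]] ideal_insert_sub[OF Q0.is_ideal, of "y [^] N"] yc
    by (auto simp: K_def W_def)
  ultimately obtain t where t: "t \<in> T" "t \<otimes> y [^] N \<in> W (Suc N)" by (auto simp: K_def saturation_def)
  obtain q r where q: "q \<in> Q0" "r \<in> carrier R" "t \<otimes> y [^] N = q \<oplus> r \<otimes> y [^] Suc N" "q \<in> carrier R"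
    by (rule mem_ideal_insert[OF Q0.is_ideal _ t(2)[unfolded W_def]]) (use yc in auto)
  have tc: "t \<in> carrier R" using t Tm by (auto simp: submonoid_set_def)
  have yN: "y [^] N \<in> carrier R" using yc by simp
  have "(t \<ominus> r \<otimes> y) \<otimes> y [^] N = t \<otimes> y [^] N \<ominus> r \<otimes> (y [^] N \<otimes> y)" using tc q(2) yc yN by algebra
  also have "\<dots> = q" unfolding q(3) nat_pow_Suc using q(2,4) yc yN by algebra
  finally have "(t \<ominus> r \<otimes> y) \<otimes> y [^] N \<in> Q0" using q by simp
  then have "t \<ominus> r \<otimes> y \<in> Q0" using Q0.I_prime[of "t \<ominus> r \<otimes> y" "y [^] N"] pow_notin[OF Q(1) y(2) yc] tc q yc by auto
  then have "t \<ominus> r \<otimes> y \<in> Q1" using Q by auto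
  then have "t \<ominus> r \<otimes> y \<oplus> r \<otimes> y \<in> Q1" using Q1.I_l_closed[OF y(1) q(2)] by auto
  moreover have "t \<ominus> r \<otimes> y \<oplus> r \<otimes> y = t" using tc q(2) yc by algebra
  ultimately have tQ: "t \<in> Q1" by simp
  obtain s j where s: "s \<in> S" "t = s \<otimes> x [^] (j::nat)" using t by (auto simp: T_def)
  then have "s \<in> Q1 \<or> x [^] j \<in> Q1" using Q1.I_prime[of s "x [^] j"] tQ xc by (auto simp: S_def)
  then show False using pow_notin[OF Q(2) xQ1 xc] s Q by (auto simp: S_def)
qed

text \<open>The chain is rerouted from the top downwards: the principal ideal theorem replaces the prime
  below the top by one that contains \<open>z\<close>, and the shorter chain ending there is treated next.\<close>

lemma chain_through:
  assumes "prime_chain R Q (Suc d)" "z \<in> Q (Suc d)"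
  shows "\<exists>Q'. prime_chain R Q' (Suc d) \<and> Q' 0 = Q 0 \<and> Q' (Suc d) = Q (Suc d) \<and> z \<in> Q' 1"
  using assms
proof (induction d arbitrary: Q)
  case 0
  then show ?case by (intro exI[of _ Q]) auto
next
  case (Suc d)
  have c: "primeideal (Q i) R" if "i \<le> Suc (Suc d)" for i using Suc.prems that by (auto simp: prime_chain_def)
  have st: "Q i \<subset> Q (Suc i)" if "i < Suc (Suc d)" for i using Suc.prems that by (auto simp: prime_chain_def)
  obtain Qs where Qs: "primeideal Qs R" "Q d \<subset> Qs" "z \<in> Qs" "Qs \<subset> Q (Suc (Suc d))"
  proof (cases "z \<in> Q (Suc d)")
    case True
    then show ?thesis using that[of "Q (Suc d)"] c[of "Suc d"] st[of d] st[of "Suc d"] by auto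
  next
    case False
    obtain Q' where "primeideal Q' R" "Q d \<subseteq> Q'" "z \<in> Q'" "Q' \<subset> Q (Suc (Suc d))"
      using principal_ideal_theorem[of "Q d" "Q (Suc d)" "Q (Suc (Suc d))" z] c st Suc.prems by auto
    moreover have "Q d \<noteq> Q'" using False calculation st[of d] by auto
    ultimately show ?thesis using that by auto
  qed
  define P where "P = Q(Suc d := Qs)"
  have "prime_chain R P (Suc d)"
    unfolding prime_chain_def
  proof (intro conjI allI impI)
    show "primeideal (P i) R" if "i \<le> Suc d" for i using c[of i] Qs that by (auto simp: P_def)
    show "P i \<subset> P (Suc i)" if "i < Suc d" for i
      using st[of i] Qs that by (cases "i = d") (auto simp: P_def)
  qed
  moreover have "P (Suc d) = Qs" by (simp add: P_def)
  ultimately obtain P' where P': "prime_chain R P' (Suc d)" "P' 0 = P 0" "P' (Suc d) = Qs" "z \<in> P' 1"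
    using Suc.IH[of P] Qs(3) by metis
  define Q' where "Q' = P'(Suc (Suc d) := Q (Suc (Suc d)))"
  have "prime_chain R Q' (Suc (Suc d))"
    unfolding prime_chain_def
  proof (intro conjI allI impI)
    show "primeideal (Q' i) R" if "i \<le> Suc (Suc d)" for i
      using c[of "Suc (Suc d)"] P'(1) that by (auto simp: Q'_def prime_chain_def)
    show "Q' i \<subset> Q' (Suc i)" if "i < Suc (Suc d)" for i
      using P'(1,3) Qs that by (cases "i = Suc d") (auto simp: Q'_def prime_chain_def)
  qed
  moreover have "Q' 0 = Q 0" "Q' (Suc (Suc d)) = Q (Suc (Suc d))" "z \<in> Q' 1"
    using P' by (auto simp: Q'_def P_def)
  ultimately show ?case by blast
qed

end

subsection \<open>Local rings\<close>

locale local_noeth = noeth_cring +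
  fixes m
  assumes m_prime: "primeideal m R"
    and m_units: "\<And>a. a \<in> carrier R \<Longrightarrow> a \<notin> m \<Longrightarrow> a \<in> Units R"
begin

sublocale m: primeideal m R by (rule m_prime)

lemma unit_cancel_ideal:
  assumes "ideal J R" "s \<in> carrier R" "s \<notin> m" "u \<in> carrier R" "s \<otimes> u \<in> J"
  shows "u \<in> J"
proof -
  have s: "s \<in> Units R" using assms m_units by auto
  have "inv s \<otimes> (s \<otimes> u) \<in> J" using ideal.I_l_closed[OF assms(1,5)] s by auto
  moreover have "inv s \<otimes> (s \<otimes> u) = u" using s assms by (simp add: m_assoc[symmetric])
  ultimately show ?thesis by simp
qed

lemma saturation_local: "ideal J R \<Longrightarrow> saturation (carrier R - m) J = J"
  using unit_cancel_ideal saturation_sub[OF submonoid_prime[OF m_prime]]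
  by (fastforce simp: saturation_def)

lemma nakayama:
  assumes "x \<in> m" "ideal K R" "ideal K' R" "K' \<subseteq> K"
    and "\<And>k. k \<in> K \<Longrightarrow> \<exists>k'\<in>K'. \<exists>h\<in>K. k = k' \<oplus> x \<otimes> h"
  shows "K = K'"
proof (rule saturated_nakayama[OF m_prime refl assms(1-4) saturation_local[OF assms(3)]])
  fix k assume k: "k \<in> K"
  then have "\<one> \<otimes> k = k" using ideal_subset[OF assms(2)] by auto
  moreover have "\<one> \<in> carrier R - m" using primeideal_one_notin[OF m_prime] by auto
  ultimately show "\<exists>s\<in>carrier R - m. \<exists>k'\<in>K'. \<exists>h\<in>K. s \<otimes> k = k' \<oplus> x \<otimes> h"
    using assms(5)[OF k] by metis
qed

text \<open>Induction on \<open>ys\<close>. By \<open>chain_through\<close> the second prime of the chain may be taken to contain the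
  first element \<open>y\<close>, so that the rest of the chain lies over \<open>J + (y)\<close> and, by induction, starts
  there. Hence each element of \<open>Q 0\<close> is \<open>j + r y\<close> with \<open>j \<in> J\<close>; since \<open>y \<notin> Q 0\<close>, also \<open>r \<in> Q 0\<close>.
  Thus \<open>Q 0 = J + y Q 0\<close>, and \<open>Q 0 = J\<close> by Nakayama.

  With \<open>J = 0\<close> this says that a regular local ring is a domain, and that each initial segment of a
  regular system of parameters generates a prime; with \<open>J\<close> unknown it detects that an ideal is
  prime by the length of a chain.\<close>

theorem height_theorem:
  assumes "ideal J R" "set ys \<subseteq> carrier R" "Idl (J \<union> set ys) = m"
    "prime_chain R Q (length ys)" "Q (length ys) = m" "J \<subseteq> Q 0"
  shows "Q 0 = J \<and> (\<forall>i\<le>length ys. primeideal (Idl (J \<union> set (take i ys))) R)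
    \<and> (\<forall>i<length ys. ys ! i \<notin> Idl (J \<union> set (take i ys)))"
  using assms
proof (induction ys arbitrary: J Q)
  case Nil
  then have "J = m" using genideal_of_ideal by auto
  then show ?case using Nil m_prime genideal_of_ideal[of J] by auto
next
  case (Cons y ys)
  have yc: "y \<in> carrier R" using Cons.prems by auto
  have Jc: "J \<subseteq> carrier R" using ideal_subset Cons.prems by auto
  have ym: "y \<in> m" using mem_genideal[of "J \<union> set (y # ys)" y] Cons.prems Jc by auto
  have "prime_chain R Q (Suc (length ys))" "y \<in> Q (Suc (length ys))" using Cons.prems ym by auto
  then obtain Q' where Q': "prime_chain R Q' (Suc (length ys))" "Q' 0 = Q 0"
    "Q' (Suc (length ys)) = Q (Suc (length ys))" "y \<in> Q' 1" using chain_through[of Q "length ys" y] by blast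
  have Q01: "Q 0 \<subset> Q' 1" using Q'(1,2) by (auto simp: prime_chain_def)
  have Q1p: "primeideal (Q' 1) R" and Q0p: "primeideal (Q 0) R"
    using Q'(1) Cons.prems by (auto simp: prime_chain_def)
  define J' where "J' = Idl (insert y J)"
  have J'i: "ideal J' R" unfolding J'_def by (rule ideal_insert[OF Cons.prems(1) yc])
  have J'sub: "J' \<subseteq> Q' 1" unfolding J'_def
    using Q'(4) Q01 Cons.prems(6) by (intro genideal_minimal) (use Q1p primeideal.axioms(1) in auto)
  have gen: "Idl (J' \<union> set xs) = Idl (J \<union> set (y # xs))" if "set xs \<subseteq> carrier R" for xs
    unfolding J'_def using genideal_Un_genideal[of "insert y J" "set xs"] Jc yc that by simp
  have IH: "Q' 1 = J'" "\<And>i. i \<le> length ys \<Longrightarrow> primeideal (Idl (J' \<union> set (take i ys))) R"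
    "\<And>i. i < length ys \<Longrightarrow> ys ! i \<notin> Idl (J' \<union> set (take i ys))"
    using Cons.IH[of J' "\<lambda>i. Q' (Suc i)"] J'i J'sub Q' Cons.prems prime_chain_tail[OF Q'(1)] gen[of ys]
    by auto
  have yQ0: "y \<notin> Q 0"
  proof
    assume "y \<in> Q 0"
    then have "J' \<subseteq> Q 0" unfolding J'_def
      by (intro genideal_minimal) (use Q0p primeideal.axioms(1) Cons.prems(6) in auto)
    then show False using IH Q01 by auto
  qed
  have Q0J: "Q 0 = J"
  proof (rule nakayama[OF ym])
    show "ideal (Q 0) R" using Q0p primeideal.axioms(1) by auto
    fix k assume k: "k \<in> Q 0"
    then have "k \<in> Idl (insert y J)" using Q01 IH J'_def by auto
    then obtain j r where j: "j \<in> J" "r \<in> carrier R" "k = j \<oplus> r \<otimes> y" "j \<in> carrier R"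
      by (rule mem_ideal_insert[OF Cons.prems(1) yc]) auto
    have "r \<otimes> y \<in> Q 0"
      using ideal_cancel[OF primeideal.axioms(1)[OF Q0p], of "r \<otimes> y" j] j k Cons.prems(6) yc
        a_comm[of j "r \<otimes> y"] by auto
    then have "r \<in> Q 0" using primeideal.I_prime[OF Q0p j(2) yc] yQ0 by auto
    then show "\<exists>k'\<in>J. \<exists>h\<in>Q 0. k = k' \<oplus> y \<otimes> h" using j m_comm[OF j(2) yc] by auto
  qed (use Cons.prems in auto)
  have cs: "set (take i ys) \<subseteq> carrier R" for i using Cons.prems(2) set_take_subset[of i ys] by auto
  show ?case
  proof (intro conjI allI impI)
    show "Q 0 = J" by fact
    show "primeideal (Idl (J \<union> set (take i (y # ys)))) R" if "i \<le> length (y # ys)" for i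
    proof (cases i)
      case 0 then show ?thesis using Q0J Q0p genideal_of_ideal[OF Cons.prems(1)] by simp
    next
      case (Suc i') then show ?thesis using IH(2)[of i'] that gen[OF cs, of i'] by simp
    qed
    show "(y # ys) ! i \<notin> Idl (J \<union> set (take i (y # ys)))" if "i < length (y # ys)" for i
    proof (cases i)
      case 0 then show ?thesis using Q0J yQ0 genideal_of_ideal[OF Cons.prems(1)] by simp
    next
      case (Suc i') then show ?thesis using IH(3)[of i'] that gen[OF cs, of i'] by simp
    qed
  qed
qed

text \<open>Write \<open>u\<close> as a combination of \<open>A\<close> and \<open>W\<close>. A coefficient of some \<open>w\<close> outside \<open>m\<close> is a unit, so
  that \<open>u\<close> can take the place of \<open>w\<close>; if all the coefficients belong to \<open>m\<close>, the part from \<open>W\<close> is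
  in \<open>m\<^sup>2\<close>.\<close>

lemma exchange:
  assumes "A \<subseteq> carrier R" "set W \<subseteq> m" "u \<in> Idl (A \<union> set W)"
  shows "(\<exists>W1 w W2. W = W1 @ w # W2 \<and> w \<in> Idl (insert u (A \<union> set (W1 @ W2)))) \<or>
    (\<exists>a\<in>Idl A. \<exists>v\<in>m \<cdot> m. u = a \<oplus> v)"
  using assms
proof (induction W arbitrary: u)
  case Nil
  have "u \<in> carrier R" using Nil ideal_subset[OF genideal_ideal[of A]] by auto
  moreover have "\<zero> \<otimes> \<zero> \<in> m \<cdot> m" by (rule ideal_prod.prod) auto
  ultimately show ?case using Nil by (intro disjI2 bexI[of _ u] bexI[of _ \<zero>]) auto
next
  case (Cons w W)
  have wm: "w \<in> m" and wc: "w \<in> carrier R" and AW: "A \<union> set W \<subseteq> carrier R" and AcC: "A \<subseteq> carrier R"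
    and Wc: "set W \<subseteq> carrier R"
    using Cons.prems m.a_subset by auto
  have "u \<in> Idl (insert w (A \<union> set W))" using Cons.prems by simp
  then obtain u0 r where u0: "u0 \<in> Idl (A \<union> set W)" "r \<in> carrier R" "u = u0 \<oplus> r \<otimes> w" "u0 \<in> carrier R"
    by (rule mem_genideal_insert[OF AW wc]) auto
  have uc: "u \<in> carrier R" using u0 wc by auto
  show ?case
  proof (cases "r \<in> m")
    case False
    let ?G = "Idl (insert u (A \<union> set W))"
    have Gi: "ideal ?G R" by (rule genideal_ideal) (use AW uc in auto)
    have "u0 \<in> ?G" using u0 genideal_mono[of "insert u (A \<union> set W)" "A \<union> set W"] AW uc by auto
    moreover have "u \<in> ?G" using mem_genideal[of "insert u (A \<union> set W)" u] AW uc by auto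
    ultimately have "r \<otimes> w \<in> ?G"
      using ideal_cancel[OF Gi, of "r \<otimes> w" u0] u0 wc a_comm[of u0 "r \<otimes> w"] by auto
    then have "w \<in> ?G" using unit_cancel_ideal[OF Gi u0(2) False wc] by simp
    then show ?thesis by (intro disjI1 exI[of _ "[]"] exI[of _ w] exI[of _ W]) auto
  next
    case True
    then have rw: "r \<otimes> w \<in> m \<cdot> m" using wm by (rule ideal_prod.prod)
    from Cons.IH[OF Cons.prems(1) _ u0(1)] Cons.prems
    consider (a) W1 w' W2 where "W = W1 @ w' # W2" "w' \<in> Idl (insert u0 (A \<union> set (W1 @ W2)))"
      | (b) a v where "a \<in> Idl A" "v \<in> m \<cdot> m" "u0 = a \<oplus> v" by auto
    then show ?thesis
    proof cases
      case a
      let ?B = "insert u (A \<union> set ((w # W1) @ W2))"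
      have Bc: "?B \<subseteq> carrier R" using uc wc AW a(1) by auto
      have Bi: "ideal (Idl ?B) R" by (rule genideal_ideal[OF Bc])
      have "w \<in> Idl ?B" "u \<in> Idl ?B" using mem_genideal[OF Bc] by auto
      then have "r \<otimes> w \<in> Idl ?B" "u \<in> Idl ?B" using ideal.I_l_closed[OF Bi] u0(2) by auto
      then have "u0 \<in> Idl ?B" using ideal_cancel[OF Bi, of u0 "r \<otimes> w"] u0 by auto
      then have "insert u0 (A \<union> set (W1 @ W2)) \<subseteq> Idl ?B" using mem_genideal[OF Bc] by auto
      then have "Idl (insert u0 (A \<union> set (W1 @ W2))) \<subseteq> Idl ?B" by (rule genideal_minimal[OF Bi])
      then show ?thesis using a by (intro disjI1 exI[of _ "w # W1"] exI[of _ w'] exI[of _ W2]) auto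
    next
      case b
      have "v \<in> carrier R" using b ideal_prod_in_carrier[of m m] m.is_ideal by auto
      moreover have "a \<in> carrier R" using b ideal_subset[OF genideal_ideal[OF AcC]] by auto
      ultimately have "u = a \<oplus> (v \<oplus> r \<otimes> w)" using u0 b wc by (simp add: a_assoc)
      moreover have "v \<oplus> r \<otimes> w \<in> m \<cdot> m" using b(2) rw by (rule ideal_prod.sum)
      ultimately show ?thesis using b by blast
    qed
  qed
qed

text \<open>The kernel of a surjection between regular local rings is generated by part of a regular system
  of parameters. Here \<open>ws\<close> is such a system of \<open>R\<close>, and \<open>ys\<close> lifts one of \<open>R / I\<close>. The elements of
  \<open>ys\<close> can be exchanged one by one for elements of \<open>ws\<close>. The elements of \<open>ws\<close> that remain are
  congruent modulo \<open>(ys)\<close> to elements \<open>zs\<close> of \<open>I\<close>, because \<open>m = I + (ys)\<close>. Now \<open>zs\<close> and \<open>ys\<close>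
  together generate \<open>m\<close> and their number is the length of \<open>P\<close>, so initial segments of \<open>zs\<close>
  generate primes by \<open>height_theorem\<close>. The same theorem for \<open>J = (zs)\<close> and the chain \<open>Q\<close> gives
  \<open>Q 0 = (zs)\<close>, and \<open>I\<close> lies in between.\<close>

theorem regular_quotient:
  assumes ws: "set ws \<subseteq> carrier R" "Idl (set ws) = m" "prime_chain R P (length ws)" "P (length ws) = m"
    and I: "ideal I R"
    and ys: "set ys \<subseteq> carrier R" "Idl (I \<union> set ys) = m" "prime_chain R Q (length ys)" "Q (length ys) = m" "I \<subseteq> Q 0"
  shows "\<exists>zs. set zs \<subseteq> I \<and> I = Idl (set zs) \<and>
    (\<forall>i<length zs. primeideal (Idl (set (take i zs))) R \<and> zs ! i \<notin> Idl (set (take i zs)))"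
proof -
  have Ic: "I \<subseteq> carrier R" by (rule ideal_subset[OF I])
  have ysm: "set ys \<subseteq> m" and Im: "I \<subseteq> m" using mem_genideal[of "I \<union> set ys"] Ic ys(1,2) by auto
  have stage1: "\<exists>W. length W + i = length ws \<and> set W \<subseteq> m \<and> Idl (set (take i ys) \<union> set W) = m"
    if "i \<le> length ys" for i
    using that
  proof (induction i)
    case 0
    then show ?case using ws genideal_self[of "set ws"] by (intro exI[of _ ws]) auto
  next
    case (Suc i)
    then obtain W where W: "length W + i = length ws" "set W \<subseteq> m" "Idl (set (take i ys) \<union> set W) = m" by auto
    define y where "y = ys ! i"
    have ym: "y \<in> m" and yc: "y \<in> carrier R" using ysm Suc.prems ys(1) by (auto simp: y_def)
    have tk: "take (Suc i) ys = take i ys @ [y]" using Suc.prems by (simp add: y_def take_Suc_conv_app_nth)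
    have Am: "set (take i ys) \<subseteq> m" using ysm set_take_subset[of i ys] by auto
    have Ac: "set (take i ys) \<subseteq> carrier R" using Am m.a_subset by auto
    consider (a) W1 w W2 where "W = W1 @ w # W2" "w \<in> Idl (insert y (set (take i ys) \<union> set (W1 @ W2)))"
      | (b) a v where "a \<in> Idl (set (take i ys))" "v \<in> m \<cdot> m" "y = a \<oplus> v"
      using exchange[OF Ac W(2), of y] W(3) ym by auto
    then show ?case
    proof cases
      case a
      let ?B = "insert y (set (take i ys) \<union> set (W1 @ W2))"
      have Bm: "?B \<subseteq> m" using ym Am W(2) a by auto
      then have Bc: "?B \<subseteq> carrier R" using m.a_subset by auto
      have "set (take i ys) \<union> set W \<subseteq> Idl ?B" using a mem_genideal[OF Bc] by auto
      then have "Idl (set (take i ys) \<union> set W) \<subseteq> Idl ?B" by (rule genideal_minimal[OF genideal_ideal[OF Bc]])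
      then have "m \<subseteq> Idl ?B" unfolding W(3) .
      moreover have "Idl ?B \<subseteq> m" by (rule genideal_minimal[OF m.is_ideal Bm])
      ultimately have "Idl (set (take (Suc i) ys) \<union> set (W1 @ W2)) = m" by (simp add: tk)
      then show ?thesis using a W by (intro exI[of _ "W1 @ W2"]) auto
    next
      case b
      \<comment> \<open>the exchange cannot fail: \<open>y \<in> (take i ys) + m\<^sup>2\<close> would make \<open>y\<close> superfluous as a generator of
        \<open>m\<close> modulo \<open>I\<close>, leaving fewer generators than the chain \<open>Q\<close> has steps\<close>
      define ys' where "ys' = take i ys @ drop (Suc i) ys"
      have ys_split: "set ys = insert y (set ys')"
        using Suc.prems id_take_nth_drop[of i ys] unfolding y_def ys'_def
        by (metis Un_insert_right set_append list.simps(15) Suc_le_lessD)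
      have len: "length ys = Suc (length ys')" using Suc.prems by (simp add: ys'_def)
      define J' where "J' = Idl (I \<union> set ys')"
      have ys'c: "set ys' \<subseteq> carrier R" using ys(1) ys_split by auto
      have J'i: "ideal J' R" unfolding J'_def by (rule genideal_ideal) (use Ic ys'c in auto)
      have mJ': "m = Idl (insert y J')"
        using genideal_Un_genideal[of "I \<union> set ys'" "{y}"] Ic ys'c yc ys(2) ys_split by (simp add: J'_def)
      have mm: "\<exists>j\<in>J'. \<exists>b\<in>m. v = j \<oplus> b \<otimes> y" if "v \<in> m \<cdot> m" for v
        using that
      proof (induction v rule: ideal_prod.induct)
        case (prod p q)
        then have "p \<in> Idl (insert y J')" using mJ' by simp
        then obtain j r where j: "j \<in> J'" "r \<in> carrier R" "p = j \<oplus> r \<otimes> y" "j \<in> carrier R"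
          by (rule mem_ideal_insert[OF J'i yc]) auto
        have qc: "q \<in> carrier R" using prod m.a_subset by auto
        have "p \<otimes> q = j \<otimes> q \<oplus> (r \<otimes> q) \<otimes> y" unfolding j(3) using j(2,4) qc yc by algebra
        moreover have "j \<otimes> q \<in> J'" using ideal.I_r_closed[OF J'i j(1) qc] .
        moreover have "r \<otimes> q \<in> m" using m.I_l_closed[OF prod(2) j(2)] .
        ultimately show ?case by blast
      next
        case (sum s1 s2)
        then obtain j1 b1 j2 b2 where s: "j1 \<in> J'" "b1 \<in> m" "s1 = j1 \<oplus> b1 \<otimes> y" "j2 \<in> J'" "b2 \<in> m" "s2 = j2 \<oplus> b2 \<otimes> y"
          by blast
        have c: "j1 \<in> carrier R" "j2 \<in> carrier R" "b1 \<in> carrier R" "b2 \<in> carrier R"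
          using s ideal_subset[OF J'i] m.a_subset by auto
        have "s1 \<oplus> s2 = (j1 \<oplus> j2) \<oplus> (b1 \<oplus> b2) \<otimes> y" unfolding s(3,6) using c yc by algebra
        moreover have "j1 \<oplus> j2 \<in> J'" using s additive_subgroup.a_closed[OF ideal.axioms(1)[OF J'i]] by auto
        ultimately show ?case using s m.a_closed by blast
      qed
      obtain j b' where j: "j \<in> J'" "b' \<in> m" "v = j \<oplus> b' \<otimes> y" using mm[OF b(2)] by blast
      have aJ': "a \<in> J'"
      proof -
        have "set (take i ys) \<subseteq> I \<union> set ys'" by (auto simp: ys'_def)
        then show ?thesis using b(1) genideal_mono[of "I \<union> set ys'" "set (take i ys)"] Ic ys'c by (auto simp: J'_def)
      qed
      have c: "a \<in> carrier R" "j \<in> carrier R" "b' \<in> carrier R"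
        using aJ' j ideal_subset[OF J'i] m.a_subset by auto
      have ye: "y = a \<oplus> (j \<oplus> b' \<otimes> y)" by (rule b(3)[unfolded j(3)])
      have "(\<one> \<ominus> b') \<otimes> y = y \<ominus> b' \<otimes> y" using c yc by algebra
      also have "\<dots> = (a \<oplus> (j \<oplus> b' \<otimes> y)) \<ominus> b' \<otimes> y"
        by (rule arg_cong[OF ye, of "\<lambda>z. z \<ominus> b' \<otimes> y"])
      also have "\<dots> = a \<oplus> j" using c yc by algebra
      also have "\<dots> \<in> J'" using aJ' j additive_subgroup.a_closed[OF ideal.axioms(1)[OF J'i]] by auto
      finally have "(\<one> \<ominus> b') \<otimes> y \<in> J'" .
      moreover have "\<one> \<ominus> b' \<notin> m"
      proof
        assume "\<one> \<ominus> b' \<in> m"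
        then have "(\<one> \<ominus> b') \<oplus> b' \<in> m" using j by auto
        moreover have "(\<one> \<ominus> b') \<oplus> b' = \<one>" using c by algebra
        ultimately show False using primeideal_one_notin[OF m_prime] by simp
      qed
      moreover have "\<one> \<ominus> b' \<in> carrier R" using c by simp
      ultimately have "y \<in> J'" using unit_cancel_ideal[OF J'i _ _ yc] by blast
      then have "Idl (I \<union> set ys') = m"
        using mJ' genideal_of_ideal[OF J'i] by (simp add: insert_absorb J'_def)
      then have "Q 1 = I"
        using height_theorem[of I ys' "\<lambda>i. Q (Suc i)"] I ys'c ys(3-5) prime_chain_tail[of R Q "length ys'"]
          prime_chain_mono[of R Q "length ys" 0 1] len by auto
      moreover have "Q 0 \<subset> Q 1" using ys(3) len by (auto simp: prime_chain_def)
      ultimately show ?thesis using ys(5) by auto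
    qed
  qed
  obtain W where W: "length W + length ys = length ws" "set W \<subseteq> m" "Idl (set ys \<union> set W) = m"
    using stage1[of "length ys"] by auto
  have "\<exists>u. u \<in> I \<and> w \<in> Idl (insert u (set ys))" if "w \<in> set W" for w
  proof -
    have "w \<in> Idl (I \<union> set ys)" using W that ys by auto
    moreover have "Idl (I \<union> set ys) = I <+> Idl (set ys)"
      using union_genideal[OF I genideal_ideal[OF ys(1)]] genideal_Un_genideal[of "set ys" I] ys(1) Ic
      by (simp add: Un_commute)
    ultimately obtain u v where u: "u \<in> I" "v \<in> Idl (set ys)" "w = u \<oplus> v" by (auto simp: set_add_def')
    have uc: "u \<in> carrier R" using u Ic by auto
    then have "ideal (Idl (insert u (set ys))) R" using ys(1) by (intro genideal_ideal) auto
    moreover have "u \<in> Idl (insert u (set ys))" "v \<in> Idl (insert u (set ys))"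
      using mem_genideal[of "insert u (set ys)" u] genideal_mono[of "insert u (set ys)" "set ys"] u uc ys(1) by auto
    ultimately have "w \<in> Idl (insert u (set ys))"
      using u additive_subgroup.a_closed[OF ideal.axioms(1)] by auto
    then show ?thesis using u by auto
  qed
  then obtain f where f: "\<And>w. w \<in> set W \<Longrightarrow> f w \<in> I \<and> w \<in> Idl (insert (f w) (set ys))" by metis
  define zs where "zs = map f W"
  have zsI: "set zs \<subseteq> I" using f by (auto simp: zs_def)
  have zc: "set zs \<subseteq> carrier R" using zsI Ic by auto
  have gzy: "Idl (set zs \<union> set ys) = m"
  proof
    show "Idl (set zs \<union> set ys) \<subseteq> m" by (rule genideal_minimal[OF m.is_ideal]) (use zsI Im ysm in auto)
    have B: "set zs \<union> set ys \<subseteq> carrier R" using zc ys(1) by auto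
    have "w \<in> Idl (set zs \<union> set ys)" if "w \<in> set W" for w
    proof -
      have "insert (f w) (set ys) \<subseteq> set zs \<union> set ys" using that by (auto simp: zs_def)
      then show ?thesis using f[OF that] genideal_mono[OF B] by blast
    qed
    then have "set ys \<union> set W \<subseteq> Idl (set zs \<union> set ys)" using mem_genideal[OF B] by auto
    then have "Idl (set ys \<union> set W) \<subseteq> Idl (set zs \<union> set ys)" by (rule genideal_minimal[OF genideal_ideal[OF B]])
    then show "m \<subseteq> Idl (set zs \<union> set ys)" unfolding W(3) .
  qed
  have len: "length (zs @ ys) = length ws" using W by (simp add: zs_def)
  have z0: "Idl ({\<zero>} \<union> A) = Idl A" if "A \<subseteq> carrier R" for A
  proof
    have "\<zero> \<in> Idl A" using additive_subgroup.zero_closed[OF ideal.axioms(1)[OF genideal_ideal[OF that]]] .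
    then show "Idl ({\<zero>} \<union> A) \<subseteq> Idl A"
      using genideal_minimal[OF genideal_ideal[OF that], of "{\<zero>} \<union> A"] genideal_self[OF that] by auto
    show "Idl A \<subseteq> Idl ({\<zero>} \<union> A)" by (rule genideal_mono) (use that in auto)
  qed
  have P0: "{\<zero>} \<subseteq> P 0" using ws(3) additive_subgroup.zero_closed[OF ideal.axioms(1)[OF primeideal.axioms(1)]]
    by (auto simp: prime_chain_def)
  have tkc: "set (take i (zs @ ys)) \<subseteq> carrier R" for i
    using set_take_subset[of i "zs @ ys"] zc ys(1) by auto
  have "(\<forall>i\<le>length (zs @ ys). primeideal (Idl ({\<zero>} \<union> set (take i (zs @ ys)))) R)
    \<and> (\<forall>i<length (zs @ ys). (zs @ ys) ! i \<notin> Idl ({\<zero>} \<union> set (take i (zs @ ys))))"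
    using height_theorem[OF zeroideal, of "zs @ ys" P] zc ys(1) gzy z0[of "set zs \<union> set ys"] ws(3,4) len P0 by auto
  then have pr: "\<forall>i\<le>length (zs @ ys). primeideal (Idl (set (take i (zs @ ys)))) R"
    and ni: "\<forall>i<length (zs @ ys). (zs @ ys) ! i \<notin> Idl (set (take i (zs @ ys)))"
    unfolding z0[OF tkc] by auto
  have Zi: "ideal (Idl (set zs)) R" by (rule genideal_ideal[OF zc])
  have ZI: "Idl (set zs) \<subseteq> I" by (rule genideal_minimal[OF I zsI])
  have "Q 0 = Idl (set zs)"
    using height_theorem[OF Zi ys(1) _ ys(3,4)] genideal_Un_genideal[OF zc ys(1)] gzy ZI ys(5) by auto
  then have "I = Idl (set zs)" using ZI ys(5) by auto
  moreover have "primeideal (Idl (set (take i zs))) R \<and> zs ! i \<notin> Idl (set (take i zs))" if "i < length zs" for i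
    using pr[rule_format, of i] ni[rule_format, of i] that by (auto simp: nth_append)
  ultimately show ?thesis using zsI by blast
qed

end

section \<open>The ring of polynomials in finitely many variables\<close>

lemma finite_submultisets: "finite {a. a \<subseteq># m}"
proof (induction m)
  case (add x m)
  have "{a. a \<subseteq># add_mset x m} \<subseteq> {a. a \<subseteq># m} \<union> add_mset x ` {a. a \<subseteq># m}"
  proof
    fix a assume a: "a \<in> {a. a \<subseteq># add_mset x m}"
    show "a \<in> {a. a \<subseteq># m} \<union> add_mset x ` {a. a \<subseteq># m}"
    proof (cases "x \<in># a")
      case True
      then obtain a' where "a = add_mset x a'" by (meson multi_member_split)
      then show ?thesis using a by auto
    next
      case False
      then have "a \<subseteq># m"
        using a by (metis mem_Collect_eq diff_single_trivial subset_eq_diff_conv add_mset_add_single)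
      then show ?thesis by simp
    qed
  qed
  then show ?case using add finite_subset by blast
qed simp

lemma finite_multiset_sums: "finite {(a, b). a + b = (m :: 'b multiset)}"
proof (rule finite_subset)
  show "{(a, b). a + b = m} \<subseteq> {a. a \<subseteq># m} \<times> {a. a \<subseteq># m}" by auto
qed (simp add: finite_submultisets)

definition mterm :: "('a, 'm) ring_scheme \<Rightarrow> 'a \<Rightarrow> nat multiset \<Rightarrow> nat multiset \<Rightarrow> 'a" where
  "mterm R c m = (\<lambda>m'. if m' = m then c else \<zero>\<^bsub>R\<^esub>)"

lemma mpoly_const_mterm: "mpoly_const R c = mterm R c {#}"
  by (auto simp: mpoly_const_def mterm_def)

context cring begin

lemma finsum_single:
  assumes "finite A" "i \<in> A" "f i \<in> carrier R" "\<And>j. j \<in> A \<Longrightarrow> j \<noteq> i \<Longrightarrow> f j = \<zero>"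
  shows "finsum R f A = f i"
proof -
  have "finsum R f A = (\<Oplus>j\<in>A. if i = j then f j else \<zero>)"
    by (rule finsum_cong') (use assms in auto)
  also have "\<dots> = f i" by (rule finsum_singleton) (use assms in force)+
  finally show ?thesis .
qed

lemma mpoly_simps:
  "zero (mpoly_ring R n) = (\<lambda>m. \<zero>)" "one (mpoly_ring R n) = mterm R \<one> {#}"
  "add (mpoly_ring R n) p q = (\<lambda>m. p m \<oplus> q m)"
  by (auto simp: mpoly_ring_def mterm_def)

lemma mpoly_mult_coeff:
  "monoid.mult (mpoly_ring R n) p q m = (\<Oplus>x\<in>{(a, b). a + b = m}. case x of (a, b) \<Rightarrow> p a \<otimes> q b)"
  by (simp add: mpoly_ring_def)

lemma mpoly_carrier:
  "p \<in> carrier (mpoly_ring R n) \<longleftrightarrow> (\<forall>m. p m \<in> carrier R) \<and> finite {m. p m \<noteq> \<zero>} \<and>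
    (\<forall>m. p m \<noteq> \<zero> \<longrightarrow> set_mset m \<subseteq> {..<n})"
  by (simp add: mpoly_ring_def)

lemma mpoly_coeff_closed: "p \<in> carrier (mpoly_ring R n) \<Longrightarrow> p m \<in> carrier R"
  by (simp add: mpoly_carrier)

lemma mpoly_mult_summand:
  "p \<in> carrier (mpoly_ring R n) \<Longrightarrow> q \<in> carrier (mpoly_ring R n) \<Longrightarrow>
    (\<lambda>(a, b). p a \<otimes> q b) \<in> A \<rightarrow> carrier R"
  by (auto simp: mpoly_coeff_closed)

lemma mterm_carrier [simp]:
  "c \<in> carrier R \<Longrightarrow> set_mset m \<subseteq> {..<n} \<Longrightarrow> mterm R c m \<in> carrier (mpoly_ring R n)"
proof -
  assume a: "c \<in> carrier R" "set_mset m \<subseteq> {..<n}"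
  have "finite {m'. mterm R c m m' \<noteq> \<zero>}"
    by (rule finite_subset[of _ "{m}"]) (auto simp: mterm_def)
  then show ?thesis using a by (auto simp: mpoly_carrier mterm_def)
qed

lemma mpoly_add_closed:
  assumes "p \<in> carrier (mpoly_ring R n)" "q \<in> carrier (mpoly_ring R n)"
  shows "p \<oplus>\<^bsub>mpoly_ring R n\<^esub> q \<in> carrier (mpoly_ring R n)"
proof -
  have "finite {m. p m \<oplus> q m \<noteq> \<zero>}"
    by (rule finite_subset[of _ "{m. p m \<noteq> \<zero>} \<union> {m. q m \<noteq> \<zero>}"]) (use assms in \<open>auto simp: mpoly_carrier\<close>)
  moreover have "set_mset m \<subseteq> {..<n}" if "p m \<oplus> q m \<noteq> \<zero>" for m
    using that assms by (cases "p m = \<zero>"; cases "q m = \<zero>") (auto simp: mpoly_carrier)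
  ultimately show ?thesis using assms unfolding mpoly_carrier mpoly_simps by auto
qed

lemma mpoly_mult_closed:
  assumes "p \<in> carrier (mpoly_ring R n)" "q \<in> carrier (mpoly_ring R n)"
  shows "p \<otimes>\<^bsub>mpoly_ring R n\<^esub> q \<in> carrier (mpoly_ring R n)"
proof -
  let ?m = "monoid.mult (mpoly_ring R n) p q"
  have nz: "\<exists>a b. m = a + b \<and> p a \<noteq> \<zero> \<and> q b \<noteq> \<zero>" if "?m m \<noteq> \<zero>" for m
  proof (rule ccontr)
    assume n: "\<not> ?thesis"
    have z: "(case x of (a, b) \<Rightarrow> p a \<otimes> q b) = \<zero>" if x: "x \<in> {(a, b). a + b = m}" for x
    proof -
      obtain a b where ab: "x = (a, b)" "a + b = m" using x by auto
      then have "p a = \<zero> \<or> q b = \<zero>" using n by blast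
      moreover have "p a \<in> carrier R" "q b \<in> carrier R" using assms mpoly_coeff_closed by auto
      ultimately show ?thesis using ab by auto
    qed
    have "?m m = \<zero>" unfolding mpoly_mult_coeff by (rule add.finprod_one_eqI) (use z in auto)
    then show False using that by simp
  qed
  have "{m. ?m m \<noteq> \<zero>} \<subseteq> (\<lambda>(a, b). a + b) ` ({a. p a \<noteq> \<zero>} \<times> {b. q b \<noteq> \<zero>})"
    using nz by (fastforce simp: image_iff)
  then have "finite {m. ?m m \<noteq> \<zero>}"
    by (rule finite_subset) (use assms in \<open>auto simp: mpoly_carrier\<close>)
  moreover have "set_mset m \<subseteq> {..<n}" if "?m m \<noteq> \<zero>" for m
    using nz[OF that] assms by (fastforce simp: mpoly_carrier)
  moreover have "?m m \<in> carrier R" for m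
    unfolding mpoly_mult_coeff by (rule finsum_closed) (rule mpoly_mult_summand[OF assms])
  ultimately show ?thesis unfolding mpoly_carrier by auto
qed

lemma mterm_mult:
  assumes "c \<in> carrier R" "d \<in> carrier R"
  shows "mterm R c a \<otimes>\<^bsub>mpoly_ring R n\<^esub> mterm R d b = mterm R (c \<otimes> d) (a + b)"
proof
  fix m
  let ?f = "\<lambda>(a', b'). mterm R c a a' \<otimes> mterm R d b b'"
  show "(mterm R c a \<otimes>\<^bsub>mpoly_ring R n\<^esub> mterm R d b) m = mterm R (c \<otimes> d) (a + b) m"
  proof (cases "m = a + b")
    case True
    have "finsum R ?f {(a, b). a + b = m} = ?f (a, b)"
      by (rule finsum_single) (use True assms finite_multiset_sums in \<open>auto simp: mterm_def split: if_splits\<close>)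
    then show ?thesis using True by (simp add: mpoly_mult_coeff mterm_def)
  next
    case False
    have "finsum R ?f {(a, b). a + b = m} = \<zero>"
      by (rule add.finprod_one_eqI) (use False assms in \<open>auto simp: mterm_def\<close>)
    then show ?thesis using False by (simp add: mpoly_mult_coeff mterm_def)
  qed
qed

lemma mpoly_l_distr:
  assumes "p \<in> carrier (mpoly_ring R n)" "p' \<in> carrier (mpoly_ring R n)" "q \<in> carrier (mpoly_ring R n)"
  shows "(p \<oplus>\<^bsub>mpoly_ring R n\<^esub> p') \<otimes>\<^bsub>mpoly_ring R n\<^esub> q
    = (p \<otimes>\<^bsub>mpoly_ring R n\<^esub> q) \<oplus>\<^bsub>mpoly_ring R n\<^esub> (p' \<otimes>\<^bsub>mpoly_ring R n\<^esub> q)"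
proof
  fix m
  have "(\<Oplus>x\<in>{(a, b). a + b = m}. case x of (a, b) \<Rightarrow> (p a \<oplus> p' a) \<otimes> q b)
     = (\<Oplus>x\<in>{(a, b). a + b = m}. (case x of (a, b) \<Rightarrow> p a \<otimes> q b) \<oplus> (case x of (a, b) \<Rightarrow> p' a \<otimes> q b))"
    by (rule finsum_cong') (use assms in \<open>auto simp: mpoly_coeff_closed l_distr\<close>)
  also have "\<dots> = (\<Oplus>x\<in>{(a, b). a + b = m}. case x of (a, b) \<Rightarrow> p a \<otimes> q b) \<oplus> (\<Oplus>x\<in>{(a, b). a + b = m}. case x of (a, b) \<Rightarrow> p' a \<otimes> q b)"
    by (rule finsum_addf) (rule mpoly_mult_summand[OF assms(1,3)] mpoly_mult_summand[OF assms(2,3)])+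
  finally show "((p \<oplus>\<^bsub>mpoly_ring R n\<^esub> p') \<otimes>\<^bsub>mpoly_ring R n\<^esub> q) m
    = ((p \<otimes>\<^bsub>mpoly_ring R n\<^esub> q) \<oplus>\<^bsub>mpoly_ring R n\<^esub> (p' \<otimes>\<^bsub>mpoly_ring R n\<^esub> q)) m"
    by (simp add: mpoly_simps mpoly_mult_coeff)
qed

lemma mpoly_m_comm:
  assumes "p \<in> carrier (mpoly_ring R n)" "q \<in> carrier (mpoly_ring R n)"
  shows "p \<otimes>\<^bsub>mpoly_ring R n\<^esub> q = q \<otimes>\<^bsub>mpoly_ring R n\<^esub> p"
proof
  fix m :: "nat multiset"
  have im: "prod.swap ` {(a, b). a + b = m} = {(a, b). a + b = m}"
  proof safe
    fix a b assume "m = a + b"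
    then show "(a, b) \<in> prod.swap ` {(a', b'). a' + b' = a + b}"
      by (intro image_eqI[of _ _ "(b, a)"]) (auto simp: union_commute)
  qed (simp add: union_commute)
  have "(\<Oplus>x\<in>{(a, b). a + b = m}. case x of (a, b) \<Rightarrow> q a \<otimes> p b)
    = (\<Oplus>x\<in>prod.swap ` {(a, b). a + b = m}. case x of (a, b) \<Rightarrow> q a \<otimes> p b)" by (simp add: im)
  also have "\<dots> = (\<Oplus>x\<in>{(a, b). a + b = m}. (case prod.swap x of (a, b) \<Rightarrow> q a \<otimes> p b))"
    by (rule add.finprod_reindex) (use mpoly_coeff_closed assms in auto)
  also have "\<dots> = (\<Oplus>x\<in>{(a, b). a + b = m}. case x of (a, b) \<Rightarrow> p a \<otimes> q b)"
    by (rule finsum_cong') (use assms mpoly_coeff_closed m_comm in auto)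
  finally show "(p \<otimes>\<^bsub>mpoly_ring R n\<^esub> q) m = (q \<otimes>\<^bsub>mpoly_ring R n\<^esub> p) m"
    by (simp add: mpoly_mult_coeff)
qed

lemma mpoly_abelian_group: "abelian_group (mpoly_ring R n)"
proof (rule abelian_groupI)
  let ?M = "mpoly_ring R n"
  show "\<zero>\<^bsub>?M\<^esub> \<in> carrier ?M" by (auto simp: mpoly_carrier mpoly_simps)
  show "x \<oplus>\<^bsub>?M\<^esub> y \<in> carrier ?M" if "x \<in> carrier ?M" "y \<in> carrier ?M" for x y
    using mpoly_add_closed[OF that] .
  show "x \<oplus>\<^bsub>?M\<^esub> y \<oplus>\<^bsub>?M\<^esub> z = x \<oplus>\<^bsub>?M\<^esub> (y \<oplus>\<^bsub>?M\<^esub> z)"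
    if "x \<in> carrier ?M" "y \<in> carrier ?M" "z \<in> carrier ?M" for x y z
    using that by (auto simp: mpoly_simps mpoly_coeff_closed a_assoc)
  show "x \<oplus>\<^bsub>?M\<^esub> y = y \<oplus>\<^bsub>?M\<^esub> x" if "x \<in> carrier ?M" "y \<in> carrier ?M" for x y
    using that by (auto simp: mpoly_simps mpoly_coeff_closed a_comm)
  show "\<zero>\<^bsub>?M\<^esub> \<oplus>\<^bsub>?M\<^esub> x = x" if "x \<in> carrier ?M" for x
    using that by (auto simp: mpoly_simps mpoly_coeff_closed)
  fix x assume x: "x \<in> carrier ?M"
  have "{m. \<ominus> x m \<noteq> \<zero>} = {m. x m \<noteq> \<zero>}" using mpoly_coeff_closed[OF x] by auto
  then have "(\<lambda>m. \<ominus> x m) \<in> carrier ?M" using x by (auto simp: mpoly_carrier)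
  then show "\<exists>y\<in>carrier ?M. y \<oplus>\<^bsub>?M\<^esub> x = \<zero>\<^bsub>?M\<^esub>"
    using mpoly_coeff_closed[OF x] by (intro bexI[of _ "\<lambda>m. \<ominus> x m"]) (auto simp: mpoly_simps l_neg)
qed

text \<open>Induction on the number of terms of \<open>p\<close>. The induction step only meets terms that occur in \<open>p\<close>,
  so that properties of the terms of \<open>p\<close>, such as their degrees, stay available.\<close>

lemma mpoly_induct [consumes 1, case_names zero add_term]:
  assumes "p \<in> carrier (mpoly_ring R n)"
    and 0: "P \<zero>\<^bsub>mpoly_ring R n\<^esub>"
    and t: "\<And>c m q. c \<in> carrier R \<Longrightarrow> c \<noteq> \<zero> \<Longrightarrow> set_mset m \<subseteq> {..<n} \<Longrightarrow> q \<in> carrier (mpoly_ring R n) \<Longrightarrow>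
      {m'. q m' \<noteq> \<zero>} = {m'. p m' \<noteq> \<zero>} \<inter> {m'. q m' \<noteq> \<zero>} \<Longrightarrow> p m = c \<Longrightarrow>
      P q \<Longrightarrow> P (mterm R c m \<oplus>\<^bsub>mpoly_ring R n\<^esub> q)"
  shows "P p"
proof -
  have "P q" if "q \<in> carrier (mpoly_ring R n)" "\<And>m. q m = p m \<or> q m = \<zero>" "card {m. q m \<noteq> \<zero>} = k" for q k
    using that
  proof (induction k arbitrary: q)
    case 0
    then have "{m. q m \<noteq> \<zero>} = {}" by (simp add: mpoly_carrier)
    then have "q = \<zero>\<^bsub>mpoly_ring R n\<^esub>" by (auto simp: mpoly_simps)
    then show ?case using assms(2) by simp
  next
    case (Suc k)
    then obtain m where m: "q m \<noteq> \<zero>" by (metis (mono_tags, lifting) Collect_empty_eq card.empty nat.distinct(1))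
    define q' where "q' = q(m := \<zero>)"
    have e: "{m'. q' m' \<noteq> \<zero>} = {m'. q m' \<noteq> \<zero>} - {m}" by (auto simp: q'_def)
    have q'c: "q' \<in> carrier (mpoly_ring R n)"
      using Suc.prems(1) e unfolding mpoly_carrier by (auto simp: q'_def)
    have "card {m'. q' m' \<noteq> \<zero>} = k" using Suc.prems m e by (simp add: mpoly_carrier)
    moreover have "q' m' = p m' \<or> q' m' = \<zero>" for m' using Suc.prems(2)[of m'] by (simp add: q'_def)
    ultimately have "P q'" using Suc.IH[OF q'c] by blast
    have sup: "{m'. q' m' \<noteq> \<zero>} = {m'. p m' \<noteq> \<zero>} \<inter> {m'. q' m' \<noteq> \<zero>}"
    proof (rule Set.set_eqI)
      fix m'
      show "(m' \<in> {m'. q' m' \<noteq> \<zero>}) = (m' \<in> {m'. p m' \<noteq> \<zero>} \<inter> {m'. q' m' \<noteq> \<zero>})"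
        using Suc.prems(2)[of m'] by (auto simp: q'_def)
    qed
    have c: "q m \<in> carrier R" "set_mset m \<subseteq> {..<n}" using Suc.prems(1) m unfolding mpoly_carrier by blast+
    have pm: "p m = q m" using Suc.prems(2)[of m] m by simp
    have "P (mterm R (q m) m \<oplus>\<^bsub>mpoly_ring R n\<^esub> q')"
      by (rule t[OF c(1) m c(2) q'c sup pm \<open>P q'\<close>])
    moreover have "mterm R (q m) m \<oplus>\<^bsub>mpoly_ring R n\<^esub> q' = q"
      using Suc.prems(1) by (auto simp: mpoly_simps mterm_def q'_def mpoly_coeff_closed)
    ultimately show ?case by simp
  qed
  then show ?thesis using assms(1) by auto
qed

lemma mpoly_zero_mult:
  assumes "q \<in> carrier (mpoly_ring R n)"
  shows "\<zero>\<^bsub>mpoly_ring R n\<^esub> \<otimes>\<^bsub>mpoly_ring R n\<^esub> q = \<zero>\<^bsub>mpoly_ring R n\<^esub>"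
proof
  fix m
  show "(\<zero>\<^bsub>mpoly_ring R n\<^esub> \<otimes>\<^bsub>mpoly_ring R n\<^esub> q) m = \<zero>\<^bsub>mpoly_ring R n\<^esub> m"
    unfolding mpoly_mult_coeff unfolding mpoly_simps
    by (rule add.finprod_one_eqI) (use mpoly_coeff_closed[OF assms] in auto)
qed

lemma mpoly_cring: "cring (mpoly_ring R n)"
proof (rule cringI)
  let ?M = "mpoly_ring R n"
  interpret M: abelian_group ?M by (rule mpoly_abelian_group)
  show "abelian_group ?M" by (rule mpoly_abelian_group)
  show ld: "(x \<oplus>\<^bsub>?M\<^esub> y) \<otimes>\<^bsub>?M\<^esub> z = x \<otimes>\<^bsub>?M\<^esub> z \<oplus>\<^bsub>?M\<^esub> y \<otimes>\<^bsub>?M\<^esub> z"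
    if "x \<in> carrier ?M" "y \<in> carrier ?M" "z \<in> carrier ?M" for x y z by (rule mpoly_l_distr[OF that])
  have rd: "z \<otimes>\<^bsub>?M\<^esub> (x \<oplus>\<^bsub>?M\<^esub> y) = z \<otimes>\<^bsub>?M\<^esub> x \<oplus>\<^bsub>?M\<^esub> z \<otimes>\<^bsub>?M\<^esub> y"
    if "x \<in> carrier ?M" "y \<in> carrier ?M" "z \<in> carrier ?M" for x y z
    using ld[OF that] mpoly_m_comm that M.a_closed by metis
  have z1: "\<zero>\<^bsub>?M\<^esub> \<otimes>\<^bsub>?M\<^esub> x = \<zero>\<^bsub>?M\<^esub>" and z2: "x \<otimes>\<^bsub>?M\<^esub> \<zero>\<^bsub>?M\<^esub> = \<zero>\<^bsub>?M\<^esub>" if "x \<in> carrier ?M" for x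
    using mpoly_zero_mult[OF that] mpoly_m_comm[OF that M.zero_closed] by auto
  note cl = mpoly_mult_closed mpoly_add_closed mterm_carrier M.zero_closed
  have one: "mterm R \<one> {#} \<otimes>\<^bsub>?M\<^esub> x = x" if "x \<in> carrier ?M" for x
    using that
  proof (induction x rule: mpoly_induct)
    case zero then show ?case by (simp add: z2)
  next
    case (add_term c m q) then show ?case by (simp add: rd mterm_mult)
  qed
  have assoc: "(x \<otimes>\<^bsub>?M\<^esub> y) \<otimes>\<^bsub>?M\<^esub> z = x \<otimes>\<^bsub>?M\<^esub> (y \<otimes>\<^bsub>?M\<^esub> z)"
    if "x \<in> carrier ?M" "y \<in> carrier ?M" "z \<in> carrier ?M" for x y z
    using that
  proof (induction x rule: mpoly_induct)
    case zero then show ?case by (simp add: z1 cl)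
  next
    case (add_term c m q)
    have "(mterm R c m \<otimes>\<^bsub>?M\<^esub> y) \<otimes>\<^bsub>?M\<^esub> z = mterm R c m \<otimes>\<^bsub>?M\<^esub> (y \<otimes>\<^bsub>?M\<^esub> z)"
      using add_term.prems(1)
    proof (induction y rule: mpoly_induct)
      case zero then show ?case using add_term by (simp add: z1 z2 cl)
    next
      case (add_term c' m' q')
      have "(mterm R c m \<otimes>\<^bsub>?M\<^esub> mterm R c' m') \<otimes>\<^bsub>?M\<^esub> z = mterm R c m \<otimes>\<^bsub>?M\<^esub> (mterm R c' m' \<otimes>\<^bsub>?M\<^esub> z)"
        using \<open>z \<in> carrier ?M\<close>
      proof (induction z rule: mpoly_induct)
        case zero then show ?case using add_term \<open>c \<in> carrier R\<close> \<open>set_mset m \<subseteq> {..<n}\<close> by (simp add: z2 cl)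
      next
        case (add_term c'' m'' q'')
        then show ?case using \<open>c \<in> carrier R\<close> \<open>set_mset m \<subseteq> {..<n}\<close> \<open>c' \<in> carrier R\<close> \<open>set_mset m' \<subseteq> {..<n}\<close>
          by (simp add: rd cl mterm_mult m_assoc union_assoc)
      qed
      then show ?case using add_term \<open>z \<in> carrier ?M\<close> \<open>c \<in> carrier R\<close> \<open>set_mset m \<subseteq> {..<n}\<close>
        by (simp add: ld rd cl)
    qed
    then show ?case using add_term by (simp add: ld cl)
  qed
  show "comm_monoid ?M"
    by (rule comm_monoidI) (use cl one assoc mpoly_m_comm in \<open>auto simp: mpoly_simps\<close>)
qed

lemma mpoly_const_hom: "mpoly_const R \<in> ring_hom R (mpoly_ring R n)"
  by (rule ring_hom_memI) (auto simp: mpoly_const_mterm mterm_mult mpoly_simps, auto simp: mterm_def)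

end

subsection \<open>Evaluation\<close>

locale mpoly_evaluation = R: cring R + A: cring A for R (structure) and A (structure) +
  fixes \<phi> fs
  assumes hom: "\<phi> \<in> ring_hom R A" and fs: "set fs \<subseteq> carrier A"
begin

abbreviation "M \<equiv> mpoly_ring R (length fs)"
abbreviation "ev \<equiv> mpoly_eval R A \<phi> fs"

sublocale M: cring M by (rule R.mpoly_cring)
lemma phi_hom:
  "x \<in> carrier R \<Longrightarrow> \<phi> x \<in> carrier A"
  "x \<in> carrier R \<Longrightarrow> y \<in> carrier R \<Longrightarrow> \<phi> (x \<otimes> y) = \<phi> x \<otimes>\<^bsub>A\<^esub> \<phi> y"
  "x \<in> carrier R \<Longrightarrow> y \<in> carrier R \<Longrightarrow> \<phi> (x \<oplus> y) = \<phi> x \<oplus>\<^bsub>A\<^esub> \<phi> y"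
  "\<phi> \<one> = \<one>\<^bsub>A\<^esub>" "\<phi> \<zero> = \<zero>\<^bsub>A\<^esub>"
proof -
  interpret phi: ring_hom_cring R A \<phi> by (rule ring_hom_cringI[OF R.is_cring A.is_cring hom])
  show "x \<in> carrier R \<Longrightarrow> \<phi> x \<in> carrier A"
    "x \<in> carrier R \<Longrightarrow> y \<in> carrier R \<Longrightarrow> \<phi> (x \<otimes> y) = \<phi> x \<otimes>\<^bsub>A\<^esub> \<phi> y"
    "x \<in> carrier R \<Longrightarrow> y \<in> carrier R \<Longrightarrow> \<phi> (x \<oplus> y) = \<phi> x \<oplus>\<^bsub>A\<^esub> \<phi> y"
    "\<phi> \<one> = \<one>\<^bsub>A\<^esub>" "\<phi> \<zero> = \<zero>\<^bsub>A\<^esub>" by auto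
qed

context notes phi_hom [simp] begin

lemma fs_nth [simp]: "i < length fs \<Longrightarrow> fs ! i \<in> carrier A"
  using fs nth_mem by blast

definition mon where "mon m = finprod A (\<lambda>i. (fs ! i) [^]\<^bsub>A\<^esub> count m i) {..<length fs}"

lemma mon_closed [simp]: "mon m \<in> carrier A"
  unfolding mon_def by (rule A.finprod_closed) (use fs in auto)

lemma mon_empty [simp]: "mon {#} = \<one>\<^bsub>A\<^esub>"
  unfolding mon_def by (rule A.finprod_one_eqI) auto

lemma mon_add: "mon (a + b) = mon a \<otimes>\<^bsub>A\<^esub> mon b"
proof -
  have "mon (a + b) = finprod A (\<lambda>i. (fs ! i) [^]\<^bsub>A\<^esub> count a i \<otimes>\<^bsub>A\<^esub> (fs ! i) [^]\<^bsub>A\<^esub> count b i) {..<length fs}"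
    unfolding mon_def using fs by (intro A.finprod_cong') (auto simp: A.nat_pow_mult)
  also have "\<dots> = mon a \<otimes>\<^bsub>A\<^esub> mon b"
    unfolding mon_def using fs by (intro A.finprod_multf) auto
  finally show ?thesis .
qed

lemma mon_single: "i < length fs \<Longrightarrow> mon {#i#} = fs ! i"
proof -
  assume i: "i < length fs"
  have "mon {#i#} = finprod A (\<lambda>j. if i = j then fs ! j else \<one>\<^bsub>A\<^esub>) {..<length fs}"
    unfolding mon_def using fs by (intro A.finprod_cong') auto
  also have "\<dots> = fs ! i" using i fs by (intro A.finprod_singleton) auto
  finally show ?thesis .
qed

text \<open>The support of a sum is in general smaller than the union of the supports; additivity of the
  evaluation is proved by summing over the union.\<close>

lemma ev_on_superset:
  assumes "p \<in> carrier M" "finite B" "{m. p m \<noteq> \<zero>\<^bsub>R\<^esub>} \<subseteq> B"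
  shows "ev p = finsum A (\<lambda>m. \<phi> (p m) \<otimes>\<^bsub>A\<^esub> mon m) B"
  unfolding mpoly_eval_def mon_def[symmetric]
  by (rule A.add.finprod_mono_neutral_cong_left) (use assms R.mpoly_coeff_closed in auto)

lemma ev_zero [simp]: "ev \<zero>\<^bsub>M\<^esub> = \<zero>\<^bsub>A\<^esub>"
  by (subst ev_on_superset[OF M.zero_closed, of "{}"]) (auto simp: R.mpoly_simps)

lemma ev_closed [simp]: "p \<in> carrier M \<Longrightarrow> ev p \<in> carrier A"
  unfolding mpoly_eval_def mon_def[symmetric]
  by (rule A.finsum_closed) (auto simp: R.mpoly_coeff_closed)

lemma ev_add:
  assumes "p \<in> carrier M" "q \<in> carrier M"
  shows "ev (p \<oplus>\<^bsub>M\<^esub> q) = ev p \<oplus>\<^bsub>A\<^esub> ev q"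
proof -
  let ?B = "{m. p m \<noteq> \<zero>\<^bsub>R\<^esub>} \<union> {m. q m \<noteq> \<zero>\<^bsub>R\<^esub>}"
  have B: "finite ?B" using assms by (auto simp: R.mpoly_carrier)
  have "ev (p \<oplus>\<^bsub>M\<^esub> q) = finsum A (\<lambda>m. \<phi> ((p \<oplus>\<^bsub>M\<^esub> q) m) \<otimes>\<^bsub>A\<^esub> mon m) ?B"
    by (rule ev_on_superset[OF M.a_closed[OF assms] B]) (use assms in \<open>auto simp: R.mpoly_simps R.mpoly_coeff_closed\<close>)
  also have "\<dots> = finsum A (\<lambda>m. \<phi> (p m) \<otimes>\<^bsub>A\<^esub> mon m \<oplus>\<^bsub>A\<^esub> \<phi> (q m) \<otimes>\<^bsub>A\<^esub> mon m) ?B"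
    using assms by (intro A.finsum_cong') (auto simp: R.mpoly_simps R.mpoly_coeff_closed A.l_distr)
  also have "\<dots> = finsum A (\<lambda>m. \<phi> (p m) \<otimes>\<^bsub>A\<^esub> mon m) ?B \<oplus>\<^bsub>A\<^esub> finsum A (\<lambda>m. \<phi> (q m) \<otimes>\<^bsub>A\<^esub> mon m) ?B"
    using assms by (intro A.finsum_addf) (auto simp: R.mpoly_coeff_closed)
  also have "\<dots> = ev p \<oplus>\<^bsub>A\<^esub> ev q"
    using ev_on_superset[OF assms(1) B] ev_on_superset[OF assms(2) B] by auto
  finally show ?thesis .
qed

lemma ev_mterm:
  assumes "c \<in> carrier R" "set_mset m \<subseteq> {..<length fs}"
  shows "ev (mterm R c m) = \<phi> c \<otimes>\<^bsub>A\<^esub> mon m"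
proof -
  have "ev (mterm R c m) = finsum A (\<lambda>m'. \<phi> (mterm R c m m') \<otimes>\<^bsub>A\<^esub> mon m') {m}"
    by (rule ev_on_superset[OF R.mterm_carrier[OF assms]]) (auto simp: mterm_def)
  then show ?thesis using assms by (simp add: mterm_def)
qed

lemma ev_mult:
  assumes "p \<in> carrier M" "q \<in> carrier M"
  shows "ev (p \<otimes>\<^bsub>M\<^esub> q) = ev p \<otimes>\<^bsub>A\<^esub> ev q"
  using assms
proof (induction p rule: R.mpoly_induct)
  case zero then show ?case by simp
next
  case (add_term c m p)
  have "ev (mterm R c m \<otimes>\<^bsub>M\<^esub> q) = ev (mterm R c m) \<otimes>\<^bsub>A\<^esub> ev q"
    using add_term.prems
  proof (induction q rule: R.mpoly_induct)
    case zero then show ?case using add_term by simp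
  next
    case (add_term c' m' q)
    then show ?case using \<open>c \<in> carrier R\<close> \<open>set_mset m \<subseteq> {..<length fs}\<close>
      by (simp add: M.r_distr R.mterm_mult ev_add ev_mterm mon_add A.r_distr A.m_ac)
  qed
  then show ?case using add_term by (simp add: M.l_distr ev_add A.l_distr)
qed

lemma ev_ring_hom: "ev \<in> ring_hom M A"
proof (rule ring_hom_memI)
  show "ev \<one>\<^bsub>M\<^esub> = \<one>\<^bsub>A\<^esub>" by (simp add: R.mpoly_simps ev_mterm)
qed (auto simp: ev_mult ev_add)

lemma ev_const: "c \<in> carrier R \<Longrightarrow> ev (mpoly_const R c) = \<phi> c"
  by (simp add: mpoly_const_mterm ev_mterm)

lemma ev_hom_ring: "ring_hom_ring M A ev"
  by (rule ring_hom_ringI2[OF M.ring_axioms A.ring_axioms ev_ring_hom])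

end

end

subsection \<open>Adjoining the last variable\<close>

text \<open>The coefficient of \<open>T\<^sub>n\<^sup>i\<close>, as a polynomial in the other variables.\<close>

definition mpoly_split :: "('a, 'm) ring_scheme \<Rightarrow> nat \<Rightarrow> (nat multiset \<Rightarrow> 'a) \<Rightarrow> nat \<Rightarrow> nat multiset \<Rightarrow> 'a" where
  "mpoly_split R n p = (\<lambda>i m. if n \<in># m then \<zero>\<^bsub>R\<^esub> else p (m + replicate_mset i n))"

lemma multiset_split_eq: "m = filter_mset (\<lambda>x. x \<noteq> n) m + replicate_mset (count m n) n"
  by (rule multiset_eqI) auto

lemma filter_replicate_count:
  "n \<notin># m \<Longrightarrow> filter_mset (\<lambda>x. x \<noteq> n) (m + replicate_mset i n) = m \<and> count (m + replicate_mset i n) n = i"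
  by (auto simp: not_in_iff multiset_eq_iff)

context cring begin

text \<open>Splitting takes terms to terms, and by distributivity the multiplicativity need only be verified
  there.\<close>

lemma mpoly_split_iso: "mpoly_split R n \<in> ring_iso (mpoly_ring R (Suc n)) (UP (mpoly_ring R n))"
proof -
  let ?M = "mpoly_ring R n" and ?M' = "mpoly_ring R (Suc n)" and ?h = "mpoly_split R n"
  interpret M: cring ?M by (rule mpoly_cring)
  interpret M': cring ?M' by (rule mpoly_cring)
  define U where "U = UP ?M"
  interpret U: UP_cring ?M U by unfold_locales (rule U_def[THEN eq_reflection])
  have carU: "carrier U = up ?M" by (simp add: U_def UP_def)
  have closed: "?h p \<in> carrier U" if p: "p \<in> carrier ?M'" for p
  proof -
    have fin: "finite {m. p m \<noteq> \<zero>}" using p by (simp add: mpoly_carrier)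
    have "?h p i \<in> carrier ?M" for i
      unfolding mpoly_carrier
    proof (intro conjI allI impI)
      show "?h p i m \<in> carrier R" for m using mpoly_coeff_closed[OF p] by (simp add: mpoly_split_def)
      have "inj_on (\<lambda>m. m + replicate_mset i n) {m. ?h p i m \<noteq> \<zero>}" by (auto simp: inj_on_def)
      moreover have "(\<lambda>m. m + replicate_mset i n) ` {m. ?h p i m \<noteq> \<zero>} \<subseteq> {m. p m \<noteq> \<zero>}"
        by (auto simp: mpoly_split_def split: if_splits)
      ultimately show "finite {m. ?h p i m \<noteq> \<zero>}" using fin by (meson finite_imageD finite_subset)
      fix m assume m: "?h p i m \<noteq> \<zero>"
      then have "n \<notin># m" "p (m + replicate_mset i n) \<noteq> \<zero>" by (auto simp: mpoly_split_def split: if_splits)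
      then have "set_mset (m + replicate_mset i n) \<subseteq> {..<Suc n}" "n \<notin># m" using p unfolding mpoly_carrier by blast+
      then show "set_mset m \<subseteq> {..<n}" by (auto simp: less_Suc_eq)
    qed
    moreover have "bound \<zero>\<^bsub>?M\<^esub> (Max (insert 0 (size ` {m. p m \<noteq> \<zero>}))) (?h p)"
    proof
      fix i assume i: "Max (insert 0 (size ` {m. p m \<noteq> \<zero>})) < i"
      have "p (m + replicate_mset i n) = \<zero>" for m
      proof (rule ccontr)
        assume "p (m + replicate_mset i n) \<noteq> \<zero>"
        then have "size (m + replicate_mset i n) \<in> size ` {m. p m \<noteq> \<zero>}" by blast
        then have "size (m + replicate_mset i n) \<le> Max (insert 0 (size ` {m. p m \<noteq> \<zero>}))"
          using fin by (intro Max_ge) auto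
        then show False using i by simp
      qed
      then show "?h p i = \<zero>\<^bsub>?M\<^esub>" by (auto simp: mpoly_split_def mpoly_simps)
    qed
    ultimately show ?thesis unfolding carU by blast
  qed
  have add: "?h (p \<oplus>\<^bsub>?M'\<^esub> q) = ?h p \<oplus>\<^bsub>U\<^esub> ?h q" if "p \<in> carrier ?M'" "q \<in> carrier ?M'" for p q
    using closed[OF that(1)] closed[OF that(2)]
    by (auto simp: U_def UP_def mpoly_split_def mpoly_simps fun_eq_iff)
  have hz: "?h \<zero>\<^bsub>?M'\<^esub> = \<zero>\<^bsub>U\<^esub>" by (auto simp: U_def UP_def mpoly_split_def mpoly_simps fun_eq_iff)
  have tm_eq: "?h (mterm R c m) = up_ring.monom U (mterm R c (filter_mset (\<lambda>x. x \<noteq> n) m)) (count m n)"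
    if "c \<in> carrier R" "set_mset m \<subseteq> {..<Suc n}" for c m
  proof -
    have s: "set_mset (filter_mset (\<lambda>x. x \<noteq> n) m) \<subseteq> {..<n}" using that(2) by (auto simp: less_Suc_eq)
    have eq: "n \<notin># m' \<and> m' + replicate_mset i n = m \<longleftrightarrow> m' = filter_mset (\<lambda>x. x \<noteq> n) m \<and> i = count m n" for m' i
      using filter_replicate_count[of n m' i] multiset_split_eq[of m n] by auto
    show ?thesis
      using mterm_carrier[OF that(1) s] eq
      by (auto simp: U_def UP_def mpoly_split_def mterm_def mpoly_simps fun_eq_iff)
  qed
  have tcar: "mterm R c (filter_mset (\<lambda>x. x \<noteq> n) m) \<in> carrier ?M" if "c \<in> carrier R" "set_mset m \<subseteq> {..<Suc n}" for c m
    by (rule mterm_carrier[OF that(1)]) (use that(2) in \<open>auto simp: less_Suc_eq\<close>)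
  have mult: "?h (p \<otimes>\<^bsub>?M'\<^esub> q) = ?h p \<otimes>\<^bsub>U\<^esub> ?h q" if "p \<in> carrier ?M'" "q \<in> carrier ?M'" for p q
    using that
  proof (induction p rule: mpoly_induct)
    case zero then show ?case by (simp add: hz closed)
  next
    case (add_term c m p)
    have "?h (mterm R c m \<otimes>\<^bsub>?M'\<^esub> q) = ?h (mterm R c m) \<otimes>\<^bsub>U\<^esub> ?h q"
      using add_term.prems
    proof (induction q rule: mpoly_induct)
      case zero then show ?case using add_term by (simp add: hz closed)
    next
      case (add_term c' m' q)
      have "?h (mterm R c m \<otimes>\<^bsub>?M'\<^esub> mterm R c' m') = ?h (mterm R c m) \<otimes>\<^bsub>U\<^esub> ?h (mterm R c' m')"
        using add_term \<open>c \<in> carrier R\<close> \<open>set_mset m \<subseteq> {..<Suc n}\<close> tcar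
        by (simp add: mterm_mult[where n = "Suc n"] tm_eq U.monom_mult[symmetric] mterm_mult[where n = n])
      then show ?case using add_term \<open>c \<in> carrier R\<close> \<open>set_mset m \<subseteq> {..<Suc n}\<close>
        by (simp add: M'.r_distr add closed U.P.r_distr)
    qed
    then show ?case using add_term by (simp add: M'.l_distr add closed U.P.l_distr)
  qed
  have one: "?h \<one>\<^bsub>?M'\<^esub> = \<one>\<^bsub>U\<^esub>"
    using tm_eq[of \<one> "{#}"] U.monom_one by (simp add: mpoly_simps)
  have inj: "inj_on ?h (carrier ?M')"
  proof (rule inj_onI)
    fix p q assume "?h p = ?h q"
    then have "?h p (count m n) (filter_mset (\<lambda>x. x \<noteq> n) m) = ?h q (count m n) (filter_mset (\<lambda>x. x \<noteq> n) m)" for m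
      by simp
    then have *: "p (filter_mset (\<lambda>x. x \<noteq> n) m + replicate_mset (count m n) n)
        = q (filter_mset (\<lambda>x. x \<noteq> n) m + replicate_mset (count m n) n)" for m
      by (simp add: mpoly_split_def)
    have "p m = q m" for m using *[of m] unfolding multiset_split_eq[of m n, symmetric] .
    then show "p = q" by auto
  qed
  have surj: "\<exists>p\<in>carrier ?M'. ?h p = f" if f: "f \<in> carrier U" for f
  proof -
    define p where "p m = f (count m n) (filter_mset (\<lambda>x. x \<noteq> n) m)" for m
    have fc: "f i \<in> carrier ?M" for i using f by (auto simp: carU)
    obtain N where N: "\<And>i. i > N \<Longrightarrow> f i = \<zero>\<^bsub>?M\<^esub>" using f unfolding carU by (auto simp: up_def)
    have "p \<in> carrier ?M'"
      unfolding mpoly_carrier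
    proof (intro conjI allI impI)
      show "p m \<in> carrier R" for m using mpoly_coeff_closed[OF fc] by (simp add: p_def)
      have "{m. p m \<noteq> \<zero>} \<subseteq> (\<Union>i\<le>N. (\<lambda>m. m + replicate_mset i n) ` {m. f i m \<noteq> \<zero>})"
      proof
        fix m assume "m \<in> {m. p m \<noteq> \<zero>}"
        then have nz: "f (count m n) (filter_mset (\<lambda>x. x \<noteq> n) m) \<noteq> \<zero>" by (simp add: p_def)
        then have "f (count m n) \<noteq> \<zero>\<^bsub>?M\<^esub>" by (auto simp: mpoly_simps)
        then have "count m n \<le> N" using N by (meson not_le)
        then show "m \<in> (\<Union>i\<le>N. (\<lambda>m. m + replicate_mset i n) ` {m. f i m \<noteq> \<zero>})"
          using nz multiset_split_eq[of m n] by auto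
      qed
      moreover have "finite {m. f i m \<noteq> \<zero>}" for i using fc[of i] by (simp add: mpoly_carrier)
      ultimately show "finite {m. p m \<noteq> \<zero>}" by (meson finite_UN_I finite_atMost finite_imageI finite_subset)
      fix m assume "p m \<noteq> \<zero>"
      then have "set_mset (filter_mset (\<lambda>x. x \<noteq> n) m) \<subseteq> {..<n}"
        using fc unfolding mpoly_carrier p_def by blast
      then show "set_mset m \<subseteq> {..<Suc n}" by (auto simp: less_Suc_eq)
    qed
    moreover have "?h p = f"
    proof (intro ext)
      fix i m
      show "?h p i m = f i m"
      proof (cases "n \<in># m")
        case True
        then have "f i m = \<zero>" using fc[of i] unfolding mpoly_carrier by fastforce
        then show ?thesis using True by (simp add: mpoly_split_def)
      next
        case False
        then show ?thesis using filter_replicate_count[of n m i] by (simp add: mpoly_split_def p_def)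
      qed
    qed
    ultimately show ?thesis by blast
  qed
  have "bij_betw ?h (carrier ?M') (carrier U)"
    unfolding bij_betw_def using inj closed surj by auto
  then show ?thesis unfolding U_def[symmetric]
    by (intro ring_iso_memI) (use closed add mult one in auto)
qed

end

section \<open>Rings with regular localizations\<close>

text \<open>Regularity of the local ring \<open>R\<^sub>p\<close>, in terms of \<open>R\<close>: its maximal ideal is generated by \<open>ws\<close>, and
  the chain shows that its dimension is at least the length of \<open>ws\<close>; it is never more.\<close>

definition regular_at :: "('a, 'm) ring_scheme \<Rightarrow> 'a set \<Rightarrow> bool" where
  "regular_at R p \<longleftrightarrow> (\<exists>ws Q. set ws \<subseteq> p \<and> prime_chain R Q (length ws) \<and> Q (length ws) = p \<and>
     (\<forall>g\<in>p. \<exists>s\<in>carrier R - p. s \<otimes>\<^bsub>R\<^esub> g \<in> Idl\<^bsub>R\<^esub> (set ws)))"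

definition regular_noetherian :: "('a, 'm) ring_scheme \<Rightarrow> bool" where
  "regular_noetherian R \<longleftrightarrow> cring R \<and> noetherian_ring R \<and> (\<forall>p. primeideal p R \<longrightarrow> regular_at R p)"

lemma (in ring_hom_ring) hom_genideal:
  assumes "A \<subseteq> carrier R" "x \<in> Idl A"
  shows "h x \<in> Idl\<^bsub>S\<^esub> (h ` A)"
proof -
  have hA: "h ` A \<subseteq> carrier S" using assms by auto
  have "ideal {r \<in> carrier R. h r \<in> Idl\<^bsub>S\<^esub> (h ` A)} R"
    by (rule ideal_vimage[OF S.genideal_ideal[OF hA]])
  then have "Idl A \<subseteq> {r \<in> carrier R. h r \<in> Idl\<^bsub>S\<^esub> (h ` A)}"
    by (rule R.genideal_minimal) (use assms S.genideal_self[OF hA] in auto)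
  then show ?thesis using assms by auto
qed

lemma (in ring_hom_ring) ideal_image:
  assumes "ideal I R" "h ` carrier R = carrier S"
  shows "ideal (h ` I) S"
proof (rule idealI[OF S.ring_axioms])
  interpret I: ideal I R by fact
  show "subgroup (h ` I) (add_monoid S)"
  proof
    show "h ` I \<subseteq> carrier (add_monoid S)" using I.a_subset by auto
    show "\<one>\<^bsub>add_monoid S\<^esub> \<in> h ` I" using I.zero_closed hom_zero by (metis image_eqI monoid.simps(2))
    show "x \<otimes>\<^bsub>add_monoid S\<^esub> y \<in> h ` I" if xy: "x \<in> h ` I" "y \<in> h ` I" for x y
    proof -
      obtain a b where "a \<in> I" "b \<in> I" "x = h a" "y = h b" using xy by blast
      then show ?thesis by (auto intro!: image_eqI[of _ _ "a \<oplus> b"])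
    qed
    show "inv\<^bsub>add_monoid S\<^esub> x \<in> h ` I" if x: "x \<in> h ` I" for x
    proof -
      obtain a where "a \<in> I" "x = h a" using x by blast
      then show ?thesis by (auto simp: a_inv_def[symmetric] intro!: image_eqI[of _ _ "\<ominus> a"])
    qed
  qed
  fix x r assume "x \<in> h ` I" and r: "r \<in> carrier S"
  then obtain a b where "a \<in> I" "x = h a" "b \<in> carrier R" "r = h b" using assms(2) by blast
  then have "r \<otimes>\<^bsub>S\<^esub> x = h (b \<otimes> a)" "b \<otimes> a \<in> I" "x \<otimes>\<^bsub>S\<^esub> r = h (a \<otimes> b)" "a \<otimes> b \<in> I"
    by (auto intro: I.I_l_closed I.I_r_closed)
  then show "r \<otimes>\<^bsub>S\<^esub> x \<in> h ` I" "x \<otimes>\<^bsub>S\<^esub> r \<in> h ` I" by blast+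
qed

lemma (in ring_hom_ring) primeideal_preimage:
  assumes "cring R" "primeideal Q S"
  shows "primeideal {r \<in> carrier R. h r \<in> Q} R"
proof (rule primeidealI)
  interpret Q: primeideal Q S by fact
  show "ideal {r \<in> carrier R. h r \<in> Q} R" by (rule ideal_vimage[OF Q.is_ideal])
  have "h \<one> \<notin> Q" using Q.I_notcarr Q.one_imp_carrier by auto
  then show "carrier R \<noteq> {r \<in> carrier R. h r \<in> Q}" by blast
qed (use assms(1) primeideal.I_prime[OF assms(2)] in auto)

lemma field_regular_noetherian:
  assumes "field R" shows "regular_noetherian R"
proof -
  interpret field R by fact
  have "regular_at R p" if p: "primeideal p R" for p
  proof -
    interpret p: primeideal p R by fact
    have "p = {\<zero>\<^bsub>R\<^esub>}" using all_ideals p.is_ideal p.I_notcarr by auto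
    moreover have "\<zero>\<^bsub>R\<^esub> \<in> Idl\<^bsub>R\<^esub> {}"
      using additive_subgroup.zero_closed[OF ideal.axioms(1)[OF genideal_ideal[of "{}"]]] by auto
    ultimately show ?thesis unfolding regular_at_def
      by (intro exI[of _ "[]"] exI[of _ "\<lambda>_. p"]) (auto simp: prime_chain_def zeroprimeideal intro!: bexI[of _ "\<one>\<^bsub>R\<^esub>"])
  qed
  moreover have "noetherian_ring R"
  proof (rule noetherian_ringI)
    fix I assume "ideal I R"
    then have "I = {\<zero>\<^bsub>R\<^esub>} \<or> I = carrier R" using all_ideals by auto
    then show "\<exists>A\<subseteq>carrier R. finite A \<and> I = Idl\<^bsub>R\<^esub> A"
      using genideal_zero genideal_one by (metis empty_subsetI finite.emptyI finite.insertI insert_subset one_closed zero_closed)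
  qed
  ultimately show ?thesis unfolding regular_noetherian_def using is_cring by auto
qed

lemma regular_noetherian_iso:
  assumes iso: "h \<in> ring_iso R S" and R: "cring R" and reg: "regular_noetherian S"
  shows "regular_noetherian R"
proof -
  interpret R: cring R by fact
  interpret S: cring S using reg by (simp add: regular_noetherian_def)
  interpret Sn: noetherian_ring S using reg by (simp add: regular_noetherian_def)
  interpret h: ring_hom_ring R S h
    by (rule ring_hom_ringI2[OF R.ring_axioms S.ring_axioms]) (use iso in \<open>simp add: ring_iso_def\<close>)
  have bij: "bij_betw h (carrier R) (carrier S)" using iso by (simp add: ring_iso_def)
  then have surj: "h ` carrier R = carrier S" and inj: "inj_on h (carrier R)" by (auto simp: bij_betw_def)
  define g where "g = inv_into (carrier R) h"
  have g: "g x \<in> carrier R" "h (g x) = x" if "x \<in> carrier S" for x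
    using that surj by (auto simp: g_def inv_into_into f_inv_into_f)
  have gen: "x \<in> Idl\<^bsub>R\<^esub> A" if A: "A \<subseteq> carrier R" "x \<in> carrier R" "h x \<in> Idl\<^bsub>S\<^esub> (h ` A)" for A x
  proof -
    have "ideal (h ` (Idl\<^bsub>R\<^esub> A)) S" by (rule h.ideal_image[OF R.genideal_ideal[OF A(1)] surj])
    then have "Idl\<^bsub>S\<^esub> (h ` A) \<subseteq> h ` (Idl\<^bsub>R\<^esub> A)" by (rule S.genideal_minimal) (use R.genideal_self[OF A(1)] in auto)
    then obtain y where "y \<in> Idl\<^bsub>R\<^esub> A" "h x = h y" using A(3) by auto
    then show ?thesis using inj A R.ideal_subset[OF R.genideal_ideal[OF A(1)]] by (metis inj_onD subsetD)
  qed
  have "noetherian_ring R"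
  proof (rule R.noetherian_ringI)
    fix I assume I: "ideal I R"
    have Ic: "I \<subseteq> carrier R" by (rule R.ideal_subset[OF I])
    have "ideal (h ` I) S" by (rule h.ideal_image[OF I surj])
    then obtain A where A: "A \<subseteq> carrier S" "finite A" "h ` I = Idl\<^bsub>S\<^esub> A"
      using Sn.finetely_gen[of "h ` I"] by metis
    have gA: "g ` A \<subseteq> carrier R" "h ` g ` A = A" using A(1) g by (auto simp: subset_iff image_iff)
    have "g ` A \<subseteq> I"
    proof
      fix y assume y: "y \<in> g ` A"
      then have "h y \<in> A" using gA by auto
      then have "h y \<in> h ` I" using A S.genideal_self[of A] by auto
      then show "y \<in> I" using inj y gA Ic by (metis image_iff inj_onD subsetD)
    qed
    then have "Idl\<^bsub>R\<^esub> (g ` A) \<subseteq> I" by (rule R.genideal_minimal[OF I])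
    moreover have "I \<subseteq> Idl\<^bsub>R\<^esub> (g ` A)"
    proof
      fix x assume x: "x \<in> I"
      then have "h x \<in> Idl\<^bsub>S\<^esub> (h ` g ` A)" using A(3) gA(2) by auto
      then show "x \<in> Idl\<^bsub>R\<^esub> (g ` A)" using gen[OF gA(1)] x Ic by blast
    qed
    ultimately show "\<exists>A\<subseteq>carrier R. finite A \<and> I = Idl\<^bsub>R\<^esub> A"
      using gA A(2) by (intro exI[of _ "g ` A"]) auto
  qed
  moreover have "regular_at R p" if p: "primeideal p R" for p
  proof -
    interpret p: primeideal p R by fact
    have hp: "h x \<in> h ` p \<longleftrightarrow> x \<in> p" if "x \<in> carrier R" for x
      using that inj p.a_subset by (auto simp: inj_on_def)
    have "primeideal (h ` p) S"
    proof (rule primeidealI)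
      show "ideal (h ` p) S" by (rule h.ideal_image[OF p.is_ideal surj])
      show "carrier S \<noteq> h ` p" using hp[of "\<one>\<^bsub>R\<^esub>"] R.primeideal_one_notin[OF p] by auto
      fix a b assume ab: "a \<in> carrier S" "b \<in> carrier S" "a \<otimes>\<^bsub>S\<^esub> b \<in> h ` p"
      then have "h (g a \<otimes>\<^bsub>R\<^esub> g b) \<in> h ` p" using g by auto
      then have "g a \<otimes>\<^bsub>R\<^esub> g b \<in> p" using hp[of "g a \<otimes>\<^bsub>R\<^esub> g b"] g ab(1,2) by simp
      then have "g a \<in> p \<or> g b \<in> p" using p.I_prime ab g by auto
      then show "a \<in> h ` p \<or> b \<in> h ` p" using g ab by force
    qed (rule S.is_cring)
    then obtain ws Q where ws: "set ws \<subseteq> h ` p" "prime_chain S Q (length ws)" "Q (length ws) = h ` p"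
      "\<And>y. y \<in> h ` p \<Longrightarrow> \<exists>s\<in>carrier S - h ` p. s \<otimes>\<^bsub>S\<^esub> y \<in> Idl\<^bsub>S\<^esub> (set ws)"
      using reg unfolding regular_noetherian_def regular_at_def by meson
    have wsc: "set ws \<subseteq> carrier S" using ws(1) p.a_subset by auto
    define Q' where "Q' i = {r \<in> carrier R. h r \<in> Q i}" for i
    show ?thesis unfolding regular_at_def
    proof (intro exI conjI ballI)
      have gin: "g w \<in> p" if "w \<in> h ` p" for w using that hp[of "g w"] g p.a_subset by (auto simp: subset_iff)
      show "set (map g ws) \<subseteq> p" using ws(1) gin by auto
      show "prime_chain R Q' (length (map g ws))"
        unfolding prime_chain_def
      proof (intro conjI allI impI)
        show "primeideal (Q' i) R" if "i \<le> length (map g ws)" for i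
          unfolding Q'_def by (rule h.primeideal_preimage) (use ws(2) that in \<open>auto simp: prime_chain_def R.is_cring\<close>)
        fix i assume i: "i < length (map g ws)"
        then have sub: "Q i \<subset> Q (Suc i)" and pr: "primeideal (Q (Suc i)) S" using ws(2) by (auto simp: prime_chain_def)
        then obtain y where y: "y \<in> Q (Suc i)" "y \<notin> Q i" by auto
        then have "y \<in> carrier S" using S.ideal_subset[OF primeideal.axioms(1)[OF pr]] by auto
        then have "g y \<in> Q' (Suc i)" "g y \<notin> Q' i" using y g by (auto simp: Q'_def)
        then show "Q' i \<subset> Q' (Suc i)" using sub by (auto simp: Q'_def)
      qed
      show "Q' (length (map g ws)) = p" using ws(3) hp p.a_subset by (auto simp: Q'_def)
      fix x assume x: "x \<in> p"
      then obtain s where s: "s \<in> carrier S - h ` p" "s \<otimes>\<^bsub>S\<^esub> h x \<in> Idl\<^bsub>S\<^esub> (set ws)" using ws(4) by blast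
      have xc: "x \<in> carrier R" using x p.a_subset by auto
      have "h ` set (map g ws) = set ws" using g wsc by (auto simp: image_iff subset_iff)
      then have "h (g s \<otimes>\<^bsub>R\<^esub> x) \<in> Idl\<^bsub>S\<^esub> (h ` set (map g ws))" using s g xc by auto
      then have "g s \<otimes>\<^bsub>R\<^esub> x \<in> Idl\<^bsub>R\<^esub> (set (map g ws))"
        using gen[of "set (map g ws)" "g s \<otimes>\<^bsub>R\<^esub> x"] g wsc s xc by auto
      moreover have "g s \<notin> p" using s g by force
      ultimately show "\<exists>s\<in>carrier R - p. s \<otimes>\<^bsub>R\<^esub> x \<in> Idl\<^bsub>R\<^esub> (set (map g ws))" using s g by blast
    qed
  qed
  ultimately show ?thesis unfolding regular_noetherian_def using R.is_cring by auto
qed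

subsection \<open>Univariate polynomials\<close>

lemma (in ring) ideal_finsum:
  assumes "ideal J R" "finite A" "\<And>i. i \<in> A \<Longrightarrow> f i \<in> J"
  shows "finsum R f A \<in> J"
  using assms(2,3)
proof (induction A rule: finite_induct)
  case empty
  then show ?case using additive_subgroup.zero_closed[OF ideal.axioms(1)[OF assms(1)]] by simp
next
  case (insert i A)
  interpret J: ideal J R by fact
  have "finsum R f (insert i A) = f i \<oplus> finsum R f A"
    using insert by (intro finsum_insert) auto
  then show ?case using insert by auto
qed

context UP_cring begin

definition degle :: "(nat \<Rightarrow> 'a) \<Rightarrow> nat \<Rightarrow> bool" where
  "degle f n \<longleftrightarrow> f \<in> carrier P \<and> (\<forall>m>n. coeff P f m = \<zero>\<^bsub>R\<^esub>)"

text \<open>The zero coefficient of elements of smaller degree is included, which makes this an ideal.\<close>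

definition leading :: "(nat \<Rightarrow> 'a) set \<Rightarrow> nat \<Rightarrow> 'a set" where
  "leading I n = {coeff P f n | f. f \<in> I \<and> degle f n}"

lemma degle_deg: "f \<in> carrier P \<Longrightarrow> degle f (deg R f)"
  using deg_aboveD by (auto simp: degle_def)

lemma monom0_mult_coeff:
  "c \<in> carrier R \<Longrightarrow> f \<in> carrier P \<Longrightarrow> coeff P (monom P c 0 \<otimes>\<^bsub>P\<^esub> f) m = c \<otimes>\<^bsub>R\<^esub> coeff P f m"
  using coeff_monom_mult[of c f 0 m] by simp

lemma monom_split: "a \<in> carrier R \<Longrightarrow> monom P a i = monom P a 0 \<otimes>\<^bsub>P\<^esub> monom P \<one>\<^bsub>R\<^esub> i"
  using monom_mult[of a "\<one>\<^bsub>R\<^esub>" 0 i] by simp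

lemma leading_ideal:
  assumes I: "ideal I P"
  shows "ideal (leading I n) R"
proof (rule idealI[OF R.ring_axioms])
  interpret I: ideal I P by fact
  show "subgroup (leading I n) (add_monoid R)"
  proof
    show "leading I n \<subseteq> carrier (add_monoid R)" by (auto simp: leading_def degle_def)
    have "degle \<zero>\<^bsub>P\<^esub> n" "\<zero>\<^bsub>P\<^esub> \<in> I" by (auto simp: degle_def)
    then show "\<one>\<^bsub>add_monoid R\<^esub> \<in> leading I n" unfolding leading_def by (force intro!: exI[of _ "\<zero>\<^bsub>P\<^esub>"])
    fix a b assume "a \<in> leading I n" "b \<in> leading I n"
    then obtain f g where "a = coeff P f n" "b = coeff P g n" "f \<in> I" "g \<in> I" "degle f n" "degle g n"
      by (auto simp: leading_def)
    then show "a \<otimes>\<^bsub>add_monoid R\<^esub> b \<in> leading I n" unfolding leading_def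
      by (auto simp: degle_def intro!: exI[of _ "f \<oplus>\<^bsub>P\<^esub> g"])
  next
    fix a assume "a \<in> leading I n"
    then obtain f where "a = coeff P f n" "f \<in> I" "degle f n" by (auto simp: leading_def)
    then show "inv\<^bsub>add_monoid R\<^esub> a \<in> leading I n" unfolding leading_def
      by (auto simp: degle_def a_inv_def[symmetric] intro!: exI[of _ "\<ominus>\<^bsub>P\<^esub> f"])
  qed
  fix a r assume "a \<in> leading I n" and r: "r \<in> carrier R"
  then obtain f where f: "a = coeff P f n" "f \<in> I" "degle f n" by (auto simp: leading_def)
  have "monom P r 0 \<otimes>\<^bsub>P\<^esub> f \<in> I" using f r by (simp add: I.I_l_closed)
  moreover have "degle (monom P r 0 \<otimes>\<^bsub>P\<^esub> f) n" "coeff P (monom P r 0 \<otimes>\<^bsub>P\<^esub> f) n = r \<otimes>\<^bsub>R\<^esub> a"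
    using f r by (auto simp: degle_def monom0_mult_coeff simp del: coeff_mult)
  ultimately show "r \<otimes>\<^bsub>R\<^esub> a \<in> leading I n" unfolding leading_def by force
  then show "a \<otimes>\<^bsub>R\<^esub> r \<in> leading I n" using f r by (simp add: degle_def R.m_comm)
qed

lemma leading_Suc:
  assumes I: "ideal I P"
  shows "leading I n \<subseteq> leading I (Suc n)"
proof
  interpret I: ideal I P by fact
  fix a assume "a \<in> leading I n"
  then obtain f where f: "a = coeff P f n" "f \<in> I" "degle f n" by (auto simp: leading_def)
  have fc: "f \<in> carrier P" using f by (simp add: degle_def)
  have c: "coeff P (monom P \<one>\<^bsub>R\<^esub> 1 \<otimes>\<^bsub>P\<^esub> f) (Suc m) = coeff P f m" for m
    using coeff_monom_mult[of "\<one>\<^bsub>R\<^esub>" f 1 m] fc by simp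
  have "monom P \<one>\<^bsub>R\<^esub> 1 \<otimes>\<^bsub>P\<^esub> f \<in> I" using f by (simp add: I.I_l_closed)
  moreover have "degle (monom P \<one>\<^bsub>R\<^esub> 1 \<otimes>\<^bsub>P\<^esub> f) (Suc n)"
    unfolding degle_def
  proof (intro conjI allI impI)
    fix m assume "Suc n < m"
    then obtain m' where "m = Suc m'" "n < m'" by (cases m) auto
    then show "coeff P (monom P \<one>\<^bsub>R\<^esub> 1 \<otimes>\<^bsub>P\<^esub> f) m = \<zero>\<^bsub>R\<^esub>" using c f by (simp add: degle_def del: coeff_mult)
  qed (use fc in simp)
  ultimately show "a \<in> leading I (Suc n)" unfolding leading_def using c[of n] f(1) by force
qed

lemma leading_mono: "ideal I P \<Longrightarrow> i \<le> j \<Longrightarrow> leading I i \<subseteq> leading I j"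
  by (rule lift_Suc_mono_le[of "leading I"]) (use leading_Suc in auto)

text \<open>Subtracting an element of \<open>J\<close> with the same leading coefficient lowers the degree.\<close>

lemma ideal_eq_if_leading_sub:
  assumes I: "ideal I P" and J: "ideal J P" and sub: "J \<subseteq> I" "\<And>n. leading I n \<subseteq> leading J n"
  shows "I \<subseteq> J"
proof -
  interpret I: ideal I P by fact
  interpret J: ideal J P by fact
  have "f \<in> J" if "f \<in> I" "degle f n" for f n
    using that
  proof (induction n arbitrary: f)
    case 0
    have fc: "f \<in> carrier P" using 0 by (simp add: degle_def)
    have "coeff P f 0 \<in> leading J 0" using 0 sub unfolding leading_def by blast
    then obtain g where g: "coeff P f 0 = coeff P g 0" "g \<in> J" "degle g 0" by (auto simp: leading_def)
    have "f = g"
    proof (rule up_eqI[OF _ fc])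
      show "coeff P f n = coeff P g n" for n using g 0 by (cases n) (auto simp: degle_def)
    qed (use g in \<open>simp add: degle_def\<close>)
    then show ?case using g by simp
  next
    case (Suc n)
    have fc: "f \<in> carrier P" using Suc by (simp add: degle_def)
    have "coeff P f (Suc n) \<in> leading J (Suc n)" using Suc sub unfolding leading_def by blast
    then obtain g where g: "coeff P f (Suc n) = coeff P g (Suc n)" "g \<in> J" "degle g (Suc n)" by (auto simp: leading_def)
    have gc: "g \<in> carrier P" using g by (simp add: degle_def)
    have "degle (f \<ominus>\<^bsub>P\<^esub> g) n" unfolding degle_def
    proof (intro conjI allI impI)
      fix m assume "n < m"
      then have "coeff P f m = coeff P g m" using g Suc by (cases "m = Suc n") (auto simp: degle_def)
      then show "coeff P (f \<ominus>\<^bsub>P\<^esub> g) m = \<zero>\<^bsub>R\<^esub>" using fc gc by simp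
    qed (use fc gc in simp)
    moreover have "f \<ominus>\<^bsub>P\<^esub> g \<in> I" using Suc g sub by (metis I.a_closed I.a_inv_closed P.minus_eq subsetD)
    ultimately have "f \<ominus>\<^bsub>P\<^esub> g \<in> J" using Suc by blast
    then have "(f \<ominus>\<^bsub>P\<^esub> g) \<oplus>\<^bsub>P\<^esub> g \<in> J" using g by auto
    moreover have "(f \<ominus>\<^bsub>P\<^esub> g) \<oplus>\<^bsub>P\<^esub> g = f" using fc gc by (simp add: P.minus_eq P.a_assoc P.l_neg)
    ultimately show ?case by simp
  qed
  then show ?thesis using degle_deg I.a_subset by blast
qed

text \<open>The ideals of leading coefficients ascend with the degree and stop growing at some degree \<open>N\<close>.
  Elements of \<open>I\<close> whose coefficients generate them in the degrees up to \<open>N\<close> generate an ideal with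
  the same ideals of leading coefficients.\<close>

theorem hilbert_basis:
  assumes "noetherian_ring R"
  shows "noetherian_ring P"
proof (rule P.noetherian_ringI)
  interpret N: noetherian_ring R by fact
  fix I assume I: "ideal I P"
  interpret I: ideal I P by fact
  have "subset.chain {J. ideal J R} (range (leading I))"
    unfolding pred_on.chain_def using leading_ideal[OF I] leading_mono[OF I]
    by auto (metis nat_le_linear subset_iff)+
  then have "\<Union>(range (leading I)) \<in> range (leading I)" using N.ideal_chain_is_trivial[of "range (leading I)"] by auto
  then obtain N where N: "\<Union>(range (leading I)) = leading I N" by auto
  have "\<exists>B. finite B \<and> B \<subseteq> I \<and> (\<forall>f\<in>B. degle f n) \<and> leading I n = Idl\<^bsub>R\<^esub> ((\<lambda>f. coeff P f n) ` B)" for n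
  proof -
    obtain A where A: "A \<subseteq> carrier R" "finite A" "leading I n = Idl\<^bsub>R\<^esub> A"
      using N.finetely_gen[OF leading_ideal[OF I]] by blast
    have "A \<subseteq> leading I n" using A R.genideal_self by auto
    then have "\<forall>a\<in>A. \<exists>f. f \<in> I \<and> degle f n \<and> coeff P f n = a" by (auto simp: leading_def)
    then obtain F where F: "\<And>a. a \<in> A \<Longrightarrow> F a \<in> I \<and> degle (F a) n \<and> coeff P (F a) n = a" by metis
    have "(\<lambda>f. coeff P f n) ` F ` A = A" using F by (auto simp: image_iff)
    then show ?thesis using A F by (intro exI[of _ "F ` A"]) auto
  qed
  then obtain B where B: "\<And>n. finite (B n)" "\<And>n. B n \<subseteq> I" "\<And>n f. f \<in> B n \<Longrightarrow> degle f n"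
    "\<And>n. leading I n = Idl\<^bsub>R\<^esub> ((\<lambda>f. coeff P f n) ` B n)" by metis
  define C where "C = (\<Union>n\<le>N. B n)"
  have CI: "C \<subseteq> I" using B(2) by (auto simp: C_def)
  then have Cc: "C \<subseteq> carrier P" using I.a_subset by blast
  have Ji: "ideal (Idl\<^bsub>P\<^esub> C) P" by (rule P.genideal_ideal[OF Cc])
  have sub: "leading I n \<subseteq> leading (Idl\<^bsub>P\<^esub> C) n" if "n \<le> N" for n
  proof -
    have "(\<lambda>f. coeff P f n) ` B n \<subseteq> leading (Idl\<^bsub>P\<^esub> C) n"
      using P.genideal_self[OF Cc] B(3) that by (auto simp: leading_def C_def)
    then show ?thesis unfolding B(4)[of n] by (rule R.genideal_minimal[OF leading_ideal[OF Ji]])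
  qed
  have "I \<subseteq> Idl\<^bsub>P\<^esub> C"
  proof (rule ideal_eq_if_leading_sub[OF I Ji])
    show "Idl\<^bsub>P\<^esub> C \<subseteq> I" by (rule P.genideal_minimal[OF I CI])
    show "leading I n \<subseteq> leading (Idl\<^bsub>P\<^esub> C) n" for n
    proof (cases "n \<le> N")
      case False
      have "leading I n \<subseteq> leading I N" using N by auto
      also have "\<dots> \<subseteq> leading (Idl\<^bsub>P\<^esub> C) N" by (rule sub) simp
      also have "\<dots> \<subseteq> leading (Idl\<^bsub>P\<^esub> C) n" by (rule leading_mono[OF Ji]) (use False in simp)
      finally show ?thesis .
    qed (rule sub)
  qed
  then have "I = Idl\<^bsub>P\<^esub> C" using P.genideal_minimal[OF I CI] by auto
  moreover have "finite C" using B(1) by (simp add: C_def)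
  ultimately show "\<exists>A\<subseteq>carrier P. finite A \<and> I = Idl\<^bsub>P\<^esub> A" using Cc by auto
qed

text \<open>The ideal \<open>Q R[T]\<close>.\<close>

definition extend :: "'a set \<Rightarrow> (nat \<Rightarrow> 'a) set" where
  "extend Q = {f \<in> carrier P. \<forall>i. coeff P f i \<in> Q}"

lemma extend_sub_ideal:
  assumes J: "ideal J P" and "\<And>a. a \<in> Q \<Longrightarrow> monom P a 0 \<in> J" and Qc: "Q \<subseteq> carrier R"
  shows "extend Q \<subseteq> J"
proof
  interpret J: ideal J P by fact
  fix f assume f: "f \<in> extend Q"
  have m: "monom P (coeff P f i) i \<in> J" for i
    using assms(2)[of "coeff P f i"] f monom_split[of "coeff P f i" i] by (simp add: extend_def J.I_r_closed)
  have "(\<Oplus>\<^bsub>P\<^esub>i\<in>{..deg R f}. monom P (coeff P f i) i) \<in> J"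
    by (rule P.ideal_finsum[OF J]) (use m in auto)
  then show "f \<in> J" using up_repr[of f] f by (simp add: extend_def)
qed

text \<open>As for Gauss's lemma: among the products contributing to the coefficient of degree \<open>i + j\<close>,
  where \<open>i\<close> and \<open>j\<close> are the lowest degrees of coefficients outside \<open>Q\<close>, only one is outside \<open>Q\<close>.\<close>

lemma extend_prime:
  assumes Q: "primeideal Q R"
  shows "primeideal (extend Q) P"
proof (rule primeidealI)
  interpret Q: primeideal Q R by fact
  have prod_coeff: "coeff P (f \<otimes>\<^bsub>P\<^esub> g) n \<in> Q" if "f \<in> carrier P" "g \<in> carrier P" "\<forall>i. coeff P f i \<in> Q" for f g n
    unfolding coeff_mult[OF that(1,2)]
    by (rule R.ideal_finsum[OF Q.is_ideal]) (use that in \<open>auto intro!: Q.I_r_closed\<close>)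
  show "ideal (extend Q) P"
  proof (rule idealI[OF P.ring_axioms])
    show "subgroup (extend Q) (add_monoid P)"
    proof
      show "inv\<^bsub>add_monoid P\<^esub> x \<in> extend Q" if "x \<in> extend Q" for x
        using that by (auto simp: extend_def a_inv_def[symmetric])
    qed (auto simp: extend_def)
    fix f g assume f: "f \<in> extend Q" and g: "g \<in> carrier P"
    then show "f \<otimes>\<^bsub>P\<^esub> g \<in> extend Q" using prod_coeff[of f g] by (auto simp: extend_def)
    then show "g \<otimes>\<^bsub>P\<^esub> f \<in> extend Q" using P.m_comm[of f g] f g by (simp add: extend_def)
  qed
  have "coeff P \<one>\<^bsub>P\<^esub> 0 \<notin> Q" using R.primeideal_one_notin[OF Q] by simp
  then have "\<one>\<^bsub>P\<^esub> \<notin> extend Q" unfolding extend_def by blast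
  then show "carrier P \<noteq> extend Q" by auto
  show "cring P" by (rule UP_cring)
  fix f g assume fg: "f \<in> carrier P" "g \<in> carrier P" "f \<otimes>\<^bsub>P\<^esub> g \<in> extend Q"
  show "f \<in> extend Q \<or> g \<in> extend Q"
  proof (rule ccontr)
    assume "\<not> ?thesis"
    then have ex: "\<exists>i. coeff P f i \<notin> Q" "\<exists>j. coeff P g j \<notin> Q" using fg by (auto simp: extend_def)
    define i where "i = (LEAST i. coeff P f i \<notin> Q)"
    define j where "j = (LEAST j. coeff P g j \<notin> Q)"
    have i: "coeff P f i \<notin> Q" "\<And>l. l < i \<Longrightarrow> coeff P f l \<in> Q"
      unfolding i_def using LeastI_ex[OF ex(1)] not_less_Least by blast+
    have j: "coeff P g j \<notin> Q" "\<And>l. l < j \<Longrightarrow> coeff P g l \<in> Q"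
      unfolding j_def using LeastI_ex[OF ex(2)] not_less_Least by blast+
    let ?t = "\<lambda>l. coeff P f l \<otimes>\<^bsub>R\<^esub> coeff P g (i + j - l)"
    have "coeff P (f \<otimes>\<^bsub>P\<^esub> g) (i + j) = finsum R ?t (insert i ({..i + j} - {i}))"
      unfolding coeff_mult[OF fg(1,2)] by (rule arg_cong[of _ _ "finsum R ?t"]) auto
    also have "\<dots> = ?t i \<oplus>\<^bsub>R\<^esub> finsum R ?t ({..i + j} - {i})"
      by (rule R.finsum_insert) (use fg in auto)
    finally have eqn: "coeff P (f \<otimes>\<^bsub>P\<^esub> g) (i + j) = ?t i \<oplus>\<^bsub>R\<^esub> finsum R ?t ({..i + j} - {i})" .
    have "coeff P (f \<otimes>\<^bsub>P\<^esub> g) (i + j) \<in> Q" using fg(3) unfolding extend_def by blast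
    then have "?t i \<oplus>\<^bsub>R\<^esub> finsum R ?t ({..i + j} - {i}) \<in> Q" unfolding eqn .
    moreover have "finsum R ?t ({..i + j} - {i}) \<in> Q"
    proof (rule R.ideal_finsum[OF Q.is_ideal])
      fix l assume l: "l \<in> {..i + j} - {i}"
      show "?t l \<in> Q"
      proof (cases "l < i")
        case True then show ?thesis using i(2) fg by (intro Q.I_r_closed) auto
      next
        case False
        then have "i + j - l < j" using l by auto
        then show ?thesis using j(2) fg by (intro Q.I_l_closed) auto
      qed
    qed simp
    moreover have "?t i \<in> carrier R" using fg by simp
    ultimately have "?t i \<in> Q" using R.ideal_cancel[OF Q.is_ideal] by blast
    then have "coeff P f i \<otimes>\<^bsub>R\<^esub> coeff P g j \<in> Q" by simp
    then show False using Q.I_prime[OF coeff_closed[OF fg(1)] coeff_closed[OF fg(2)]] i(1) j(1) by blast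
  qed
qed

lemma extend_strict:
  assumes "Q \<subset> Q'" "primeideal Q R" "primeideal Q' R"
  shows "extend Q \<subset> extend Q'"
proof -
  obtain a where a: "a \<in> Q'" "a \<notin> Q" using assms by auto
  interpret Q': primeideal Q' R by fact
  have ac: "a \<in> carrier R" using a by auto
  have "monom P a 0 \<in> extend Q'" using a ac by (auto simp: extend_def)
  moreover have "coeff P (monom P a 0) 0 \<notin> Q" using a ac by simp
  then have "monom P a 0 \<notin> extend Q" unfolding extend_def by blast
  ultimately show ?thesis using assms by (auto simp: extend_def)
qed

lemma const_hom: "ring_hom_ring R P (\<lambda>a. monom P a 0)"
  by (rule ring_hom_ringI2[OF R.ring_axioms P.ring_axioms const_ring_hom])

text \<open>Over \<open>q\<close>, the contraction of \<open>p\<close>, the prime \<open>p\<close> corresponds to a prime of the principal ideal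
  domain \<open>\<kappa>(q)[T]\<close>. A generator is an element \<open>f\<close> of \<open>p\<close> of least degree outside \<open>q R[T]\<close>: its
  leading coefficient is not in \<open>q\<close>, and after multiplication by a power of that coefficient every
  element of \<open>p\<close> can be divided by \<open>f\<close>, with a remainder of smaller degree, which lies in
  \<open>q R[T]\<close>.\<close>

lemma prime_over_contraction:
  assumes p: "primeideal p P" and ne: "extend {a \<in> carrier R. monom P a 0 \<in> p} \<noteq> p"
  shows "\<exists>f\<in>p. f \<in> carrier P \<and> (\<forall>g\<in>p. \<exists>c\<in>carrier R. monom P c 0 \<notin> p \<and>
    (\<exists>h\<in>carrier P. \<exists>r\<in>extend {a \<in> carrier R. monom P a 0 \<in> p}. monom P c 0 \<otimes>\<^bsub>P\<^esub> g = f \<otimes>\<^bsub>P\<^esub> h \<oplus>\<^bsub>P\<^esub> r))"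
proof -
  interpret p: primeideal p P by fact
  define q where "q = {a \<in> carrier R. monom P a 0 \<in> p}"
  have q: "primeideal q R" unfolding q_def
    by (rule ring_hom_ring.primeideal_preimage[OF const_hom R.is_cring p])
  interpret q: primeideal q R by fact
  interpret E: primeideal "extend q" P by (rule extend_prime[OF q])
  have eq: "extend q \<subseteq> p" by (rule extend_sub_ideal[OF p.is_ideal]) (unfold q_def, blast+)
  then obtain f0 where f0: "f0 \<in> p" "f0 \<notin> extend q" using ne[folded q_def] by blast
  define n where "n = (LEAST n. \<exists>f. f \<in> p - extend q \<and> degle f n)"
  have "\<exists>f. f \<in> p - extend q \<and> degle f (deg R f0)" using f0 degle_deg[of f0] by auto
  then have "\<exists>n f. f \<in> p - extend q \<and> degle f n" by blast
  then have "\<exists>f. f \<in> p - extend q \<and> degle f n" unfolding n_def by (rule LeastI_ex)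
  then obtain f where f: "f \<in> p" "f \<notin> extend q" "degle f n" by auto
  have least: "g \<in> extend q" if "g \<in> p" "degle g m" "m < n" for g m
    using not_less_Least[of m "\<lambda>n. \<exists>f. f \<in> p - extend q \<and> degle f n"] that unfolding n_def by auto
  have fc: "f \<in> carrier P" using f by auto
  have lc: "coeff P f n \<notin> q"
  proof
    assume l: "coeff P f n \<in> q"
    let ?m = "monom P (coeff P f n) n"
    have "coeff P ?m i \<in> q" for i using l coeff_closed[OF fc, of n] by (cases "i = n") simp_all
    then have mq: "?m \<in> extend q" using fc unfolding extend_def by simp
    have "f \<ominus>\<^bsub>P\<^esub> ?m \<in> p" using f mq eq P.ideal_diff[OF p.is_ideal] by auto
    moreover have z: "coeff P (f \<ominus>\<^bsub>P\<^esub> ?m) k = \<zero>\<^bsub>R\<^esub>" if "k \<ge> n" for k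
      using f(3) fc that by (cases "k = n") (auto simp: degle_def R.minus_eq R.r_neg)
    ultimately have "f \<ominus>\<^bsub>P\<^esub> ?m \<in> extend q"
    proof (cases n)
      case 0
      have "f \<ominus>\<^bsub>P\<^esub> ?m = \<zero>\<^bsub>P\<^esub>"
      proof (rule up_eqI)
        show "coeff P (f \<ominus>\<^bsub>P\<^esub> ?m) k = coeff P \<zero>\<^bsub>P\<^esub> k" for k using z[of k] 0 by (simp del: coeff_minus)
      qed (use fc in auto)
      then show ?thesis by simp
    next
      case (Suc n')
      have "degle (f \<ominus>\<^bsub>P\<^esub> ?m) n'"
        unfolding degle_def using fc z Suc by (simp del: coeff_minus add: Suc_le_eq)
      then show ?thesis using least[of "f \<ominus>\<^bsub>P\<^esub> ?m" n'] Suc \<open>f \<ominus>\<^bsub>P\<^esub> ?m \<in> p\<close> by simp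
    qed
    then have "(f \<ominus>\<^bsub>P\<^esub> ?m) \<oplus>\<^bsub>P\<^esub> ?m \<in> extend q"
      using mq by simp
    moreover have "(f \<ominus>\<^bsub>P\<^esub> ?m) \<oplus>\<^bsub>P\<^esub> ?m = f" using fc by (simp add: P.minus_eq P.a_assoc P.l_neg)
    ultimately show False using f by simp
  qed
  have nz: "coeff P f n \<noteq> \<zero>\<^bsub>R\<^esub>" using lc q.zero_closed by auto
  have dn: "deg R f = n"
  proof (rule antisym)
    show "deg R f \<le> n" using f(3) fc by (intro deg_aboveI) (auto simp: degle_def)
    show "n \<le> deg R f" using nz fc by (intro deg_belowI)
  qed
  have fnz: "f \<noteq> \<zero>\<^bsub>P\<^esub>" using nz by auto
  show ?thesis unfolding q_def[symmetric]
  proof (intro bexI[of _ f] conjI ballI)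
    fix g assume g: "g \<in> p"
    then have gc: "g \<in> carrier P" by auto
    obtain h r k where d: "h \<in> carrier P" "r \<in> carrier P"
      "(coeff P f n [^]\<^bsub>R\<^esub> (k::nat)) \<odot>\<^bsub>P\<^esub> g = f \<otimes>\<^bsub>P\<^esub> h \<oplus>\<^bsub>P\<^esub> r" "r = \<zero>\<^bsub>P\<^esub> \<or> deg R r < n"
      using long_div_theorem[OF fc gc fnz] dn by auto
    let ?c = "coeff P f n [^]\<^bsub>R\<^esub> k"
    have cc: "?c \<in> carrier R" using fc by simp
    have eqn: "monom P ?c 0 \<otimes>\<^bsub>P\<^esub> g = f \<otimes>\<^bsub>P\<^esub> h \<oplus>\<^bsub>P\<^esub> r"
      using d(3) monom_mult_is_smult[OF cc gc] by simp
    have cq: "?c \<notin> q"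
    proof (induction k)
      case 0 then show ?case using R.primeideal_one_notin[OF q] by simp
    next
      case (Suc k) then show ?case using q.I_prime[of "coeff P f n [^]\<^bsub>R\<^esub> k" "coeff P f n"] lc fc by auto
    qed
    have "f \<otimes>\<^bsub>P\<^esub> h \<oplus>\<^bsub>P\<^esub> r \<in> p" unfolding eqn[symmetric] using g cc by (intro p.I_l_closed) auto
    then have "r \<in> p" using P.ideal_cancel[OF p.is_ideal, of r "f \<otimes>\<^bsub>P\<^esub> h"] p.I_r_closed[OF f(1) d(1)] d fc
      by (simp add: P.a_comm)
    then have rq: "r \<in> extend q"
      using d(4) least[of r "deg R r"] degle_deg[OF d(2)] by auto
    have "monom P ?c 0 \<notin> p" using cq cc unfolding q_def by blast
    then show "\<exists>c\<in>carrier R. monom P c 0 \<notin> p \<and> (\<exists>h\<in>carrier P. \<exists>r\<in>extend q.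
        monom P c 0 \<otimes>\<^bsub>P\<^esub> g = f \<otimes>\<^bsub>P\<^esub> h \<oplus>\<^bsub>P\<^esub> r)"
      using cc eqn rq d(1) by blast
  qed (use f fc in auto)
qed

text \<open>Let \<open>q\<close> be the contraction of \<open>p\<close>. Local generators of \<open>q\<close> and a chain below \<open>q\<close> extend to
  \<open>R[T]\<close>. Either \<open>p = q R[T]\<close>, or \<open>p\<close> needs the one further generator \<open>f\<close> and is one further prime
  on top of the chain.\<close>

lemma UP_regular_at:
  assumes reg: "\<And>q. primeideal q R \<Longrightarrow> regular_at R q" and p: "primeideal p P"
  shows "regular_at P p"
proof -
  interpret p: primeideal p P by fact
  define q where "q = {a \<in> carrier R. monom P a 0 \<in> p}"
  have q: "primeideal q R" unfolding q_def
    by (rule ring_hom_ring.primeideal_preimage[OF const_hom R.is_cring p])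
  interpret q: primeideal q R by fact
  interpret E: primeideal "extend q" P by (rule extend_prime[OF q])
  have eq: "extend q \<subseteq> p" by (rule extend_sub_ideal[OF p.is_ideal]) (unfold q_def, blast+)
  obtain ws Q where ws: "set ws \<subseteq> q" "prime_chain R Q (length ws)" "Q (length ws) = q"
    and "\<forall>g\<in>q. \<exists>s\<in>carrier R - q. s \<otimes>\<^bsub>R\<^esub> g \<in> Idl\<^bsub>R\<^esub> (set ws)"
    using reg[OF q] unfolding regular_at_def by blast
  note ws = ws this(4)[rule_format]
  define ws' where "ws' = map (\<lambda>w. monom P w 0) ws"
  have wsc: "set ws \<subseteq> carrier R" using ws(1) by auto
  have "monom P w 0 \<in> p" if "w \<in> set ws" for w using ws(1) that unfolding q_def by blast
  then have ws'p: "set ws' \<subseteq> p" by (auto simp: ws'_def)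
  have ws'c: "set ws' \<subseteq> carrier P" using ws'p by auto
  define S where "S = carrier P - p"
  have Sm: "P.submonoid_set S" unfolding S_def by (rule P.submonoid_prime[OF p])
  have sat: "extend q \<subseteq> P.saturation S (Idl\<^bsub>P\<^esub> A)" if A: "set ws' \<subseteq> A" "A \<subseteq> carrier P" for A
  proof (rule extend_sub_ideal)
    show "ideal (P.saturation S (Idl\<^bsub>P\<^esub> A)) P" by (rule P.saturation_ideal[OF Sm P.genideal_ideal[OF A(2)]])
    fix a assume a: "a \<in> q"
    obtain s where s: "s \<in> carrier R - q" "s \<otimes>\<^bsub>R\<^esub> a \<in> Idl\<^bsub>R\<^esub> (set ws)" using ws(4)[OF a] by auto
    have "monom P (s \<otimes>\<^bsub>R\<^esub> a) 0 \<in> Idl\<^bsub>P\<^esub> ((\<lambda>w. monom P w 0) ` set ws)"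
      by (rule ring_hom_ring.hom_genideal[OF const_hom wsc s(2)])
    then have "monom P (s \<otimes>\<^bsub>R\<^esub> a) 0 \<in> Idl\<^bsub>P\<^esub> A"
      using P.genideal_mono[OF A(2), of "set ws'"] A(1) by (auto simp: ws'_def)
    then have "monom P s 0 \<otimes>\<^bsub>P\<^esub> monom P a 0 \<in> Idl\<^bsub>P\<^esub> A" using s a monom_mult[of s a 0 0] by simp
    moreover have "monom P s 0 \<notin> p" using s(1) unfolding q_def by blast
    then have "monom P s 0 \<in> S" using s(1) by (simp add: S_def)
    ultimately show "monom P a 0 \<in> P.saturation S (Idl\<^bsub>P\<^esub> A)"
      using a unfolding P.saturation_def by auto
  qed auto
  have ch: "prime_chain P (\<lambda>i. extend (Q i)) (length ws)"
    using ws(2) extend_prime extend_strict unfolding prime_chain_def by auto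
  show ?thesis
  proof (cases "extend q = p")
    case True
    show ?thesis unfolding regular_at_def
    proof (intro exI conjI ballI)
      show "set ws' \<subseteq> p" by (rule ws'p)
      show "prime_chain P (\<lambda>i. extend (Q i)) (length ws')" using ch by (simp add: ws'_def)
      show "extend (Q (length ws')) = p" using True ws(3) by (simp add: ws'_def)
      show "\<exists>s\<in>carrier P - p. s \<otimes>\<^bsub>P\<^esub> g \<in> Idl\<^bsub>P\<^esub> (set ws')" if "g \<in> p" for g
        using sat[OF order_refl ws'c] that True by (auto simp: P.saturation_def S_def)
    qed
  next
    case False
    obtain f where f: "f \<in> p" "f \<in> carrier P" and div: "\<And>g. g \<in> p \<Longrightarrow> \<exists>c\<in>carrier R. monom P c 0 \<notin> p \<and>
      (\<exists>h\<in>carrier P. \<exists>r\<in>extend q. monom P c 0 \<otimes>\<^bsub>P\<^esub> g = f \<otimes>\<^bsub>P\<^esub> h \<oplus>\<^bsub>P\<^esub> r)"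
      using prime_over_contraction[OF p] False unfolding q_def by meson
    let ?A = "set (ws' @ [f])"
    have Ac: "?A \<subseteq> carrier P" using ws'c f by auto
    show ?thesis unfolding regular_at_def
    proof (intro exI conjI ballI)
      show "set (ws' @ [f]) \<subseteq> p" using ws'p f by auto
      have "extend (Q (length ws)) \<subset> p" using False eq ws(3) by auto
      then show "prime_chain P (\<lambda>i. if i \<le> length ws then extend (Q i) else p) (length (ws' @ [f]))"
        using ch p unfolding prime_chain_def ws'_def by (auto simp: less_Suc_eq le_Suc_eq)
      show "(if length (ws' @ [f]) \<le> length ws then extend (Q (length (ws' @ [f]))) else p) = p"
        by (simp add: ws'_def)
      fix g assume g: "g \<in> p"
      obtain c h r where c: "c \<in> carrier R" "monom P c 0 \<notin> p" "h \<in> carrier P" "r \<in> extend q"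
        "monom P c 0 \<otimes>\<^bsub>P\<^esub> g = f \<otimes>\<^bsub>P\<^esub> h \<oplus>\<^bsub>P\<^esub> r" using div[OF g] by blast
      let ?T = "P.saturation S (Idl\<^bsub>P\<^esub> ?A)"
      interpret T: ideal ?T P by (rule P.saturation_ideal[OF Sm P.genideal_ideal[OF Ac]])
      have "f \<in> ?T" using P.saturation_sub[OF Sm P.genideal_ideal[OF Ac]] P.genideal_self[OF Ac] by auto
      moreover have "r \<in> ?T" using sat[OF _ Ac] c(4) by auto
      ultimately have "monom P c 0 \<otimes>\<^bsub>P\<^esub> g \<in> ?T" unfolding c(5)
        using T.a_closed[OF T.I_r_closed[OF _ c(3)]] by blast
      moreover have "monom P c 0 \<in> S" using c by (simp add: S_def)
      moreover have "g \<in> carrier P" using g by auto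
      ultimately have "g \<in> ?T" using P.saturation_idem[OF Sm] by blast
      then show "\<exists>s\<in>carrier P - p. s \<otimes>\<^bsub>P\<^esub> g \<in> Idl\<^bsub>P\<^esub> ?A"
        unfolding P.saturation_def S_def by blast
    qed
  qed
qed

end

lemma UP_regular_noetherian:
  assumes "regular_noetherian R" shows "regular_noetherian (UP R)"
proof -
  interpret R: cring R using assms by (simp add: regular_noetherian_def)
  interpret U: UP_cring R "UP R" by unfold_locales
  show ?thesis
    using U.hilbert_basis U.UP_regular_at U.UP_cring assms unfolding regular_noetherian_def by blast
qed

theorem mpoly_regular_noetherian:
  assumes "field k" shows "regular_noetherian (mpoly_ring k n)"
proof (induction n)
  case 0
  interpret field k by fact
  interpret M: cring "mpoly_ring k 0" by (rule mpoly_cring)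
  have c: "p = mpoly_const k (p {#})" if "p \<in> carrier (mpoly_ring k 0)" for p
  proof
    fix m show "p m = mpoly_const k (p {#}) m"
      using that unfolding mpoly_carrier by (cases "m = {#}") (auto simp: mpoly_const_def)
  qed
  have "(\<lambda>p. p {#}) \<in> ring_iso (mpoly_ring k 0) k"
  proof (rule ring_iso_memI)
    show "(p \<otimes>\<^bsub>mpoly_ring k 0\<^esub> q) {#} = p {#} \<otimes>\<^bsub>k\<^esub> q {#}"
      if "p \<in> carrier (mpoly_ring k 0)" "q \<in> carrier (mpoly_ring k 0)" for p q
    proof -
      have "(p \<otimes>\<^bsub>mpoly_ring k 0\<^esub> q) {#} = (mpoly_const k (p {#}) \<otimes>\<^bsub>mpoly_ring k 0\<^esub> mpoly_const k (q {#})) {#}"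
        using c[OF that(1)] c[OF that(2)] by simp
      also have "\<dots> = p {#} \<otimes>\<^bsub>k\<^esub> q {#}" using mpoly_coeff_closed that
        by (simp add: mpoly_const_mterm mterm_mult) (simp add: mterm_def)
      finally show ?thesis .
    qed
    show "bij_betw (\<lambda>p. p {#}) (carrier (mpoly_ring k 0)) (carrier k)"
    proof (rule bij_betw_imageI)
      show "inj_on (\<lambda>p. p {#}) (carrier (mpoly_ring k 0))"
      proof (rule inj_onI)
        fix p q assume pq: "p \<in> carrier (mpoly_ring k 0)" "q \<in> carrier (mpoly_ring k 0)" "p {#} = q {#}"
        show "p = q" by (rule trans[OF c[OF pq(1)]], subst pq(3), rule c[OF pq(2), symmetric])
      qed
      have "a \<in> (\<lambda>p. p {#}) ` carrier (mpoly_ring k 0)" if "a \<in> carrier k" for a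
        using that by (intro image_eqI[of _ _ "mpoly_const k a"]) (auto simp: mpoly_const_mterm, simp add: mterm_def)
      then show "(\<lambda>p. p {#}) ` carrier (mpoly_ring k 0) = carrier k" using mpoly_coeff_closed by auto
    qed
  qed (auto simp: mpoly_coeff_closed mpoly_simps mterm_def)
  then show ?case by (rule regular_noetherian_iso[OF _ M.is_cring field_regular_noetherian[OF assms]])
next
  case (Suc n)
  interpret field k by fact
  show ?case by (rule regular_noetherian_iso[OF mpoly_split_iso mpoly_cring UP_regular_noetherian[OF Suc]])
qed

section \<open>Ideals of linear type\<close>

definition form :: "('a, 'm) ring_scheme \<Rightarrow> nat \<Rightarrow> nat \<Rightarrow> (nat multiset \<Rightarrow> 'a) set" where
  "form R k n = {F \<in> carrier (mpoly_ring R k). \<forall>m. F m \<noteq> \<zero>\<^bsub>R\<^esub> \<longrightarrow> size m = n}"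

definition hom_part :: "('a, 'm) ring_scheme \<Rightarrow> nat \<Rightarrow> (nat multiset \<Rightarrow> 'a) \<Rightarrow> nat multiset \<Rightarrow> 'a" where
  "hom_part R n F = (\<lambda>m. if size m = n then F m else \<zero>\<^bsub>R\<^esub>)"

context cring begin

lemma form_carrier: "F \<in> form R k n \<Longrightarrow> F \<in> carrier (mpoly_ring R k)"
  by (simp add: form_def)

lemma form_mterm: "c \<in> carrier R \<Longrightarrow> set_mset m \<subseteq> {..<k} \<Longrightarrow> mterm R c m \<in> form R k (size m)"
  by (simp add: form_def) (simp add: mterm_def)

lemma form_zero: "\<zero>\<^bsub>mpoly_ring R k\<^esub> \<in> form R k n"
  using abelian_monoid.zero_closed[OF abelian_group.axioms(1)[OF mpoly_abelian_group]]
  by (simp add: form_def) (simp add: mpoly_simps)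

lemma form_add:
  assumes "F \<in> form R k n" "G \<in> form R k n"
  shows "F \<oplus>\<^bsub>mpoly_ring R k\<^esub> G \<in> form R k n"
proof -
  have "size m = n" if "F m \<oplus> G m \<noteq> \<zero>" for m
    using that assms mpoly_coeff_closed[of G k m] by (cases "F m = \<zero>") (auto simp: form_def)
  then show ?thesis using mpoly_add_closed[of F k G] assms by (simp add: form_def mpoly_simps)
qed

lemma form_mult:
  assumes "F \<in> form R k n" "G \<in> form R k n'"
  shows "F \<otimes>\<^bsub>mpoly_ring R k\<^esub> G \<in> form R k (n + n')"
proof -
  have "(F \<otimes>\<^bsub>mpoly_ring R k\<^esub> G) m = \<zero>" if "size m \<noteq> n + n'" for m
    unfolding mpoly_mult_coeff
  proof (rule add.finprod_one_eqI)
    fix x assume "x \<in> {(a, b). a + b = m}"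
    then obtain a b where x: "x = (a, b)" "a + b = m" by auto
    then have "size a \<noteq> n \<or> size b \<noteq> n'" using that by auto
    then have "F a = \<zero> \<or> G b = \<zero>" using assms by (auto simp: form_def)
    moreover have "F a \<in> carrier R" "G b \<in> carrier R" using assms mpoly_coeff_closed by (auto simp: form_def)
    ultimately show "(case x of (a, b) \<Rightarrow> F a \<otimes> G b) = \<zero>" using x by auto
  qed
  then show ?thesis using mpoly_mult_closed[of F k G] assms by (auto simp: form_def)
qed

lemma form_uminus:
  assumes "F \<in> form R k n" shows "\<ominus>\<^bsub>mpoly_ring R k\<^esub> F \<in> form R k n"
proof -
  interpret M: cring "mpoly_ring R k" by (rule mpoly_cring)
  have F: "F \<in> carrier (mpoly_ring R k)" using assms by (simp add: form_def)
  have "(\<ominus>\<^bsub>mpoly_ring R k\<^esub> F) m = \<ominus> F m" for m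
  proof -
    have "(F \<oplus>\<^bsub>mpoly_ring R k\<^esub> (\<ominus>\<^bsub>mpoly_ring R k\<^esub> F)) m = \<zero>" using M.r_neg[OF F] by (simp add: mpoly_simps)
    then have "F m \<oplus> (\<ominus>\<^bsub>mpoly_ring R k\<^esub> F) m = \<zero>" by (simp add: mpoly_simps)
    then show ?thesis using mpoly_coeff_closed[OF F] mpoly_coeff_closed[OF M.a_inv_closed[OF F]]
      by (metis minus_equality a_comm)
  qed
  moreover have "\<ominus> F m = \<zero> \<longleftrightarrow> F m = \<zero>" for m using mpoly_coeff_closed[OF F] by auto
  ultimately show ?thesis using assms F by (simp add: form_def)
qed

lemma form_minus:
  "F \<in> form R k n \<Longrightarrow> G \<in> form R k n \<Longrightarrow> F \<ominus>\<^bsub>mpoly_ring R k\<^esub> G \<in> form R k n"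
  unfolding a_minus_def by (rule form_add[OF _ form_uminus])

lemma hom_part_form: 
  assumes "F \<in> carrier (mpoly_ring R k)" shows "hom_part R n F \<in> form R k n"
proof -
  have "finite {m. hom_part R n F m \<noteq> \<zero>}"
    by (rule finite_subset[of _ "{m. F m \<noteq> \<zero>}"]) (use assms in \<open>auto simp: hom_part_def mpoly_carrier\<close>)
  then show ?thesis using assms by (auto simp: form_def mpoly_carrier hom_part_def)
qed

lemma hom_part_of_form: "F \<in> form R k n \<Longrightarrow> hom_part R n' F = (if n' = n then F else \<zero>\<^bsub>mpoly_ring R k\<^esub>)"
  by (force simp: form_def hom_part_def mpoly_simps fun_eq_iff)

lemma hom_part_add:
  "hom_part R n (F \<oplus>\<^bsub>mpoly_ring R k\<^esub> G) = hom_part R n F \<oplus>\<^bsub>mpoly_ring R k\<^esub> hom_part R n G"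
  by (auto simp: hom_part_def mpoly_simps fun_eq_iff)

lemma hom_parts_in_ideal:
  assumes J: "ideal J (mpoly_ring R k)" and F: "F \<in> carrier (mpoly_ring R k)"
    and parts: "\<And>n. hom_part R n F \<in> J"
  shows "F \<in> J"
proof -
  interpret J: ideal J "mpoly_ring R k" by fact
  have "G \<in> J" if "G \<in> carrier (mpoly_ring R k)" "\<And>n. hom_part R n G \<in> J" "\<And>m. G m \<noteq> \<zero> \<Longrightarrow> size m < N" for G N
    using that
  proof (induction N arbitrary: G)
    case 0
    then have "G = \<zero>\<^bsub>mpoly_ring R k\<^esub>" by (auto simp: mpoly_simps)
    then show ?case by simp
  next
    case (Suc N)
    define G' where "G' m = (if size m = N then \<zero> else G m)" for m
    have "finite {m. G' m \<noteq> \<zero>}"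
      by (rule finite_subset[of _ "{m. G m \<noteq> \<zero>}"]) (use Suc.prems(1) in \<open>auto simp: G'_def mpoly_carrier\<close>)
    then have G'c: "G' \<in> carrier (mpoly_ring R k)" using Suc.prems(1) by (auto simp: mpoly_carrier G'_def)
    have "hom_part R n G' = (if n = N then \<zero>\<^bsub>mpoly_ring R k\<^esub> else hom_part R n G)" for n
      by (auto simp: hom_part_def G'_def mpoly_simps fun_eq_iff)
    then have "hom_part R n G' \<in> J" for n using Suc.prems(2)[of n] by simp
    moreover have "size m < N" if "G' m \<noteq> \<zero>" for m
      using that Suc.prems(3)[of m] by (auto simp: G'_def less_Suc_eq split: if_splits)
    ultimately have "G' \<in> J" by (rule Suc.IH[OF G'c])
    then have "G' \<oplus>\<^bsub>mpoly_ring R k\<^esub> hom_part R N G \<in> J" using Suc.prems(2)[of N] by (rule additive_subgroup.a_closed[OF ideal.axioms(1)[OF J]])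
    moreover have "G = G' \<oplus>\<^bsub>mpoly_ring R k\<^esub> hom_part R N G"
      using mpoly_coeff_closed[OF Suc.prems(1)] by (auto simp: mpoly_simps G'_def hom_part_def fun_eq_iff)
    ultimately show ?case by simp
  qed
  moreover have "size m < Suc (Max (size ` {m. F m \<noteq> \<zero>}))" if "F m \<noteq> \<zero>" for m
    using F that by (auto simp: mpoly_carrier less_Suc_eq_le intro!: Max_ge)
  ultimately show ?thesis using F parts by blast
qed

end

subsection \<open>Relations among generators\<close>

text \<open>Here \<open>zs\<close> is a regular sequence in the sense of the colon condition, and \<open>as\<close> is any family of
  generators of the same ideal; the relation type refers to an unspecified one. The evaluation
  sends the variables to the elements of \<open>as\<close>.\<close>

locale linear_relations = mpoly_evaluation R R "\<lambda>x. x" as for R (structure) and as +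
  fixes zs :: "'a list"
  assumes zs_carrier: "set zs \<subseteq> carrier R"
    and prefix_colon: "\<And>i x. i < length zs \<Longrightarrow> x \<in> carrier R \<Longrightarrow> zs ! i \<otimes> x \<in> Idl (set (take i zs)) \<Longrightarrow>
      x \<in> Idl (set (take i zs))"
    and lift: "\<And>u. u \<in> Idl (set zs) \<Longrightarrow> \<exists>X\<in>form R (length as) 1. ev X = u"
    and as_in: "set as \<subseteq> Idl (set zs)"
begin

text \<open>The ideal generated by the linear relations among \<open>as\<close>.\<close>

definition L where "L = Idl\<^bsub>M\<^esub> {X \<in> form R (length as) 1. ev X = \<zero>}"

definition lin where "lin j = (SOME X. X \<in> form R (length as) 1 \<and> ev X = zs ! j)"

lemma lin: "j < length zs \<Longrightarrow> lin j \<in> form R (length as) 1 \<and> ev (lin j) = zs ! j"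
proof -
  assume "j < length zs"
  then obtain X where "X \<in> form R (length as) 1 \<and> ev X = zs ! j"
    using lift[of "zs ! j"] R.mem_genideal[OF zs_carrier, of "zs ! j"] nth_mem[of j zs] by blast
  then show ?thesis unfolding lin_def by (rule someI[of "\<lambda>X. X \<in> form R (length as) 1 \<and> ev X = zs ! j"])
qed

text \<open>The sums of an element of \<open>L\<close> and of multiples of \<open>lin 0, \<dots>, lin (j - 1)\<close> by forms of degree
  \<open>n\<close>: modulo \<open>L\<close>, the forms of degree \<open>n + 1\<close> whose value is visibly in the ideal of the first
  \<open>j\<close> elements of \<open>zs\<close>.\<close>

primrec W where
  "W 0 n = L"
| "W (Suc j) n = {w \<oplus>\<^bsub>M\<^esub> lin j \<otimes>\<^bsub>M\<^esub> G | w G. w \<in> W j n \<and> G \<in> form R (length as) n}"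

lemma L_ideal: "ideal L M"
  unfolding L_def by (rule M.genideal_ideal) (auto simp: form_def)

lemma lin_carrier: "j < length zs \<Longrightarrow> lin j \<in> carrier M"
  using lin R.form_carrier by blast

lemma W_carrier: "j \<le> length zs \<Longrightarrow> w \<in> W j n \<Longrightarrow> w \<in> carrier M"
proof (induction j arbitrary: w)
  case 0 then show ?case using M.ideal_subset[OF L_ideal] by auto
next
  case (Suc j) then show ?case using lin_carrier[of j] R.form_carrier by auto
qed

lemma W_zero: "j \<le> length zs \<Longrightarrow> \<zero>\<^bsub>M\<^esub> \<in> W j n"
proof (induction j)
  case 0 then show ?case using additive_subgroup.zero_closed[OF ideal.axioms(1)[OF L_ideal]] by simp
next
  case (Suc j)
  have "\<zero>\<^bsub>M\<^esub> = \<zero>\<^bsub>M\<^esub> \<oplus>\<^bsub>M\<^esub> lin j \<otimes>\<^bsub>M\<^esub> \<zero>\<^bsub>M\<^esub>" using lin_carrier[of j] Suc by simp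
  then show ?case using Suc R.form_zero by fastforce
qed

lemma W_add: "j \<le> length zs \<Longrightarrow> w \<in> W j n \<Longrightarrow> w' \<in> W j n \<Longrightarrow> w \<oplus>\<^bsub>M\<^esub> w' \<in> W j n"
proof (induction j arbitrary: w w')
  case 0 then show ?case using additive_subgroup.a_closed[OF ideal.axioms(1)[OF L_ideal]] by simp
next
  case (Suc j)
  then obtain v G v' G' where *: "v \<in> W j n" "G \<in> form R (length as) n" "w = v \<oplus>\<^bsub>M\<^esub> lin j \<otimes>\<^bsub>M\<^esub> G"
     "v' \<in> W j n" "G' \<in> form R (length as) n" "w' = v' \<oplus>\<^bsub>M\<^esub> lin j \<otimes>\<^bsub>M\<^esub> G'" by auto
  have c: "v \<in> carrier M" "v' \<in> carrier M" "G \<in> carrier M" "G' \<in> carrier M" "lin j \<in> carrier M"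
    using * W_carrier[of j] Suc.prems(1) lin_carrier[of j] R.form_carrier by auto
  have "w \<oplus>\<^bsub>M\<^esub> w' = (v \<oplus>\<^bsub>M\<^esub> v') \<oplus>\<^bsub>M\<^esub> lin j \<otimes>\<^bsub>M\<^esub> (G \<oplus>\<^bsub>M\<^esub> G')"
    unfolding *(3,6) using c by algebra
  moreover have "v \<oplus>\<^bsub>M\<^esub> v' \<in> W j n" using Suc * by simp
  moreover have "G \<oplus>\<^bsub>M\<^esub> G' \<in> form R (length as) n" using R.form_add * by blast
  ultimately show ?case by auto
qed

lemma W_mult: "j \<le> length zs \<Longrightarrow> w \<in> W j n \<Longrightarrow> X \<in> form R (length as) n' \<Longrightarrow> w \<otimes>\<^bsub>M\<^esub> X \<in> W j (n + n')"
proof (induction j arbitrary: w)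
  case 0 then show ?case using ideal.I_r_closed[OF L_ideal] R.form_carrier by simp
next
  case (Suc j)
  then obtain v G where *: "v \<in> W j n" "G \<in> form R (length as) n" "w = v \<oplus>\<^bsub>M\<^esub> lin j \<otimes>\<^bsub>M\<^esub> G" by auto
  have c: "v \<in> carrier M" "G \<in> carrier M" "lin j \<in> carrier M" "X \<in> carrier M"
    using * W_carrier[of j] Suc.prems lin_carrier[of j] R.form_carrier by auto
  have "w \<otimes>\<^bsub>M\<^esub> X = v \<otimes>\<^bsub>M\<^esub> X \<oplus>\<^bsub>M\<^esub> lin j \<otimes>\<^bsub>M\<^esub> (G \<otimes>\<^bsub>M\<^esub> X)" unfolding *(3) using c by algebra
  moreover have "v \<otimes>\<^bsub>M\<^esub> X \<in> W j (n + n')" using Suc * by simp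
  moreover have "G \<otimes>\<^bsub>M\<^esub> X \<in> form R (length as) (n + n')" using R.form_mult * Suc.prems by blast
  ultimately show ?case by auto
qed

lemma ev_minus: "p \<in> carrier M \<Longrightarrow> q \<in> carrier M \<Longrightarrow> ev (p \<ominus>\<^bsub>M\<^esub> q) = ev p \<ominus> ev q"
proof -
  assume a: "p \<in> carrier M" "q \<in> carrier M"
  interpret h: ring_hom_ring M R ev by (rule ev_hom_ring)
  show ?thesis using a by (simp add: M.minus_eq R.minus_eq ev_add h.hom_a_inv)
qed

lemma prefix_carrier: "set (take j zs) \<subseteq> carrier R"
  using zs_carrier set_take_subset by fast

lemma prefix_ideal: "ideal (Idl (set (take j zs))) R"
  by (rule R.genideal_ideal[OF prefix_carrier])

lemma prefix_Suc: "j < length zs \<Longrightarrow> set (take (Suc j) zs) = insert (zs ! j) (set (take j zs))"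
  by (simp add: take_Suc_conv_app_nth)

lemma ev_L: "w \<in> L \<Longrightarrow> ev w = \<zero>"
proof -
  interpret h: ring_hom_ring M R ev by (rule ev_hom_ring)
  have "ideal {p \<in> carrier M. ev p \<in> {\<zero>}} M" by (rule h.ideal_vimage[OF R.zeroideal])
  then have "L \<subseteq> {p \<in> carrier M. ev p \<in> {\<zero>}}" unfolding L_def
    by (rule M.genideal_minimal) (auto simp: form_def)
  then show "w \<in> L \<Longrightarrow> ev w = \<zero>" by auto
qed

lemma ev_W: "j \<le> length zs \<Longrightarrow> w \<in> W j n \<Longrightarrow> ev w \<in> Idl (set (take j zs))"
proof (induction j arbitrary: w)
  case 0
  then show ?case using ev_L additive_subgroup.zero_closed[OF ideal.axioms(1)[OF prefix_ideal[of 0]]] by simp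
next
  case (Suc j)
  then obtain v G where *: "v \<in> W j n" "G \<in> form R (length as) n" "w = v \<oplus>\<^bsub>M\<^esub> lin j \<otimes>\<^bsub>M\<^esub> G" by auto
  have c: "v \<in> carrier M" "G \<in> carrier M" "lin j \<in> carrier M"
    using * W_carrier[of j] Suc.prems lin_carrier[of j] R.form_carrier by auto
  interpret I: ideal "Idl (set (take (Suc j) zs))" R by (rule prefix_ideal)
  have "ev v \<in> Idl (set (take (Suc j) zs))"
    using Suc * R.genideal_mono[OF prefix_carrier[of "Suc j"], of "set (take j zs)"] prefix_Suc[of j] by auto
  moreover have "zs ! j \<in> Idl (set (take (Suc j) zs))"
    using R.mem_genideal[OF prefix_carrier[of "Suc j"]] prefix_Suc[of j] Suc.prems by auto
  ultimately show ?case using * c lin[of j] Suc.prems by (simp add: ev_add ev_mult I.I_r_closed)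
qed

lemma linear_in_W:
  "j \<le> length zs \<Longrightarrow> X \<in> form R (length as) 1 \<Longrightarrow> ev X \<in> Idl (set (take j zs)) \<Longrightarrow> X \<in> W j 0"
proof (induction j arbitrary: X)
  case 0
  have "Idl ({} :: 'a set) = {\<zero>}"
  proof
    show "Idl {} \<subseteq> {\<zero>}" by (rule R.genideal_minimal[OF R.zeroideal]) simp
    show "{\<zero>} \<subseteq> Idl {}" using additive_subgroup.zero_closed[OF ideal.axioms(1)[OF prefix_ideal[of 0]]] by simp
  qed
  then have "ev X = \<zero>" using 0 by simp
  then show ?case using 0 unfolding W.simps L_def by (intro M.mem_genideal) (auto simp: form_def)
next
  case (Suc j)
  then have j: "j < length zs" by simp
  then have zc: "zs ! j \<in> carrier R" using zs_carrier nth_mem by blast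
  have "ev X \<in> Idl (insert (zs ! j) (set (take j zs)))" using Suc.prems(3) prefix_Suc[OF j] by simp
  then obtain a c where a: "a \<in> Idl (set (take j zs))" "c \<in> carrier R" "ev X = a \<oplus> c \<otimes> zs ! j" "a \<in> carrier R"
    by (rule R.mem_genideal_insert[OF prefix_carrier zc]) auto
  define C where "C = mpoly_const R c"
  have C: "C \<in> form R (length as) 0" using R.form_mterm[of c "{#}"] a by (simp add: C_def mpoly_const_mterm)
  have evC: "ev C = c" using ev_const[OF a(2)] by (simp add: C_def)
  have c: "X \<in> carrier M" "C \<in> carrier M" "lin j \<in> carrier M" using Suc.prems C lin_carrier[OF j] R.form_carrier by auto
  define X' where "X' = X \<ominus>\<^bsub>M\<^esub> lin j \<otimes>\<^bsub>M\<^esub> C"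
  have "lin j \<otimes>\<^bsub>M\<^esub> C \<in> form R (length as) 1" using R.form_mult[of "lin j" "length as" 1 C 0] lin[OF j] C by simp
  then have "X' \<in> form R (length as) 1" unfolding X'_def using Suc.prems by (intro R.form_minus)
  moreover have "ev X' = a"
  proof -
    have "ev X' = (a \<oplus> c \<otimes> zs ! j) \<ominus> zs ! j \<otimes> c"
      unfolding X'_def using c lin[OF j] a evC by (simp add: ev_minus ev_mult)
    also have "\<dots> = a" using a(2,4) zc by algebra
    finally show ?thesis .
  qed
  ultimately have "X' \<in> W j 0" using Suc.IH[of X'] j a by simp
  moreover have "X = X' \<oplus>\<^bsub>M\<^esub> lin j \<otimes>\<^bsub>M\<^esub> C" unfolding X'_def using c by algebra
  ultimately show ?case using C by auto
qed

text \<open>Induction on the degree, and descending induction on \<open>j\<close>. For the full sequence \<open>zs\<close> every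
  variable belongs to \<open>W\<close> since all of \<open>as\<close> is in the ideal. If \<open>F = w + lin j G\<close> has its value in
  the ideal of the first \<open>j\<close> elements, then this ideal contains \<open>zs ! j\<close> times the value of \<open>G\<close>,
  and by the colon condition the value of \<open>G\<close>. As \<open>G\<close> has smaller degree, it can be rewritten
  without \<open>lin j\<close>. For \<open>j = 0\<close> this says that a relation of positive degree is a combination of
  linear ones.\<close>

lemma form_in_W:
  "j \<le> length zs \<Longrightarrow> F \<in> form R (length as) (Suc n) \<Longrightarrow> ev F \<in> Idl (set (take j zs)) \<Longrightarrow> F \<in> W j n"
proof (induction n arbitrary: j F)
  case 0 then show ?case using linear_in_W by simp
next
  case (Suc n)
  show ?case using Suc.prems
  proof (induction j arbitrary: F rule: inc_induct)
    case base
    have szF: "size m = Suc (Suc n)" if "F m \<noteq> \<zero>" for m using base that by (simp add: form_def)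
    have "F \<in> carrier M" using base R.form_carrier by blast
    then show ?case
    proof (induction F rule: R.mpoly_induct)
      case zero show ?case by (rule W_zero[OF order_refl])
    next
      case (add_term c m q)
      have sz: "size m = Suc (Suc n)" using szF[of m] add_term(2,6) by simp
      have qW: "q \<in> W (length zs) (Suc n)" by (rule add_term(7))
      obtain i m' where m: "m = add_mset i m'" using sz by (metis size_eq_Suc_imp_eq_union)
      have i: "i < length as" "set_mset m' \<subseteq> {..<length as}" using add_term m by auto
      have X: "mterm R \<one> {#i#} \<in> form R (length as) 1" using R.form_mterm[of \<one> "{#i#}" "length as"] i by simp
      have "as ! i \<in> carrier R" using i by simp
      then have "ev (mterm R \<one> {#i#}) = as ! i" using i by (simp add: ev_mterm mon_single)
      then have "ev (mterm R \<one> {#i#}) \<in> Idl (set (take (length zs) zs))" using as_in i by auto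
      then have "mterm R \<one> {#i#} \<in> W (length zs) 0" by (rule linear_in_W[OF order_refl X])
      moreover have "mterm R c m' \<in> form R (length as) (Suc n)"
        using R.form_mterm[of c m' "length as"] add_term(1) i sz m by simp
      ultimately have "mterm R \<one> {#i#} \<otimes>\<^bsub>M\<^esub> mterm R c m' \<in> W (length zs) (0 + Suc n)"
        by (rule W_mult[OF order_refl])
      then have "mterm R c m \<in> W (length zs) (Suc n)" using add_term(1) m by (simp add: R.mterm_mult)
      then show ?case using qW by (intro W_add) auto
    qed
  next
    case (step j)
    have j: "j < length zs" by fact
    have "Idl (set (take j zs)) \<subseteq> Idl (set (take (Suc j) zs))"
      using R.genideal_mono[OF prefix_carrier[of "Suc j"], of "set (take j zs)"] prefix_Suc[OF j] by auto
    then have "F \<in> W (Suc j) (Suc n)" using step by auto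
    then obtain w G where *: "w \<in> W j (Suc n)" "G \<in> form R (length as) (Suc n)" "F = w \<oplus>\<^bsub>M\<^esub> lin j \<otimes>\<^bsub>M\<^esub> G" by auto
    have c: "w \<in> carrier M" "G \<in> carrier M" "lin j \<in> carrier M"
      using * W_carrier[of j] j lin_carrier[of j] R.form_carrier by auto
    have "ev F = ev w \<oplus> zs ! j \<otimes> ev G" using * c lin[OF j] by (simp add: ev_add ev_mult)
    then have "zs ! j \<otimes> ev G \<oplus> ev w \<in> Idl (set (take j zs))"
      using step.prems(2) c j zs_carrier nth_mem by (metis R.a_comm R.m_closed ev_closed subsetD)
    moreover have "ev w \<in> Idl (set (take j zs))" using ev_W[of j w] * j by simp
    moreover have "zs ! j \<otimes> ev G \<in> carrier R" using zs_carrier nth_mem[OF j] c by auto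
    ultimately have "zs ! j \<otimes> ev G \<in> Idl (set (take j zs))" using R.ideal_cancel[OF prefix_ideal] by blast
    then have "ev G \<in> Idl (set (take j zs))" using prefix_colon[OF j, of "ev G"] c by simp
    then have "G \<in> W j n" using Suc.IH[of j G] * j by simp
    then have "G \<otimes>\<^bsub>M\<^esub> lin j \<in> W j (n + 1)" using W_mult[of j G n "lin j" 1] lin[OF j] j by simp
    then have "lin j \<otimes>\<^bsub>M\<^esub> G \<in> W j (Suc n)" using c by (simp add: M.m_comm)
    then show ?case unfolding *(3) using *(1) j by (intro W_add) auto
  qed
qed

theorem relation_in_L: "F \<in> form R (length as) (Suc n) \<Longrightarrow> ev F = \<zero> \<Longrightarrow> F \<in> L"
  using form_in_W[of 0 F n] additive_subgroup.zero_closed[OF ideal.axioms(1)[OF prefix_ideal[of 0]]] by simp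

end

subsection \<open>The Rees algebra\<close>

context cring begin

lemma ideal_pow_ideal: "ideal I R \<Longrightarrow> ideal (ideal_pow R I n) R"
  by (induction n) (auto simp: ideal_pow_def oneideal ideal_prod_is_ideal)

lemma ideal_pow_Suc: "ideal_pow R I (Suc n) = I \<cdot> ideal_pow R I n"
  by (simp add: ideal_pow_def)

lemma ideal_pow_1: "ideal I R \<Longrightarrow> ideal_pow R I 1 = I"
  using ideal_prod_one[of I] by (simp add: ideal_pow_def)

lemma ideal_pow_mult:
  assumes I: "ideal I R" and y: "y \<in> ideal_pow R I b"
  shows "x \<in> ideal_pow R I a \<Longrightarrow> x \<otimes> y \<in> ideal_pow R I (a + b)"
proof (induction a arbitrary: x)
  case 0
  then show ?case using ideal.I_l_closed[OF ideal_pow_ideal[OF I] y] by (simp add: ideal_pow_def)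
next
  case (Suc a)
  have yc: "y \<in> carrier R" using y ideal_subset[OF ideal_pow_ideal[OF I]] by auto
  have "x \<in> I \<cdot> ideal_pow R I a" using Suc.prems by (simp add: ideal_pow_Suc)
  then show ?case
  proof (induction x rule: ideal_prod.induct)
    case (prod i j)
    have c: "i \<in> carrier R" "j \<in> carrier R"
      using prod ideal_subset[OF I] ideal_subset[OF ideal_pow_ideal[OF I]] by auto
    have "i \<otimes> (j \<otimes> y) \<in> I \<cdot> ideal_pow R I (a + b)" using prod Suc.IH by (intro ideal_prod.prod)
    then show ?case using c yc by (simp add: ideal_pow_Suc m_assoc)
  next
    case (sum s1 s2)
    have "s1 \<in> carrier R" "s2 \<in> carrier R"
      using sum ideal_prod_in_carrier[OF I ideal_pow_ideal[OF I]] by auto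
    moreover have "s1 \<otimes> y \<oplus> s2 \<otimes> y \<in> ideal_pow R I (Suc a + b)"
      using sum additive_subgroup.a_closed[OF ideal.axioms(1)[OF ideal_pow_ideal[OF I]]] by blast
    ultimately show ?case using yc by (simp add: l_distr)
  qed
qed

lemma rees_cring:
  assumes I: "ideal I R" shows "cring (rees_algebra R I)"
proof -
  interpret U: UP_cring R "UP R" by unfold_locales
  let ?H = "{p \<in> up R. \<forall>n. p n \<in> ideal_pow R I n}"
  have cu: "carrier (UP R) = up R" by (simp add: UP_def)
  have H: "p \<in> ?H \<longleftrightarrow> p \<in> carrier (UP R) \<and> (\<forall>n. coeff (UP R) p n \<in> ideal_pow R I n)" for p
    by (auto simp: UP_def)
  have z: "\<zero> \<in> ideal_pow R I n" for n
    using additive_subgroup.zero_closed[OF ideal.axioms(1)[OF ideal_pow_ideal[OF I]]] .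
  have "subring ?H (UP R)"
  proof (rule ring.subringI[OF U.UP_ring])
    show "?H \<subseteq> carrier (UP R)" by (auto simp: cu)
    show "\<one>\<^bsub>UP R\<^esub> \<in> ?H" unfolding H using z by (auto simp: ideal_pow_def)
    show "\<ominus>\<^bsub>UP R\<^esub> h \<in> ?H" if "h \<in> ?H" for h
      using that additive_subgroup.a_inv_closed[OF ideal.axioms(1)[OF ideal_pow_ideal[OF I]]] unfolding H by auto
    show "h1 \<oplus>\<^bsub>UP R\<^esub> h2 \<in> ?H" if "h1 \<in> ?H" "h2 \<in> ?H" for h1 h2
      using that additive_subgroup.a_closed[OF ideal.axioms(1)[OF ideal_pow_ideal[OF I]]] unfolding H by auto
    show "h1 \<otimes>\<^bsub>UP R\<^esub> h2 \<in> ?H" if "h1 \<in> ?H" "h2 \<in> ?H" for h1 h2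
    proof -
      have "coeff (UP R) (h1 \<otimes>\<^bsub>UP R\<^esub> h2) n \<in> ideal_pow R I n" for n
      proof -
        have "(\<Oplus>i\<in>{..n}. coeff (UP R) h1 i \<otimes> coeff (UP R) h2 (n - i)) \<in> ideal_pow R I n"
        proof (rule ideal_finsum[OF ideal_pow_ideal[OF I]])
          fix i assume "i \<in> {..n}"
          then show "coeff (UP R) h1 i \<otimes> coeff (UP R) h2 (n - i) \<in> ideal_pow R I n"
            using ideal_pow_mult[OF I, of "coeff (UP R) h2 (n - i)" "n - i" "coeff (UP R) h1 i" i] that unfolding H by simp
        qed simp
        then show ?thesis using that unfolding H by (simp add: U.coeff_mult)
      qed
      then show ?thesis using that unfolding H by (simp del: U.coeff_mult)
    qed
  qed
  then show ?thesis
    using cring.subcringI'[OF U.UP_cring, of ?H] ring.subcring_iff[OF U.UP_ring, of ?H] unfolding rees_algebra_def by (auto simp: cu)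
qed

end

text \<open>Two evaluations of the polynomial ring are compared: \<open>eA\<close> sends the variables to the elements
  \<open>a t\<close> of the Rees algebra, and \<open>eR\<close> sends them to the elements \<open>a\<close> of \<open>R\<close>. On forms of degree
  \<open>n\<close> they differ by the factor \<open>t\<^sup>n\<close>, so that the relations in the Rees algebra are the
  polynomials all of whose homogeneous parts are relations in \<open>R\<close>.\<close>

locale rees_evaluation = R: cring R for R (structure) +
  fixes I as
  assumes I: "ideal I R" and as_I: "set as \<subseteq> I"
begin

abbreviation "U \<equiv> UP R"
abbreviation "A \<equiv> rees_algebra R I"
abbreviation "fs \<equiv> map (\<lambda>a. up_ring.monom U a (Suc 0)) as"
abbreviation "\<phi> \<equiv> \<lambda>r. up_ring.monom U r 0"

sublocale UP: UP_cring R U by unfold_locales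

lemma as_carrier: "set as \<subseteq> carrier R" using as_I R.ideal_subset[OF I] by auto

lemma A_carrier: "p \<in> carrier A \<longleftrightarrow> p \<in> carrier U \<and> (\<forall>n. coeff U p n \<in> ideal_pow R I n)"
  by (auto simp: rees_algebra_def UP_def)

lemma A_simps: "add A = add U" "monoid.mult A = monoid.mult U" "one A = one U" "zero A = zero U"
  by (simp_all add: rees_algebra_def)

lemma monom_A: "u \<in> ideal_pow R I n \<Longrightarrow> up_ring.monom U u n \<in> carrier A"
  using additive_subgroup.zero_closed[OF ideal.axioms(1)[OF R.ideal_pow_ideal[OF I]]]
    R.ideal_subset[OF R.ideal_pow_ideal[OF I]]
  by (auto simp: A_carrier subset_iff)

sublocale eA: mpoly_evaluation R A \<phi> fs
proof (intro mpoly_evaluation.intro mpoly_evaluation_axioms.intro)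
  show "cring R" by (rule R.is_cring)
  show "cring A" by (rule R.rees_cring[OF I])
  show "\<phi> \<in> ring_hom R A"
  proof (rule ring_hom_memI)
    show "\<phi> x \<in> carrier A" if "x \<in> carrier R" for x
      by (rule monom_A) (use that in \<open>simp add: ideal_pow_def\<close>)
    show "\<phi> (x \<otimes> y) = \<phi> x \<otimes>\<^bsub>A\<^esub> \<phi> y" if "x \<in> carrier R" "y \<in> carrier R" for x y
      using UP.monom_mult[OF that, of 0 0] by (simp add: A_simps)
  qed (simp_all add: A_simps)
  show "set fs \<subseteq> carrier A"
    using as_I monom_A[of _ 1] R.ideal_pow_1[OF I] by (auto simp del: UP.monom_closed)
qed

sublocale eR: mpoly_evaluation R R "\<lambda>x. x" as
  by (intro mpoly_evaluation.intro mpoly_evaluation_axioms.intro R.is_cring as_carrier)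
    (auto simp: ring_hom_def)

lemma mon_monom: "set_mset m \<subseteq> {..<length as} \<Longrightarrow> eA.mon m = up_ring.monom U (eR.mon m) (size m)"
proof (induction m)
  case empty then show ?case by (simp add: A_simps)
next
  case (add i m)
  have i: "i < length as" using add by auto
  have "eA.mon (add_mset i m) = eA.mon {#i#} \<otimes>\<^bsub>A\<^esub> eA.mon m" using eA.mon_add[of "{#i#}" m] by simp
  also have "\<dots> = up_ring.monom U (as ! i) 1 \<otimes>\<^bsub>U\<^esub> up_ring.monom U (eR.mon m) (size m)"
    using add i by (simp add: A_simps eA.mon_single)
  also have "\<dots> = up_ring.monom U (as ! i \<otimes> eR.mon m) (1 + size m)"
    using i by (intro UP.monom_mult[symmetric]) auto
  also have "as ! i \<otimes> eR.mon m = eR.mon (add_mset i m)" using eR.mon_add[of "{#i#}" m] i by (simp add: eR.mon_single)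
  finally show ?case by simp
qed

lemma coeff_ev: "p \<in> carrier eR.M \<Longrightarrow> coeff U (eA.ev p) n = eR.ev (hom_part R n p)"
proof (induction p rule: R.mpoly_induct)
  case zero
  have "hom_part R n \<zero>\<^bsub>eR.M\<^esub> = \<zero>\<^bsub>eR.M\<^esub>" by (auto simp: hom_part_def R.mpoly_simps)
  then show ?case using eA.ev_zero by (simp add: A_simps)
next
  case (add_term c m q)
  have t: "mterm R c m \<in> carrier eR.M" using add_term by simp
  have evt: "eA.ev (mterm R c m) = up_ring.monom U (c \<otimes> eR.mon m) (size m)"
    using add_term eA.ev_mterm[of c m] mon_monom[of m] UP.monom_mult[of c "eR.mon m" 0 "size m"] by (simp add: A_simps)
  have cl: "eA.ev (mterm R c m) \<in> carrier U" "eA.ev q \<in> carrier U"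
    using eA.ev_closed[of "mterm R c m"] eA.ev_closed[of q] t add_term(4) A_carrier by auto
  have "coeff U (eA.ev (mterm R c m)) n = eR.ev (hom_part R n (mterm R c m))"
    using R.hom_part_of_form[OF R.form_mterm[OF add_term(1,3)], of n] eR.ev_mterm[OF add_term(1,3)] evt add_term(1)
    by auto
  moreover have "hom_part R n (mterm R c m) \<in> carrier eR.M" "hom_part R n q \<in> carrier eR.M"
    using R.hom_part_form t add_term(4) R.form_carrier by blast+
  moreover have "eA.ev (mterm R c m \<oplus>\<^bsub>eR.M\<^esub> q) = eA.ev (mterm R c m) \<oplus>\<^bsub>U\<^esub> eA.ev q"
    using eA.ev_add[of "mterm R c m" q] t add_term(4) by (simp add: A_simps)
  ultimately show ?case using add_term cl by (simp add: R.hom_part_add eR.ev_add)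
qed

lemma ev_form:
  assumes "X \<in> form R (length as) n" shows "eA.ev X = up_ring.monom U (eR.ev X) n"
proof (rule UP.up_eqI)
  have X: "X \<in> carrier eR.M" using assms R.form_carrier by blast
  show "eA.ev X \<in> carrier U" using eA.ev_closed[of X] X A_carrier by simp
  show "up_ring.monom U (eR.ev X) n \<in> carrier U" using X by simp
  show "coeff U (eA.ev X) k = coeff U (up_ring.monom U (eR.ev X) n) k" for k
    using coeff_ev[OF X, of k] R.hom_part_of_form[OF assms, of k] X by simp
qed

lemma relation_iff:
  assumes "p \<in> carrier eR.M"
  shows "eA.ev p = \<zero>\<^bsub>A\<^esub> \<longleftrightarrow> (\<forall>n. eR.ev (hom_part R n p) = \<zero>)"
proof -
  have c: "eA.ev p \<in> carrier U" using eA.ev_closed[of p] assms A_carrier by simp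
  have "eA.ev p = \<zero>\<^bsub>U\<^esub> \<longleftrightarrow> (\<forall>n. coeff U (eA.ev p) n = \<zero>)"
    using UP.up_eqI[OF _ c UP.UP_zero_closed] by auto
  then show ?thesis using coeff_ev[OF assms] by (simp add: A_simps)
qed

lemma lifts_if_generates:
  assumes "generates_algebra R A \<phi> fs" "u \<in> I"
  shows "\<exists>X\<in>form R (length as) 1. eR.ev X = u"
proof -
  have uc: "u \<in> carrier R" using assms R.ideal_subset[OF I] by auto
  have "up_ring.monom U u 1 \<in> carrier A" using monom_A[of u 1] R.ideal_pow_1[OF I] assms by simp
  moreover have "eA.ev ` carrier eA.M = carrier A" using assms(1) unfolding generates_algebra_def by blast
  ultimately have "up_ring.monom U u 1 \<in> eA.ev ` carrier eA.M" by simp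
  then obtain p where p: "p \<in> carrier eR.M" "eA.ev p = up_ring.monom U u 1" by auto
  have "eR.ev (hom_part R 1 p) = u" using coeff_ev[OF p(1), of 1] p(2) uc by simp
  then show ?thesis using R.hom_part_form[OF p(1)] by blast
qed

lemma lifts_pow:
  assumes lift: "\<And>u. u \<in> I \<Longrightarrow> \<exists>X\<in>form R (length as) 1. eR.ev X = u"
  shows "u \<in> ideal_pow R I n \<Longrightarrow> \<exists>X\<in>form R (length as) n. eR.ev X = u"
proof (induction n arbitrary: u)
  case 0
  then have "u \<in> carrier R" by (simp add: ideal_pow_def)
  then show ?case using R.form_mterm[of u "{#}" "length as"] eR.ev_mterm[of u "{#}"] by force
next
  case (Suc n)
  then have "u \<in> I \<cdot> ideal_pow R I n" by (simp add: R.ideal_pow_Suc)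
  then show ?case
  proof (induction u rule: ideal_prod.induct)
    case (prod i j)
    obtain X Y where "X \<in> form R (length as) 1" "eR.ev X = i" "Y \<in> form R (length as) n" "eR.ev Y = j"
      using lift[OF prod(1)] Suc.IH[OF prod(2)] by blast
    then show ?case using R.form_mult[of X "length as" 1 Y n] eR.ev_mult[of X Y] R.form_carrier
      by (intro bexI[of _ "X \<otimes>\<^bsub>eR.M\<^esub> Y"]) auto
  next
    case (sum s1 s2)
    then obtain X Y where "X \<in> form R (length as) (Suc n)" "eR.ev X = s1" "Y \<in> form R (length as) (Suc n)" "eR.ev Y = s2"
      by blast
    then show ?case using R.form_add[of X "length as" "Suc n" Y] eR.ev_add[of X Y] R.form_carrier
      by (intro bexI[of _ "X \<oplus>\<^bsub>eR.M\<^esub> Y"]) auto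
  qed
qed

text \<open>Induction on the degree in \<open>t\<close>: the top coefficient is in \<open>I\<^sup>N\<close> and is therefore the value of a
  form of degree \<open>N\<close>.\<close>

lemma generates_if_lifts:
  assumes lift: "\<And>u. u \<in> I \<Longrightarrow> \<exists>X\<in>form R (length as) 1. eR.ev X = u"
  shows "generates_algebra R A \<phi> fs"
proof -
  have "\<exists>p\<in>carrier eR.M. eA.ev p = q" if "q \<in> carrier A" "\<And>n. n \<ge> N \<Longrightarrow> coeff U q n = \<zero>" for q N
    using that
  proof (induction N arbitrary: q)
    case 0
    have "q = \<zero>\<^bsub>U\<^esub>" by (rule UP.up_eqI) (use 0 A_carrier in auto)
    then show ?case using eA.ev_zero by (intro bexI[of _ "\<zero>\<^bsub>eR.M\<^esub>"]) (auto simp: A_simps)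
  next
    case (Suc N)
    define u where "u = coeff U q N"
    have qU: "q \<in> carrier U" and u: "u \<in> ideal_pow R I N" using Suc.prems(1) A_carrier by (auto simp: u_def)
    have uc: "u \<in> carrier R" using qU by (simp add: u_def)
    obtain X where X: "X \<in> form R (length as) N" "eR.ev X = u" using lifts_pow[OF lift u] by blast
    have mA: "up_ring.monom U u N \<in> carrier A" by (rule monom_A[OF u])
    define q' where "q' = q \<ominus>\<^bsub>A\<^esub> up_ring.monom U u N"
    have q'A: "q' \<in> carrier A" unfolding q'_def using Suc.prems(1) mA by simp
    have recov: "q = q' \<oplus>\<^bsub>A\<^esub> up_ring.monom U u N"
      unfolding q'_def using Suc.prems(1) mA by (simp add: eA.A.minus_eq eA.A.a_assoc eA.A.l_neg)
    then have recovU: "q = q' \<oplus>\<^bsub>U\<^esub> up_ring.monom U u N" by (simp add: A_simps)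
    have q'U: "q' \<in> carrier U" using q'A A_carrier by simp
    have "coeff U q' n = \<zero>" if "n \<ge> N" for n
    proof -
      have e: "coeff U q n = coeff U q' n \<oplus> coeff U (up_ring.monom U u N) n"
        using q'U uc by (subst recovU) simp
      show ?thesis
      proof (cases "n = N")
        case True
        then have "u = coeff U q' n \<oplus> u" using e uc by (simp add: u_def)
        then show ?thesis using q'U uc by (metis UP.coeff_closed R.add.l_cancel_one' R.a_comm)
      next
        case False
        then show ?thesis using e that Suc.prems(2)[of n] q'U uc by simp
      qed
    qed
    then obtain p where p: "p \<in> carrier eR.M" "eA.ev p = q'" using Suc.IH[OF q'A] by blast
    have "eA.ev (p \<oplus>\<^bsub>eR.M\<^esub> X) = q"
      using eA.ev_add[of p X] p X R.form_carrier[OF X(1)] ev_form[OF X(1)] recov by simp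
    moreover have "p \<oplus>\<^bsub>eR.M\<^esub> X \<in> carrier eR.M" using p R.form_carrier[OF X(1)] by simp
    ultimately show ?case by blast
  qed
  note lower = this
  have "carrier A \<subseteq> eA.ev ` carrier eR.M"
  proof
    fix q assume q: "q \<in> carrier A"
    then have "coeff U q n = \<zero>" if "n \<ge> Suc (deg R q)" for n
      using that A_carrier UP.deg_aboveD[of q n] by simp
    then obtain p where "p \<in> carrier eR.M" "eA.ev p = q" using lower[OF q] by blast
    then show "q \<in> eA.ev ` carrier eR.M" by blast
  qed
  moreover have "eA.ev ` carrier eR.M \<subseteq> carrier A" using eA.ev_closed by auto
  ultimately show ?thesis unfolding generates_algebra_def using eA.fs by auto
qed

end

context cring begin

lemma linear_lifts:
  assumes "set as \<subseteq> carrier R" "u \<in> Idl (set as)"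
  shows "\<exists>X\<in>form R (length as) 1. mpoly_eval R R (\<lambda>x. x) as X = u"
proof -
  interpret e: mpoly_evaluation R R "\<lambda>x. x" as
    by (intro mpoly_evaluation.intro mpoly_evaluation_axioms.intro is_cring assms) (auto simp: ring_hom_def)
  interpret h: ring_hom_ring e.M R e.ev by (rule e.ev_hom_ring)
  let ?T = "e.ev ` form R (length as) 1"
  have "ideal ?T R"
  proof (rule idealI[OF ring_axioms])
    show "subgroup ?T (add_monoid R)"
    proof
      show "?T \<subseteq> carrier (add_monoid R)" using form_carrier by auto
      show "\<one>\<^bsub>add_monoid R\<^esub> \<in> ?T" using form_zero[of "length as" 1] e.ev_zero by (metis image_eqI monoid.simps(2))
      fix x assume "x \<in> ?T"
      then obtain X where X: "X \<in> form R (length as) 1" "x = e.ev X" by blast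
      have "inv\<^bsub>add_monoid R\<^esub> x = e.ev (\<ominus>\<^bsub>e.M\<^esub> X)"
        using X form_carrier[OF X(1)] by (simp add: a_inv_def[symmetric])
      then show "inv\<^bsub>add_monoid R\<^esub> x \<in> ?T" using form_uminus[OF X(1)] by blast
      fix y assume "y \<in> ?T"
      then obtain Y where Y: "Y \<in> form R (length as) 1" "y = e.ev Y" by blast
      have "x \<otimes>\<^bsub>add_monoid R\<^esub> y = e.ev (X \<oplus>\<^bsub>e.M\<^esub> Y)"
        using X Y form_carrier by (simp add: e.ev_add)
      then show "x \<otimes>\<^bsub>add_monoid R\<^esub> y \<in> ?T" using form_add[OF X(1) Y(1)] by blast
    qed
    fix x c assume "x \<in> ?T" and c: "c \<in> carrier R"
    then obtain X where X: "X \<in> form R (length as) 1" "x = e.ev X" by blast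
    have C: "mterm R c {#} \<in> form R (length as) 0" using form_mterm[OF c, of "{#}"] by simp
    have "c \<otimes> x = e.ev (mterm R c {#} \<otimes>\<^bsub>e.M\<^esub> X)"
      using X C form_carrier c by (simp add: e.ev_mult e.ev_mterm)
    then show "c \<otimes> x \<in> ?T" using form_mult[OF C X(1)] by auto
    then show "x \<otimes> c \<in> ?T" using X form_carrier[OF X(1)] c by (simp add: m_comm)
  qed
  moreover have "set as \<subseteq> ?T"
  proof
    fix a assume "a \<in> set as"
    then obtain i where i: "i < length as" "a = as ! i" by (auto simp: in_set_conv_nth)
    have "mterm R \<one> {#i#} \<in> form R (length as) 1" using form_mterm[of \<one> "{#i#}"] i by simp
    moreover have "e.ev (mterm R \<one> {#i#}) = a" using i by (simp add: e.ev_mterm e.mon_single)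
    ultimately show "a \<in> ?T" by blast
  qed
  ultimately have "Idl (set as) \<subseteq> ?T" by (rule genideal_minimal)
  then show ?thesis using assms by blast
qed

text \<open>An ideal generated by a regular sequence is of linear type. The definition of the relation type
  chooses some generators \<open>a t\<close> of the Rees algebra; \<open>zs\<close> shows that a choice is possible, and the
  result is proved for whatever family \<open>as\<close> is chosen.\<close>

theorem rt_ideal_regular_sequence:
  assumes zs: "set zs \<subseteq> carrier R"
    and colon: "\<And>i x. i < length zs \<Longrightarrow> x \<in> carrier R \<Longrightarrow> zs ! i \<otimes> x \<in> Idl (set (take i zs)) \<Longrightarrow>
      x \<in> Idl (set (take i zs))"
  shows "rt_ideal R (Idl (set zs)) = 1"
proof -
  let ?I = "Idl (set zs)"
  have I: "ideal ?I R" by (rule genideal_ideal[OF zs])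
  let ?A = "rees_algebra R ?I" and ?\<phi> = "\<lambda>r. up_ring.monom (UP R) r 0"
  let ?A1 = "{up_ring.monom (UP R) a (Suc 0) |a. a \<in> ?I}"
  let ?ok = "\<lambda>fs. set fs \<subseteq> ?A1 \<and> generates_algebra R ?A ?\<phi> fs"
  have "?ok (map (\<lambda>a. up_ring.monom (UP R) a (Suc 0)) zs)"
  proof -
    interpret rees_evaluation R ?I zs
      by (rule rees_evaluation.intro[OF is_cring rees_evaluation_axioms.intro[OF I genideal_self[OF zs]]])
    show ?thesis using generates_if_lifts linear_lifts[OF zs] as_I by auto
  qed
  then have ex: "\<exists>fs. ?ok fs" by blast
  define fs where "fs = (SOME fs. ?ok fs)"
  have ok: "?ok fs" unfolding fs_def by (rule someI_ex[OF ex])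
  then have "\<forall>f\<in>set fs. \<exists>a. a \<in> ?I \<and> f = up_ring.monom (UP R) a (Suc 0)" by blast
  then obtain g where g: "\<And>f. f \<in> set fs \<Longrightarrow> g f \<in> ?I \<and> f = up_ring.monom (UP R) (g f) (Suc 0)" by metis
  define as where "as = map g fs"
  have fs_as: "fs = map (\<lambda>a. up_ring.monom (UP R) a (Suc 0)) as"
    unfolding as_def map_map by (rule map_idI[symmetric]) (use g in auto)
  have asI: "set as \<subseteq> ?I" using g by (auto simp: as_def)
  interpret rees_evaluation R ?I as
    by (rule rees_evaluation.intro[OF is_cring rees_evaluation_axioms.intro[OF I asI]])
  interpret LR: linear_relations R as zs
  proof (unfold_locales)
    show "\<exists>X\<in>form R (length as) 1. eR.ev X = u" if "u \<in> ?I" for u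
      using lifts_if_generates[OF _ that] ok fs_as by simp
  qed (use zs colon as_I in auto)
  let ?M = "mpoly_ring R (length as)"
  let ?Q = "relation_ideal R ?A ?\<phi> fs"
  let ?G = "{p \<in> ?Q. \<forall>m. p m \<noteq> \<zero> \<longrightarrow> size m \<le> 1}"
  have Q: "?Q = {p \<in> carrier ?M. eA.ev p \<in> {\<zero>\<^bsub>?A\<^esub>}}" by (auto simp: relation_ideal_def fs_as)
  interpret hA: ring_hom_ring ?M ?A eA.ev using eA.ev_hom_ring by simp
  have Qi: "ideal ?Q ?M" unfolding Q by (rule hA.ideal_vimage[OF eA.A.zeroideal])
  have Gc: "?G \<subseteq> carrier ?M" by (auto simp: Q)
  have "?Q \<subseteq> Idl\<^bsub>?M\<^esub> ?G"
  proof
    fix p assume "p \<in> ?Q"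
    then have p: "p \<in> carrier ?M" "\<And>n. eR.ev (hom_part R n p) = \<zero>" using relation_iff by (auto simp: Q)
    have LG: "LR.L \<subseteq> Idl\<^bsub>?M\<^esub> ?G" unfolding LR.L_def
    proof (rule eR.M.genideal_mono[OF Gc])
      show "{X \<in> form R (length as) 1. eR.ev X = \<zero>} \<subseteq> ?G"
      proof
        fix X assume X: "X \<in> {X \<in> form R (length as) 1. eR.ev X = \<zero>}"
        then have "eA.ev X = \<zero>\<^bsub>?A\<^esub>" using ev_form[of X 1] by (simp add: A_simps)
        then show "X \<in> ?G" using X by (auto simp: Q form_def)
      qed
    qed
    show "p \<in> Idl\<^bsub>?M\<^esub> ?G"
    proof (rule hom_parts_in_ideal[OF eR.M.genideal_ideal[OF Gc] p(1)])
      fix n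
      show "hom_part R n p \<in> Idl\<^bsub>?M\<^esub> ?G"
      proof (cases n)
        \<comment> \<open>in degree 0 the evaluation is injective\<close>
        case 0
        have pc: "p {#} \<in> carrier R" using mpoly_coeff_closed[OF p(1)] .
        have h: "hom_part R 0 p = mterm R (p {#}) {#}" by (auto simp: hom_part_def mterm_def fun_eq_iff)
        then have "p {#} = \<zero>" using p(2)[of 0] pc by (simp add: eR.ev_mterm)
        then have "hom_part R n p = \<zero>\<^bsub>?M\<^esub>" using h 0 by (simp add: mterm_def mpoly_simps fun_eq_iff)
        then show ?thesis
          using additive_subgroup.zero_closed[OF ideal.axioms(1)[OF eR.M.genideal_ideal[OF Gc]]] by simp
      next
        case (Suc n')
        then have "hom_part R n p \<in> LR.L"
          using LR.relation_in_L[of "hom_part R n p" n'] hom_part_form[OF p(1), of n] p(2)[of n] by simp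
        then show ?thesis using LG by auto
      qed
    qed
  qed
  moreover have "Idl\<^bsub>?M\<^esub> ?G \<subseteq> ?Q" by (rule eR.M.genideal_minimal[OF Qi]) auto
  ultimately have "?Q = Idl\<^bsub>mpoly_ring R (length fs)\<^esub> ?G" using fs_as by auto
  then have "relation_type_wrt R ?A ?\<phi> fs = 1"
    unfolding relation_type_wrt_def by (intro Least_equality) auto
  then show ?thesis by (simp add: rt_ideal_def relation_type_def fs_def)
qed

end

section \<open>Localization\<close>

locale localization = cring R for R (structure) +
  fixes S
  assumes S: "submonoid_set S"
begin

abbreviation "\<L> \<equiv> loc_ring R S"
abbreviation "fr \<equiv> fract R S"

lemma S_carrier: "s \<in> S \<Longrightarrow> s \<in> carrier R" using S by (auto simp: submonoid_set_def)
lemma S_one: "\<one> \<in> S" using S by (auto simp: submonoid_set_def)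
lemma S_mult: "s \<in> S \<Longrightarrow> t \<in> S \<Longrightarrow> s \<otimes> t \<in> S" using S by (auto simp: submonoid_set_def)

lemma minus_zero_iff: "a \<in> carrier R \<Longrightarrow> b \<in> carrier R \<Longrightarrow> a \<ominus> b = \<zero> \<longleftrightarrow> a = b"
  by (simp add: r_right_minus_eq)

lemma mem_fract:
  assumes "a \<in> carrier R" "s \<in> S"
  shows "(b, t) \<in> fr a s \<longleftrightarrow> b \<in> carrier R \<and> t \<in> S \<and> (\<exists>u\<in>S. u \<otimes> (a \<otimes> t) = u \<otimes> (b \<otimes> s))"
proof -
  have "u \<otimes> (a \<otimes> t \<ominus> b \<otimes> s) = \<zero> \<longleftrightarrow> u \<otimes> (a \<otimes> t) = u \<otimes> (b \<otimes> s)"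
    if "b \<in> carrier R" "t \<in> S" "u \<in> S" for u
  proof -
    have c: "u \<in> carrier R" "t \<in> carrier R" "s \<in> carrier R" using that assms S_carrier by auto
    have "u \<otimes> (a \<otimes> t \<ominus> b \<otimes> s) = u \<otimes> (a \<otimes> t) \<ominus> u \<otimes> (b \<otimes> s)" using c that assms by algebra
    then show ?thesis using minus_zero_iff[of "u \<otimes> (a \<otimes> t)" "u \<otimes> (b \<otimes> s)"] c that assms by simp
  qed
  then show ?thesis unfolding fract_def by auto
qed

lemma fract_trans:
  assumes c: "a \<in> carrier R" "b \<in> carrier R" "c \<in> carrier R" "s \<in> S" "t \<in> S" "w \<in> S"
    and u: "u \<in> S" "u \<otimes> (a \<otimes> t) = u \<otimes> (b \<otimes> s)" and v: "v \<in> S" "v \<otimes> (b \<otimes> w) = v \<otimes> (c \<otimes> t)"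
  shows "\<exists>x\<in>S. x \<otimes> (a \<otimes> w) = x \<otimes> (c \<otimes> s)"
proof
  have d: "s \<in> carrier R" "t \<in> carrier R" "w \<in> carrier R" "u \<in> carrier R" "v \<in> carrier R"
    using c u v S_carrier by auto
  have "(u \<otimes> v \<otimes> t) \<otimes> (a \<otimes> w) = v \<otimes> w \<otimes> (u \<otimes> (a \<otimes> t))" using c(1-3) d by algebra
  also have "\<dots> = u \<otimes> s \<otimes> (v \<otimes> (b \<otimes> w))" unfolding u(2) using c(1-3) d by algebra
  also have "\<dots> = (u \<otimes> v \<otimes> t) \<otimes> (c \<otimes> s)" unfolding v(2) using c(1-3) d by algebra
  finally show "(u \<otimes> v \<otimes> t) \<otimes> (a \<otimes> w) = (u \<otimes> v \<otimes> t) \<otimes> (c \<otimes> s)" .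
  show "u \<otimes> v \<otimes> t \<in> S" using c u v S_mult by auto
qed

lemma fract_self: "a \<in> carrier R \<Longrightarrow> s \<in> S \<Longrightarrow> (a, s) \<in> fr a s"
  using mem_fract S_one S_carrier by auto

lemma fract_eq_iff:
  assumes c: "a \<in> carrier R" "b \<in> carrier R" "s \<in> S" "t \<in> S"
  shows "fr a s = fr b t \<longleftrightarrow> (\<exists>u\<in>S. u \<otimes> (a \<otimes> t) = u \<otimes> (b \<otimes> s))"
proof
  assume "fr a s = fr b t"
  then have "(b, t) \<in> fr a s" using fract_self c by simp
  then show "\<exists>u\<in>S. u \<otimes> (a \<otimes> t) = u \<otimes> (b \<otimes> s)" using mem_fract c by simp
next
  have sub: "fr b t \<subseteq> fr a s" if c: "a \<in> carrier R" "b \<in> carrier R" "s \<in> S" "t \<in> S"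
    and u: "u \<in> S" "u \<otimes> (a \<otimes> t) = u \<otimes> (b \<otimes> s)" for a b s t u
  proof
    fix x assume x: "x \<in> fr b t"
    obtain d w where dw: "x = (d, w)" by (cases x)
    then have d: "d \<in> carrier R" "w \<in> S" "\<exists>v\<in>S. v \<otimes> (b \<otimes> w) = v \<otimes> (d \<otimes> t)" using x mem_fract[OF c(2,4)] by auto
    then obtain v where "v \<in> S" "v \<otimes> (b \<otimes> w) = v \<otimes> (d \<otimes> t)" by blast
    then show "x \<in> fr a s" using fract_trans[OF c(1,2) d(1) c(3,4) d(2) u] mem_fract[OF c(1,3)] d dw by auto
  qed
  assume "\<exists>u\<in>S. u \<otimes> (a \<otimes> t) = u \<otimes> (b \<otimes> s)"
  then obtain u where "u \<in> S" "u \<otimes> (a \<otimes> t) = u \<otimes> (b \<otimes> s)" by blast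
  then show "fr a s = fr b t" using sub[of a b s t u] sub[of b a t s u] c by auto
qed

lemma fract_eqI:
  assumes "a \<in> carrier R" "b \<in> carrier R" "s \<in> S" "t \<in> S" "a \<otimes> t = b \<otimes> s"
  shows "fr a s = fr b t"
  using fract_eq_iff[OF assms(1-4)] assms(5) S_one by auto

lemma loc_carrier: "x \<in> carrier \<L> \<longleftrightarrow> (\<exists>a\<in>carrier R. \<exists>s\<in>S. x = fr a s)"
  by (auto simp: loc_ring_def)

lemma fract_carrier [simp]: "a \<in> carrier R \<Longrightarrow> s \<in> S \<Longrightarrow> fr a s \<in> carrier \<L>"
  using loc_carrier by auto

lemma loc_one: "\<one>\<^bsub>\<L>\<^esub> = fr \<one> \<one>" and loc_zero: "\<zero>\<^bsub>\<L>\<^esub> = fr \<zero> \<one>"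
  by (simp_all add: loc_ring_def)

text \<open>The operations of the ring of fractions are unions over all representatives; it suffices that
  the sets united are all equal.\<close>

lemma UN_const_reps:
  assumes "X \<noteq> {}" "Y \<noteq> {}" "\<And>a s b t. (a, s) \<in> X \<Longrightarrow> (b, t) \<in> Y \<Longrightarrow> F a s b t = Z"
  shows "(\<Union>(a, s)\<in>X. \<Union>(b, t)\<in>Y. F a s b t) = Z"
  using assms by force

lemma fract_mult:
  assumes c: "a \<in> carrier R" "b \<in> carrier R" "s \<in> S" "t \<in> S"
  shows "fr a s \<otimes>\<^bsub>\<L>\<^esub> fr b t = fr (a \<otimes> b) (s \<otimes> t)"
proof -
  have "(\<Union>(a, s)\<in>fr a s. \<Union>(b, t)\<in>fr b t. fr (a \<otimes> b) (s \<otimes> t)) = fr (a \<otimes> b) (s \<otimes> t)"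
  proof (rule UN_const_reps)
    show "fr a s \<noteq> {}" "fr b t \<noteq> {}" using fract_self c by blast+
    fix a' s' b' t' assume m: "(a', s') \<in> fr a s" "(b', t') \<in> fr b t"
    obtain u where u: "a' \<in> carrier R" "s' \<in> S" "u \<in> S" "u \<otimes> (a \<otimes> s') = u \<otimes> (a' \<otimes> s)"
      using m(1) mem_fract[OF c(1,3)] by auto
    obtain v where v: "b' \<in> carrier R" "t' \<in> S" "v \<in> S" "v \<otimes> (b \<otimes> t') = v \<otimes> (b' \<otimes> t)"
      using m(2) mem_fract[OF c(2,4)] by auto
    have d: "s \<in> carrier R" "t \<in> carrier R" "s' \<in> carrier R" "t' \<in> carrier R" "u \<in> carrier R" "v \<in> carrier R"
      using c u v S_carrier by auto
    have "(u \<otimes> v) \<otimes> ((a \<otimes> b) \<otimes> (s' \<otimes> t')) = (u \<otimes> (a \<otimes> s')) \<otimes> (v \<otimes> (b \<otimes> t'))"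
      using d c(1,2) by algebra
    also have "\<dots> = (u \<otimes> v) \<otimes> ((a' \<otimes> b') \<otimes> (s \<otimes> t))" unfolding u(4) v(4) using d u(1) v(1) by algebra
    finally have "\<exists>w\<in>S. w \<otimes> ((a \<otimes> b) \<otimes> (s' \<otimes> t')) = w \<otimes> ((a' \<otimes> b') \<otimes> (s \<otimes> t))"
      using u v S_mult by blast
    then show "fr (a' \<otimes> b') (s' \<otimes> t') = fr (a \<otimes> b) (s \<otimes> t)"
      using fract_eq_iff[of "a \<otimes> b" "a' \<otimes> b'" "s \<otimes> t" "s' \<otimes> t'"] c u v S_mult by auto
  qed
  then show ?thesis by (simp add: loc_ring_def)
qed

lemma fract_add:
  assumes c: "a \<in> carrier R" "b \<in> carrier R" "s \<in> S" "t \<in> S"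
  shows "fr a s \<oplus>\<^bsub>\<L>\<^esub> fr b t = fr (a \<otimes> t \<oplus> b \<otimes> s) (s \<otimes> t)"
proof -
  have "(\<Union>(a, s)\<in>fr a s. \<Union>(b, t)\<in>fr b t. fr (a \<otimes> t \<oplus> b \<otimes> s) (s \<otimes> t)) = fr (a \<otimes> t \<oplus> b \<otimes> s) (s \<otimes> t)"
  proof (rule UN_const_reps)
    show "fr a s \<noteq> {}" "fr b t \<noteq> {}" using fract_self c by blast+
    fix a' s' b' t' assume m: "(a', s') \<in> fr a s" "(b', t') \<in> fr b t"
    obtain u where u: "a' \<in> carrier R" "s' \<in> S" "u \<in> S" "u \<otimes> (a \<otimes> s') = u \<otimes> (a' \<otimes> s)"
      using m(1) mem_fract[OF c(1,3)] by auto
    obtain v where v: "b' \<in> carrier R" "t' \<in> S" "v \<in> S" "v \<otimes> (b \<otimes> t') = v \<otimes> (b' \<otimes> t)"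
      using m(2) mem_fract[OF c(2,4)] by auto
    have d: "s \<in> carrier R" "t \<in> carrier R" "s' \<in> carrier R" "t' \<in> carrier R" "u \<in> carrier R" "v \<in> carrier R"
      using c u v S_carrier by auto
    have "(u \<otimes> v) \<otimes> ((a \<otimes> t \<oplus> b \<otimes> s) \<otimes> (s' \<otimes> t'))
        = (u \<otimes> (a \<otimes> s')) \<otimes> (v \<otimes> t \<otimes> t') \<oplus> (v \<otimes> (b \<otimes> t')) \<otimes> (u \<otimes> s \<otimes> s')"
      using d c(1,2) by algebra
    also have "\<dots> = (u \<otimes> v) \<otimes> ((a' \<otimes> t' \<oplus> b' \<otimes> s') \<otimes> (s \<otimes> t))" unfolding u(4) v(4) using d u(1) v(1) by algebra
    finally have "\<exists>w\<in>S. w \<otimes> ((a \<otimes> t \<oplus> b \<otimes> s) \<otimes> (s' \<otimes> t')) = w \<otimes> ((a' \<otimes> t' \<oplus> b' \<otimes> s') \<otimes> (s \<otimes> t))"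
      using u v S_mult by blast
    then show "fr (a' \<otimes> t' \<oplus> b' \<otimes> s') (s' \<otimes> t') = fr (a \<otimes> t \<oplus> b \<otimes> s) (s \<otimes> t)"
      using fract_eq_iff[of "a \<otimes> t \<oplus> b \<otimes> s" "a' \<otimes> t' \<oplus> b' \<otimes> s'" "s \<otimes> t" "s' \<otimes> t'"] c u v d S_mult by auto
  qed
  then show ?thesis by (simp add: loc_ring_def)
qed

lemma loc_cring: "cring \<L>"
proof (rule cringI)
  note cl = S_carrier S_mult S_one
  have E: "\<exists>a\<in>carrier R. \<exists>s\<in>S. x = fr a s" if "x \<in> carrier \<L>" for x using that loc_carrier by simp
  show "abelian_group \<L>"
  proof (rule abelian_groupI)
    show "x \<oplus>\<^bsub>\<L>\<^esub> y \<in> carrier \<L>" if "x \<in> carrier \<L>" "y \<in> carrier \<L>" for x y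
      using E[OF that(1)] E[OF that(2)] by (auto simp: fract_add cl)
    show "\<zero>\<^bsub>\<L>\<^esub> \<in> carrier \<L>" by (simp add: loc_zero cl)
    show "x \<oplus>\<^bsub>\<L>\<^esub> y \<oplus>\<^bsub>\<L>\<^esub> z = x \<oplus>\<^bsub>\<L>\<^esub> (y \<oplus>\<^bsub>\<L>\<^esub> z)" if "x \<in> carrier \<L>" "y \<in> carrier \<L>" "z \<in> carrier \<L>" for x y z
    proof -
      note th = that
      obtain a s b t c w where *: "a \<in> carrier R" "b \<in> carrier R" "c \<in> carrier R" "s \<in> S" "t \<in> S" "w \<in> S"
        "x = fr a s" "y = fr b t" "z = fr c w" using E[OF th(1)] E[OF th(2)] E[OF th(3)] by blast
      have d: "s \<in> carrier R" "t \<in> carrier R" "w \<in> carrier R" using * cl by auto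
      have "(a \<otimes> t \<oplus> b \<otimes> s) \<otimes> w \<oplus> c \<otimes> (s \<otimes> t) = a \<otimes> (t \<otimes> w) \<oplus> (b \<otimes> w \<oplus> c \<otimes> t) \<otimes> s"
        using *(1-3) d by algebra
      then show ?thesis using * d by (simp add: fract_add cl m_assoc)
    qed
    show "x \<oplus>\<^bsub>\<L>\<^esub> y = y \<oplus>\<^bsub>\<L>\<^esub> x" if "x \<in> carrier \<L>" "y \<in> carrier \<L>" for x y
    proof -
      note th = that
      obtain a s b t where *: "a \<in> carrier R" "b \<in> carrier R" "s \<in> S" "t \<in> S" "x = fr a s" "y = fr b t"
        using E[OF th(1)] E[OF th(2)] by blast
      then show ?thesis using S_carrier by (simp add: fract_add a_comm m_comm)
    qed
    show "\<zero>\<^bsub>\<L>\<^esub> \<oplus>\<^bsub>\<L>\<^esub> x = x" if "x \<in> carrier \<L>" for x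
      using E[OF that] by (auto simp: loc_zero fract_add cl)
    show "\<exists>y\<in>carrier \<L>. y \<oplus>\<^bsub>\<L>\<^esub> x = \<zero>\<^bsub>\<L>\<^esub>" if "x \<in> carrier \<L>" for x
    proof -
      note th = that
      obtain a s where *: "a \<in> carrier R" "s \<in> S" "x = fr a s" using E[OF th] by blast
      have "fr (\<ominus> a) s \<oplus>\<^bsub>\<L>\<^esub> x = fr \<zero> (s \<otimes> s)" using * S_carrier by (simp add: fract_add l_minus l_neg)
      also have "\<dots> = \<zero>\<^bsub>\<L>\<^esub>" unfolding loc_zero by (rule fract_eqI) (use * cl in auto)
      finally show ?thesis using * by (intro bexI[of _ "fr (\<ominus> a) s"]) auto
    qed
  qed
  show "comm_monoid \<L>"
  proof (rule comm_monoidI)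
    show "x \<otimes>\<^bsub>\<L>\<^esub> y \<in> carrier \<L>" if "x \<in> carrier \<L>" "y \<in> carrier \<L>" for x y
      using E[OF that(1)] E[OF that(2)] by (auto simp: fract_mult cl)
    show "\<one>\<^bsub>\<L>\<^esub> \<in> carrier \<L>" by (simp add: loc_one cl)
    show "x \<otimes>\<^bsub>\<L>\<^esub> y \<otimes>\<^bsub>\<L>\<^esub> z = x \<otimes>\<^bsub>\<L>\<^esub> (y \<otimes>\<^bsub>\<L>\<^esub> z)" if "x \<in> carrier \<L>" "y \<in> carrier \<L>" "z \<in> carrier \<L>" for x y z
    proof -
      note th = that
      obtain a s b t c w where "a \<in> carrier R" "b \<in> carrier R" "c \<in> carrier R" "s \<in> S" "t \<in> S" "w \<in> S"
        "x = fr a s" "y = fr b t" "z = fr c w" using E[OF th(1)] E[OF th(2)] E[OF th(3)] by blast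
      then show ?thesis by (simp add: fract_mult cl m_assoc)
    qed
    show "x \<otimes>\<^bsub>\<L>\<^esub> y = y \<otimes>\<^bsub>\<L>\<^esub> x" if "x \<in> carrier \<L>" "y \<in> carrier \<L>" for x y
    proof -
      note th = that
      obtain a s b t where "a \<in> carrier R" "b \<in> carrier R" "s \<in> S" "t \<in> S" "x = fr a s" "y = fr b t"
        using E[OF th(1)] E[OF th(2)] by blast
      then show ?thesis using S_carrier by (simp add: fract_mult m_comm)
    qed
    show "\<one>\<^bsub>\<L>\<^esub> \<otimes>\<^bsub>\<L>\<^esub> x = x" if "x \<in> carrier \<L>" for x
      using E[OF that] by (auto simp: loc_one fract_mult cl)
  qed
  show "(x \<oplus>\<^bsub>\<L>\<^esub> y) \<otimes>\<^bsub>\<L>\<^esub> z = x \<otimes>\<^bsub>\<L>\<^esub> z \<oplus>\<^bsub>\<L>\<^esub> y \<otimes>\<^bsub>\<L>\<^esub> z"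
    if "x \<in> carrier \<L>" "y \<in> carrier \<L>" "z \<in> carrier \<L>" for x y z
  proof -
    note th = that
    obtain a s b t c w where *: "a \<in> carrier R" "b \<in> carrier R" "c \<in> carrier R" "s \<in> S" "t \<in> S" "w \<in> S"
      "x = fr a s" "y = fr b t" "z = fr c w" using E[OF th(1)] E[OF th(2)] E[OF th(3)] by blast
    have d: "s \<in> carrier R" "t \<in> carrier R" "w \<in> carrier R" using * cl by auto
    have "(x \<oplus>\<^bsub>\<L>\<^esub> y) \<otimes>\<^bsub>\<L>\<^esub> z = fr ((a \<otimes> t \<oplus> b \<otimes> s) \<otimes> c) (s \<otimes> t \<otimes> w)"
      using * d by (simp add: fract_add fract_mult cl)
    also have "\<dots> = fr ((a \<otimes> c) \<otimes> (t \<otimes> w) \<oplus> (b \<otimes> c) \<otimes> (s \<otimes> w)) ((s \<otimes> w) \<otimes> (t \<otimes> w))"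
    proof (rule fract_eqI)
      show "(a \<otimes> t \<oplus> b \<otimes> s) \<otimes> c \<otimes> (s \<otimes> w \<otimes> (t \<otimes> w))
        = (a \<otimes> c \<otimes> (t \<otimes> w) \<oplus> b \<otimes> c \<otimes> (s \<otimes> w)) \<otimes> (s \<otimes> t \<otimes> w)" using *(1-3) d by algebra
    qed (use * d cl in auto)
    also have "\<dots> = x \<otimes>\<^bsub>\<L>\<^esub> z \<oplus>\<^bsub>\<L>\<^esub> y \<otimes>\<^bsub>\<L>\<^esub> z" using * d by (simp add: fract_add fract_mult cl)
    finally show ?thesis .
  qed
qed

sublocale L: cring \<L> by (rule loc_cring)

lemma fract_hom: "(\<lambda>a. fr a \<one>) \<in> ring_hom R \<L>"
  by (rule ring_hom_memI) (auto simp: S_one fract_mult fract_add loc_one)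

lemma fract_split: "a \<in> carrier R \<Longrightarrow> s \<in> S \<Longrightarrow> fr a s = fr \<one> s \<otimes>\<^bsub>\<L>\<^esub> fr a \<one>"
  by (simp add: fract_mult S_one S_carrier)

lemma fract_unit:
  assumes "s \<in> S" "t \<in> S" shows "fr s t \<in> Units \<L>"
proof -
  have c: "s \<in> carrier R" "t \<in> carrier R" using assms S_carrier by auto
  have "fr t s \<otimes>\<^bsub>\<L>\<^esub> fr s t = \<one>\<^bsub>\<L>\<^esub>"
    using assms c by (simp add: fract_mult loc_one) (rule fract_eqI, auto simp: S_mult S_one m_comm)
  then show ?thesis using assms c L.m_comm unfolding Units_def
    by (intro CollectI conjI bexI[of _ "fr t s"]) auto
qed

lemma fract_zero_iff:
  "a \<in> carrier R \<Longrightarrow> s \<in> S \<Longrightarrow> fr a s = \<zero>\<^bsub>\<L>\<^esub> \<longleftrightarrow> (\<exists>u\<in>S. u \<otimes> a = \<zero>)"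
  unfolding loc_zero using fract_eq_iff[of a \<zero> s \<one>] S_one S_carrier by auto

definition ext :: "'a set \<Rightarrow> ('a \<times> 'a) set set" where
  "ext J = {fr a s |a s. a \<in> J \<and> s \<in> S}"

lemma mem_ext:
  assumes J: "ideal J R" and "a \<in> carrier R" "s \<in> S"
  shows "fr a s \<in> ext J \<longleftrightarrow> a \<in> saturation S J"
proof
  have Jc: "J \<subseteq> carrier R" by (rule ideal_subset[OF J])
  assume "fr a s \<in> ext J"
  then obtain b t where b: "b \<in> J" "t \<in> S" "fr a s = fr b t" by (auto simp: ext_def)
  then obtain u where u: "u \<in> S" "u \<otimes> (a \<otimes> t) = u \<otimes> (b \<otimes> s)" using fract_eq_iff[of a b s t] assms Jc by auto
  have c: "u \<in> carrier R" "t \<in> carrier R" "s \<in> carrier R" "b \<in> carrier R" using u b assms S_carrier Jc by auto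
  have "(u \<otimes> t) \<otimes> a = (u \<otimes> s) \<otimes> b" using u(2) c assms(2) by (simp add: m_ac)
  also have "\<dots> \<in> J" using ideal.I_l_closed[OF J b(1)] c by auto
  finally show "a \<in> saturation S J" unfolding saturation_def using S_mult[OF u(1) b(2)] assms(2) by auto
next
  assume "a \<in> saturation S J"
  then obtain u where u: "u \<in> S" "u \<otimes> a \<in> J" by (auto simp: saturation_def)
  have c: "u \<in> carrier R" "s \<in> carrier R" using u assms S_carrier by auto
  have "fr a s = fr (u \<otimes> a) (u \<otimes> s)"
    by (rule fract_eqI) (use c u assms S_mult in \<open>auto simp: m_ac\<close>)
  then show "fr a s \<in> ext J" unfolding ext_def using u S_mult[OF u(1) assms(3)] by blast
qed

lemma ext_ideal:
  assumes J: "ideal J R" shows "ideal (ext J) \<L>"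
proof (rule idealI[OF L.ring_axioms])
  interpret J: ideal J R by fact
  show "subgroup (ext J) (add_monoid \<L>)"
  proof
    show "ext J \<subseteq> carrier (add_monoid \<L>)" by (auto simp: ext_def)
    have "fr \<zero> \<one> \<in> ext J"
      unfolding ext_def using additive_subgroup.zero_closed[OF J.is_additive_subgroup] S_one by blast
    then show "\<one>\<^bsub>add_monoid \<L>\<^esub> \<in> ext J" by (simp add: loc_zero)
    fix x assume "x \<in> ext J"
    then obtain a s where a: "a \<in> J" "s \<in> S" "x = fr a s" by (auto simp: ext_def)
    have "fr a s \<oplus>\<^bsub>\<L>\<^esub> fr (\<ominus> a) s = \<zero>\<^bsub>\<L>\<^esub>"
    proof -
      have "fr a s \<oplus>\<^bsub>\<L>\<^esub> fr (\<ominus> a) s = fr \<zero> (s \<otimes> s)" using a S_carrier J.a_subset by (simp add: fract_add l_minus r_neg)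
      also have "\<dots> = \<zero>\<^bsub>\<L>\<^esub>" unfolding loc_zero
        by (rule fract_eqI) (use a S_mult S_one S_carrier in auto)
      finally show ?thesis .
    qed
    then have "\<ominus>\<^bsub>\<L>\<^esub> x = fr (\<ominus> a) s" using a by (metis L.add.inv_comm L.minus_equality fract_carrier J.Icarr a_inv_closed L.a_comm)
    moreover have "fr (\<ominus> a) s \<in> ext J" using a by (auto simp: ext_def)
    ultimately show "inv\<^bsub>add_monoid \<L>\<^esub> x \<in> ext J" by (simp add: a_inv_def)
    fix y assume "y \<in> ext J"
    then obtain b t where b: "b \<in> J" "t \<in> S" "y = fr b t" by (auto simp: ext_def)
    have "x \<oplus>\<^bsub>\<L>\<^esub> y = fr (a \<otimes> t \<oplus> b \<otimes> s) (s \<otimes> t)" using a b by (simp add: fract_add)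
    moreover have "a \<otimes> t \<oplus> b \<otimes> s \<in> J" using a b S_carrier by (simp add: J.I_r_closed)
    ultimately show "x \<otimes>\<^bsub>add_monoid \<L>\<^esub> y \<in> ext J" using S_mult[OF a(2) b(2)] by (auto simp: ext_def)
  qed
  fix x y assume "x \<in> ext J" "y \<in> carrier \<L>"
  then obtain a s b t where a: "a \<in> J" "s \<in> S" "x = fr a s" and b: "b \<in> carrier R" "t \<in> S" "y = fr b t"
    unfolding loc_carrier by (auto simp: ext_def)
  have "y \<otimes>\<^bsub>\<L>\<^esub> x = fr (b \<otimes> a) (t \<otimes> s)" using a b by (simp add: fract_mult)
  moreover have "b \<otimes> a \<in> J" using a b by (simp add: J.I_l_closed)
  ultimately show "y \<otimes>\<^bsub>\<L>\<^esub> x \<in> ext J" using S_mult[OF b(2) a(2)] by (auto simp: ext_def)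
  then show "x \<otimes>\<^bsub>\<L>\<^esub> y \<in> ext J" using a b by (simp add: L.m_comm)
qed

lemma ext_genideal:
  assumes A: "A \<subseteq> carrier R"
  shows "ext (Idl A) = Idl\<^bsub>\<L>\<^esub> ((\<lambda>a. fr a \<one>) ` A)"
proof
  interpret h: ring_hom_ring R \<L> "\<lambda>a. fr a \<one>"
    by (rule ring_hom_ringI2[OF ring_axioms L.ring_axioms fract_hom])
  have iA: "(\<lambda>a. fr a \<one>) ` A \<subseteq> carrier \<L>" using A S_one by auto
  show "Idl\<^bsub>\<L>\<^esub> ((\<lambda>a. fr a \<one>) ` A) \<subseteq> ext (Idl A)"
    by (rule L.genideal_minimal[OF ext_ideal[OF genideal_ideal[OF A]]])
      (use genideal_self[OF A] S_one in \<open>auto simp: ext_def\<close>)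
  show "ext (Idl A) \<subseteq> Idl\<^bsub>\<L>\<^esub> ((\<lambda>a. fr a \<one>) ` A)"
  proof
    fix x assume "x \<in> ext (Idl A)"
    then obtain a s where a: "a \<in> Idl A" "s \<in> S" "x = fr a s" by (auto simp: ext_def)
    have "fr a \<one> \<in> Idl\<^bsub>\<L>\<^esub> ((\<lambda>a. fr a \<one>) ` A)" by (rule h.hom_genideal[OF A a(1)])
    moreover have "a \<in> carrier R" using a ideal_subset[OF genideal_ideal[OF A]] by auto
    ultimately show "x \<in> Idl\<^bsub>\<L>\<^esub> ((\<lambda>a. fr a \<one>) ` A)"
      using a fract_split[of a s] ideal.I_l_closed[OF L.genideal_ideal[OF iA]] by simp
  qed
qed

lemma ext_contract:
  assumes K: "ideal K \<L>"
  shows "ideal {a \<in> carrier R. fr a \<one> \<in> K} R" "ext {a \<in> carrier R. fr a \<one> \<in> K} = K"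
proof -
  interpret h: ring_hom_ring R \<L> "\<lambda>a. fr a \<one>"
    by (rule ring_hom_ringI2[OF ring_axioms L.ring_axioms fract_hom])
  interpret K: ideal K \<L> by fact
  show "ideal {a \<in> carrier R. fr a \<one> \<in> K} R" by (rule h.ideal_vimage[OF K])
  show "ext {a \<in> carrier R. fr a \<one> \<in> K} = K"
  proof
    show "ext {a \<in> carrier R. fr a \<one> \<in> K} \<subseteq> K"
    proof
      fix x assume "x \<in> ext {a \<in> carrier R. fr a \<one> \<in> K}"
      then obtain a s where "a \<in> carrier R" "fr a \<one> \<in> K" "s \<in> S" "x = fr a s" by (auto simp: ext_def)
      then show "x \<in> K" using fract_split[of a s] K.I_l_closed by simp
    qed
    show "K \<subseteq> ext {a \<in> carrier R. fr a \<one> \<in> K}"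
    proof
      fix x assume x: "x \<in> K"
      then have "x \<in> carrier \<L>" using K.a_subset by auto
      then obtain a s where a: "a \<in> carrier R" "s \<in> S" "x = fr a s" unfolding loc_carrier by auto
      have sc: "s \<in> carrier R" using a S_carrier by auto
      have "fr s \<one> \<otimes>\<^bsub>\<L>\<^esub> x = fr (s \<otimes> a) s" using a sc by (simp add: fract_mult S_one)
      also have "\<dots> = fr a \<one>" by (rule fract_eqI) (use a sc S_one in \<open>auto simp: m_comm\<close>)
      finally have "fr a \<one> \<in> K" using K.I_l_closed[OF x, of "fr s \<one>"] sc S_one by simp
      then show "x \<in> ext {a \<in> carrier R. fr a \<one> \<in> K}" using a by (auto simp: ext_def)
    qed
  qed
qed

lemma ext_noetherian:
  assumes "noetherian_ring R" shows "noetherian_ring \<L>"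
proof (rule L.noetherian_ringI)
  interpret N: noetherian_ring R by fact
  fix K assume K: "ideal K \<L>"
  obtain A where A: "A \<subseteq> carrier R" "finite A" "{a \<in> carrier R. fr a \<one> \<in> K} = Idl A"
    using N.finetely_gen[OF ext_contract(1)[OF K]] by metis
  have "K = Idl\<^bsub>\<L>\<^esub> ((\<lambda>a. fr a \<one>) ` A)" using ext_contract(2)[OF K] ext_genideal[OF A(1)] A(3) by simp
  moreover have "(\<lambda>a. fr a \<one>) ` A \<subseteq> carrier \<L>" using A S_one by auto
  ultimately show "\<exists>A\<subseteq>carrier \<L>. finite A \<and> K = Idl\<^bsub>\<L>\<^esub> A" using A(2) by blast
qed

lemma prime_saturation:
  assumes Q: "primeideal Q R" "Q \<inter> S = {}" shows "saturation S Q = Q"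
proof
  show "Q \<subseteq> saturation S Q" by (rule saturation_sub[OF S primeideal.axioms(1)[OF Q(1)]])
  show "saturation S Q \<subseteq> Q"
    using primeideal.I_prime[OF Q(1)] Q(2) S_carrier by (auto simp: saturation_def)
qed

lemma mem_ext_prime:
  assumes "primeideal Q R" "Q \<inter> S = {}" "a \<in> carrier R" "s \<in> S"
  shows "fr a s \<in> ext Q \<longleftrightarrow> a \<in> Q"
  using mem_ext[OF primeideal.axioms(1)[OF assms(1)] assms(3,4)] prime_saturation[OF assms(1,2)] by simp

lemma ext_prime:
  assumes Q: "primeideal Q R" "Q \<inter> S = {}" shows "primeideal (ext Q) \<L>"
proof (rule primeidealI)
  show "ideal (ext Q) \<L>" by (rule ext_ideal[OF primeideal.axioms(1)[OF Q(1)]])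
  show "cring \<L>" by (rule loc_cring)
  have "fr \<one> \<one> \<notin> ext Q" using mem_ext_prime[OF Q, of \<one> \<one>] primeideal_one_notin[OF Q(1)] S_one by simp
  moreover have "fr \<one> \<one> \<in> carrier \<L>" by (simp add: S_one)
  ultimately show "carrier \<L> \<noteq> ext Q" by blast
  fix x y assume xy: "x \<in> carrier \<L>" "y \<in> carrier \<L>" "x \<otimes>\<^bsub>\<L>\<^esub> y \<in> ext Q"
  obtain a s b t where a: "a \<in> carrier R" "s \<in> S" "x = fr a s" "b \<in> carrier R" "t \<in> S" "y = fr b t"
    using xy(1,2) unfolding loc_carrier by blast
  have "a \<otimes> b \<in> Q" using xy(3) a mem_ext_prime[OF Q, of "a \<otimes> b" "s \<otimes> t"] S_mult by (simp add: fract_mult)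
  then have "a \<in> Q \<or> b \<in> Q" using primeideal.I_prime[OF Q(1)] a by auto
  then show "x \<in> ext Q \<or> y \<in> ext Q" using mem_ext_prime[OF Q] a by auto
qed

lemma ext_chain:
  assumes ch: "prime_chain R Q d" and disj: "Q d \<inter> S = {}"
  shows "prime_chain \<L> (\<lambda>i. ext (Q i)) d"
  unfolding prime_chain_def
proof (intro conjI allI impI)
  have sub: "Q i \<inter> S = {}" if "i \<le> d" for i using prime_chain_mono[OF ch that order_refl] disj by auto
  have pr: "primeideal (Q i) R" if "i \<le> d" for i using ch that by (auto simp: prime_chain_def)
  show "primeideal (ext (Q i)) \<L>" if "i \<le> d" for i by (rule ext_prime[OF pr[OF that] sub[OF that]])
  fix i assume i: "i < d"
  then have st: "Q i \<subset> Q (Suc i)" using ch by (auto simp: prime_chain_def)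
  then obtain a where a: "a \<in> Q (Suc i)" "a \<notin> Q i" by auto
  have ac: "a \<in> carrier R" using a ideal_subset[OF primeideal.axioms(1)[OF pr[of "Suc i"]]] i by auto
  have "fr a \<one> \<in> ext (Q (Suc i))" "fr a \<one> \<notin> ext (Q i)"
    using mem_ext_prime[OF pr[of "Suc i"] sub[of "Suc i"] ac S_one] mem_ext_prime[OF pr[of i] sub[of i] ac S_one] a i
    by simp_all
  moreover have "ext (Q i) \<subseteq> ext (Q (Suc i))" using st by (auto simp: ext_def)
  ultimately show "ext (Q i) \<subset> ext (Q (Suc i))" by auto
qed

end

lemma localization_at: "primeideal p R \<Longrightarrow> localization R (carrier R - p)"
  using cring.submonoid_prime primeideal.axioms(2) by (intro localization.intro localization_axioms.intro) auto

lemma loc_ideal_ext: "primeideal p R \<Longrightarrow> loc_ideal R p I = localization.ext R (carrier R - p) I"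
proof -
  assume "primeideal p R"
  then interpret localization R "carrier R - p" by (rule localization_at)
  show ?thesis by (simp add: loc_ideal_def ext_def)
qed

lemma local_noeth_loc_at:
  assumes p: "primeideal p R" and N: "noetherian_ring R"
  shows "local_noeth (loc_at R p) (loc_ideal R p p)"
proof -
  interpret localization R "carrier R - p" by (rule localization_at[OF p])
  have d: "p \<inter> (carrier R - p) = {}" by auto
  interpret Ln: noetherian_ring \<L> by (rule ext_noetherian[OF N])
  have "local_noeth \<L> (ext p)"
  proof (intro local_noeth.intro noeth_cring.intro local_noeth_axioms.intro)
    show "cring \<L>" "noetherian_ring \<L>" by (rule loc_cring, rule ext_noetherian[OF N])
    show "primeideal (ext p) \<L>" by (rule ext_prime[OF p d])
    fix x assume x: "x \<in> carrier \<L>" "x \<notin> ext p"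
    then obtain a s where a: "a \<in> carrier R" "s \<in> carrier R - p" "x = fr a s" unfolding loc_carrier by blast
    then have "a \<notin> p" using x mem_ext_prime[OF p d] by auto
    then show "x \<in> Units \<L>" using a fract_unit by simp
  qed
  then show ?thesis using loc_ideal_ext[OF p] by (simp add: loc_at_def)
qed

text \<open>The hypotheses on \<open>ys\<close> and \<open>Q\<close> say, in terms of \<open>R\<close>, that \<open>R\<^sub>p / I\<^sub>p\<close> is regular. So is \<open>R\<^sub>p\<close>,
  and \<open>regular_quotient\<close> yields generators of \<open>I\<^sub>p\<close> whose initial segments generate primes not
  containing the next generator. Such a sequence is regular.\<close>

theorem rt_loc_ideal_if_regular_quotient:
  assumes reg: "regular_noetherian R" and p: "primeideal p R" and I: "ideal I R" "I \<subseteq> p"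
    and ys: "set ys \<subseteq> p" "\<And>g. g \<in> p \<Longrightarrow> \<exists>s\<in>carrier R - p. s \<otimes>\<^bsub>R\<^esub> g \<in> Idl\<^bsub>R\<^esub> (I \<union> set ys)"
    and Q: "prime_chain R Q (length ys)" "I \<subseteq> Q 0" "Q (length ys) \<subseteq> p"
  shows "rt_ideal (loc_at R p) (loc_ideal R p I) = 1"
proof -
  interpret localization R "carrier R - p" by (rule localization_at[OF p])
  let ?\<iota> = "\<lambda>a. fr a \<one>\<^bsub>R\<^esub>"
  have L: "loc_at R p = \<L>" by (simp add: loc_at_def)
  have N: "noetherian_ring R" and at: "regular_at R p" using reg p by (auto simp: regular_noetherian_def)
  have "local_noeth \<L> (ext p)" using local_noeth_loc_at[OF p N] loc_ideal_ext[OF p] by (simp add: L)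
  then interpret LN: local_noeth \<L> "ext p" .
  have pc: "p \<subseteq> carrier R" by (rule ideal_subset[OF primeideal.axioms(1)[OF p]])
  have Ic: "I \<subseteq> carrier R" using I pc by auto
  have extp: "ext (Idl\<^bsub>R\<^esub> A) = ext p"
    if A: "A \<subseteq> p" "\<And>g. g \<in> p \<Longrightarrow> \<exists>s\<in>carrier R - p. s \<otimes>\<^bsub>R\<^esub> g \<in> Idl\<^bsub>R\<^esub> A" for A
  proof
    have Ac: "A \<subseteq> carrier R" using A pc by auto
    have "Idl\<^bsub>R\<^esub> A \<subseteq> p" by (rule genideal_minimal[OF primeideal.axioms(1)[OF p] A(1)])
    then show "ext (Idl\<^bsub>R\<^esub> A) \<subseteq> ext p" by (auto simp: ext_def)
    show "ext p \<subseteq> ext (Idl\<^bsub>R\<^esub> A)"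
    proof
      fix x assume "x \<in> ext p"
      then obtain g s where g: "g \<in> p" "s \<in> carrier R - p" "x = fr g s" by (auto simp: ext_def)
      then have "g \<in> saturation (carrier R - p) (Idl\<^bsub>R\<^esub> A)" using A(2)[OF g(1)] pc by (auto simp: saturation_def)
      then show "x \<in> ext (Idl\<^bsub>R\<^esub> A)" using mem_ext[OF genideal_ideal[OF Ac], of g s] g pc by auto
    qed
  qed
  obtain ws P where ws: "set ws \<subseteq> p" "prime_chain R P (length ws)" "P (length ws) = p"
    and "\<forall>g\<in>p. \<exists>s\<in>carrier R - p. s \<otimes>\<^bsub>R\<^esub> g \<in> Idl\<^bsub>R\<^esub> (set ws)"
    using at unfolding regular_at_def by blast
  note wsg = this(4)[rule_format]
  define ws' where "ws' = map ?\<iota> ws"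
  define ys' where "ys' = map ?\<iota> ys"
  have ws'c: "set ws' \<subseteq> carrier \<L>" and ys'c: "set ys' \<subseteq> carrier \<L>"
    using ws(1) ys(1) pc S_one by (auto simp: ws'_def ys'_def)
  have ws'g: "Idl\<^bsub>\<L>\<^esub> (set ws') = ext p"
    using ext_genideal[of "set ws"] extp[OF ws(1) wsg] ws(1) pc by (auto simp: ws'_def)
  have ch1: "prime_chain \<L> (\<lambda>i. ext (P i)) (length ws')" "ext (P (length ws')) = ext p"
    using ext_chain[OF ws(2)] ws(3) by (auto simp: ws'_def)
  \<comment> \<open>regularity requires chains that end at \<open>p\<close> itself, so the last prime is replaced by \<open>p\<close>\<close>
  define Q' where "Q' = Q(length ys := p)"
  have Qch: "prime_chain R Q' (length ys)"
    unfolding prime_chain_def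
  proof (intro conjI allI impI)
    show "primeideal (Q' i) R" if "i \<le> length ys" for i using Q(1) p that by (auto simp: prime_chain_def Q'_def)
    fix i assume "i < length ys"
    then have "Q i \<subset> Q (Suc i)" using Q(1) by (auto simp: prime_chain_def)
    then show "Q' i \<subset> Q' (Suc i)"
      using Q(3) \<open>i < length ys\<close> by (cases "Suc i = length ys") (auto simp: Q'_def)
  qed
  have IQ: "I \<subseteq> Q' 0" using Q(2) I(2) by (auto simp: Q'_def)
  have ch2: "prime_chain \<L> (\<lambda>i. ext (Q' i)) (length ys')" "ext (Q' (length ys')) = ext p"
    using ext_chain[OF Qch] by (auto simp: ys'_def Q'_def)
  have Ii: "?\<iota> ` I \<subseteq> carrier \<L>"
  proof (rule image_subsetI)
    show "?\<iota> a \<in> carrier \<L>" if "a \<in> I" for a by (rule fract_carrier[OF _ S_one]) (use that Ic in auto)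
  qed
  have "Idl\<^bsub>\<L>\<^esub> (ext I \<union> set ys') = Idl\<^bsub>\<L>\<^esub> (?\<iota> ` (I \<union> set ys))"
    using L.genideal_Un_genideal[OF Ii ys'c] ext_genideal[OF Ic] genideal_of_ideal[OF I(1)]
    by (simp add: ys'_def image_Un)
  also have "\<dots> = ext p"
    using ext_genideal[of "I \<union> set ys"] extp[of "I \<union> set ys"] ys I(2) order_trans[OF ys(1) pc] Ic by simp
  finally have ys'g: "Idl\<^bsub>\<L>\<^esub> (ext I \<union> set ys') = ext p" .
  have ext_mono: "ext I \<subseteq> ext (Q' 0)" using IQ by (auto simp: ext_def)
  obtain zs where zs: "set zs \<subseteq> ext I" "ext I = Idl\<^bsub>\<L>\<^esub> (set zs)"
    "\<And>i. i < length zs \<Longrightarrow> primeideal (Idl\<^bsub>\<L>\<^esub> (set (take i zs))) \<L> \<and> zs ! i \<notin> Idl\<^bsub>\<L>\<^esub> (set (take i zs))"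
    using LN.regular_quotient[OF ws'c ws'g ch1 ext_ideal[OF I(1)] ys'c ys'g ch2 ext_mono] by blast
  have zc: "set zs \<subseteq> carrier \<L>" using zs(1) L.ideal_subset[OF ext_ideal[OF I(1)]] by auto
  have "rt_ideal \<L> (Idl\<^bsub>\<L>\<^esub> (set zs)) = 1"
  proof (rule L.rt_ideal_regular_sequence[OF zc])
    fix i x assume i: "i < length zs" and x: "x \<in> carrier \<L>" "zs ! i \<otimes>\<^bsub>\<L>\<^esub> x \<in> Idl\<^bsub>\<L>\<^esub> (set (take i zs))"
    have "zs ! i \<in> carrier \<L>" using zc i nth_mem by blast
    moreover have "primeideal (Idl\<^bsub>\<L>\<^esub> (set (take i zs))) \<L>" using zs(3)[OF i] ..
    ultimately show "x \<in> Idl\<^bsub>\<L>\<^esub> (set (take i zs))"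
      using primeideal.I_prime[of _ \<L> "zs ! i" x] x zs(3)[OF i] by metis
  qed
  then show ?thesis using zs(2) loc_ideal_ext[OF p] by (simp add: L)
qed

section \<open>Regular local quotients of localizations\<close>

text \<open>A characterization of \<open>T\<close> as \<open>R\<^sub>p / I\<^sub>p\<close>, with \<open>\<theta>\<close> the canonical map. Local rings of schemes are
  stalks and not literally rings of fractions, but satisfy this.\<close>

definition localization_map ::
  "('a, 'm) ring_scheme \<Rightarrow> 'a set \<Rightarrow> 'a set \<Rightarrow> ('b, 'n) ring_scheme \<Rightarrow> ('a \<Rightarrow> 'b) \<Rightarrow> bool" where
  "localization_map R I p T \<theta> \<longleftrightarrow> \<theta> \<in> ring_hom R T \<and>
     (\<forall>B\<in>carrier T. \<exists>a\<in>carrier R. \<exists>s\<in>carrier R - p. \<theta> s \<otimes>\<^bsub>T\<^esub> B = \<theta> a) \<and>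
     (\<forall>a\<in>carrier R. \<theta> a = \<zero>\<^bsub>T\<^esub> \<longleftrightarrow> (\<exists>s\<in>carrier R - p. s \<otimes>\<^bsub>R\<^esub> a \<in> I)) \<and>
     (\<forall>s\<in>carrier R - p. \<theta> s \<in> Units T)"

lemma krull_dim_attained:
  assumes "krull_dim T = enat n" "primeideal Q0 T"
  shows "\<exists>Q. prime_chain T Q n"
proof -
  define D where "D = {enat n |n. \<exists>P. prime_chain T P n}"
  have dim: "Sup D = enat n" using assms(1) by (simp add: krull_dim_def D_def prime_chain_def)
  have "prime_chain T (\<lambda>_. Q0) 0" using assms(2) by (simp add: prime_chain_def)
  then have ne: "D \<noteq> {}" by (auto simp: D_def)
  then have "finite D" "Sup D = Max D" using dim by (auto simp: Sup_enat_def split: if_splits)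
  then have "enat n \<in> D" using Max_in[OF _ ne] dim by simp
  then show ?thesis by (auto simp: D_def)
qed

lemma (in noeth_cring) proper_ideal_in_maximal:
  assumes "ideal J R" "J \<noteq> carrier R"
  shows "\<exists>m. maximalideal m R \<and> J \<subseteq> m"
proof -
  obtain m where m: "ideal m R \<and> J \<subseteq> m \<and> m \<noteq> carrier R"
    "\<And>K. ideal K R \<and> J \<subseteq> K \<and> K \<noteq> carrier R \<Longrightarrow> m \<subseteq> K \<Longrightarrow> K = m"
    by (rule ideal_maximal[of "\<lambda>K. ideal K R \<and> J \<subseteq> K \<and> K \<noteq> carrier R" J]) (use assms in auto)
  have "maximalideal m R"
  proof (rule maximalidealI)
    fix K assume K: "ideal K R" "m \<subseteq> K" "K \<subseteq> carrier R"
    show "K = m \<or> K = carrier R"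
    proof (cases "K = carrier R")
      case False
      then have "ideal K R \<and> J \<subseteq> K \<and> K \<noteq> carrier R" using K m(1) by blast
      then show ?thesis using m(2)[OF _ K(2)] by blast
    qed simp
  qed (use m(1) in auto)
  then show ?thesis using m(1) by blast
qed

lemma (in cring) unit_notin_proper_ideal:
  assumes "ideal J R" "J \<noteq> carrier R" "u \<in> Units R" shows "u \<notin> J"
proof
  assume "u \<in> J"
  then have "inv u \<otimes> u \<in> J" using ideal.I_l_closed[OF assms(1)] assms(3) Units_inv_closed by blast
  then have "\<one> \<in> J" using assms(3) by (simp only: Units_l_inv)
  then show False using assms(2) ideal.one_imp_carrier[OF assms(1)] by blast
qed

text \<open>The generators of the maximal ideal of \<open>T\<close> become values of \<open>\<theta>\<close> after multiplication by units,
  and a maximal chain of primes of \<open>T\<close> is contracted along \<open>\<theta>\<close>. To see that the resulting \<open>ys\<close>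
  generate \<open>p\<close> locally modulo \<open>I\<close>, one passes to \<open>T\<close>, where \<open>K W\<close> below is the extension of the
  ideal \<open>W\<close>, and clears denominators.\<close>

lemma regular_presentation:
  assumes R: "cring R" and I: "ideal I R" "I \<subseteq> p" and p: "primeideal p R"
    and T: "regular_local_ring T" and \<theta>: "localization_map R I p T \<theta>"
  shows "\<exists>ys Q. set ys \<subseteq> p \<and> (\<forall>g\<in>p. \<exists>s\<in>carrier R - p. s \<otimes>\<^bsub>R\<^esub> g \<in> Idl\<^bsub>R\<^esub> (I \<union> set ys)) \<and>
    prime_chain R Q (length ys) \<and> I \<subseteq> Q 0 \<and> Q (length ys) \<subseteq> p"
proof -
  interpret R: cring R by fact
  interpret T: noeth_cring T
    using T by (intro noeth_cring.intro) (auto simp: regular_local_ring_def local_ring_def)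
  interpret p: primeideal p R by fact
  have hom: "\<theta> \<in> ring_hom R T"
    and frac: "\<And>B. B \<in> carrier T \<Longrightarrow> \<exists>a\<in>carrier R. \<exists>s\<in>carrier R - p. \<theta> s \<otimes>\<^bsub>T\<^esub> B = \<theta> a"
    and ker: "\<And>a. a \<in> carrier R \<Longrightarrow> \<theta> a = \<zero>\<^bsub>T\<^esub> \<longleftrightarrow> (\<exists>s\<in>carrier R - p. s \<otimes>\<^bsub>R\<^esub> a \<in> I)"
    and unit: "\<And>s. s \<in> carrier R - p \<Longrightarrow> \<theta> s \<in> Units T"
    using \<theta> unfolding localization_map_def by blast+
  interpret h: ring_hom_ring R T \<theta> by (rule ring_hom_ringI2[OF R.ring_axioms T.ring_axioms hom])
  have Sm: "s \<otimes>\<^bsub>R\<^esub> t \<in> carrier R - p" if "s \<in> carrier R - p" "t \<in> carrier R - p" for s t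
    using that p.I_prime[of s t] by auto
  have S1: "\<one>\<^bsub>R\<^esub> \<in> carrier R - p" using R.primeideal_one_notin[OF p] by auto
  have Ic: "I \<subseteq> carrier R" by (rule R.ideal_subset[OF I(1)])
  have eqT: "\<exists>u\<in>carrier R - p. u \<otimes>\<^bsub>R\<^esub> (a \<ominus>\<^bsub>R\<^esub> b) \<in> I" if "a \<in> carrier R" "b \<in> carrier R" "\<theta> a = \<theta> b" for a b
  proof -
    have "\<theta> (a \<ominus>\<^bsub>R\<^esub> b) = \<zero>\<^bsub>T\<^esub>" using that by (simp add: R.minus_eq T.r_neg)
    then show ?thesis using ker[of "a \<ominus>\<^bsub>R\<^esub> b"] that by simp
  qed
  define K where "K W = {B \<in> carrier T. \<exists>s\<in>carrier R - p. \<exists>a\<in>W. \<theta> s \<otimes>\<^bsub>T\<^esub> B = \<theta> a}" for W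
  have Kideal: "ideal (K W) T" if W: "ideal W R" for W
  proof (rule idealI[OF T.ring_axioms])
    interpret W: ideal W R by fact
    note Wadd = additive_subgroup.a_closed[OF W.is_additive_subgroup]
    show "subgroup (K W) (add_monoid T)"
    proof
      show "K W \<subseteq> carrier (add_monoid T)" by (auto simp: K_def)
      have "\<theta> \<one>\<^bsub>R\<^esub> \<otimes>\<^bsub>T\<^esub> \<zero>\<^bsub>T\<^esub> = \<theta> \<zero>\<^bsub>R\<^esub>" by simp
      then have "\<zero>\<^bsub>T\<^esub> \<in> K W" unfolding K_def
        using S1 additive_subgroup.zero_closed[OF W.is_additive_subgroup] T.zero_closed by blast
      then show "\<one>\<^bsub>add_monoid T\<^esub> \<in> K W" by simp
      fix B assume "B \<in> K W"
      then obtain s a where B: "B \<in> carrier T" "s \<in> carrier R - p" "a \<in> W" "\<theta> s \<otimes>\<^bsub>T\<^esub> B = \<theta> a" by (auto simp: K_def)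
      have sc: "s \<in> carrier R" "a \<in> carrier R" using B W.a_subset by auto
      have "\<theta> s \<otimes>\<^bsub>T\<^esub> (\<ominus>\<^bsub>T\<^esub> B) = \<theta> (\<ominus>\<^bsub>R\<^esub> a)" using B sc by (simp add: T.r_minus)
      moreover have "\<ominus>\<^bsub>R\<^esub> a \<in> W" using B(3) by simp
      ultimately have "\<ominus>\<^bsub>T\<^esub> B \<in> K W" unfolding K_def using B by blast
      then show "inv\<^bsub>add_monoid T\<^esub> B \<in> K W" by (simp add: a_inv_def)
      fix C assume "C \<in> K W"
      then obtain t b where C: "C \<in> carrier T" "t \<in> carrier R - p" "b \<in> W" "\<theta> t \<otimes>\<^bsub>T\<^esub> C = \<theta> b" by (auto simp: K_def)
      have tc: "t \<in> carrier R" "b \<in> carrier R" using C W.a_subset by auto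
      have d: "\<theta> s \<in> carrier T" "\<theta> t \<in> carrier T" "\<theta> a \<in> carrier T" "\<theta> b \<in> carrier T" using sc tc by auto
      have "(\<theta> s \<otimes>\<^bsub>T\<^esub> \<theta> t) \<otimes>\<^bsub>T\<^esub> (B \<oplus>\<^bsub>T\<^esub> C)
          = \<theta> t \<otimes>\<^bsub>T\<^esub> (\<theta> s \<otimes>\<^bsub>T\<^esub> B) \<oplus>\<^bsub>T\<^esub> \<theta> s \<otimes>\<^bsub>T\<^esub> (\<theta> t \<otimes>\<^bsub>T\<^esub> C)"
        using d(1,2) B(1) C(1) by algebra
      also have "\<dots> = \<theta> t \<otimes>\<^bsub>T\<^esub> \<theta> a \<oplus>\<^bsub>T\<^esub> \<theta> s \<otimes>\<^bsub>T\<^esub> \<theta> b" using B(4) C(4) by simp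
      finally have "\<theta> (s \<otimes>\<^bsub>R\<^esub> t) \<otimes>\<^bsub>T\<^esub> (B \<oplus>\<^bsub>T\<^esub> C) = \<theta> (t \<otimes>\<^bsub>R\<^esub> a \<oplus>\<^bsub>R\<^esub> s \<otimes>\<^bsub>R\<^esub> b)" using sc tc by simp
      moreover have "t \<otimes>\<^bsub>R\<^esub> a \<oplus>\<^bsub>R\<^esub> s \<otimes>\<^bsub>R\<^esub> b \<in> W" using B C sc tc W.I_l_closed Wadd by auto
      ultimately have "B \<oplus>\<^bsub>T\<^esub> C \<in> K W" unfolding K_def using Sm[OF B(2) C(2)] B(1) C(1) by blast
      then show "B \<otimes>\<^bsub>add_monoid T\<^esub> C \<in> K W" by simp
    qed
    fix B C assume "B \<in> K W" and Cc: "C \<in> carrier T"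
    then obtain s a where B: "B \<in> carrier T" "s \<in> carrier R - p" "a \<in> W" "\<theta> s \<otimes>\<^bsub>T\<^esub> B = \<theta> a" by (auto simp: K_def)
    obtain b t where C: "b \<in> carrier R" "t \<in> carrier R - p" "\<theta> t \<otimes>\<^bsub>T\<^esub> C = \<theta> b" using frac[OF Cc] by blast
    have c: "s \<in> carrier R" "t \<in> carrier R" "a \<in> carrier R" using B C W.a_subset by auto
    have d: "\<theta> s \<in> carrier T" "\<theta> t \<in> carrier T" using c by auto
    have "(\<theta> t \<otimes>\<^bsub>T\<^esub> \<theta> s) \<otimes>\<^bsub>T\<^esub> (C \<otimes>\<^bsub>T\<^esub> B) = (\<theta> t \<otimes>\<^bsub>T\<^esub> C) \<otimes>\<^bsub>T\<^esub> (\<theta> s \<otimes>\<^bsub>T\<^esub> B)"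
      using d B(1) Cc by algebra
    then have "\<theta> (t \<otimes>\<^bsub>R\<^esub> s) \<otimes>\<^bsub>T\<^esub> (C \<otimes>\<^bsub>T\<^esub> B) = \<theta> (b \<otimes>\<^bsub>R\<^esub> a)" using B(4) C c by simp
    moreover have "b \<otimes>\<^bsub>R\<^esub> a \<in> W" using B C W.I_l_closed by auto
    ultimately show "C \<otimes>\<^bsub>T\<^esub> B \<in> K W" unfolding K_def using Sm[OF C(2) B(2)] B(1) Cc by blast
    then show "B \<otimes>\<^bsub>T\<^esub> C \<in> K W" using B(1) Cc by (simp add: T.m_comm)
  qed
  have thetaK: "\<theta> a \<in> K W" if "a \<in> W" "ideal W R" for a W
  proof -
    have "a \<in> carrier R" using that R.ideal_subset by auto
    then have "\<theta> \<one>\<^bsub>R\<^esub> \<otimes>\<^bsub>T\<^esub> \<theta> a = \<theta> a" "\<theta> a \<in> carrier T" by simp_all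
    then show ?thesis unfolding K_def using S1 that by blast
  qed
  define m where "m = max_ideal T"
  have ex1: "\<exists>!m. maximalideal m T" using T by (simp add: regular_local_ring_def local_ring_def)
  have m: "maximalideal m T" unfolding m_def max_ideal_def by (rule theI'[OF ex1])
  interpret m: maximalideal m T by (rule m)
  have mprime: "primeideal m T" by (rule T.maximalideal_prime[OF m])
  have unitm: "u \<notin> m" if "u \<in> Units T" for u
    using T.unit_notin_proper_ideal[OF m.is_ideal _ that] m.I_notcarr by auto
  have "K p \<noteq> carrier T"
  proof
    assume "K p = carrier T"
    then have "\<one>\<^bsub>T\<^esub> \<in> K p" by simp
    then obtain s a where s: "s \<in> carrier R - p" "a \<in> p" "\<theta> s \<otimes>\<^bsub>T\<^esub> \<one>\<^bsub>T\<^esub> = \<theta> a" by (auto simp: K_def)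
    have c: "s \<in> carrier R" "a \<in> carrier R" using s by auto
    have "\<theta> s = \<theta> a" using s c by simp
    then obtain u where u: "u \<in> carrier R - p" "u \<otimes>\<^bsub>R\<^esub> (s \<ominus>\<^bsub>R\<^esub> a) \<in> I" using eqT c by blast
    then have "s \<ominus>\<^bsub>R\<^esub> a \<in> p" using p.I_prime[of u "s \<ominus>\<^bsub>R\<^esub> a"] I(2) c by auto
    then have "(s \<ominus>\<^bsub>R\<^esub> a) \<oplus>\<^bsub>R\<^esub> a \<in> p" using s by auto
    moreover have "(s \<ominus>\<^bsub>R\<^esub> a) \<oplus>\<^bsub>R\<^esub> a = s" using c by (simp add: R.minus_eq R.a_assoc R.l_neg)
    ultimately show False using s by simp
  qed
  then obtain m' where "maximalideal m' T" "K p \<subseteq> m'"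
    using T.proper_ideal_in_maximal[OF Kideal[OF p.is_ideal]] by blast
  then have Km: "K p \<subseteq> m" using ex1 m by blast
  have thp: "\<theta> g \<in> m" if "g \<in> p" for g using thetaK[OF that p.is_ideal] Km by auto
  obtain fs where fs: "set fs \<subseteq> carrier T" "enat (length fs) = krull_dim T" "Idl\<^bsub>T\<^esub> (set fs) = m"
    using T by (auto simp: regular_local_ring_def m_def)
  obtain QT where QT: "prime_chain T QT (length fs)" using krull_dim_attained[OF fs(2)[symmetric] mprime] by blast
  define Q where "Q i = {a \<in> carrier R. \<theta> a \<in> QT i}" for i
  have QTp: "primeideal (QT i) T" if "i \<le> length fs" for i using QT that by (auto simp: prime_chain_def)
  have QTu: "u \<notin> QT i" if "u \<in> Units T" "i \<le> length fs" for u i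
    using T.unit_notin_proper_ideal[OF primeideal.axioms(1)[OF QTp[OF that(2)]] _ that(1)]
      primeideal.I_notcarr[OF QTp[OF that(2)]] by auto
  have Qch: "prime_chain R Q (length fs)"
    unfolding prime_chain_def
  proof (intro conjI allI impI)
    show "primeideal (Q i) R" if "i \<le> length fs" for i
      unfolding Q_def by (rule h.primeideal_preimage[OF R QTp[OF that]])
    fix i assume i: "i < length fs"
    then have sub: "QT i \<subset> QT (Suc i)" using QT by (auto simp: prime_chain_def)
    then obtain B where B: "B \<in> QT (Suc i)" "B \<notin> QT i" by auto
    have Bc: "B \<in> carrier T" using B T.ideal_subset[OF primeideal.axioms(1)[OF QTp[of "Suc i"]]] i by auto
    then obtain a s where a: "a \<in> carrier R" "s \<in> carrier R - p" "\<theta> s \<otimes>\<^bsub>T\<^esub> B = \<theta> a" using frac by blast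
    have sT: "\<theta> s \<in> carrier T" using a(2) by simp
    have "\<theta> a \<in> QT (Suc i)" unfolding a(3)[symmetric]
      using ideal.I_l_closed[OF primeideal.axioms(1)[OF QTp[of "Suc i"]] B(1) sT] i by simp
    moreover have "\<theta> a \<notin> QT i"
    proof
      assume "\<theta> a \<in> QT i"
      then have "\<theta> s \<otimes>\<^bsub>T\<^esub> B \<in> QT i" using a by simp
      then have "\<theta> s \<in> QT i" using primeideal.I_prime[OF QTp[of i], of "\<theta> s" B] i a Bc B by auto
      then show False using QTu[OF unit[OF a(2)], of i] i by auto
    qed
    ultimately show "Q i \<subset> Q (Suc i)" using sub a by (auto simp: Q_def)
  qed
  have IQ: "I \<subseteq> Q 0"
  proof
    fix a assume a: "a \<in> I"
    then have ac: "a \<in> carrier R" using Ic by auto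
    have "\<one>\<^bsub>R\<^esub> \<otimes>\<^bsub>R\<^esub> a \<in> I" using a ac by simp
    then have "\<theta> a = \<zero>\<^bsub>T\<^esub>" using ker[OF ac] S1 by blast
    then show "a \<in> Q 0" using ac additive_subgroup.zero_closed[OF ideal.axioms(1)[OF primeideal.axioms(1)[OF QTp[of 0]]]]
      by (simp add: Q_def)
  qed
  have Qp: "Q (length fs) \<subseteq> p" using QTu[OF unit] by (auto simp: Q_def)
  have "\<exists>y. y \<in> p \<and> (\<exists>s\<in>carrier R - p. \<theta> s \<otimes>\<^bsub>T\<^esub> f = \<theta> y)" if f: "f \<in> set fs" for f
  proof -
    have fm: "f \<in> m" using f fs T.mem_genideal by auto
    obtain y s where y: "y \<in> carrier R" "s \<in> carrier R - p" "\<theta> s \<otimes>\<^bsub>T\<^esub> f = \<theta> y" using frac f fs(1) by blast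
    have "\<theta> s \<in> carrier T" using y(2) by simp
    then have "\<theta> y \<in> m" unfolding y(3)[symmetric] by (rule m.I_l_closed[OF fm])
    then have "y \<in> p" using unit[of y] unitm y by auto
    then show ?thesis using y by blast
  qed
  then obtain Y where Y: "\<And>f. f \<in> set fs \<Longrightarrow> Y f \<in> p \<and> (\<exists>s\<in>carrier R - p. \<theta> s \<otimes>\<^bsub>T\<^esub> f = \<theta> (Y f))" by metis
  define ys where "ys = map Y fs"
  have ysp: "set ys \<subseteq> p" using Y by (auto simp: ys_def)
  define W where "W = Idl\<^bsub>R\<^esub> (I \<union> set ys)"
  have Wc: "I \<union> set ys \<subseteq> carrier R" using Ic ysp p.a_subset by auto
  have Wi: "ideal W R" unfolding W_def by (rule R.genideal_ideal[OF Wc])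
  interpret W: ideal W R by (rule Wi)
  have "set fs \<subseteq> K W"
  proof
    fix f assume f: "f \<in> set fs"
    have "Y f \<in> W" unfolding W_def using R.mem_genideal[OF Wc] f by (auto simp: ys_def)
    then show "f \<in> K W" unfolding K_def using Y[OF f] f fs(1) by blast
  qed
  then have mK: "m \<subseteq> K W" using T.genideal_minimal[OF Kideal[OF Wi]] fs(3) by blast
  have "\<exists>s\<in>carrier R - p. s \<otimes>\<^bsub>R\<^esub> g \<in> W" if g: "g \<in> p" for g
  proof -
    have "\<theta> g \<in> K W" using thp[OF g] mK by auto
    then obtain s a where s: "s \<in> carrier R - p" "a \<in> W" "\<theta> s \<otimes>\<^bsub>T\<^esub> \<theta> g = \<theta> a" by (auto simp: K_def)
    have c: "s \<in> carrier R" "a \<in> carrier R" "g \<in> carrier R" using s g W.a_subset by auto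
    have "\<theta> (s \<otimes>\<^bsub>R\<^esub> g) = \<theta> a" using s(3) c by simp
    then obtain u where u: "u \<in> carrier R - p" "u \<otimes>\<^bsub>R\<^esub> (s \<otimes>\<^bsub>R\<^esub> g \<ominus>\<^bsub>R\<^esub> a) \<in> I" using eqT[of "s \<otimes>\<^bsub>R\<^esub> g" a] c by auto
    have uc: "u \<in> carrier R" using u by simp
    have "u \<otimes>\<^bsub>R\<^esub> (s \<otimes>\<^bsub>R\<^esub> g \<ominus>\<^bsub>R\<^esub> a) \<in> W" using u(2) R.mem_genideal[OF Wc] by (auto simp: W_def)
    moreover have "u \<otimes>\<^bsub>R\<^esub> a \<in> W" using s(2) uc W.I_l_closed by auto
    ultimately have "u \<otimes>\<^bsub>R\<^esub> (s \<otimes>\<^bsub>R\<^esub> g \<ominus>\<^bsub>R\<^esub> a) \<oplus>\<^bsub>R\<^esub> u \<otimes>\<^bsub>R\<^esub> a \<in> W"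
      using additive_subgroup.a_closed[OF W.is_additive_subgroup] by auto
    moreover have "u \<otimes>\<^bsub>R\<^esub> (s \<otimes>\<^bsub>R\<^esub> g \<ominus>\<^bsub>R\<^esub> a) \<oplus>\<^bsub>R\<^esub> u \<otimes>\<^bsub>R\<^esub> a = (u \<otimes>\<^bsub>R\<^esub> s) \<otimes>\<^bsub>R\<^esub> g" using uc c by algebra
    ultimately show ?thesis using Sm[OF u(1) s(1)] by auto
  qed
  moreover have "prime_chain R Q (length ys)" "Q (length ys) \<subseteq> p" using Qch Qp by (simp_all add: ys_def)
  ultimately show ?thesis using ysp IQ unfolding W_def by blast
qed

theorem rt_of_regular_presentation:
  assumes "field k" "ideal I (mpoly_ring k n)" "primeideal p (mpoly_ring k n)" "I \<subseteq> p"
    "regular_local_ring T" "localization_map (mpoly_ring k n) I p T \<theta>"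
  shows "rt_ideal (loc_at (mpoly_ring k n) p) (loc_ideal (mpoly_ring k n) p I) = 1"
proof -
  have reg: "regular_noetherian (mpoly_ring k n)" by (rule mpoly_regular_noetherian[OF assms(1)])
  then have "cring (mpoly_ring k n)" by (simp add: regular_noetherian_def)
  from regular_presentation[OF this assms(2,4,3,5,6)] show ?thesis
    using rt_loc_ideal_if_regular_quotient[OF reg assms(3,2,4)] by blast
qed

section \<open>Stalks of sheaves of rings\<close>

text \<open>For stalks the ring axioms are not verified directly: only the closure of the carrier is, and
  the axioms are carried over along a comparison map.\<close>

lemma ring_iso_transport:
  assumes h: "h \<in> ring_iso S T" and h0: "h \<zero>\<^bsub>S\<^esub> = \<zero>\<^bsub>T\<^esub>" and T: "cring T"
    and closed: "\<one>\<^bsub>S\<^esub> \<in> carrier S" "\<zero>\<^bsub>S\<^esub> \<in> carrier S"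
      "\<And>x y. x \<in> carrier S \<Longrightarrow> y \<in> carrier S \<Longrightarrow> x \<otimes>\<^bsub>S\<^esub> y \<in> carrier S"
      "\<And>x y. x \<in> carrier S \<Longrightarrow> y \<in> carrier S \<Longrightarrow> x \<oplus>\<^bsub>S\<^esub> y \<in> carrier S"
  shows "cring S"
proof -
  interpret T: cring T by fact
  note hE = ring_iso_memE[OF h]
  define g where "g = inv_into (carrier S) h"
  have bij: "bij_betw g (carrier T) (carrier S)" unfolding g_def by (rule bij_betw_inv_into[OF hE(5)])
  have g: "g x \<in> carrier S" "h (g x) = x" if "x \<in> carrier T" for x
    using that hE(5) by (auto simp: g_def bij_betw_def inv_into_into f_inv_into_f)
  have gh: "g (h x) = x" if "x \<in> carrier S" for x
    using that hE(5) by (auto simp: g_def bij_betw_def)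
  have "g \<in> ring_iso T S"
  proof (rule ring_iso_memI[OF g(1) _ _ _ bij])
    show "g (x \<otimes>\<^bsub>T\<^esub> y) = g x \<otimes>\<^bsub>S\<^esub> g y" if "x \<in> carrier T" "y \<in> carrier T" for x y
      using gh[of "g x \<otimes>\<^bsub>S\<^esub> g y"] hE(2)[of "g x" "g y"] g that closed(3) by simp
    show "g (x \<oplus>\<^bsub>T\<^esub> y) = g x \<oplus>\<^bsub>S\<^esub> g y" if "x \<in> carrier T" "y \<in> carrier T" for x y
      using gh[of "g x \<oplus>\<^bsub>S\<^esub> g y"] hE(3)[of "g x" "g y"] g that closed(4) by simp
    show "g \<one>\<^bsub>T\<^esub> = \<one>\<^bsub>S\<^esub>" using gh[of "\<one>\<^bsub>S\<^esub>"] hE(4) closed(1) by simp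
  qed
  then have "cring (S\<lparr>zero := g \<zero>\<^bsub>T\<^esub>\<rparr>)" by (rule T.ring_iso_imp_img_cring)
  moreover have "g \<zero>\<^bsub>T\<^esub> = \<zero>\<^bsub>S\<^esub>" using gh[of "\<zero>\<^bsub>S\<^esub>"] h0 closed(2) by simp
  ultimately show ?thesis by simp
qed

lemma maximalideal_preimage:
  assumes h: "h \<in> ring_iso S T" and S: "cring S" and T: "cring T" and m: "maximalideal m T"
  shows "maximalideal {x \<in> carrier S. h x \<in> m} S"
proof -
  interpret S: cring S by fact
  interpret T: cring T by fact
  interpret m: maximalideal m T by fact
  note hE = ring_iso_memE[OF h]
  interpret h: ring_hom_ring S T h
    by (rule ring_hom_ringI2[OF S.ring_axioms T.ring_axioms]) (use h in \<open>simp add: ring_iso_def\<close>)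
  have surj: "h ` carrier S = carrier T" and inj: "inj_on h (carrier S)" using hE(5) by (auto simp: bij_betw_def)
  show ?thesis
  proof (rule maximalidealI)
    show "ideal {x \<in> carrier S. h x \<in> m} S" by (rule h.ideal_vimage[OF m.is_ideal])
    have "\<one>\<^bsub>T\<^esub> \<notin> m" using m.I_notcarr m.one_imp_carrier by auto
    then have "\<one>\<^bsub>S\<^esub> \<notin> {x \<in> carrier S. h x \<in> m}" by simp
    then show "carrier S \<noteq> {x \<in> carrier S. h x \<in> m}" using S.one_closed by blast
    fix J assume J: "ideal J S" "{x \<in> carrier S. h x \<in> m} \<subseteq> J" "J \<subseteq> carrier S"
    have hJ: "ideal (h ` J) T" by (rule h.ideal_image[OF J(1) surj])
    have "m \<subseteq> h ` J"
    proof
      fix y assume y: "y \<in> m"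
      then obtain x where "x \<in> carrier S" "y = h x" using surj m.a_subset by blast
      then show "y \<in> h ` J" using J(2) y by blast
    qed
    moreover have "h ` J \<subseteq> carrier T" using J(3) surj by blast
    ultimately have "h ` J = m \<or> h ` J = carrier T" using m.I_maximal[OF hJ] by blast
    then show "J = {x \<in> carrier S. h x \<in> m} \<or> J = carrier S"
    proof
      assume "h ` J = m"
      then show ?thesis using J by blast
    next
      assume e: "h ` J = carrier T"
      have "carrier S \<subseteq> J"
      proof
        fix x assume x: "x \<in> carrier S"
        then have "h x \<in> h ` J" using e surj by blast
        then obtain x' where "x' \<in> J" "h x = h x'" by blast
        then show "x \<in> J" using inj_onD[OF inj, of x x'] x J(3) by blast
      qed
      then show ?thesis using J(3) by blast
    qed
  qed
qed

lemma ring_iso_inv: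
  assumes "h \<in> ring_iso S T" "cring S"
  shows "inv_into (carrier S) h \<in> ring_iso T S"
  using ring_iso_set_sym[OF _ assms(1)] assms(2) cring.axioms(1) by blast

lemma local_ring_transport:
  assumes h: "h \<in> ring_iso S T" and S: "cring S" and T: "local_ring T"
  shows "local_ring S" "max_ideal S = {x \<in> carrier S. h x \<in> max_ideal T}"
proof -
  have Tc: "cring T" and ex1: "\<exists>!m. maximalideal m T" using T by (auto simp: local_ring_def)
  define m where "m = max_ideal T"
  have m: "maximalideal m T" unfolding m_def max_ideal_def by (rule theI'[OF ex1])
  let ?m = "{x \<in> carrier S. h x \<in> m}"
  have m': "maximalideal ?m S" by (rule maximalideal_preimage[OF h S Tc m])
  let ?g = "inv_into (carrier S) h"
  have bij: "bij_betw h (carrier S) (carrier T)" using h by (simp add: ring_iso_def)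
  have uniq: "n = ?m" if n: "maximalideal n S" for n
  proof -
    have "maximalideal {y \<in> carrier T. ?g y \<in> n} T"
      by (rule maximalideal_preimage[OF ring_iso_inv[OF h S] Tc S n])
    then have e: "{y \<in> carrier T. ?g y \<in> n} = m" using ex1 m by blast
    have nc: "n \<subseteq> carrier S" using n by (meson additive_subgroup.a_subset ideal.axioms(1) maximalideal.axioms(1))
    have "x \<in> n \<longleftrightarrow> h x \<in> m" if x: "x \<in> carrier S" for x
    proof -
      have "?g (h x) = x" "h x \<in> carrier T" using bij x by (auto simp: bij_betw_def)
      then show ?thesis unfolding e[symmetric] by simp
    qed
    then show ?thesis using nc by blast
  qed
  show "local_ring S" unfolding local_ring_def using S m' uniq by blast
  show "max_ideal S = {x \<in> carrier S. h x \<in> max_ideal T}"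
    unfolding max_ideal_def[of S] m_def[symmetric] by (rule the_equality) (use m' uniq in blast)+
qed

text \<open>The part of the structure of a ringed space that determines its stalks.\<close>

locale ring_presheaf =
  fixes X :: "('x, 's) rspace"
  assumes sections_cring: "is_open X U \<Longrightarrow> cring (sections X U)"
    and restr_hom: "\<lbrakk>is_open X U; is_open X V; V \<subseteq> U\<rbrakk>
          \<Longrightarrow> restr X U V \<in> ring_hom (sections X U) (sections X V)"
    and restr_id: "\<lbrakk>is_open X U; s \<in> carrier (sections X U)\<rbrakk> \<Longrightarrow> restr X U U s = s"
    and restr_restr: "\<lbrakk>is_open X U; is_open X V; is_open X W; W \<subseteq> V; V \<subseteq> U;
            s \<in> carrier (sections X U)\<rbrakk> \<Longrightarrow> restr X V W (restr X U V s) = restr X U W s"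
begin

lemma restr_closed:
  "\<lbrakk>is_open X U; is_open X V; V \<subseteq> U; s \<in> carrier (sections X U)\<rbrakk> \<Longrightarrow> restr X U V s \<in> carrier (sections X V)"
  by (rule ring_hom_closed[OF restr_hom])

lemma restr_mult:
  "\<lbrakk>is_open X U; is_open X V; V \<subseteq> U; s \<in> carrier (sections X U); t \<in> carrier (sections X U)\<rbrakk> \<Longrightarrow>
    restr X U V (s \<otimes>\<^bsub>sections X U\<^esub> t) = restr X U V s \<otimes>\<^bsub>sections X V\<^esub> restr X U V t"
  by (rule ring_hom_mult[OF restr_hom])

lemma restr_add:
  "\<lbrakk>is_open X U; is_open X V; V \<subseteq> U; s \<in> carrier (sections X U); t \<in> carrier (sections X U)\<rbrakk> \<Longrightarrow>
    restr X U V (s \<oplus>\<^bsub>sections X U\<^esub> t) = restr X U V s \<oplus>\<^bsub>sections X V\<^esub> restr X U V t"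
  by (rule ring_hom_add[OF restr_hom])

lemma restr_one: "\<lbrakk>is_open X U; is_open X V; V \<subseteq> U\<rbrakk> \<Longrightarrow> restr X U V \<one>\<^bsub>sections X U\<^esub> = \<one>\<^bsub>sections X V\<^esub>"
  by (rule ring_hom_one[OF restr_hom])

lemma restr_zero: "\<lbrakk>is_open X U; is_open X V; V \<subseteq> U\<rbrakk> \<Longrightarrow> restr X U V \<zero>\<^bsub>sections X U\<^esub> = \<zero>\<^bsub>sections X V\<^esub>"
  using ring_hom_zero[OF restr_hom] sections_cring cring.axioms(1) by metis

lemma sec_closed:
  assumes "is_open X U"
  shows "\<one>\<^bsub>sections X U\<^esub> \<in> carrier (sections X U)" "\<zero>\<^bsub>sections X U\<^esub> \<in> carrier (sections X U)"
    "\<And>s t. s \<in> carrier (sections X U) \<Longrightarrow> t \<in> carrier (sections X U) \<Longrightarrow> s \<otimes>\<^bsub>sections X U\<^esub> t \<in> carrier (sections X U)"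
    "\<And>s t. s \<in> carrier (sections X U) \<Longrightarrow> t \<in> carrier (sections X U) \<Longrightarrow> s \<oplus>\<^bsub>sections X U\<^esub> t \<in> carrier (sections X U)"
proof -
  interpret cring "sections X U" by (rule sections_cring[OF assms])
  show "\<one>\<^bsub>sections X U\<^esub> \<in> carrier (sections X U)" "\<zero>\<^bsub>sections X U\<^esub> \<in> carrier (sections X U)"
    "\<And>s t. s \<in> carrier (sections X U) \<Longrightarrow> t \<in> carrier (sections X U) \<Longrightarrow> s \<otimes>\<^bsub>sections X U\<^esub> t \<in> carrier (sections X U)"
    "\<And>s t. s \<in> carrier (sections X U) \<Longrightarrow> t \<in> carrier (sections X U) \<Longrightarrow> s \<oplus>\<^bsub>sections X U\<^esub> t \<in> carrier (sections X U)"
    by auto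
qed

definition section_near :: "'x \<Rightarrow> 'x set \<Rightarrow> 's \<Rightarrow> bool" where
  "section_near x U s \<longleftrightarrow> is_open X U \<and> x \<in> U \<and> s \<in> carrier (sections X U)"

lemma section_near_restr: "section_near x U s \<Longrightarrow> is_open X W \<Longrightarrow> x \<in> W \<Longrightarrow> W \<subseteq> U \<Longrightarrow> section_near x W (restr X U W s)"
  using restr_closed by (auto simp: section_near_def)

lemma mem_germ:
  "(V, t) \<in> germ X x U s \<longleftrightarrow> section_near x V t \<and>
    (\<exists>W. is_open X W \<and> x \<in> W \<and> W \<subseteq> U \<inter> V \<and> restr X U W s = restr X V W t)"
  by (auto simp: germ_def section_near_def)

lemma germ_eq_iff:
  assumes s: "section_near x U s" and t: "section_near x V t"
  shows "germ X x U s = germ X x V t \<longleftrightarrow>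
    (\<exists>W. is_open X W \<and> x \<in> W \<and> W \<subseteq> U \<inter> V \<and> restr X U W s = restr X V W t)"
proof
  assume e: "germ X x U s = germ X x V t"
  have "(V, t) \<in> germ X x V t" unfolding mem_germ using t by (auto simp: section_near_def intro!: exI[of _ V])
  then show "\<exists>W. is_open X W \<and> x \<in> W \<and> W \<subseteq> U \<inter> V \<and> restr X U W s = restr X V W t"
    unfolding e[symmetric] mem_germ by blast
next
  have sub: "germ X x V t \<subseteq> germ X x U s"
    if s: "section_near x U s" and t: "section_near x V t"
      and W: "is_open X W" "x \<in> W" "W \<subseteq> U \<inter> V" "restr X U W s = restr X V W t" for U s V t W
  proof
    fix y assume y: "y \<in> germ X x V t"
    obtain V' t' where y': "y = (V', t')" by (cases y)
    then obtain W' where t': "section_near x V' t'"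
      and W': "is_open X W'" "x \<in> W'" "W' \<subseteq> V \<inter> V'" "restr X V W' t = restr X V' W' t'"
      using y unfolding y' mem_germ by blast
    have o: "is_open X (W \<inter> W')" using W W' by auto
    have "restr X U (W \<inter> W') s = restr X W (W \<inter> W') (restr X U W s)"
      using restr_restr[of U W "W \<inter> W'" s] s W o by (auto simp: section_near_def)
    also have "\<dots> = restr X V (W \<inter> W') t"
      unfolding W(4) using restr_restr[of V W "W \<inter> W'" t] t W o by (auto simp: section_near_def)
    also have "\<dots> = restr X W' (W \<inter> W') (restr X V W' t)"
      using restr_restr[of V W' "W \<inter> W'" t] t W' o by (auto simp: section_near_def)
    also have "\<dots> = restr X V' (W \<inter> W') t'"
      unfolding W'(4) using restr_restr[of V' W' "W \<inter> W'" t'] t' W' o by (auto simp: section_near_def)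
    finally have "restr X U (W \<inter> W') s = restr X V' (W \<inter> W') t'" .
    then show "y \<in> germ X x U s" unfolding y' mem_germ using t' o W W' by blast
  qed
  assume "\<exists>W. is_open X W \<and> x \<in> W \<and> W \<subseteq> U \<inter> V \<and> restr X U W s = restr X V W t"
  then obtain W where W: "is_open X W" "x \<in> W" "W \<subseteq> U \<inter> V" "restr X U W s = restr X V W t" by blast
  have "W \<subseteq> V \<inter> U" using W by blast
  then show "germ X x U s = germ X x V t"
    using sub[OF s t W] sub[OF t s W(1,2) _ W(4)[symmetric]] by blast
qed

lemma germ_self: "section_near x U s \<Longrightarrow> (U, s) \<in> germ X x U s"
  unfolding mem_germ by (auto simp: section_near_def intro!: exI[of _ U])

lemma germ_rep: "section_near x U s \<Longrightarrow> (V, t) \<in> germ X x U s \<Longrightarrow> section_near x V t \<and> germ X x V t = germ X x U s"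
  using germ_eq_iff[of x U s V t] mem_germ[of V t x U s] by auto

lemma germ_restr:
  "section_near x U s \<Longrightarrow> is_open X W \<Longrightarrow> x \<in> W \<Longrightarrow> W \<subseteq> U \<Longrightarrow> germ X x W (restr X U W s) = germ X x U s"
  using germ_eq_iff[OF section_near_restr[of x U s W], of U s] restr_id[of W "restr X U W s"] restr_closed[of U W s]
  by (auto simp: section_near_def)

lemma stalk_carrier: "B \<in> carrier (stalk X x) \<longleftrightarrow> (\<exists>U s. section_near x U s \<and> B = germ X x U s)"
  by (auto simp: stalk_def section_near_def)

lemma germ_eqD_small:
  assumes s: "section_near x U s" and t: "section_near x V t" and e: "germ X x U s = germ X x V t"
    and N: "is_open X N" "x \<in> N"
  obtains W where "is_open X W" "x \<in> W" "W \<subseteq> U" "W \<subseteq> V" "W \<subseteq> N" "restr X U W s = restr X V W t"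
proof -
  obtain W where W: "is_open X W" "x \<in> W" "W \<subseteq> U \<inter> V" "restr X U W s = restr X V W t"
    using e germ_eq_iff[OF s t] by blast
  have o: "is_open X (W \<inter> N)" using W N by auto
  have "restr X U (W \<inter> N) s = restr X W (W \<inter> N) (restr X U W s)"
    using restr_restr[of U W "W \<inter> N" s] s W o by (auto simp: section_near_def)
  also have "\<dots> = restr X V (W \<inter> N) t"
    unfolding W(4) using restr_restr[of V W "W \<inter> N" t] t W o by (auto simp: section_near_def)
  finally show ?thesis using that[of "W \<inter> N"] o W N by auto
qed

text \<open>Two pairs of representatives agree on a common small neighbourhood, and both ring operations are
  compatible with restriction.\<close>

lemma stalk_op:
  assumes s: "section_near x U s" and t: "section_near x U t"
    and opc: "\<And>V s t. is_open X V \<Longrightarrow> s \<in> carrier (sections X V) \<Longrightarrow> t \<in> carrier (sections X V) \<Longrightarrow>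
      opr V s t \<in> carrier (sections X V)"
    and opr: "\<And>U V s t. \<lbrakk>is_open X U; is_open X V; V \<subseteq> U; s \<in> carrier (sections X U); t \<in> carrier (sections X U)\<rbrakk> \<Longrightarrow>
      restr X U V (opr U s t) = opr V (restr X U V s) (restr X U V t)"
  shows "(\<Union>(U', s')\<in>germ X x U s. \<Union>(V, t')\<in>germ X x U t.
       germ X x (U' \<inter> V) (opr (U' \<inter> V) (restr X U' (U' \<inter> V) s') (restr X V (U' \<inter> V) t')))
     = germ X x U (opr U s t)"
proof -
  have "germ X x (U1 \<inter> U2) (opr (U1 \<inter> U2) (restr X U1 (U1 \<inter> U2) s1) (restr X U2 (U1 \<inter> U2) t1)) = germ X x U (opr U s t)"
    if "(U1, s1) \<in> germ X x U s" "(U2, t1) \<in> germ X x U t" for U1 s1 U2 t1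
  proof -
    have s1: "section_near x U1 s1" "germ X x U1 s1 = germ X x U s" using germ_rep[OF s that(1)] by auto
    have t1: "section_near x U2 t1" "germ X x U2 t1 = germ X x U t" using germ_rep[OF t that(2)] by auto
    have o12: "is_open X (U1 \<inter> U2)" "x \<in> U1 \<inter> U2" using s1 t1 by (auto simp: section_near_def)
    obtain W1 where W1: "is_open X W1" "x \<in> W1" "W1 \<subseteq> U1" "W1 \<subseteq> U" "W1 \<subseteq> U1 \<inter> U2" "restr X U1 W1 s1 = restr X U W1 s"
      by (rule germ_eqD_small[OF s1(1) s s1(2) o12]) blast
    obtain W where W: "is_open X W" "x \<in> W" "W \<subseteq> U2" "W \<subseteq> U" "W \<subseteq> W1" "restr X U2 W t1 = restr X U W t"
      by (rule germ_eqD_small[OF t1(1) t t1(2) W1(1,2)]) blast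
    have WU: "W \<subseteq> U1 \<inter> U2" "W \<subseteq> U1" using W W1 by auto
    have "restr X U1 W s1 = restr X W1 W (restr X U1 W1 s1)"
      using restr_restr[of U1 W1 W s1] s1 W W1 by (auto simp: section_near_def)
    also have "\<dots> = restr X U W s" unfolding W1(6)
      using restr_restr[of U W1 W s] s W W1 by (auto simp: section_near_def)
    finally have sW: "restr X U1 W s1 = restr X U W s" .
    have r: "restr X (U1 \<inter> U2) W (restr X U1 (U1 \<inter> U2) s1) = restr X U1 W s1"
      "restr X (U1 \<inter> U2) W (restr X U2 (U1 \<inter> U2) t1) = restr X U2 W t1"
      using restr_restr[of U1 "U1 \<inter> U2" W s1] restr_restr[of U2 "U1 \<inter> U2" W t1] s1 t1 W WU o12
      by (auto simp: section_near_def)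
    have c: "restr X U1 (U1 \<inter> U2) s1 \<in> carrier (sections X (U1 \<inter> U2))"
      "restr X U2 (U1 \<inter> U2) t1 \<in> carrier (sections X (U1 \<inter> U2))"
      using restr_closed s1 t1 o12 by (auto simp: section_near_def)
    have "restr X (U1 \<inter> U2) W (opr (U1 \<inter> U2) (restr X U1 (U1 \<inter> U2) s1) (restr X U2 (U1 \<inter> U2) t1))
        = opr W (restr X U W s) (restr X U W t)"
      unfolding opr[OF o12(1) W(1) WU(1) c] r sW W(6) ..
    also have "\<dots> = restr X U W (opr U s t)"
      using opr[of U W s t] s t W by (auto simp: section_near_def)
    finally have e: "restr X (U1 \<inter> U2) W (opr (U1 \<inter> U2) (restr X U1 (U1 \<inter> U2) s1) (restr X U2 (U1 \<inter> U2) t1))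
        = restr X U W (opr U s t)" .
    have n: "section_near x (U1 \<inter> U2) (opr (U1 \<inter> U2) (restr X U1 (U1 \<inter> U2) s1) (restr X U2 (U1 \<inter> U2) t1))"
      "section_near x U (opr U s t)" using opc[OF o12(1) c] opc[of U s t] o12 s t by (auto simp: section_near_def)
    show ?thesis unfolding germ_eq_iff[OF n] using e W WU by blast
  qed
  moreover have "germ X x U s \<noteq> {}" "germ X x U t \<noteq> {}" using germ_self s t by blast+
  ultimately show ?thesis by force
qed

lemma stalk_mult:
  assumes "section_near x U s" "section_near x U t"
  shows "germ X x U s \<otimes>\<^bsub>stalk X x\<^esub> germ X x U t = germ X x U (s \<otimes>\<^bsub>sections X U\<^esub> t)"
proof -
  have "monoid.mult (stalk X x) (germ X x U s) (germ X x U t) = (\<Union>(U', s')\<in>germ X x U s. \<Union>(V, t')\<in>germ X x U t.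
       germ X x (U' \<inter> V) (monoid.mult (sections X (U' \<inter> V)) (restr X U' (U' \<inter> V) s') (restr X V (U' \<inter> V) t')))"
    by (simp add: stalk_def)
  also have "\<dots> = germ X x U (monoid.mult (sections X U) s t)"
    by (rule stalk_op[OF assms, where opr = "\<lambda>V. monoid.mult (sections X V)"]) (rule sec_closed(3) restr_mult; assumption)+
  finally show ?thesis .
qed

lemma stalk_add:
  assumes "section_near x U s" "section_near x U t"
  shows "germ X x U s \<oplus>\<^bsub>stalk X x\<^esub> germ X x U t = germ X x U (s \<oplus>\<^bsub>sections X U\<^esub> t)"
proof -
  have "add (stalk X x) (germ X x U s) (germ X x U t) = (\<Union>(U', s')\<in>germ X x U s. \<Union>(V, t')\<in>germ X x U t.
       germ X x (U' \<inter> V) (add (sections X (U' \<inter> V)) (restr X U' (U' \<inter> V) s') (restr X V (U' \<inter> V) t')))"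
    by (simp add: stalk_def)
  also have "\<dots> = germ X x U (add (sections X U) s t)"
    by (rule stalk_op[OF assms, where opr = "\<lambda>V. add (sections X V)"]) (rule sec_closed(4) restr_add; assumption)+
  finally show ?thesis .
qed

lemma stalk_one:
  assumes "is_open X U" "x \<in> U" shows "\<one>\<^bsub>stalk X x\<^esub> = germ X x U \<one>\<^bsub>sections X U\<^esub>"
proof -
  have U: "U \<subseteq> points X" "is_open X (points X)" using assms openin_subset by blast+
  then have "section_near x (points X) \<one>\<^bsub>sections X (points X)\<^esub>" using assms sec_closed(1) by (auto simp: section_near_def)
  from germ_restr[OF this assms U(1)] restr_one[OF U(2) assms(1) U(1)] show ?thesis by (simp add: stalk_def)
qed

lemma stalk_zero:
  assumes "is_open X U" "x \<in> U" shows "\<zero>\<^bsub>stalk X x\<^esub> = germ X x U \<zero>\<^bsub>sections X U\<^esub>"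
proof -
  have U: "U \<subseteq> points X" "is_open X (points X)" using assms openin_subset by blast+
  then have "section_near x (points X) \<zero>\<^bsub>sections X (points X)\<^esub>" using assms sec_closed(2) by (auto simp: section_near_def)
  from germ_restr[OF this assms U(1)] restr_zero[OF U(2) assms(1) U(1)] show ?thesis by (simp add: stalk_def)
qed

lemma stalk_rep2:
  assumes "B \<in> carrier (stalk X x)" "C \<in> carrier (stalk X x)"
  obtains U s t where "section_near x U s" "section_near x U t" "B = germ X x U s" "C = germ X x U t"
proof -
  obtain U s V t where *: "section_near x U s" "B = germ X x U s" "section_near x V t" "C = germ X x V t"
    using assms unfolding stalk_carrier by blast
  then have o: "is_open X (U \<inter> V)" "x \<in> U \<inter> V" by (auto simp: section_near_def)
  show ?thesis
    by (rule that[OF section_near_restr[OF *(1) o] section_near_restr[OF *(3) o]])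
      (use germ_restr[OF *(1) o] germ_restr[OF *(3) o] * in auto)
qed

lemma stalk_closed:
  assumes "x \<in> points X"
  shows "\<one>\<^bsub>stalk X x\<^esub> \<in> carrier (stalk X x)" "\<zero>\<^bsub>stalk X x\<^esub> \<in> carrier (stalk X x)"
    "\<And>B C. B \<in> carrier (stalk X x) \<Longrightarrow> C \<in> carrier (stalk X x) \<Longrightarrow> B \<otimes>\<^bsub>stalk X x\<^esub> C \<in> carrier (stalk X x)"
    "\<And>B C. B \<in> carrier (stalk X x) \<Longrightarrow> C \<in> carrier (stalk X x) \<Longrightarrow> B \<oplus>\<^bsub>stalk X x\<^esub> C \<in> carrier (stalk X x)"
proof -
  have o: "is_open X (points X)" by simp
  show "\<one>\<^bsub>stalk X x\<^esub> \<in> carrier (stalk X x)" "\<zero>\<^bsub>stalk X x\<^esub> \<in> carrier (stalk X x)"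
    unfolding stalk_carrier stalk_one[OF o assms] stalk_zero[OF o assms]
    using sec_closed(1,2)[OF o] assms o unfolding section_near_def by blast+
  fix B C assume "B \<in> carrier (stalk X x)" "C \<in> carrier (stalk X x)"
  then obtain U s t where *: "section_near x U s" "section_near x U t" "B = germ X x U s" "C = germ X x U t" by (rule stalk_rep2)
  have "section_near x U (s \<otimes>\<^bsub>sections X U\<^esub> t)" "section_near x U (s \<oplus>\<^bsub>sections X U\<^esub> t)"
    using * sec_closed(3,4) by (auto simp: section_near_def)
  then show "B \<otimes>\<^bsub>stalk X x\<^esub> C \<in> carrier (stalk X x)" "B \<oplus>\<^bsub>stalk X x\<^esub> C \<in> carrier (stalk X x)"
    unfolding *(3,4) stalk_mult[OF *(1,2)] stalk_add[OF *(1,2)] stalk_carrier by blast+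
qed

end

subsection \<open>Comparing stalks\<close>

text \<open>The sets \<open>N V\<close>, for \<open>V\<close> a neighbourhood of \<open>y\<close>, form a basis of neighbourhoods of \<open>x\<close>, and the
  sections over \<open>N V\<close> are those over \<open>V\<close>. This covers an open subspace, with \<open>N V = V\<close>, as well as
  an isomorphism \<open>f\<close> from an open subspace to \<open>Y\<close>, with \<open>N V = f\<^sup>-\<^sup>1(V)\<close>.\<close>

locale stalk_comparison = X: ring_presheaf X + Y: ring_presheaf Y
  for X :: "('x, 's) rspace" and Y :: "('y, 't) rspace" +
  fixes x y N \<phi>
  assumes xX: "x \<in> points X" and yY: "y \<in> points Y"
    and N_open: "is_open Y V \<Longrightarrow> is_open X (N V)"
    and N_mem: "is_open Y V \<Longrightarrow> y \<in> V \<Longrightarrow> x \<in> N V"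
    and N_mono: "V' \<subseteq> V \<Longrightarrow> N V' \<subseteq> N V"
    and N_base: "is_open X U \<Longrightarrow> x \<in> U \<Longrightarrow> \<exists>V. is_open Y V \<and> y \<in> V \<and> N V \<subseteq> U"
    and iso: "is_open Y V \<Longrightarrow> \<phi> V \<in> ring_iso (sections Y V) (sections X (N V))"
    and natural: "\<lbrakk>is_open Y V; is_open Y W; W \<subseteq> V; t \<in> carrier (sections Y V)\<rbrakk> \<Longrightarrow>
      \<phi> W (restr Y V W t) = restr X (N V) (N W) (\<phi> V t)"
begin

text \<open>For \<open>N V = f\<^sup>-\<^sup>1(V)\<close> this is the \<open>stalk_map\<close> of a morphism \<open>(f, \<phi>)\<close>.\<close>

definition "cmp B = (\<Union>(V, t)\<in>B. germ X x (N V) (\<phi> V t))"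

lemma section_near_phi: "Y.section_near y V t \<Longrightarrow> X.section_near x (N V) (\<phi> V t)"
  unfolding X.section_near_def Y.section_near_def using N_open N_mem ring_iso_memE(1)[OF iso] by blast

lemma cmp_germ:
  assumes t: "Y.section_near y V t" shows "cmp (germ Y y V t) = germ X x (N V) (\<phi> V t)"
proof -
  have "germ X x (N V') (\<phi> V' t') = germ X x (N V) (\<phi> V t)" if "(V', t') \<in> germ Y y V t" for V' t'
  proof -
    note rep = that
    have t': "Y.section_near y V' t'" using Y.germ_rep[OF t that] by simp
    obtain W where W: "is_open Y W" "y \<in> W" "W \<subseteq> V \<inter> V'" "restr Y V W t = restr Y V' W t'"
      using rep unfolding Y.mem_germ by blast
    have "restr X (N V') (N W) (\<phi> V' t') = restr X (N V) (N W) (\<phi> V t)"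
      using natural[of V W t] natural[of V' W t'] W t t' by (auto simp: Y.section_near_def)
    moreover have "N W \<subseteq> N V' \<inter> N V" using N_mono W(3) by blast
    ultimately show ?thesis
      unfolding X.germ_eq_iff[OF section_near_phi[OF t'] section_near_phi[OF t]]
      using N_open[OF W(1)] N_mem[OF W(1,2)] by (intro exI[of _ "N W"] conjI)
  qed
  moreover have "germ Y y V t \<noteq> {}" using Y.germ_self[OF t] by blast
  ultimately show ?thesis unfolding cmp_def by force
qed

text \<open>Injective, since sections that agree near \<open>x\<close> agree on some \<open>N V'\<close> and hence correspond to equal
  sections over \<open>V'\<close>; surjective, since every germ at \<open>x\<close> is represented over some \<open>N V\<close>.\<close>

theorem cmp_iso: "cmp \<in> ring_iso (stalk Y y) (stalk X x)"
proof (rule ring_iso_memI)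
  show cl: "cmp B \<in> carrier (stalk X x)" if "B \<in> carrier (stalk Y y)" for B
    using that section_near_phi cmp_germ unfolding X.stalk_carrier Y.stalk_carrier by metis
  have hom: "cmp (B \<otimes>\<^bsub>stalk Y y\<^esub> C) = cmp B \<otimes>\<^bsub>stalk X x\<^esub> cmp C \<and> cmp (B \<oplus>\<^bsub>stalk Y y\<^esub> C) = cmp B \<oplus>\<^bsub>stalk X x\<^esub> cmp C"
    if "B \<in> carrier (stalk Y y)" "C \<in> carrier (stalk Y y)" for B C
  proof -
    note BC = that
    obtain V s t where *: "Y.section_near y V s" "Y.section_near y V t" "B = germ Y y V s" "C = germ Y y V t"
      using BC by (rule Y.stalk_rep2)
    have o: "is_open Y V" and sc: "s \<in> carrier (sections Y V)" "t \<in> carrier (sections Y V)"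
      using * by (auto simp: Y.section_near_def)
    have n: "Y.section_near y V (s \<otimes>\<^bsub>sections Y V\<^esub> t)" "Y.section_near y V (s \<oplus>\<^bsub>sections Y V\<^esub> t)"
      using * Y.sec_closed(3,4) by (auto simp: Y.section_near_def)
    show ?thesis
      unfolding *(3,4) Y.stalk_mult[OF *(1,2)] Y.stalk_add[OF *(1,2)] cmp_germ[OF n(1)] cmp_germ[OF n(2)]
        cmp_germ[OF *(1)] cmp_germ[OF *(2)] X.stalk_mult[OF section_near_phi[OF *(1)] section_near_phi[OF *(2)]]
        X.stalk_add[OF section_near_phi[OF *(1)] section_near_phi[OF *(2)]]
      using ring_iso_memE(2,3)[OF iso[OF o] sc] by simp
  qed
  show "cmp (B \<otimes>\<^bsub>stalk Y y\<^esub> C) = cmp B \<otimes>\<^bsub>stalk X x\<^esub> cmp C" "cmp (B \<oplus>\<^bsub>stalk Y y\<^esub> C) = cmp B \<oplus>\<^bsub>stalk X x\<^esub> cmp C"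
    if "B \<in> carrier (stalk Y y)" "C \<in> carrier (stalk Y y)" for B C using hom[OF that] by auto
  have o: "is_open Y (points Y)" by simp
  have "Y.section_near y (points Y) \<one>\<^bsub>sections Y (points Y)\<^esub>" using Y.sec_closed(1)[OF o] yY by (simp add: Y.section_near_def)
  then show "cmp \<one>\<^bsub>stalk Y y\<^esub> = \<one>\<^bsub>stalk X x\<^esub>"
    unfolding Y.stalk_one[OF o yY] X.stalk_one[OF N_open[OF o] N_mem[OF o yY]]
    using cmp_germ ring_iso_memE(4)[OF iso[OF o]] by metis
  show "bij_betw cmp (carrier (stalk Y y)) (carrier (stalk X x))"
  proof (rule bij_betw_imageI)
    show "inj_on cmp (carrier (stalk Y y))"
    proof (rule inj_onI)
      fix B C assume BC: "B \<in> carrier (stalk Y y)" "C \<in> carrier (stalk Y y)" and e: "cmp B = cmp C"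
      obtain V s t where *: "Y.section_near y V s" "Y.section_near y V t" "B = germ Y y V s" "C = germ Y y V t"
        using BC by (rule Y.stalk_rep2)
      have "germ X x (N V) (\<phi> V s) = germ X x (N V) (\<phi> V t)"
        using e cmp_germ[OF *(1)] cmp_germ[OF *(2)] * by simp
      then obtain W where W: "is_open X W" "x \<in> W" "W \<subseteq> N V \<inter> N V"
        "restr X (N V) W (\<phi> V s) = restr X (N V) W (\<phi> V t)"
        unfolding X.germ_eq_iff[OF section_near_phi[OF *(1)] section_near_phi[OF *(2)]] by blast
      obtain V1 where V1: "is_open Y V1" "y \<in> V1" "N V1 \<subseteq> W" using N_base[OF W(1,2)] by blast
      define V' where "V' = V1 \<inter> V"
      have V': "is_open Y V'" "y \<in> V'" "V' \<subseteq> V" "N V' \<subseteq> W"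
        using V1 * N_mono[of V' V1] by (auto simp: V'_def Y.section_near_def)
      have o: "is_open Y V" and sc: "s \<in> carrier (sections Y V)" "t \<in> carrier (sections Y V)"
        using * by (auto simp: Y.section_near_def)
      have pc: "\<phi> V s \<in> carrier (sections X (N V))" "\<phi> V t \<in> carrier (sections X (N V))"
        using ring_iso_memE(1)[OF iso[OF o]] sc by auto
      have WN: "W \<subseteq> N V" using W by simp
      have "restr X (N V) (N V') (\<phi> V s) = restr X (N V) (N V') (\<phi> V t)"
        using X.restr_restr[OF N_open[OF o] W(1) N_open[OF V'(1)] V'(4) WN pc(1)]
          X.restr_restr[OF N_open[OF o] W(1) N_open[OF V'(1)] V'(4) WN pc(2)] W(4) by simp
      then have "\<phi> V' (restr Y V V' s) = \<phi> V' (restr Y V V' t)"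
        using natural[OF o V'(1,3)] sc by simp
      moreover have "restr Y V V' s \<in> carrier (sections Y V')" "restr Y V V' t \<in> carrier (sections Y V')"
        using Y.restr_closed[OF o V'(1,3)] sc by auto
      ultimately have "restr Y V V' s = restr Y V V' t"
        using ring_iso_memE(5)[OF iso[OF V'(1)]] by (auto simp: bij_betw_def dest: inj_onD)
      then show "B = C" unfolding *(3,4) Y.germ_eq_iff[OF *(1,2)] using V' by blast
    qed
    show "cmp ` carrier (stalk Y y) = carrier (stalk X x)"
    proof
      show "cmp ` carrier (stalk Y y) \<subseteq> carrier (stalk X x)"
        using cl by blast
      show "carrier (stalk X x) \<subseteq> cmp ` carrier (stalk Y y)"
      proof
        fix B assume "B \<in> carrier (stalk X x)"
        then obtain U s where s: "X.section_near x U s" "B = germ X x U s" unfolding X.stalk_carrier by blast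
        then obtain V where V: "is_open Y V" "y \<in> V" "N V \<subseteq> U" using N_base[of U] by (auto simp: X.section_near_def)
        have B: "B = germ X x (N V) (restr X U (N V) s)"
          using X.germ_restr[OF s(1) N_open[OF V(1)] N_mem[OF V(1,2)] V(3)] s(2) by simp
        have "restr X U (N V) s \<in> carrier (sections X (N V))"
          using X.restr_closed[of U "N V" s] s(1) N_open[OF V(1)] V(3) by (auto simp: X.section_near_def)
        then have "restr X U (N V) s \<in> \<phi> V ` carrier (sections Y V)"
          using ring_iso_memE(5)[OF iso[OF V(1)]] by (auto simp: bij_betw_def)
        then obtain t where t: "t \<in> carrier (sections Y V)" "restr X U (N V) s = \<phi> V t" by blast
        then have "Y.section_near y V t" using V by (simp add: Y.section_near_def)
        then have "germ Y y V t \<in> carrier (stalk Y y)" "cmp (germ Y y V t) = B"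
          using cmp_germ B t(2) Y.stalk_carrier by auto
        then show "B \<in> cmp ` carrier (stalk Y y)" by blast
      qed
    qed
  qed
qed

lemma phi_zero: "is_open Y V \<Longrightarrow> \<phi> V \<zero>\<^bsub>sections Y V\<^esub> = \<zero>\<^bsub>sections X (N V)\<^esub>"
  using iso[of V] Y.sections_cring[of V] X.sections_cring[of "N V"] N_open
  by (intro ring_hom_zero) (auto simp: ring_iso_def cring.axioms(1))

lemma cmp_zero: "cmp \<zero>\<^bsub>stalk Y y\<^esub> = \<zero>\<^bsub>stalk X x\<^esub>"
proof -
  have o: "is_open Y (points Y)" by simp
  have "Y.section_near y (points Y) \<zero>\<^bsub>sections Y (points Y)\<^esub>" using Y.sec_closed(2)[OF o] yY by (simp add: Y.section_near_def)
  then show ?thesis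
    unfolding Y.stalk_zero[OF o yY] X.stalk_zero[OF N_open[OF o] N_mem[OF o yY]]
    using cmp_germ phi_zero[OF o] by metis
qed

lemma stalk_local:
  assumes "local_ring (stalk X x)"
  shows "local_ring (stalk Y y)"
    "max_ideal (stalk Y y) = {B \<in> carrier (stalk Y y). cmp B \<in> max_ideal (stalk X x)}"
proof -
  have "cring (stalk X x)" using assms by (simp add: local_ring_def)
  then have c: "cring (stalk Y y)"
    by (rule ring_iso_transport[OF cmp_iso cmp_zero _ Y.stalk_closed[OF yY]])
  show "local_ring (stalk Y y)"
    "max_ideal (stalk Y y) = {B \<in> carrier (stalk Y y). cmp B \<in> max_ideal (stalk X x)}"
    using local_ring_transport[OF cmp_iso c assms] by auto
qed

end

lemma (in ringed_space) is_ring_presheaf: "ring_presheaf X"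
  by (rule ring_presheaf.intro[OF sections_cring restr_hom restr_id restr_restr])

lemma open_subspace_open:
  "is_open X U \<Longrightarrow> is_open (open_subspace X U) V \<longleftrightarrow> is_open X V \<and> V \<subseteq> U"
  by (auto simp: open_subspace_def openin_open_subtopology)

lemma open_subspace_simps:
  "sections (open_subspace X U) = sections X" "restr (open_subspace X U) = restr X"
  by (simp_all add: open_subspace_def)

lemma open_subspace_points: "is_open X U \<Longrightarrow> points (open_subspace X U) = U"
  using openin_subset by (fastforce simp: open_subspace_def)

lemma open_subspace_presheaf:
  assumes "ring_presheaf X" "is_open X U" shows "ring_presheaf (open_subspace X U)"
proof -
  interpret ring_presheaf X by fact
  show ?thesis
    by (rule ring_presheaf.intro)
      (use sections_cring restr_hom restr_id restr_restr in
        \<open>auto simp: open_subspace_open[OF assms(2)] open_subspace_simps\<close>)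
qed

lemma open_subspace_local:
  assumes "ring_presheaf X" "is_open X U" "x \<in> U" "local_ring (stalk X x)"
  shows "local_ring (stalk (open_subspace X U) x)"
proof -
  interpret X: ring_presheaf X by fact
  interpret Y: ring_presheaf "open_subspace X U" by (rule open_subspace_presheaf[OF assms(1,2)])
  have "x \<in> points X" using assms(2,3) openin_subset by blast
  then interpret stalk_comparison X "open_subspace X U" x x "\<lambda>V. V" "\<lambda>V s. s"
    using assms(2,3)
    by (intro stalk_comparison.intro stalk_comparison_axioms.intro X.ring_presheaf_axioms Y.ring_presheaf_axioms)
      (auto simp: open_subspace_open open_subspace_simps open_subspace_points ring_iso_def ring_hom_def bij_betw_def
        intro: exI[of _ "U \<inter> _"])
  show ?thesis by (rule stalk_local(1)[OF assms(4)])
qed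

text \<open>The maps on stalks are isomorphisms of rings and hence match the maximal ideals.\<close>

lemma lrs_isoI:
  assumes X: "ring_presheaf X" and Y: "ring_presheaf Y"
    and loc: "\<And>x. x \<in> points X \<Longrightarrow> local_ring (stalk X x)"
    and f: "homeomorphic_map (sp_top X) (sp_top Y) f"
    and iso: "\<And>V. is_open Y V \<Longrightarrow> \<phi> V \<in> ring_iso (sections Y V) (sections X (preim X f V))"
    and nat: "\<And>V W t. \<lbrakk>is_open Y V; is_open Y W; W \<subseteq> V; t \<in> carrier (sections Y V)\<rbrakk> \<Longrightarrow>
      \<phi> W (restr Y V W t) = restr X (preim X f V) (preim X f W) (\<phi> V t)"
  shows "lrs_iso X Y f \<phi>"
proof -
  have cont: "continuous_map (sp_top X) (sp_top Y) f" by (rule homeomorphic_imp_continuous_map[OF f])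
  have "{B \<in> carrier (stalk Y (f x)). stalk_map X f \<phi> x B \<in> max_ideal (stalk X x)} = max_ideal (stalk Y (f x))"
    if x: "x \<in> points X" for x
  proof -
    have fx: "f x \<in> points Y" using f x by (metis homeomorphic_imp_surjective_map imageI)
    interpret stalk_comparison X Y x "f x" "preim X f" \<phi>
    proof (intro stalk_comparison.intro stalk_comparison_axioms.intro X Y)
      show "is_open X (preim X f V)" if "is_open Y V" for V
        using openin_continuous_map_preimage[OF cont that] by (simp add: preim_def)
      show "\<exists>V. is_open Y V \<and> f x \<in> V \<and> preim X f V \<subseteq> U" if "is_open X U" "x \<in> U" for U
      proof (intro exI conjI)
        show "is_open Y (f ` U)" using f that(1) by (meson homeomorphic_imp_open_map open_map_def)
        have "inj_on f (points X)" by (rule homeomorphic_imp_injective_map[OF f])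
        then show "preim X f (f ` U) \<subseteq> U" using openin_subset[OF that(1)] by (auto simp: preim_def inj_on_def)
      qed (use that in auto)
    qed (use x fx iso nat in \<open>auto simp: preim_def\<close>)
    show ?thesis using stalk_local(2)[OF loc[OF x]] by (simp add: cmp_def stalk_map_def)
  qed
  then show ?thesis
    unfolding lrs_iso_def lrs_morphism_def using cont f iso nat by (auto simp: ring_iso_def)
qed

section \<open>Affine schemes\<close>

lemma Spec_open: "is_open (Spec R) = zariski_open R"
  by (simp add: Spec_def topology_inverse'[OF istopology_zariski_open])

lemma Spec_simps: "sections (Spec R) = spec_sections R" "restr (Spec R) = (\<lambda>U V s. restrict s V)"
  by (simp_all add: Spec_def)

lemma zariski_open_primes: "zariski_open R U \<Longrightarrow> U \<subseteq> primes R"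
  by (auto simp: zariski_open_def)

lemma zariski_open_Int: "zariski_open R U \<Longrightarrow> zariski_open R V \<Longrightarrow> zariski_open R (U \<inter> V)"
  using istopology_zariski_open unfolding istopology_def by blast

lemma zariski_open_basic: "a \<in> carrier R \<Longrightarrow> zariski_open R {p \<in> primes R. a \<notin> p}"
  unfolding zariski_open_def by (rule exI[of _ "{a}"]) auto

context cring begin

lemma zariski_open_all: "zariski_open R (primes R)"
proof -
  have "{p \<in> primes R. \<one> \<notin> p} = primes R" using primeideal_one_notin by (auto simp: primes_def)
  then show ?thesis using zariski_open_basic[OF one_closed] by simp
qed

lemma Spec_points: "points (Spec R) = primes R"
proof
  show "points (Spec R) \<subseteq> primes R"
    using zariski_open_primes[of R "points (Spec R)"] Spec_open[of R] openin_topspace[of "sp_top (Spec R)"] by simp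
  show "primes R \<subseteq> points (Spec R)"
    using openin_subset[of "sp_top (Spec R)" "primes R"] zariski_open_all Spec_open[of R] by simp
qed

abbreviation frac :: "'a set \<Rightarrow> 'a \<Rightarrow> 'a \<Rightarrow> ('a \<times> 'a) set" where
  "frac q a f \<equiv> fract R (carrier R - q) a f"

lemma primes_localization: "q \<in> primes R \<Longrightarrow> localization R (carrier R - q)"
  using localization_at by (simp add: primes_def)

lemma loc_at_cring: "q \<in> primes R \<Longrightarrow> cring (loc_at R q)"
  using localization.loc_cring[OF primes_localization] by (simp add: loc_at_def)

lemma prime_mult_notin: "q \<in> primes R \<Longrightarrow> f \<in> carrier R \<Longrightarrow> g \<in> carrier R \<Longrightarrow> f \<notin> q \<Longrightarrow> g \<notin> q \<Longrightarrow> f \<otimes> g \<notin> q"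
  using primeideal.I_prime[of q R f g] by (auto simp: primes_def)

lemma prime_one_notin: "q \<in> primes R \<Longrightarrow> \<one> \<notin> q"
  using primeideal_one_notin by (auto simp: primes_def)

lemma frac_ops:
  assumes q: "q \<in> primes R" and a: "a \<in> carrier R" "b \<in> carrier R"
    and f: "f \<in> carrier R" "g \<in> carrier R" "f \<notin> q" "g \<notin> q"
  shows "frac q a f \<in> carrier (loc_at R q)"
    "frac q a f \<otimes>\<^bsub>loc_at R q\<^esub> frac q b g = frac q (a \<otimes> b) (f \<otimes> g)"
    "frac q a f \<oplus>\<^bsub>loc_at R q\<^esub> frac q b g = frac q (a \<otimes> g \<oplus> b \<otimes> f) (f \<otimes> g)"
    "\<ominus>\<^bsub>loc_at R q\<^esub> frac q a f = frac q (\<ominus> a) f"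
proof -
  interpret localization R "carrier R - q" by (rule primes_localization[OF q])
  show "frac q a f \<in> carrier (loc_at R q)"
    "frac q a f \<otimes>\<^bsub>loc_at R q\<^esub> frac q b g = frac q (a \<otimes> b) (f \<otimes> g)"
    "frac q a f \<oplus>\<^bsub>loc_at R q\<^esub> frac q b g = frac q (a \<otimes> g \<oplus> b \<otimes> f) (f \<otimes> g)"
    using a f by (simp_all add: loc_at_def fract_mult fract_add)
  have "frac q (\<ominus> a) f \<oplus>\<^bsub>\<L>\<^esub> frac q a f = frac q \<zero> (f \<otimes> f)"
    using a f by (simp add: fract_add l_minus l_neg)
  also have "\<dots> = \<zero>\<^bsub>\<L>\<^esub>" unfolding loc_zero
    by (rule fract_eqI) (use a f prime_mult_notin[OF q f(1) f(1)] S_one in auto)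
  finally have "\<ominus>\<^bsub>\<L>\<^esub> frac q a f = frac q (\<ominus> a) f"
    using a f by (intro L.minus_equality) auto
  then show "\<ominus>\<^bsub>loc_at R q\<^esub> frac q a f = frac q (\<ominus> a) f" by (simp add: loc_at_def)
qed

lemma frac_eqI:
  assumes "q \<in> primes R" "a \<in> carrier R" "b \<in> carrier R" "f \<in> carrier R" "g \<in> carrier R" "f \<notin> q" "g \<notin> q"
    "a \<otimes> g = b \<otimes> f"
  shows "frac q a f = frac q b g"
  by (rule localization.fract_eqI[OF primes_localization[OF assms(1)] assms(2,3) _ _ assms(8)]) (use assms in auto)

lemma loc_at_one: "\<one>\<^bsub>loc_at R q\<^esub> = frac q \<one> \<one>" and loc_at_zero: "\<zero>\<^bsub>loc_at R q\<^esub> = frac q \<zero> \<one>"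
  by (simp_all add: loc_at_def loc_ring_def)

lemma frac_zero_iff:
  "q \<in> primes R \<Longrightarrow> a \<in> carrier R \<Longrightarrow> f \<in> carrier R \<Longrightarrow> f \<notin> q \<Longrightarrow>
    frac q a f = \<zero>\<^bsub>loc_at R q\<^esub> \<longleftrightarrow> (\<exists>u\<in>carrier R - q. u \<otimes> a = \<zero>)"
  using localization.fract_zero_iff[OF primes_localization] by (simp add: loc_at_def)

lemma loc_at_rep:
  "q \<in> primes R \<Longrightarrow> x \<in> carrier (loc_at R q) \<Longrightarrow> \<exists>a f. a \<in> carrier R \<and> f \<in> carrier R \<and> f \<notin> q \<and> x = frac q a f"
  using localization.loc_carrier[OF primes_localization] by (auto simp: loc_at_def)

definition locally_frac :: "'a set set \<Rightarrow> ('a set \<Rightarrow> ('a \<times> 'a) set) \<Rightarrow> bool" where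
  "locally_frac U s \<longleftrightarrow> (\<forall>p\<in>U. \<exists>V a f. zariski_open R V \<and> p \<in> V \<and> V \<subseteq> U \<and> a \<in> carrier R \<and> f \<in> carrier R \<and>
         (\<forall>q\<in>V. f \<notin> q \<and> s q = frac q a f))"

lemma locally_fracE:
  assumes "locally_frac U s" "p \<in> U"
  obtains V a f where "zariski_open R V" "p \<in> V" "V \<subseteq> U" "a \<in> carrier R" "f \<in> carrier R"
    "\<And>q. q \<in> V \<Longrightarrow> f \<notin> q \<and> s q = frac q a f"
proof -
  have "\<exists>V a f. zariski_open R V \<and> p \<in> V \<and> V \<subseteq> U \<and> a \<in> carrier R \<and> f \<in> carrier R \<and>
         (\<forall>q\<in>V. f \<notin> q \<and> s q = frac q a f)"
    using assms unfolding locally_frac_def by (rule bspec)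
  then obtain V a f where *: "zariski_open R V" "p \<in> V" "V \<subseteq> U" "a \<in> carrier R" "f \<in> carrier R"
    "\<forall>q\<in>V. f \<notin> q \<and> s q = frac q a f" by (elim exE conjE)
  show ?thesis by (rule that[OF *(1-5)]) (rule bspec[OF *(6)])
qed

lemma spec_sections_carrier:
  assumes "zariski_open R U"
  shows "s \<in> carrier (spec_sections R U) \<longleftrightarrow> s \<in> extensional U \<and> locally_frac U s"
proof -
  have "s p \<in> carrier (loc_at R p)" if "locally_frac U s" "p \<in> U" for p
  proof -
    note sp = that
    obtain V a f where V: "zariski_open R V" "p \<in> V" "V \<subseteq> U" "a \<in> carrier R" "f \<in> carrier R"
      "\<And>q. q \<in> V \<Longrightarrow> f \<notin> q \<and> s q = frac q a f"
      using locally_fracE[OF sp] by metis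
    have "p \<in> primes R" using zariski_open_primes[OF assms] sp by auto
    then show ?thesis using frac_ops(1)[of p a a f f] V(6)[OF V(2)] V(4,5) by simp
  qed
  then show ?thesis by (auto simp: spec_sections_def locally_frac_def PiE_iff)
qed

lemma spec_section_value:
  "zariski_open R U \<Longrightarrow> s \<in> carrier (spec_sections R U) \<Longrightarrow> p \<in> U \<Longrightarrow> s p \<in> carrier (loc_at R p)"
  by (auto simp: spec_sections_def)

lemma locally_fracI:
  assumes "\<And>p. p \<in> U \<Longrightarrow> \<exists>V a f. zariski_open R V \<and> p \<in> V \<and> V \<subseteq> U \<and> a \<in> carrier R \<and> f \<in> carrier R \<and>
         (\<forall>q\<in>V. f \<notin> q \<and> s q = frac q a f)"
  shows "locally_frac U s"
  using assms by (simp add: locally_frac_def)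

lemma locally_frac_const:
  "zariski_open R U \<Longrightarrow> a \<in> carrier R \<Longrightarrow> f \<in> carrier R \<Longrightarrow> (\<And>q. q \<in> U \<Longrightarrow> f \<notin> q \<and> s q = frac q a f) \<Longrightarrow> locally_frac U s"
  by (rule locally_fracI) blast

lemma locally_frac_op:
  assumes U: "zariski_open R U" and s: "locally_frac U s" and t: "locally_frac U t"
    and opA: "\<And>a f b g. \<lbrakk>a \<in> carrier R; f \<in> carrier R; b \<in> carrier R; g \<in> carrier R\<rbrakk> \<Longrightarrow> num a f b g \<in> carrier R"
    and opq: "\<And>q a f b g. \<lbrakk>q \<in> U; a \<in> carrier R; f \<in> carrier R; b \<in> carrier R; g \<in> carrier R; f \<notin> q; g \<notin> q\<rbrakk> \<Longrightarrow>
      opr q (frac q a f) (frac q b g) = frac q (num a f b g) (f \<otimes> g)"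
  shows "locally_frac U (\<lambda>p\<in>U. opr p (s p) (t p))"
proof (rule locally_fracI)
  fix p assume p: "p \<in> U"
  obtain V a f where V: "zariski_open R V" "p \<in> V" "V \<subseteq> U" "a \<in> carrier R" "f \<in> carrier R"
    "\<And>q. q \<in> V \<Longrightarrow> f \<notin> q \<and> s q = frac q a f" by (rule locally_fracE[OF s p]) blast
  obtain W b g where W: "zariski_open R W" "p \<in> W" "W \<subseteq> U" "b \<in> carrier R" "g \<in> carrier R"
    "\<And>q. q \<in> W \<Longrightarrow> g \<notin> q \<and> t q = frac q b g" by (rule locally_fracE[OF t p]) blast
  have "f \<otimes> g \<notin> q \<and> (\<lambda>p\<in>U. opr p (s p) (t p)) q = frac q (num a f b g) (f \<otimes> g)" if "q \<in> V \<inter> W" for q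
    using V(6)[of q] W(6)[of q] that V W opq[of q a f b g] prime_mult_notin[of q f g] zariski_open_primes[OF U] by auto
  then show "\<exists>V a f. zariski_open R V \<and> p \<in> V \<and> V \<subseteq> U \<and> a \<in> carrier R \<and> f \<in> carrier R \<and>
         (\<forall>q\<in>V. f \<notin> q \<and> (\<lambda>p\<in>U. opr p (s p) (t p)) q = frac q a f)"
    using V W zariski_open_Int[OF V(1) W(1)] opA[of a f b g]
    by (intro exI[of _ "V \<inter> W"] exI[of _ "num a f b g"] exI[of _ "f \<otimes> g"]) auto
qed

lemma spec_sections_simps:
  "monoid.mult (spec_sections R U) = (\<lambda>s t. \<lambda>p\<in>U. s p \<otimes>\<^bsub>loc_at R p\<^esub> t p)"
  "add (spec_sections R U) = (\<lambda>s t. \<lambda>p\<in>U. s p \<oplus>\<^bsub>loc_at R p\<^esub> t p)"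
  "one (spec_sections R U) = (\<lambda>p\<in>U. \<one>\<^bsub>loc_at R p\<^esub>)"
  "zero (spec_sections R U) = (\<lambda>p\<in>U. \<zero>\<^bsub>loc_at R p\<^esub>)"
  by (simp_all add: spec_sections_def)

lemma spec_sections_closed:
  assumes U: "zariski_open R U" and s: "s \<in> carrier (spec_sections R U)" and t: "t \<in> carrier (spec_sections R U)"
  shows "s \<otimes>\<^bsub>spec_sections R U\<^esub> t \<in> carrier (spec_sections R U)"
    "s \<oplus>\<^bsub>spec_sections R U\<^esub> t \<in> carrier (spec_sections R U)"
    "(\<lambda>p\<in>U. \<ominus>\<^bsub>loc_at R p\<^esub> s p) \<in> carrier (spec_sections R U)"
proof -
  note pr = zariski_open_primes[OF U]
  note st = s[unfolded spec_sections_carrier[OF U]] t[unfolded spec_sections_carrier[OF U]]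
  have "locally_frac U (\<lambda>p\<in>U. s p \<otimes>\<^bsub>loc_at R p\<^esub> t p)"
    by (rule locally_frac_op[OF U, where num = "\<lambda>a f b g. a \<otimes> b" and opr = "\<lambda>p. monoid.mult (loc_at R p)"])
      (use st frac_ops(2) pr in auto)
  then show "s \<otimes>\<^bsub>spec_sections R U\<^esub> t \<in> carrier (spec_sections R U)"
    by (simp add: spec_sections_carrier[OF U] spec_sections_simps)
  have "locally_frac U (\<lambda>p\<in>U. s p \<oplus>\<^bsub>loc_at R p\<^esub> t p)"
    by (rule locally_frac_op[OF U, where num = "\<lambda>a f b g. a \<otimes> g \<oplus> b \<otimes> f" and opr = "\<lambda>p. add (loc_at R p)"])
      (use st frac_ops(3) pr in auto)
  then show "s \<oplus>\<^bsub>spec_sections R U\<^esub> t \<in> carrier (spec_sections R U)"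
    by (simp add: spec_sections_carrier[OF U] spec_sections_simps)
  have "locally_frac U (\<lambda>p\<in>U. (\<lambda>x y. \<ominus>\<^bsub>loc_at R p\<^esub> x) (s p) (s p))"
  proof (rule locally_frac_op[OF U, where num = "\<lambda>a f b g. (\<ominus> a) \<otimes> g" and opr = "\<lambda>p x y. \<ominus>\<^bsub>loc_at R p\<^esub> x"])
    fix q a f b g
    assume *: "q \<in> U" "a \<in> carrier R" "f \<in> carrier R" "b \<in> carrier R" "g \<in> carrier R" "f \<notin> q" "g \<notin> q"
    then have q: "q \<in> primes R" using pr by auto
    have "frac q (\<ominus> a) f = frac q ((\<ominus> a) \<otimes> g) (f \<otimes> g)"
      by (rule frac_eqI[OF q]) (use * prime_mult_notin[OF q] in \<open>auto simp: m_ac\<close>)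
    then show "\<ominus>\<^bsub>loc_at R q\<^esub> frac q a f = frac q ((\<ominus> a) \<otimes> g) (f \<otimes> g)"
      using frac_ops(4)[OF q *(2) *(2) *(3) *(3) *(6) *(6)] by simp
  qed (use st in auto)
  then show "(\<lambda>p\<in>U. \<ominus>\<^bsub>loc_at R p\<^esub> s p) \<in> carrier (spec_sections R U)"
    by (simp add: spec_sections_carrier[OF U])
qed

lemma spec_sections_cring:
  assumes U: "zariski_open R U" shows "cring (spec_sections R U)"
proof -
  let ?S = "spec_sections R U"
  have L: "cring (loc_at R p)" if "p \<in> U" for p using loc_at_cring that zariski_open_primes[OF U] by auto
  note v = spec_section_value[OF U]
  have ext: "s = t" if "s \<in> carrier ?S" "t \<in> carrier ?S" "\<And>p. p \<in> U \<Longrightarrow> s p = t p" for s t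
    using that extensionalityI[of s U t] by (auto simp: spec_sections_carrier[OF U])
  note cl = spec_sections_closed[OF U]
  have one: "\<one>\<^bsub>?S\<^esub> \<in> carrier ?S"
    unfolding spec_sections_carrier[OF U] spec_sections_simps
    using locally_frac_const[OF U one_closed one_closed, of "\<lambda>p\<in>U. \<one>\<^bsub>loc_at R p\<^esub>"] prime_one_notin zariski_open_primes[OF U]
    by (auto simp: loc_at_one)
  have zero: "\<zero>\<^bsub>?S\<^esub> \<in> carrier ?S"
    unfolding spec_sections_carrier[OF U] spec_sections_simps
    using locally_frac_const[OF U zero_closed one_closed, of "\<lambda>p\<in>U. \<zero>\<^bsub>loc_at R p\<^esub>"] prime_one_notin zariski_open_primes[OF U]
    by (auto simp: loc_at_zero)
  show ?thesis
  proof (rule cringI)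
    show "abelian_group ?S"
    proof (rule abelian_groupI)
      fix x assume x: "x \<in> carrier ?S"
      show "\<zero>\<^bsub>?S\<^esub> \<oplus>\<^bsub>?S\<^esub> x = x"
      proof (rule ext[OF cl(2)[OF zero x] x])
        fix p assume p: "p \<in> U"
        interpret L: cring "loc_at R p" by (rule L[OF p])
        show "(\<zero>\<^bsub>?S\<^esub> \<oplus>\<^bsub>?S\<^esub> x) p = x p" using p v[OF x p] by (simp add: spec_sections_simps)
      qed
      show "\<exists>y\<in>carrier ?S. y \<oplus>\<^bsub>?S\<^esub> x = \<zero>\<^bsub>?S\<^esub>"
      proof (rule bexI[OF _ cl(3)[OF x x]])
        show "(\<lambda>p\<in>U. \<ominus>\<^bsub>loc_at R p\<^esub> x p) \<oplus>\<^bsub>?S\<^esub> x = \<zero>\<^bsub>?S\<^esub>"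
        proof (rule ext[OF cl(2)[OF cl(3)[OF x x] x] zero])
          fix p assume p: "p \<in> U"
          interpret L: cring "loc_at R p" by (rule L[OF p])
          show "((\<lambda>p\<in>U. \<ominus>\<^bsub>loc_at R p\<^esub> x p) \<oplus>\<^bsub>?S\<^esub> x) p = \<zero>\<^bsub>?S\<^esub> p"
            using p v[OF x p] by (simp add: spec_sections_simps L.l_neg)
        qed
      qed
      fix y assume y: "y \<in> carrier ?S"
      show "x \<oplus>\<^bsub>?S\<^esub> y = y \<oplus>\<^bsub>?S\<^esub> x"
      proof (rule ext[OF cl(2)[OF x y] cl(2)[OF y x]])
        fix p assume p: "p \<in> U"
        interpret L: cring "loc_at R p" by (rule L[OF p])
        show "(x \<oplus>\<^bsub>?S\<^esub> y) p = (y \<oplus>\<^bsub>?S\<^esub> x) p" using p v[OF x p] v[OF y p] by (simp add: spec_sections_simps L.a_comm)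
      qed
      fix z assume z: "z \<in> carrier ?S"
      show "x \<oplus>\<^bsub>?S\<^esub> y \<oplus>\<^bsub>?S\<^esub> z = x \<oplus>\<^bsub>?S\<^esub> (y \<oplus>\<^bsub>?S\<^esub> z)"
      proof (rule ext[OF cl(2)[OF cl(2)[OF x y] z] cl(2)[OF x cl(2)[OF y z]]])
        fix p assume p: "p \<in> U"
        interpret L: cring "loc_at R p" by (rule L[OF p])
        show "(x \<oplus>\<^bsub>?S\<^esub> y \<oplus>\<^bsub>?S\<^esub> z) p = (x \<oplus>\<^bsub>?S\<^esub> (y \<oplus>\<^bsub>?S\<^esub> z)) p"
          using p v[OF x p] v[OF y p] v[OF z p] by (simp add: spec_sections_simps L.a_assoc)
      qed
    qed (use cl zero in auto)
    show "comm_monoid ?S"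
    proof (rule comm_monoidI)
      fix x assume x: "x \<in> carrier ?S"
      show "\<one>\<^bsub>?S\<^esub> \<otimes>\<^bsub>?S\<^esub> x = x"
      proof (rule ext[OF cl(1)[OF one x] x])
        fix p assume p: "p \<in> U"
        interpret L: cring "loc_at R p" by (rule L[OF p])
        show "(\<one>\<^bsub>?S\<^esub> \<otimes>\<^bsub>?S\<^esub> x) p = x p" using p v[OF x p] by (simp add: spec_sections_simps)
      qed
      fix y assume y: "y \<in> carrier ?S"
      show "x \<otimes>\<^bsub>?S\<^esub> y = y \<otimes>\<^bsub>?S\<^esub> x"
      proof (rule ext[OF cl(1)[OF x y] cl(1)[OF y x]])
        fix p assume p: "p \<in> U"
        interpret L: cring "loc_at R p" by (rule L[OF p])
        show "(x \<otimes>\<^bsub>?S\<^esub> y) p = (y \<otimes>\<^bsub>?S\<^esub> x) p" using p v[OF x p] v[OF y p] by (simp add: spec_sections_simps L.m_comm)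
      qed
      fix z assume z: "z \<in> carrier ?S"
      show "x \<otimes>\<^bsub>?S\<^esub> y \<otimes>\<^bsub>?S\<^esub> z = x \<otimes>\<^bsub>?S\<^esub> (y \<otimes>\<^bsub>?S\<^esub> z)"
      proof (rule ext[OF cl(1)[OF cl(1)[OF x y] z] cl(1)[OF x cl(1)[OF y z]]])
        fix p assume p: "p \<in> U"
        interpret L: cring "loc_at R p" by (rule L[OF p])
        show "(x \<otimes>\<^bsub>?S\<^esub> y \<otimes>\<^bsub>?S\<^esub> z) p = (x \<otimes>\<^bsub>?S\<^esub> (y \<otimes>\<^bsub>?S\<^esub> z)) p"
          using p v[OF x p] v[OF y p] v[OF z p] by (simp add: spec_sections_simps L.m_assoc)
      qed
    qed (use cl one in auto)
    fix x y z assume x: "x \<in> carrier ?S" and y: "y \<in> carrier ?S" and z: "z \<in> carrier ?S"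
    show "(x \<oplus>\<^bsub>?S\<^esub> y) \<otimes>\<^bsub>?S\<^esub> z = x \<otimes>\<^bsub>?S\<^esub> z \<oplus>\<^bsub>?S\<^esub> y \<otimes>\<^bsub>?S\<^esub> z"
    proof (rule ext[OF cl(1)[OF cl(2)[OF x y] z] cl(2)[OF cl(1)[OF x z] cl(1)[OF y z]]])
      fix p assume p: "p \<in> U"
      interpret L: cring "loc_at R p" by (rule L[OF p])
      show "((x \<oplus>\<^bsub>?S\<^esub> y) \<otimes>\<^bsub>?S\<^esub> z) p = (x \<otimes>\<^bsub>?S\<^esub> z \<oplus>\<^bsub>?S\<^esub> y \<otimes>\<^bsub>?S\<^esub> z) p"
        using p v[OF x p] v[OF y p] v[OF z p] by (simp add: spec_sections_simps L.l_distr)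
    qed
  qed
qed

lemma restrict_section:
  assumes "zariski_open R U" "zariski_open R V" "V \<subseteq> U" "s \<in> carrier (spec_sections R U)"
  shows "restrict s V \<in> carrier (spec_sections R V)"
proof -
  have "locally_frac V (restrict s V)"
  proof (rule locally_fracI)
    fix p assume p: "p \<in> V"
    have s: "locally_frac U s" and pU: "p \<in> U" using assms(3,4) p unfolding spec_sections_carrier[OF assms(1)] by auto
    obtain W a f where W: "zariski_open R W" "p \<in> W" "W \<subseteq> U" "a \<in> carrier R" "f \<in> carrier R"
      "\<And>q. q \<in> W \<Longrightarrow> f \<notin> q \<and> s q = frac q a f"
      by (rule locally_fracE[OF s pU]) blast
    have "f \<notin> q \<and> restrict s V q = frac q a f" if "q \<in> W \<inter> V" for q using W(6)[of q] that by simp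
    then show "\<exists>W a f. zariski_open R W \<and> p \<in> W \<and> W \<subseteq> V \<and> a \<in> carrier R \<and> f \<in> carrier R \<and>
         (\<forall>q\<in>W. f \<notin> q \<and> restrict s V q = frac q a f)"
      using zariski_open_Int[OF W(1) assms(2)] p W(2,4,5)
      by (intro exI[of _ "W \<inter> V"] exI[of _ a] exI[of _ f] conjI ballI) simp_all
  qed
  then show ?thesis by (simp add: spec_sections_carrier[OF assms(2)])
qed

lemma Spec_presheaf: "ring_presheaf (Spec R)"
proof (rule ring_presheaf.intro)
  show "cring (sections (Spec R) U)" if "is_open (Spec R) U" for U
    using that spec_sections_cring by (simp add: Spec_open Spec_simps)
  show "restr (Spec R) U V \<in> ring_hom (sections (Spec R) U) (sections (Spec R) V)"
    if "is_open (Spec R) U" "is_open (Spec R) V" "V \<subseteq> U" for U V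
    using that restrict_section
    by (intro ring_hom_memI) (auto simp: Spec_open Spec_simps spec_sections_simps restrict_def fun_eq_iff)
  show "restr (Spec R) U U s = s" if "is_open (Spec R) U" "s \<in> carrier (sections (Spec R) U)" for U s
    using that by (auto simp: Spec_open Spec_simps spec_sections_carrier extensional_restrict)
  show "restr (Spec R) V W (restr (Spec R) U V s) = restr (Spec R) U W s"
    if "W \<subseteq> V" for U V W s
    using that by (auto simp: Spec_simps restrict_def fun_eq_iff)
qed

end

subsection \<open>The local rings of a spectrum\<close>

context cring begin

lemma spec_global_section: "a \<in> carrier R \<Longrightarrow> spec_global R a \<in> carrier (spec_sections R (primes R))"
  unfolding spec_sections_carrier[OF zariski_open_all]
  using locally_frac_const[OF zariski_open_all _ one_closed, of a "spec_global R a"] prime_one_notin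
  by (auto simp: spec_global_def)

text \<open>A germ is represented by a fraction \<open>a / f\<close> near \<open>y\<close>. An element of \<open>R\<close> with zero germ has zero
  image in \<open>R\<^sub>y\<close> and is killed by some \<open>u \<notin> y\<close>; conversely it then vanishes where \<open>u\<close> is
  invertible. An \<open>f \<notin> y\<close> has the inverse \<open>1 / f\<close> where it does not vanish.\<close>

lemma Spec_stalk:
  assumes y: "y \<in> primes R"
  shows "localization_map R {\<zero>} y (stalk (Spec R) y) (\<lambda>a. germ (Spec R) y (primes R) (spec_global R a))"
proof -
  interpret S: ring_presheaf "Spec R" by (rule Spec_presheaf)
  let ?T = "stalk (Spec R) y" and ?\<theta> = "\<lambda>a. germ (Spec R) y (primes R) (spec_global R a)"
  have o: "is_open (Spec R) (primes R)" using zariski_open_all by (simp add: Spec_open)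
  have g: "S.section_near y (primes R) (spec_global R a)" if "a \<in> carrier R" for a
    using spec_global_section[OF that] o y by (simp add: S.section_near_def Spec_simps)
  note yo = prime_one_notin
  have restrict_germ: "?\<theta> a = germ (Spec R) y V (restrict (spec_global R a) V)"
    if "a \<in> carrier R" "zariski_open R V" "y \<in> V" for a V
    using S.germ_restr[OF g[OF that(1)], of V] that(2,3) zariski_open_primes[OF that(2)] by (simp add: Spec_open Spec_simps)
  have hom: "?\<theta> \<in> ring_hom R ?T"
  proof (rule ring_hom_memI)
    show "?\<theta> a \<in> carrier ?T" if "a \<in> carrier R" for a using g[OF that] S.stalk_carrier by blast
    show "?\<theta> (a \<otimes> b) = ?\<theta> a \<otimes>\<^bsub>?T\<^esub> ?\<theta> b" if "a \<in> carrier R" "b \<in> carrier R" for a b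
    proof -
      have "spec_global R (a \<otimes> b) = spec_global R a \<otimes>\<^bsub>spec_sections R (primes R)\<^esub> spec_global R b"
        using that frac_ops(2) yo by (auto simp: spec_global_def spec_sections_simps restrict_def fun_eq_iff)
      then show ?thesis using S.stalk_mult[OF g g] that by (simp add: Spec_simps)
    qed
    show "?\<theta> (a \<oplus> b) = ?\<theta> a \<oplus>\<^bsub>?T\<^esub> ?\<theta> b" if "a \<in> carrier R" "b \<in> carrier R" for a b
    proof -
      have "spec_global R (a \<oplus> b) = spec_global R a \<oplus>\<^bsub>spec_sections R (primes R)\<^esub> spec_global R b"
        using that frac_ops(3) yo by (auto simp: spec_global_def spec_sections_simps restrict_def fun_eq_iff)
      then show ?thesis using S.stalk_add[OF g g] that by (simp add: Spec_simps)
    qed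
    have "spec_global R \<one> = \<one>\<^bsub>spec_sections R (primes R)\<^esub>"
      by (auto simp: spec_global_def spec_sections_simps loc_at_one)
    then show "?\<theta> \<one> = \<one>\<^bsub>?T\<^esub>" using S.stalk_one[OF o y] by (simp add: Spec_simps)
  qed
  have fracs: "\<exists>a\<in>carrier R. \<exists>f\<in>carrier R - y. ?\<theta> f \<otimes>\<^bsub>?T\<^esub> B = ?\<theta> a" if "B \<in> carrier ?T" for B
  proof -
    note Bc = that
    obtain U s where s: "S.section_near y U s" "B = germ (Spec R) y U s" using Bc unfolding S.stalk_carrier by blast
    have U: "zariski_open R U" "y \<in> U" "s \<in> carrier (spec_sections R U)"
      using s by (auto simp: S.section_near_def Spec_open Spec_simps)
    obtain V a f where V: "zariski_open R V" "y \<in> V" "V \<subseteq> U" "a \<in> carrier R" "f \<in> carrier R"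
      "\<And>q. q \<in> V \<Longrightarrow> f \<notin> q \<and> s q = frac q a f"
      by (rule locally_fracE[OF _ U(2), of s]) (use U(3) in \<open>simp add: spec_sections_carrier[OF U(1)]\<close>, blast)
    have oV: "is_open (Spec R) V" using V(1) by (simp add: Spec_open)
    have B: "B = germ (Spec R) y V (restrict s V)"
      using S.germ_restr[OF s(1) oV V(2,3)] s(2) by (simp add: Spec_simps)
    have n: "S.section_near y V (restrict s V)" "S.section_near y V (restrict (spec_global R f) V)"
      using S.section_near_restr[OF s(1) oV V(2,3)] S.section_near_restr[OF g[OF V(5)] oV V(2) zariski_open_primes[OF V(1)]]
      by (simp_all add: Spec_simps)
    have "restrict (spec_global R f) V \<otimes>\<^bsub>spec_sections R V\<^esub> restrict s V = restrict (spec_global R a) V"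
      unfolding spec_sections_simps
    proof (rule restrict_ext)
      fix q assume q: "q \<in> V"
      then have qp: "q \<in> primes R" using zariski_open_primes[OF V(1)] by auto
      have "frac q f \<one> \<otimes>\<^bsub>loc_at R q\<^esub> frac q a f = frac q (f \<otimes> a) (\<one> \<otimes> f)"
        using frac_ops(2)[OF qp V(5,4) one_closed V(5)] V(6)[OF q] yo[OF qp] by simp
      also have "\<dots> = frac q a \<one>"
        by (rule frac_eqI[OF qp]) (use V(4-6) q yo[OF qp] in \<open>auto simp: m_comm\<close>)
      finally show "restrict (spec_global R f) V q \<otimes>\<^bsub>loc_at R q\<^esub> restrict s V q = spec_global R a q"
        using q qp V(6)[OF q] by (simp add: spec_global_def)
    qed
    then have "?\<theta> f \<otimes>\<^bsub>?T\<^esub> B = ?\<theta> a"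
      unfolding B restrict_germ[OF V(5,1,2)] restrict_germ[OF V(4,1,2)] S.stalk_mult[OF n(2,1)] by (simp add: Spec_simps)
    then show ?thesis using V by blast
  qed
  have ker: "?\<theta> a = \<zero>\<^bsub>?T\<^esub> \<longleftrightarrow> (\<exists>u\<in>carrier R - y. u \<otimes> a \<in> {\<zero>})" if a: "a \<in> carrier R" for a
  proof
    have nz: "S.section_near y (primes R) \<zero>\<^bsub>spec_sections R (primes R)\<^esub>"
      using S.sec_closed(2)[OF o] o y by (simp add: S.section_near_def Spec_simps)
    assume "?\<theta> a = \<zero>\<^bsub>?T\<^esub>"
    then have "?\<theta> a = germ (Spec R) y (primes R) \<zero>\<^bsub>spec_sections R (primes R)\<^esub>"
      using S.stalk_zero[OF o y] by (simp add: Spec_simps)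
    then obtain W where W: "y \<in> W" "restrict (spec_global R a) W = restrict \<zero>\<^bsub>spec_sections R (primes R)\<^esub> W"
      unfolding S.germ_eq_iff[OF g[OF a] nz] by (auto simp: Spec_simps)
    have "restrict (spec_global R a) W y = restrict \<zero>\<^bsub>spec_sections R (primes R)\<^esub> W y"
      by (rule fun_cong[OF W(2)])
    then have "frac y a \<one> = \<zero>\<^bsub>loc_at R y\<^esub>"
      using W(1) y by (simp add: spec_global_def spec_sections_simps)
    then show "\<exists>u\<in>carrier R - y. u \<otimes> a \<in> {\<zero>}" using frac_zero_iff[OF y a one_closed yo[OF y]] by auto
  next
    assume "\<exists>u\<in>carrier R - y. u \<otimes> a \<in> {\<zero>}"
    then obtain u where u: "u \<in> carrier R" "u \<notin> y" "u \<otimes> a = \<zero>" by auto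
    let ?V = "{p \<in> primes R. u \<notin> p}"
    have V: "zariski_open R ?V" "y \<in> ?V" using zariski_open_basic u y by auto
    have "restrict (spec_global R a) ?V = \<zero>\<^bsub>spec_sections R ?V\<^esub>"
      unfolding spec_sections_simps
    proof (rule restrict_ext)
      fix q assume q: "q \<in> ?V"
      then show "spec_global R a q = \<zero>\<^bsub>loc_at R q\<^esub>"
        using frac_zero_iff[of q a \<one>] a u yo by (auto simp: spec_global_def)
    qed
    then show "?\<theta> a = \<zero>\<^bsub>?T\<^esub>"
      using restrict_germ[OF a V] S.stalk_zero[of ?V y] V by (simp add: Spec_open Spec_simps)
  qed
  have unit: "?\<theta> f \<in> Units ?T" if f: "f \<in> carrier R - y" for f
  proof -
    have fc: "f \<in> carrier R" and fy: "f \<notin> y" using f by auto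
    let ?V = "{p \<in> primes R. f \<notin> p}"
    have V: "zariski_open R ?V" "y \<in> ?V" using zariski_open_basic fc fy y by auto
    have oV: "is_open (Spec R) ?V" using V by (simp add: Spec_open)
    define s where "s = (\<lambda>q\<in>?V. frac q \<one> f)"
    have "s \<in> carrier (spec_sections R ?V)"
      unfolding spec_sections_carrier[OF V(1)] using locally_frac_const[OF V(1) one_closed fc, of s] by (auto simp: s_def)
    then have s: "S.section_near y ?V s" using oV V by (simp add: S.section_near_def Spec_simps)
    have n: "S.section_near y ?V (restrict (spec_global R f) ?V)"
      using S.section_near_restr[OF g[OF fc] oV V(2)] by (simp add: Spec_simps)
    have v: "frac q \<one> f \<otimes>\<^bsub>loc_at R q\<^esub> frac q f \<one> = \<one>\<^bsub>loc_at R q\<^esub>" "frac q f \<one> \<otimes>\<^bsub>loc_at R q\<^esub> frac q \<one> f = \<one>\<^bsub>loc_at R q\<^esub>"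
      if "q \<in> ?V" for q
    proof -
      have qp: "q \<in> primes R" "f \<notin> q" using that by auto
      have "frac q f f = frac q \<one> \<one>" by (rule frac_eqI) (use qp fc yo in auto)
      then show "frac q \<one> f \<otimes>\<^bsub>loc_at R q\<^esub> frac q f \<one> = \<one>\<^bsub>loc_at R q\<^esub>" "frac q f \<one> \<otimes>\<^bsub>loc_at R q\<^esub> frac q \<one> f = \<one>\<^bsub>loc_at R q\<^esub>"
        using frac_ops(2)[OF qp(1) one_closed fc fc one_closed qp(2) yo[OF qp(1)]]
          frac_ops(2)[OF qp(1) fc one_closed one_closed fc yo[OF qp(1)] qp(2)] fc by (simp_all add: loc_at_one)
    qed
    have "s \<otimes>\<^bsub>spec_sections R ?V\<^esub> restrict (spec_global R f) ?V = \<one>\<^bsub>spec_sections R ?V\<^esub>"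
      "restrict (spec_global R f) ?V \<otimes>\<^bsub>spec_sections R ?V\<^esub> s = \<one>\<^bsub>spec_sections R ?V\<^esub>"
      unfolding spec_sections_simps by (rule restrict_ext, use v in \<open>simp add: s_def spec_global_def\<close>)+
    then have "germ (Spec R) y ?V s \<otimes>\<^bsub>?T\<^esub> ?\<theta> f = \<one>\<^bsub>?T\<^esub>" "?\<theta> f \<otimes>\<^bsub>?T\<^esub> germ (Spec R) y ?V s = \<one>\<^bsub>?T\<^esub>"
      unfolding restrict_germ[OF fc V] S.stalk_mult[OF s n] S.stalk_mult[OF n s] S.stalk_one[OF oV V(2)]
      by (simp_all add: Spec_simps)
    moreover have "germ (Spec R) y ?V s \<in> carrier ?T" using s S.stalk_carrier by blast
    ultimately show ?thesis using ring_hom_closed[OF hom fc] unfolding Units_def by blast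
  qed
  show ?thesis unfolding localization_map_def using hom fracs ker unit by blast
qed

end

lemma localization_map_iso:
  assumes \<theta>: "localization_map R J p S \<theta>" and h: "h \<in> ring_iso S T" and h0: "h \<zero>\<^bsub>S\<^esub> = \<zero>\<^bsub>T\<^esub>" "\<zero>\<^bsub>S\<^esub> \<in> carrier S"
    and p: "p \<subseteq> carrier R"
  shows "localization_map R J p T (\<lambda>a. h (\<theta> a))"
proof -
  note hE = ring_iso_memE[OF h]
  have inj: "inj_on h (carrier S)" and surj: "h ` carrier S = carrier T" using hE(5) by (auto simp: bij_betw_def)
  have hom: "\<theta> \<in> ring_hom R S"
    and frac: "\<And>B. B \<in> carrier S \<Longrightarrow> \<exists>a\<in>carrier R. \<exists>s\<in>carrier R - p. \<theta> s \<otimes>\<^bsub>S\<^esub> B = \<theta> a"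
    and ker: "\<And>a. a \<in> carrier R \<Longrightarrow> \<theta> a = \<zero>\<^bsub>S\<^esub> \<longleftrightarrow> (\<exists>s\<in>carrier R - p. s \<otimes>\<^bsub>R\<^esub> a \<in> J)"
    and unit: "\<And>s. s \<in> carrier R - p \<Longrightarrow> \<theta> s \<in> Units S"
    using \<theta> unfolding localization_map_def by blast+
  note tc = ring_hom_closed[OF hom]
  show ?thesis unfolding localization_map_def
  proof (intro conjI ballI)
    show "(\<lambda>a. h (\<theta> a)) \<in> ring_hom R T"
      using ring_hom_trans[OF hom, of h T] h by (simp add: ring_iso_def comp_def)
    show "\<exists>a\<in>carrier R. \<exists>s\<in>carrier R - p. h (\<theta> s) \<otimes>\<^bsub>T\<^esub> B = h (\<theta> a)" if B: "B \<in> carrier T" for B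
    proof -
      obtain C where C: "C \<in> carrier S" "B = h C" using B surj by blast
      then obtain a s where "a \<in> carrier R" "s \<in> carrier R - p" "\<theta> s \<otimes>\<^bsub>S\<^esub> C = \<theta> a" using frac by blast
      moreover have "h (\<theta> s) \<otimes>\<^bsub>T\<^esub> B = h (\<theta> s \<otimes>\<^bsub>S\<^esub> C)"
        unfolding C(2) using hE(2)[OF tc C(1), of s] \<open>s \<in> carrier R - p\<close> by simp
      ultimately show ?thesis by metis
    qed
    show "(h (\<theta> a) = \<zero>\<^bsub>T\<^esub>) = (\<exists>s\<in>carrier R - p. s \<otimes>\<^bsub>R\<^esub> a \<in> J)" if "a \<in> carrier R" for a
      unfolding ker[OF that, symmetric] h0(1)[symmetric] using inj_on_eq_iff[OF inj tc[OF that] h0(2)] .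
    show "h (\<theta> s) \<in> Units T" if s: "s \<in> carrier R - p" for s
    proof -
      obtain v where v: "v \<in> carrier S" "v \<otimes>\<^bsub>S\<^esub> \<theta> s = \<one>\<^bsub>S\<^esub>" "\<theta> s \<otimes>\<^bsub>S\<^esub> v = \<one>\<^bsub>S\<^esub>" "\<theta> s \<in> carrier S"
        using unit[OF s] unfolding Units_def by blast
      have "h v \<otimes>\<^bsub>T\<^esub> h (\<theta> s) = \<one>\<^bsub>T\<^esub>" "h (\<theta> s) \<otimes>\<^bsub>T\<^esub> h v = \<one>\<^bsub>T\<^esub>"
        using hE(2)[OF v(1,4)] hE(2)[OF v(4,1)] v hE(4) by simp_all
      then show ?thesis unfolding Units_def using hE(1) v by blast
    qed
  qed
qed

text \<open>The identification \<open>(P / I)\<^sub>y = P\<^sub>p / I\<^sub>p\<close>.\<close>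

lemma localization_map_quotient:
  assumes P: "cring P" and I: "ideal I P" and y: "primeideal y (P Quot I)"
    and \<theta>: "localization_map (P Quot I) {\<zero>\<^bsub>P Quot I\<^esub>} y T \<theta>"
  defines "p \<equiv> {g \<in> carrier P. I +>\<^bsub>P\<^esub> g \<in> y}"
  shows "primeideal p P" "I \<subseteq> p" "localization_map P I p T (\<lambda>g. \<theta> (I +>\<^bsub>P\<^esub> g))"
proof -
  interpret P: cring P by fact
  interpret I: ideal I P by fact
  interpret Q: ring "P Quot I" by (rule I.quotient_is_ring)
  let ?\<pi> = "\<lambda>g. I +>\<^bsub>P\<^esub> g"
  have rep: "\<exists>g\<in>carrier P. x = ?\<pi> g" if "x \<in> carrier (P Quot I)" for x
    using that unfolding FactRing_def A_RCOSETS_def' by (simp only: partial_object.select_convs) blast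
  interpret h: ring_hom_ring P "P Quot I" ?\<pi> by (rule I.rcos_ring_hom_ring)
  interpret y: primeideal y "P Quot I" by fact
  show pp: "primeideal p P" unfolding p_def by (rule h.primeideal_preimage[OF P y])
  have z: "?\<pi> a = \<zero>\<^bsub>P Quot I\<^esub> \<longleftrightarrow> a \<in> I" if "a \<in> carrier P" for a
  proof -
    have "\<zero>\<^bsub>P Quot I\<^esub> = I" by (simp only: FactRing_def ring.select_convs)
    then show ?thesis using I.rcos_const_imp_mem[OF that] P.a_rcos_zero[OF I] by metis
  qed
  show Ip: "I \<subseteq> p"
  proof
    fix a assume a: "a \<in> I"
    then have ac: "a \<in> carrier P" using I.a_subset by auto
    have "?\<pi> a \<in> y" using z[OF ac] a additive_subgroup.zero_closed[OF y.is_additive_subgroup] by simp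
    then show "a \<in> p" using ac by (simp add: p_def)
  qed
  have hom: "\<theta> \<in> ring_hom (P Quot I) T"
    and frac: "\<And>B. B \<in> carrier T \<Longrightarrow> \<exists>a\<in>carrier (P Quot I). \<exists>s\<in>carrier (P Quot I) - y. \<theta> s \<otimes>\<^bsub>T\<^esub> B = \<theta> a"
    and ker: "\<And>a. a \<in> carrier (P Quot I) \<Longrightarrow> \<theta> a = \<zero>\<^bsub>T\<^esub> \<longleftrightarrow> (\<exists>s\<in>carrier (P Quot I) - y. s \<otimes>\<^bsub>P Quot I\<^esub> a \<in> {\<zero>\<^bsub>P Quot I\<^esub>})"
    and unit: "\<And>s. s \<in> carrier (P Quot I) - y \<Longrightarrow> \<theta> s \<in> Units T"
    using \<theta> unfolding localization_map_def by blast+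
  have rep': "\<exists>g\<in>carrier P - p. x = ?\<pi> g" if "x \<in> carrier (P Quot I) - y" for x
    using rep[of x] that by (auto simp: p_def)
  have im: "?\<pi> g \<in> carrier (P Quot I) - y" if "g \<in> carrier P - p" for g using that by (auto simp: p_def)
  show "localization_map P I p T (\<lambda>g. \<theta> (?\<pi> g))" unfolding localization_map_def
  proof (intro conjI ballI)
    show "(\<lambda>g. \<theta> (?\<pi> g)) \<in> ring_hom P T" using ring_hom_trans[OF h.homh hom] by (simp add: comp_def)
    show "\<exists>a\<in>carrier P. \<exists>s\<in>carrier P - p. \<theta> (?\<pi> s) \<otimes>\<^bsub>T\<^esub> B = \<theta> (?\<pi> a)" if "B \<in> carrier T" for B
      using frac[OF that] rep rep' by metis
    show "(\<theta> (?\<pi> a) = \<zero>\<^bsub>T\<^esub>) = (\<exists>s\<in>carrier P - p. s \<otimes>\<^bsub>P\<^esub> a \<in> I)" if a: "a \<in> carrier P" for a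
    proof -
      have e: "?\<pi> s \<otimes>\<^bsub>P Quot I\<^esub> ?\<pi> a \<in> {\<zero>\<^bsub>P Quot I\<^esub>} \<longleftrightarrow> s \<otimes>\<^bsub>P\<^esub> a \<in> I" if "s \<in> carrier P" for s
        using z[of "s \<otimes>\<^bsub>P\<^esub> a"] h.hom_mult[OF that a] that a by simp
      have "(\<theta> (?\<pi> a) = \<zero>\<^bsub>T\<^esub>) = (\<exists>s\<in>carrier (P Quot I) - y. s \<otimes>\<^bsub>P Quot I\<^esub> ?\<pi> a \<in> {\<zero>\<^bsub>P Quot I\<^esub>})"
        by (rule ker) (use a in simp)
      also have "\<dots> = (\<exists>s\<in>carrier P - p. ?\<pi> s \<otimes>\<^bsub>P Quot I\<^esub> ?\<pi> a \<in> {\<zero>\<^bsub>P Quot I\<^esub>})"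
        using rep' im by metis
      also have "\<dots> = (\<exists>s\<in>carrier P - p. s \<otimes>\<^bsub>P\<^esub> a \<in> I)" using e by (intro bex_cong) auto
      finally show ?thesis .
    qed
    show "\<theta> (?\<pi> s) \<in> Units T" if "s \<in> carrier P - p" for s by (rule unit[OF im[OF that]])
  qed
qed

subsection \<open>Isomorphic rings have isomorphic spectra\<close>

definition spec_map :: "('a, 'm) ring_scheme \<Rightarrow> ('a \<Rightarrow> 'b) \<Rightarrow> 'b set \<Rightarrow> 'a set" where
  "spec_map A \<alpha> q = {a \<in> carrier A. \<alpha> a \<in> q}"

text \<open>A fraction is the set of its representatives, so an isomorphism acts by taking images.\<close>

definition frac_map :: "('a \<Rightarrow> 'b) \<Rightarrow> ('a \<times> 'a) set \<Rightarrow> ('b \<times> 'b) set" where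
  "frac_map \<alpha> X = (\<lambda>(a, s). (\<alpha> a, \<alpha> s)) ` X"

definition spec_preimage ::
  "('a, 'm) ring_scheme \<Rightarrow> ('b, 'n) ring_scheme \<Rightarrow> ('a \<Rightarrow> 'b) \<Rightarrow> 'a set set \<Rightarrow> 'b set set" where
  "spec_preimage A B \<alpha> W = {q \<in> primes B. spec_map A \<alpha> q \<in> W}"

definition spec_pullback ::
  "('a, 'm) ring_scheme \<Rightarrow> ('b, 'n) ring_scheme \<Rightarrow> ('a \<Rightarrow> 'b) \<Rightarrow> 'a set set \<Rightarrow>
   ('a set \<Rightarrow> ('a \<times> 'a) set) \<Rightarrow> 'b set \<Rightarrow> ('b \<times> 'b) set" where
  "spec_pullback A B \<alpha> W s = (\<lambda>q\<in>spec_preimage A B \<alpha> W. frac_map \<alpha> (s (spec_map A \<alpha> q)))"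

text \<open>With the inverse as part of the data the situation is symmetric, and each statement about the
  pullback along \<open>\<alpha>\<close> also applies to its inverse.\<close>

locale inverse_isos = A: cring A + B: cring B
  for A :: "('a, 'm) ring_scheme" and B :: "('b, 'n) ring_scheme" +
  fixes \<alpha> \<beta>
  assumes \<alpha>: "\<alpha> \<in> ring_iso A B" and \<beta>: "\<beta> \<in> ring_iso B A"
    and \<beta>\<alpha>: "\<And>a. a \<in> carrier A \<Longrightarrow> \<beta> (\<alpha> a) = a" and \<alpha>\<beta>: "\<And>b. b \<in> carrier B \<Longrightarrow> \<alpha> (\<beta> b) = b"
begin

lemma swap: "inverse_isos B A \<beta> \<alpha>"
  by (intro inverse_isos.intro inverse_isos_axioms.intro A.is_cring B.is_cring \<alpha> \<beta> \<alpha>\<beta> \<beta>\<alpha>)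

lemma hom: "ring_hom_ring A B \<alpha>"
  by (rule ring_hom_ringI2[OF A.ring_axioms B.ring_axioms]) (use \<alpha> in \<open>simp add: ring_iso_def\<close>)

lemma \<alpha>_closed: "a \<in> carrier A \<Longrightarrow> \<alpha> a \<in> carrier B" by (rule ring_iso_memE(1)[OF \<alpha>])
lemma \<beta>_closed: "b \<in> carrier B \<Longrightarrow> \<beta> b \<in> carrier A" by (rule ring_iso_memE(1)[OF \<beta>])

lemma spec_map_prime: "q \<in> primes B \<Longrightarrow> spec_map A \<alpha> q \<in> primes A"
  using ring_hom_ring.primeideal_preimage[OF hom A.is_cring] by (simp add: primes_def spec_map_def)

lemma spec_map_inverse:
  assumes "p \<in> primes A" shows "spec_map A \<alpha> (spec_map B \<beta> p) = p"
proof -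
  have "p \<subseteq> carrier A" using assms A.ideal_subset primeideal.axioms(1) by (auto simp: primes_def)
  then show ?thesis using \<beta>\<alpha> \<alpha>_closed by (auto simp: spec_map_def)
qed

lemma spec_preimage_open:
  assumes "zariski_open A W" shows "zariski_open B (spec_preimage A B \<alpha> W)"
proof -
  obtain S where S: "S \<subseteq> carrier A" "W = {p \<in> primes A. \<not> S \<subseteq> p}" using assms by (auto simp: zariski_open_def)
  have "spec_preimage A B \<alpha> W = {q \<in> primes B. \<not> \<alpha> ` S \<subseteq> q}"
    using spec_map_prime S(1) by (auto simp: spec_preimage_def S(2) spec_map_def)
  then show ?thesis unfolding zariski_open_def using S(1) \<alpha>_closed by (intro exI[of _ "\<alpha> ` S"]) auto
qed

lemma spec_preimage_inverse:
  assumes "W \<subseteq> primes A" shows "spec_preimage B A \<beta> (spec_preimage A B \<alpha> W) = W"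
  using assms inverse_isos.spec_map_prime[OF swap] spec_map_inverse by (auto simp: spec_preimage_def)

lemma frac_map_fract:
  assumes a: "a \<in> carrier A" "s \<in> carrier A"
  shows "frac_map \<alpha> (fract A (carrier A - spec_map A \<alpha> q) a s) = fract B (carrier B - q) (\<alpha> a) (\<alpha> s)"
proof -
  interpret h: ring_hom_ring A B \<alpha> by (rule hom)
  have inj: "\<alpha> x = \<zero>\<^bsub>B\<^esub> \<Longrightarrow> x \<in> carrier A \<Longrightarrow> x = \<zero>\<^bsub>A\<^esub>" for x
    using \<beta>\<alpha>[of x] \<beta>\<alpha>[of "\<zero>\<^bsub>A\<^esub>"] by simp
  have e: "\<alpha> (u \<otimes>\<^bsub>A\<^esub> (a \<otimes>\<^bsub>A\<^esub> t \<ominus>\<^bsub>A\<^esub> b \<otimes>\<^bsub>A\<^esub> s)) = \<alpha> u \<otimes>\<^bsub>B\<^esub> (\<alpha> a \<otimes>\<^bsub>B\<^esub> \<alpha> t \<ominus>\<^bsub>B\<^esub> \<alpha> b \<otimes>\<^bsub>B\<^esub> \<alpha> s)"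
    if "u \<in> carrier A" "b \<in> carrier A" "t \<in> carrier A" for u b t
    using that a by (simp add: A.minus_eq B.minus_eq)
  show ?thesis
  proof
    show "frac_map \<alpha> (fract A (carrier A - spec_map A \<alpha> q) a s) \<subseteq> fract B (carrier B - q) (\<alpha> a) (\<alpha> s)"
    proof
      fix x assume "x \<in> frac_map \<alpha> (fract A (carrier A - spec_map A \<alpha> q) a s)"
      then obtain b t u where x: "x = (\<alpha> b, \<alpha> t)" "b \<in> carrier A" "t \<in> carrier A" "t \<notin> spec_map A \<alpha> q"
        "u \<in> carrier A" "u \<notin> spec_map A \<alpha> q" "u \<otimes>\<^bsub>A\<^esub> (a \<otimes>\<^bsub>A\<^esub> t \<ominus>\<^bsub>A\<^esub> b \<otimes>\<^bsub>A\<^esub> s) = \<zero>\<^bsub>A\<^esub>"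
        unfolding frac_map_def fract_def by auto
      have "\<alpha> u \<otimes>\<^bsub>B\<^esub> (\<alpha> a \<otimes>\<^bsub>B\<^esub> \<alpha> t \<ominus>\<^bsub>B\<^esub> \<alpha> b \<otimes>\<^bsub>B\<^esub> \<alpha> s) = \<zero>\<^bsub>B\<^esub>"
        using e[OF x(5,2,3)] x(7) by simp
      moreover have "\<alpha> u \<in> carrier B - q" "\<alpha> t \<in> carrier B - q" "\<alpha> b \<in> carrier B"
        using x(2-6) \<alpha>_closed by (auto simp: spec_map_def)
      ultimately show "x \<in> fract B (carrier B - q) (\<alpha> a) (\<alpha> s)" unfolding fract_def x(1) by blast
    qed
    show "fract B (carrier B - q) (\<alpha> a) (\<alpha> s) \<subseteq> frac_map \<alpha> (fract A (carrier A - spec_map A \<alpha> q) a s)"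
    proof
      fix x assume "x \<in> fract B (carrier B - q) (\<alpha> a) (\<alpha> s)"
      then obtain b t u where x: "x = (b, t)" "b \<in> carrier B" "t \<in> carrier B" "t \<notin> q" "u \<in> carrier B" "u \<notin> q"
        "u \<otimes>\<^bsub>B\<^esub> (\<alpha> a \<otimes>\<^bsub>B\<^esub> t \<ominus>\<^bsub>B\<^esub> b \<otimes>\<^bsub>B\<^esub> \<alpha> s) = \<zero>\<^bsub>B\<^esub>"
        unfolding fract_def by auto
      have c: "\<beta> u \<in> carrier A" "\<beta> b \<in> carrier A" "\<beta> t \<in> carrier A" using x \<beta>_closed by auto
      have "\<alpha> (\<beta> u \<otimes>\<^bsub>A\<^esub> (a \<otimes>\<^bsub>A\<^esub> \<beta> t \<ominus>\<^bsub>A\<^esub> \<beta> b \<otimes>\<^bsub>A\<^esub> s)) = \<zero>\<^bsub>B\<^esub>"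
        unfolding e[OF c] \<alpha>\<beta>[OF x(2)] \<alpha>\<beta>[OF x(3)] \<alpha>\<beta>[OF x(5)] by (rule x(7))
      then have "\<beta> u \<otimes>\<^bsub>A\<^esub> (a \<otimes>\<^bsub>A\<^esub> \<beta> t \<ominus>\<^bsub>A\<^esub> \<beta> b \<otimes>\<^bsub>A\<^esub> s) = \<zero>\<^bsub>A\<^esub>" by (rule inj) (use c a in simp)
      moreover have "\<beta> u \<in> carrier A - spec_map A \<alpha> q" "\<beta> t \<in> carrier A - spec_map A \<alpha> q"
        using c x \<alpha>\<beta> by (auto simp: spec_map_def)
      ultimately have "(\<beta> b, \<beta> t) \<in> fract A (carrier A - spec_map A \<alpha> q) a s" unfolding fract_def using c by blast
      then have "(\<alpha> (\<beta> b), \<alpha> (\<beta> t)) \<in> frac_map \<alpha> (fract A (carrier A - spec_map A \<alpha> q) a s)"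
        unfolding frac_map_def by force
      then show "x \<in> frac_map \<alpha> (fract A (carrier A - spec_map A \<alpha> q) a s)"
        unfolding \<alpha>\<beta>[OF x(2)] \<alpha>\<beta>[OF x(3)] x(1) .
    qed
  qed
qed

lemma frac_map_inverse:
  assumes "X \<subseteq> carrier A \<times> carrier A" shows "frac_map \<beta> (frac_map \<alpha> X) = X"
proof -
  have "(\<lambda>x. (\<lambda>(a, s). (\<beta> a, \<beta> s)) ((\<lambda>(a, s). (\<alpha> a, \<alpha> s)) x)) ` X = (\<lambda>x. x) ` X"
    by (rule image_cong) (use assms \<beta>\<alpha> in auto)
  then show ?thesis unfolding frac_map_def image_image by simp
qed

lemma spec_preimage_mem: "q \<in> spec_preimage A B \<alpha> W \<Longrightarrow> q \<in> primes B \<and> spec_map A \<alpha> q \<in> W"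
  by (simp add: spec_preimage_def)

lemma pullback_section:
  assumes W: "zariski_open A W" and s: "s \<in> carrier (spec_sections A W)"
  shows "spec_pullback A B \<alpha> W s \<in> carrier (spec_sections B (spec_preimage A B \<alpha> W))"
proof -
  have "B.locally_frac (spec_preimage A B \<alpha> W) (spec_pullback A B \<alpha> W s)"
  proof (rule B.locally_fracI)
    fix q assume q: "q \<in> spec_preimage A B \<alpha> W"
    have sl: "A.locally_frac W s" using s A.spec_sections_carrier[OF W] by simp
    obtain V a f where V: "zariski_open A V" "spec_map A \<alpha> q \<in> V" "V \<subseteq> W" "a \<in> carrier A" "f \<in> carrier A"
      "\<And>p. p \<in> V \<Longrightarrow> f \<notin> p \<and> s p = A.frac p a f"
      by (rule A.locally_fracE[OF sl]) (use spec_preimage_mem[OF q] in blast)+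
    have "\<alpha> f \<notin> q' \<and> spec_pullback A B \<alpha> W s q' = B.frac q' (\<alpha> a) (\<alpha> f)" if q': "q' \<in> spec_preimage A B \<alpha> V" for q'
    proof -
      have m: "spec_map A \<alpha> q' \<in> V" "q' \<in> spec_preimage A B \<alpha> W"
        using q' V(3) by (auto simp: spec_preimage_def)
      then show ?thesis using V(6)[OF m(1)] V(4,5) frac_map_fract[OF V(4,5), of q']
        by (simp add: spec_pullback_def spec_map_def[of A \<alpha> q'])
    qed
    moreover have "spec_preimage A B \<alpha> V \<subseteq> spec_preimage A B \<alpha> W" using V(3) by (auto simp: spec_preimage_def)
    moreover have "q \<in> spec_preimage A B \<alpha> V" using q V(2) by (auto simp: spec_preimage_def)
    ultimately show "\<exists>V a f. zariski_open B V \<and> q \<in> V \<and> V \<subseteq> spec_preimage A B \<alpha> W \<and> a \<in> carrier B \<and> f \<in> carrier B \<and>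
         (\<forall>q\<in>V. f \<notin> q \<and> spec_pullback A B \<alpha> W s q = B.frac q a f)"
      using spec_preimage_open[OF V(1)] \<alpha>_closed V(4,5) by blast
  qed
  then show ?thesis
    unfolding B.spec_sections_carrier[OF spec_preimage_open[OF W]] by (simp add: spec_pullback_def)
qed

lemma pullback_inverse:
  assumes W: "zariski_open A W" and s: "s \<in> carrier (spec_sections A W)"
  shows "spec_pullback B A \<beta> (spec_preimage A B \<alpha> W) (spec_pullback A B \<alpha> W s) = s"
proof
  fix p
  have pi: "spec_preimage B A \<beta> (spec_preimage A B \<alpha> W) = W"
    by (rule spec_preimage_inverse[OF zariski_open_primes[OF W]])
  show "spec_pullback B A \<beta> (spec_preimage A B \<alpha> W) (spec_pullback A B \<alpha> W s) p = s p"
  proof (cases "p \<in> W")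
    case True
    then have pp: "p \<in> primes A" using zariski_open_primes[OF W] by auto
    obtain a f where "s p = A.frac p a f" using A.loc_at_rep[OF pp A.spec_section_value[OF W s True]] by blast
    then have sub: "s p \<subseteq> carrier A \<times> carrier A" by (auto simp: fract_def)
    have "p \<in> spec_preimage B A \<beta> (spec_preimage A B \<alpha> W)" using True pi by simp
    then have m: "spec_map B \<beta> p \<in> spec_preimage A B \<alpha> W" by (simp add: spec_preimage_def)
    show ?thesis
      using True m pi spec_map_inverse[OF pp] frac_map_inverse[OF sub] by (simp add: spec_pullback_def)
  next
    case False
    have "s \<in> extensional W" using s unfolding A.spec_sections_carrier[OF W] by (simp add: PiE_def)
    then have "s p = undefined" using False by (rule extensional_arb)
    then show ?thesis unfolding spec_pullback_def[of B] pi using False by simp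
  qed
qed

lemma pullback_iso:
  assumes W: "zariski_open A W"
  shows "spec_pullback A B \<alpha> W \<in> ring_iso (spec_sections A W) (spec_sections B (spec_preimage A B \<alpha> W))"
proof (rule ring_iso_memI)
  interpret h: ring_hom_ring A B \<alpha> by (rule hom)
  let ?W = "spec_preimage A B \<alpha> W"
  show "spec_pullback A B \<alpha> W s \<in> carrier (spec_sections B ?W)" if "s \<in> carrier (spec_sections A W)" for s
    by (rule pullback_section[OF W that])
  have ops: "spec_pullback A B \<alpha> W (s \<otimes>\<^bsub>spec_sections A W\<^esub> t)
      = spec_pullback A B \<alpha> W s \<otimes>\<^bsub>spec_sections B ?W\<^esub> spec_pullback A B \<alpha> W t \<and>
    spec_pullback A B \<alpha> W (s \<oplus>\<^bsub>spec_sections A W\<^esub> t)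
      = spec_pullback A B \<alpha> W s \<oplus>\<^bsub>spec_sections B ?W\<^esub> spec_pullback A B \<alpha> W t"
    if s: "s \<in> carrier (spec_sections A W)" and t: "t \<in> carrier (spec_sections A W)" for s t
  proof -
    have pt: "frac_map \<alpha> (s p \<otimes>\<^bsub>loc_at A p\<^esub> t p) = frac_map \<alpha> (s p) \<otimes>\<^bsub>loc_at B q\<^esub> frac_map \<alpha> (t p) \<and>
        frac_map \<alpha> (s p \<oplus>\<^bsub>loc_at A p\<^esub> t p) = frac_map \<alpha> (s p) \<oplus>\<^bsub>loc_at B q\<^esub> frac_map \<alpha> (t p)"
      if q: "q \<in> primes B" and p: "p = spec_map A \<alpha> q" "p \<in> W" for q p
    proof -
      have pp: "p \<in> primes A" using zariski_open_primes[OF W] p by auto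
      obtain a f where a: "a \<in> carrier A" "f \<in> carrier A" "f \<notin> p" "s p = A.frac p a f"
        using A.loc_at_rep[OF pp A.spec_section_value[OF W s p(2)]] by blast
      obtain b g where b: "b \<in> carrier A" "g \<in> carrier A" "g \<notin> p" "t p = A.frac p b g"
        using A.loc_at_rep[OF pp A.spec_section_value[OF W t p(2)]] by blast
      have n: "\<alpha> f \<notin> q" "\<alpha> g \<notin> q" using a b p by (auto simp: spec_map_def)
      note c = \<alpha>_closed[OF a(1)] \<alpha>_closed[OF b(1)] \<alpha>_closed[OF a(2)] \<alpha>_closed[OF b(2)]
      note fm = frac_map_fract[of _ _ q, folded p(1)]
      show ?thesis
        unfolding a(4) b(4) A.frac_ops(2)[OF pp a(1) b(1) a(2) b(2) a(3) b(3)]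
          A.frac_ops(3)[OF pp a(1) b(1) a(2) b(2) a(3) b(3)] fm[OF a(1,2)] fm[OF b(1,2)]
          B.frac_ops(2)[OF q c n] B.frac_ops(3)[OF q c n]
        using fm[of "a \<otimes>\<^bsub>A\<^esub> b" "f \<otimes>\<^bsub>A\<^esub> g"] fm[of "a \<otimes>\<^bsub>A\<^esub> g \<oplus>\<^bsub>A\<^esub> b \<otimes>\<^bsub>A\<^esub> f" "f \<otimes>\<^bsub>A\<^esub> g"] a(1,2) b(1,2) by simp
    qed
    show ?thesis
      using pt[OF _ refl] by (auto simp: spec_pullback_def A.spec_sections_simps B.spec_sections_simps
          spec_preimage_def restrict_def fun_eq_iff)
  qed
  show "spec_pullback A B \<alpha> W (s \<otimes>\<^bsub>spec_sections A W\<^esub> t)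
      = spec_pullback A B \<alpha> W s \<otimes>\<^bsub>spec_sections B ?W\<^esub> spec_pullback A B \<alpha> W t"
    "spec_pullback A B \<alpha> W (s \<oplus>\<^bsub>spec_sections A W\<^esub> t)
      = spec_pullback A B \<alpha> W s \<oplus>\<^bsub>spec_sections B ?W\<^esub> spec_pullback A B \<alpha> W t"
    if "s \<in> carrier (spec_sections A W)" "t \<in> carrier (spec_sections A W)" for s t using ops[OF that] by auto
  show "spec_pullback A B \<alpha> W \<one>\<^bsub>spec_sections A W\<^esub> = \<one>\<^bsub>spec_sections B ?W\<^esub>"
    using frac_map_fract[OF A.one_closed A.one_closed]
    by (auto simp: spec_pullback_def A.spec_sections_simps B.spec_sections_simps
        spec_preimage_def restrict_def fun_eq_iff A.loc_at_one B.loc_at_one)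
  show "bij_betw (spec_pullback A B \<alpha> W) (carrier (spec_sections A W)) (carrier (spec_sections B ?W))"
  proof (rule bij_betw_byWitness[where f' = "spec_pullback B A \<beta> ?W"])
    have pi: "spec_preimage B A \<beta> ?W = W" by (rule spec_preimage_inverse[OF zariski_open_primes[OF W]])
    note oW = spec_preimage_open[OF W]
    show "\<forall>s\<in>carrier (spec_sections A W). spec_pullback B A \<beta> ?W (spec_pullback A B \<alpha> W s) = s"
      using pullback_inverse[OF W] by blast
    show "\<forall>s\<in>carrier (spec_sections B ?W). spec_pullback A B \<alpha> W (spec_pullback B A \<beta> ?W s) = s"
      using inverse_isos.pullback_inverse[OF swap oW] unfolding pi by blast
    show "spec_pullback A B \<alpha> W ` carrier (spec_sections A W) \<subseteq> carrier (spec_sections B ?W)"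
      using pullback_section[OF W] by blast
    show "spec_pullback B A \<beta> ?W ` carrier (spec_sections B ?W) \<subseteq> carrier (spec_sections A W)"
      using inverse_isos.pullback_section[OF swap oW] unfolding pi by blast
  qed
qed

lemma spec_map_continuous: "continuous_map (sp_top (Spec B)) (sp_top (Spec A)) (spec_map A \<alpha>)"
  unfolding continuous_map_def
  using spec_map_prime spec_preimage_open
  by (auto simp: A.Spec_points B.Spec_points Spec_open spec_preimage_def)

lemma spec_map_homeomorphic: "homeomorphic_map (sp_top (Spec B)) (sp_top (Spec A)) (spec_map A \<alpha>)"
  unfolding homeomorphic_map_maps homeomorphic_maps_def
  using spec_map_continuous inverse_isos.spec_map_continuous[OF swap]
    spec_map_inverse inverse_isos.spec_map_inverse[OF swap]
  by (intro exI[of _ "spec_map B \<beta>"]) (simp add: A.Spec_points B.Spec_points)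

theorem lrs_iso_change_ring:
  assumes X: "ring_presheaf X" and loc: "\<And>x. x \<in> points X \<Longrightarrow> local_ring (stalk X x)"
    and iso: "lrs_iso X (Spec B) f \<phi>"
  shows "lrs_iso X (Spec A) (\<lambda>x. spec_map A \<alpha> (f x)) (\<lambda>W s. \<phi> (spec_preimage A B \<alpha> W) (spec_pullback A B \<alpha> W s))"
proof (rule lrs_isoI[OF X A.Spec_presheaf loc])
  have hf: "homeomorphic_map (sp_top X) (sp_top (Spec B)) f"
    and ri: "\<And>V. zariski_open B V \<Longrightarrow> \<phi> V \<in> ring_iso (spec_sections B V) (sections X (preim X f V))"
    and nat: "\<And>V W t. zariski_open B V \<Longrightarrow> zariski_open B W \<Longrightarrow> W \<subseteq> V \<Longrightarrow> t \<in> carrier (spec_sections B V) \<Longrightarrow>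
        \<phi> W (restrict t W) = restr X (preim X f V) (preim X f W) (\<phi> V t)"
    using iso unfolding lrs_iso_def lrs_morphism_def by (auto simp: Spec_open Spec_simps)
  have fp: "f x \<in> primes B" if "x \<in> points X" for x
    using homeomorphic_imp_surjective_map[OF hf] that by (auto simp: B.Spec_points)
  show "homeomorphic_map (sp_top X) (sp_top (Spec A)) (\<lambda>x. spec_map A \<alpha> (f x))"
    using homeomorphic_map_compose[OF hf spec_map_homeomorphic] by (simp add: comp_def)
  have pre: "preim X (\<lambda>x. spec_map A \<alpha> (f x)) W = preim X f (spec_preimage A B \<alpha> W)" for W
    using fp by (auto simp: preim_def spec_preimage_def)
  show "(\<lambda>s. \<phi> (spec_preimage A B \<alpha> W) (spec_pullback A B \<alpha> W s))
      \<in> ring_iso (sections (Spec A) W) (sections X (preim X (\<lambda>x. spec_map A \<alpha> (f x)) W))"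
    if "is_open (Spec A) W" for W
    using ring_iso_set_trans[OF pullback_iso ri[OF spec_preimage_open]] that
    by (simp add: Spec_open Spec_simps pre comp_def)
  show "\<phi> (spec_preimage A B \<alpha> W) (spec_pullback A B \<alpha> W (restr (Spec A) V W t))
      = restr X (preim X (\<lambda>x. spec_map A \<alpha> (f x)) V) (preim X (\<lambda>x. spec_map A \<alpha> (f x)) W)
          (\<phi> (spec_preimage A B \<alpha> V) (spec_pullback A B \<alpha> V t))"
    if "is_open (Spec A) V" "is_open (Spec A) W" "W \<subseteq> V" "t \<in> carrier (sections (Spec A) V)" for V W t
  proof -
    have o: "zariski_open A V" "zariski_open A W" "t \<in> carrier (spec_sections A V)"
      using that by (auto simp: Spec_open Spec_simps)
    have sub: "spec_preimage A B \<alpha> W \<subseteq> spec_preimage A B \<alpha> V" using that(3) by (auto simp: spec_preimage_def)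
    have "spec_pullback A B \<alpha> W (restrict t W) = restrict (spec_pullback A B \<alpha> V t) (spec_preimage A B \<alpha> W)"
      using sub by (auto simp: spec_pullback_def spec_preimage_def restrict_def fun_eq_iff)
    then show ?thesis
      using nat[OF spec_preimage_open[OF o(1)] spec_preimage_open[OF o(2)] sub pullback_section[OF o(1,3)]]
      by (simp add: Spec_simps pre)
  qed
qed

lemma pullback_global:
  assumes "a \<in> carrier A"
  shows "spec_pullback A B \<alpha> (primes A) (spec_global A a) = spec_global B (\<alpha> a)"
proof -
  interpret h: ring_hom_ring A B \<alpha> by (rule hom)
  show ?thesis
    using frac_map_fract[OF assms A.one_closed] spec_map_prime
    by (auto simp: spec_pullback_def spec_global_def spec_preimage_def restrict_def fun_eq_iff)
qed

lemma preimage_primes: "spec_preimage A B \<alpha> (primes A) = primes B"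
  using spec_map_prime by (auto simp: spec_preimage_def)

end

lemma inverse_isosI:
  assumes "cring A" "cring B" "\<alpha> \<in> ring_iso A B"
  shows "inverse_isos A B \<alpha> (inv_into (carrier A) \<alpha>)"
proof (intro inverse_isos.intro inverse_isos_axioms.intro assms ring_iso_inv)
  have "inj_on \<alpha> (carrier A)" "\<alpha> ` carrier A = carrier B"
    using ring_iso_memE(5)[OF assms(3)] by (auto simp: bij_betw_def)
  then show "inv_into (carrier A) \<alpha> (\<alpha> a) = a" if "a \<in> carrier A" for a using that by simp
  show "\<alpha> (inv_into (carrier A) \<alpha> b) = b" if "b \<in> carrier B" for b
    using that \<open>\<alpha> ` carrier A = carrier B\<close> by (simp add: f_inv_into_f)
qed

section \<open>Presentations of the local rings of a scheme\<close>

text \<open>The inverse images under \<open>f\<close> of the neighbourhoods of \<open>f x\<close> form a basis of neighbourhoods of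
  \<open>x\<close> in \<open>X\<close>, as \<open>U\<close> is open. So the stalk is that of \<open>Spec A\<close> at \<open>f x\<close>, the localization of \<open>A\<close>.\<close>

lemma affine_chart_stalk:
  assumes X: "locally_ringed_space X" and xU: "x \<in> U" and ch: "affine_chart k X \<psi> U A \<iota> f \<phi>"
  shows "f x \<in> primes A" "\<exists>\<theta>. localization_map A {\<zero>\<^bsub>A\<^esub>} (f x) (stalk X x) \<theta>"
proof -
  have U: "is_open X U" and A: "cring A" and iso: "lrs_iso (open_subspace X U) (Spec A) f \<phi>"
    using ch unfolding affine_chart_def by auto
  interpret A: cring A by (rule A)
  interpret locally_ringed_space X by (rule X)
  interpret X: ring_presheaf X by (rule is_ring_presheaf)
  interpret Y: ring_presheaf "Spec A" by (rule A.Spec_presheaf)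
  let ?XU = "open_subspace X U"
  have pts: "points ?XU = U" by (rule open_subspace_points[OF U])
  have hf: "homeomorphic_map (sp_top ?XU) (sp_top (Spec A)) f"
    and ri: "\<And>V. is_open (Spec A) V \<Longrightarrow> \<phi> V \<in> ring_iso (sections (Spec A) V) (sections X (preim ?XU f V))"
    and nat: "\<And>V W t. is_open (Spec A) V \<Longrightarrow> is_open (Spec A) W \<Longrightarrow> W \<subseteq> V \<Longrightarrow> t \<in> carrier (sections (Spec A) V) \<Longrightarrow>
        \<phi> W (restr (Spec A) V W t) = restr X (preim ?XU f V) (preim ?XU f W) (\<phi> V t)"
    using iso unfolding lrs_iso_def lrs_morphism_def by (auto simp: open_subspace_simps)
  show y: "f x \<in> primes A"
    using homeomorphic_imp_surjective_map[OF hf] xU unfolding pts A.Spec_points by blast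
  have xX: "x \<in> points X" using openin_subset[OF U] xU by blast
  interpret stalk_comparison X "Spec A" x "f x" "preim ?XU f" \<phi>
  proof (intro stalk_comparison.intro stalk_comparison_axioms.intro X.ring_presheaf_axioms Y.ring_presheaf_axioms xX)
    show "f x \<in> points (Spec A)" using y by (simp add: A.Spec_points)
    show "is_open X (preim ?XU f V)" if "is_open (Spec A) V" for V
      using openin_continuous_map_preimage[OF homeomorphic_imp_continuous_map[OF hf] that]
      unfolding preim_def[symmetric] open_subspace_open[OF U] by blast
    show "x \<in> preim ?XU f V" if "is_open (Spec A) V" "f x \<in> V" for V
      using that(2) xU by (simp add: preim_def pts)
    show "preim ?XU f V' \<subseteq> preim ?XU f V" if "V' \<subseteq> V" for V' V using that by (auto simp: preim_def)
    show "\<exists>V. is_open (Spec A) V \<and> f x \<in> V \<and> preim ?XU f V \<subseteq> W" if W: "is_open X W" "x \<in> W" for W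
    proof (intro exI conjI)
      have o: "is_open ?XU (W \<inter> U)" using W(1) U by (simp add: open_subspace_open[OF U] openin_Int)
      show "is_open (Spec A) (f ` (W \<inter> U))" using hf o by (meson homeomorphic_imp_open_map open_map_def)
      show "f x \<in> f ` (W \<inter> U)" using W(2) xU by blast
      have "inj_on f U" using homeomorphic_imp_injective_map[OF hf] by (simp add: pts)
      then show "preim ?XU f (f ` (W \<inter> U)) \<subseteq> W" unfolding preim_def pts inj_on_def by blast
    qed
  qed (rule ri nat, assumption+)+
  have "\<zero>\<^bsub>stalk (Spec A) (f x)\<^esub> \<in> carrier (stalk (Spec A) (f x))"
    by (rule Y.stalk_closed) (use y in \<open>simp add: A.Spec_points\<close>)
  moreover have "f x \<subseteq> carrier A"
    using y A.ideal_subset by (auto simp: primes_def dest: primeideal.axioms(1))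
  ultimately show "\<exists>\<theta>. localization_map A {\<zero>\<^bsub>A\<^esub>} (f x) (stalk X x) \<theta>"
    using localization_map_iso[OF A.Spec_stalk[OF y] cmp_iso cmp_zero] by blast
qed

lemma rt_of_local_presentation:
  assumes k: "field k" and X: "locally_ringed_space X" and reg: "regular_local_ring (stalk X x)"
    and pr: "local_presentation k X \<psi> x n I p"
  shows "rt_ideal (loc_at (mpoly_ring k n) p) (loc_ideal (mpoly_ring k n) p I) = 1"
proof -
  let ?P = "mpoly_ring k n"
  interpret k: field k by (rule k)
  obtain U f \<phi> where I: "ideal I ?P" and xU: "x \<in> U"
    and ch: "affine_chart k X \<psi> U (?P Quot I) (\<lambda>c. I +>\<^bsub>?P\<^esub> mpoly_const k c) f \<phi>"
    and p: "p = {g \<in> carrier ?P. I +>\<^bsub>?P\<^esub> g \<in> f x}"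
    using pr unfolding local_presentation_def by blast
  obtain \<theta> where \<theta>: "localization_map (?P Quot I) {\<zero>\<^bsub>?P Quot I\<^esub>} (f x) (stalk X x) \<theta>"
    using affine_chart_stalk(2)[OF X xU ch] by blast
  have y: "primeideal (f x) (?P Quot I)" using affine_chart_stalk(1)[OF X xU ch] by (simp add: primes_def)
  note q = localization_map_quotient[OF k.mpoly_cring I y \<theta>, folded p]
  show ?thesis by (rule rt_of_regular_presentation[OF k I q(1,2) reg q(3)])
qed

text \<open>If \<open>A\<close> is generated by \<open>fs\<close>, then \<open>A\<close> is isomorphic to \<open>k[T\<^sub>1, \<dots>, T\<^sub>n] / I\<close> with \<open>I\<close> the ideal
  of relations, and the chart with values in \<open>Spec A\<close> is composed with the isomorphism of spectra.\<close>

lemma local_presentation_exists: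
  assumes k: "cring k" and X: "locally_ringed_space X" and xU: "x \<in> U"
    and ch: "affine_chart k X \<psi> U A \<iota> f \<phi>" and gen: "generates_algebra k A \<iota> fs"
  shows "\<exists>n I p. local_presentation k X \<psi> x n I p"
proof -
  have U: "is_open X U" and A: "cring A" and \<iota>: "\<iota> \<in> ring_hom k A"
    and iso: "lrs_iso (open_subspace X U) (Spec A) f \<phi>"
    and comp: "\<And>c. c \<in> carrier k \<Longrightarrow> \<phi> (primes A) (spec_global A (\<iota> c)) = algebra_map k X \<psi> U c"
    using ch unfolding affine_chart_def by auto
  have fs: "set fs \<subseteq> carrier A" using gen by (simp add: generates_algebra_def)
  interpret mpoly_evaluation k A \<iota> fs
    by (intro mpoly_evaluation.intro mpoly_evaluation_axioms.intro k A \<iota> fs)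
  interpret h: ring_hom_ring M A ev by (rule ev_hom_ring)
  interpret locally_ringed_space X by (rule X)
  have surj: "ev ` carrier M = carrier A" using gen by (simp add: generates_algebra_def)
  define I where "I = a_kernel M A ev"
  define \<alpha> where "\<alpha> = (\<lambda>X. the_elem (ev ` X))"
  have I: "ideal I M" unfolding I_def by (rule h.kernel_is_ideal)
  have \<alpha>: "\<alpha> \<in> ring_iso (M Quot I) A" unfolding \<alpha>_def I_def by (rule h.FactRing_iso_set[OF surj])
  have \<alpha>_coset: "\<alpha> (I +>\<^bsub>M\<^esub> g) = ev g" if "g \<in> carrier M" for g
    unfolding \<alpha>_def I_def by (rule h.the_elem_simp[OF that])
  have Q: "cring (M Quot I)" by (rule ideal.quotient_is_cring[OF I M.is_cring])
  let ?\<iota> = "\<lambda>c. I +>\<^bsub>M\<^esub> mpoly_const k c"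
  have c: "mpoly_const k c \<in> carrier M" if "c \<in> carrier k" for c
    using ring_hom_closed[OF R.mpoly_const_hom that] .
  have quot: "(\<lambda>g. I +>\<^bsub>M\<^esub> g) \<in> ring_hom M (M Quot I)" by (rule ideal.rcos_ring_hom[OF I])
  have \<iota>': "?\<iota> \<in> ring_hom k (M Quot I)"
    using ring_hom_trans[OF R.mpoly_const_hom quot] by (simp add: comp_def)
  interpret T: inverse_isos "M Quot I" A \<alpha> "inv_into (carrier (M Quot I)) \<alpha>"
    by (rule inverse_isosI[OF Q A \<alpha>])
  let ?f = "\<lambda>x. spec_map (M Quot I) \<alpha> (f x)"
  let ?\<phi> = "\<lambda>W s. \<phi> (spec_preimage (M Quot I) A \<alpha> W) (spec_pullback (M Quot I) A \<alpha> W s)"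
  have iso': "lrs_iso (open_subspace X U) (Spec (M Quot I)) ?f ?\<phi>"
  proof (rule T.lrs_iso_change_ring[OF open_subspace_presheaf[OF is_ring_presheaf U] _ iso])
    fix z assume "z \<in> points (open_subspace X U)"
    then have z: "z \<in> U" unfolding open_subspace_points[OF U] .
    then have "z \<in> points X" using openin_subset[OF U] by blast
    then show "local_ring (stalk (open_subspace X U) z)"
      by (rule open_subspace_local[OF is_ring_presheaf U z stalk_local])
  qed
  have "?\<phi> (primes (M Quot I)) (spec_global (M Quot I) (?\<iota> c)) = algebra_map k X \<psi> U c" if "c \<in> carrier k" for c
    unfolding T.pullback_global[OF ring_hom_closed[OF \<iota>' that]] T.preimage_primes \<alpha>_coset[OF c[OF that]]
      ev_const[OF that] by (rule comp[OF that])
  then have "affine_chart k X \<psi> U (M Quot I) ?\<iota> ?f ?\<phi>"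
    unfolding affine_chart_def using U Q \<iota>' iso' by blast
  then show ?thesis unfolding local_presentation_def using I xU by blast
qed

text \<open>The relation type at a point is computed from a chosen presentation; one exists, and all give
  the value 1.\<close>

lemma rt_point_eq_1:
  fixes X :: "('x, 's) rspace"
  assumes k: "field k" and X: "finite_type_scheme k X \<pi> \<psi>" and reg: "regular_scheme X" and x: "x \<in> points X"
  shows "rt_point k X \<psi> x = 1"
proof -
  interpret scheme X using X by (simp add: finite_type_scheme_def scheme_over_def)
  have X': "locally_ringed_space X" by (rule locally_ringed_space_axioms)
  obtain \<U> where \<U>: "\<Union>\<U> = points X" "\<forall>U\<in>\<U>. \<exists>(A :: 's ring) \<iota> f \<phi>. affine_chart k X \<psi> U A \<iota> f \<phi> \<and>
           (\<exists>fs. generates_algebra k A \<iota> fs)"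
    using X unfolding finite_type_scheme_def by blast
  from \<U>(1) x obtain U where U: "U \<in> \<U>" "x \<in> U" by blast
  from bspec[OF \<U>(2) U(1)] obtain A :: "'s ring" and \<iota> f \<phi> fs
    where "affine_chart k X \<psi> U A \<iota> f \<phi>" "generates_algebra k A \<iota> fs" by blast
  then obtain n I p where ex: "local_presentation k X \<psi> x n I p"
    using local_presentation_exists[OF fieldE(1)[OF k] X' U(2)] by blast
  let ?P = "\<lambda>(n, I, p). local_presentation k X \<psi> x n I p"
  obtain n' I' p' where s: "(SOME q. ?P q) = (n', I', p')" by (rule prod_cases3)
  have "?P (SOME q. ?P q)" by (rule someI[of ?P "(n, I, p)"]) (simp add: ex)
  then have "local_presentation k X \<psi> x n' I' p'" unfolding s by simp
  from rt_of_local_presentation[OF k X' _ this] reg x show ?thesis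
    unfolding rt_point_def s by (simp add: regular_scheme_def)
qed

theorem proposition3p1:
  fixes k :: "('k, 'm) ring_scheme"
    and X :: "('x, 's) rspace"
    and \<pi> :: "'x \<Rightarrow> 'k set"
    and \<psi> :: "'k set set \<Rightarrow> ('k set \<Rightarrow> ('k \<times> 'k) set) \<Rightarrow> 's"
  assumes "field k"
    and "finite_type_scheme k X \<pi> \<psi>"
    and "regular_scheme X"
  shows "rt_scheme k X \<psi> = 1"
proof (cases "points X = {}")
  case False
  then have "rt_point k X \<psi> ` points X = {1}" using rt_point_eq_1[OF assms] by fastforce
  then show ?thesis using False by (simp add: rt_scheme_def)
qed (simp add: rt_scheme_def)

end
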